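(* Let $\sigma>0$ and let $p=p(m)\in(0,1)$ satisfy $mp^{2/3}\to\sigma$ as $m\to\infty$. Then, as $m\to\infty$, \[\Big((m/\sigma)^{-1/2}\tilde X^m(\lfloor (m/\sigma)t\rfloor),\ 0\le t\le\sigma\Big)\xrightarrow{d}\big(\tilde e^{(\sigma)}(t),\ 0\le t\le\sigma\big)\] in $\mathbb D([0,\sigma],\mathbb R^+)$ with the Skorohod topology.
   Context: Ordered depth-first search ${\bf oDFS}(T)$ for a tree $T$ on $[m]$: set $\mathcal O_0=(1)$ (ordered list), $\mathcal A_0=\emptyset$; for $i=0,\dots,m-1$ let $v_i$ be the first element of $\mathcal O_i$, $\mathcal N_i$ the neighbours of $v_i$ outside $\mathcal A_i\cup\mathcal O_i$, $\mathcal A_{i+1}=\mathcal A_i\cup\{v_i\}$, and $\mathcal O_{i+1}$ obtained by deleting $v_i$ from the front of $\mathcal O_i$ and placing $\mathcal N_i$ in increasing order at the front. Depth-first walk $X(i)=|\mathcal O_i|-1$ for $0\le i<m$, and $X(i)=0$ for $i\ge m$; area $a(T)=\sum_{i=1}^{m-1}X(i)$. The tilted tree $\tilde T^p_m$ is a random tree on $[m]$ with $\mathbb P(\tilde T^p_m=T)\propto(1-p)^{-a(T)}$; $\tilde X^m$ is its depth-first walk. For $\sigma>0$, $e^{(\sigma)}$ is a Brownian excursion of length $\sigma$ (extended by $0$ after time $\sigma$), and the tilted excursion $\tilde e^{(\sigma)}$ is the random excursion with law $\mathbb P(\tilde e^{(\sigma)}\in B)=\mathbb E[\mathbf 1\{e^{(\sigma)}\in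 B\}\exp(\int_0^\sigma e^{(\sigma)}(s)ds)]/\mathbb E[\exp(\int_0^\sigma e^{(\sigma)}(s)ds)]$ for Borel sets $B$ (Borel $\sigma$-algebra of the supremum norm). *)

theory Defs
  imports "HOL-Probability.Probability"
begin

section \<open>Labelled trees on [m] = {1..m}\<close>

text \<open>A graph on {1..m} is a set of 2-element edges; a tree is a connected acyclic graph.\<close>

definition graph_on :: "nat \<Rightarrow> nat set set \<Rightarrow> bool" where
  "graph_on m T \<longleftrightarrow> (\<forall>e\<in>T. \<exists>a b. a \<noteq> b \<and> a \<in> {1..m} \<and> b \<in> {1..m} \<and> e = {a, b})"

definition adj :: "nat set set \<Rightarrow> (nat \<times> nat) set" where
  "adj T = {(a, b). {a, b} \<in> T}"

definition connected_on :: "nat \<Rightarrow> nat set set \<Rightarrow> bool" where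
  "connected_on m T \<longleftrightarrow> (\<forall>u\<in>{1..m}. \<forall>v\<in>{1..m}. (u, v) \<in> (adj T)\<^sup>*)"

definition has_cycle :: "nat set set \<Rightarrow> bool" where
  "has_cycle T \<longleftrightarrow> (\<exists>vs :: nat list. length vs \<ge> 3 \<and> distinct vs \<and>
      (\<forall>i < length vs. {vs ! i, vs ! ((i + 1) mod length vs)} \<in> T))"

definition is_tree :: "nat \<Rightarrow> nat set set \<Rightarrow> bool" where
  "is_tree m T \<longleftrightarrow> graph_on m T \<and> connected_on m T \<and> \<not> has_cycle T"

definition trees :: "nat \<Rightarrow> nat set set set" where
  "trees m = {T. is_tree m T}"

section \<open>Ordered depth-first search and depth-first walk\<close>

text \<open>State: (ordered list O_i, set A_i).\<close>

definition odfs_step :: "nat set set \<Rightarrow> nat list \<times> nat set \<Rightarrow> nat list \<times> nat set" where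
  "odfs_step T st = (let Os = fst st; As = snd st; v = hd Os;
      Ns = sorted_list_of_set {w. {v, w} \<in> T \<and> w \<notin> As \<and> w \<notin> set Os}
    in (Ns @ tl Os, insert v As))"

definition odfs_state :: "nat set set \<Rightarrow> nat \<Rightarrow> nat list \<times> nat set" where
  "odfs_state T i = (odfs_step T ^^ i) ([1], {})"

definition dfwalk :: "nat \<Rightarrow> nat set set \<Rightarrow> nat \<Rightarrow> real" where
  "dfwalk m T i = (if i < m then real (length (fst (odfs_state T i))) - 1 else 0)"

definition area :: "nat \<Rightarrow> nat set set \<Rightarrow> real" where
  "area m T = (\<Sum>i = 1..m - 1. dfwalk m T i)"

text \<open>Expectation of F(tilde T^p_m): P(tilde T = T) proportional to (1-p)^(-a(T)).\<close>

definition tilted_expect :: "nat \<Rightarrow> real \<Rightarrow> (nat set set \<Rightarrow> real) \<Rightarrow> real" where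
  "tilted_expect m p F =
     (\<Sum>T\<in>trees m. (1 - p) powr (- area m T) * F T) / (\<Sum>T\<in>trees m. (1 - p) powr (- area m T))"

text \<open>Rescaled depth-first walk on [0,sigma] (set to 0 outside [0,sigma]).\<close>

definition scaled_walk :: "real \<Rightarrow> nat \<Rightarrow> nat set set \<Rightarrow> real \<Rightarrow> real" where
  "scaled_walk \<sigma> m T t = (if 0 \<le> t \<and> t \<le> \<sigma>
      then (real m / \<sigma>) powr (-1/2) * dfwalk m T (nat \<lfloor>(real m / \<sigma>) * t\<rfloor>) else 0)"

section \<open>Skorohod space D([0,sigma]) with the J1 metric\<close>

definition restr :: "real \<Rightarrow> (real \<Rightarrow> real) \<Rightarrow> real \<Rightarrow> real" where
  "restr \<sigma> x t = (if 0 \<le> t \<and> t \<le> \<sigma> then x t else 0)"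

definition skorohod_D :: "real \<Rightarrow> (real \<Rightarrow> real) set" where
  "skorohod_D \<sigma> = {x. (\<forall>t. t \<notin> {0..\<sigma>} \<longrightarrow> x t = 0)
      \<and> (\<forall>t\<in>{0..<\<sigma>}. (x \<longlongrightarrow> x t) (at_right t))
      \<and> (\<forall>t\<in>{0<..\<sigma>}. \<exists>l. (x \<longlongrightarrow> l) (at_left t))}"

definition time_changes :: "real \<Rightarrow> (real \<Rightarrow> real) set" where
  "time_changes \<sigma> = {lam. strict_mono_on {0..\<sigma>} lam \<and> continuous_on {0..\<sigma>} lam \<and> lam ` {0..\<sigma>} = {0..\<sigma>}}"

definition skorohod_dist :: "real \<Rightarrow> (real \<Rightarrow> real) \<Rightarrow> (real \<Rightarrow> real) \<Rightarrow> real" where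
  "skorohod_dist \<sigma> x y = Inf {max (SUP t\<in>{0..\<sigma>}. \<bar>lam t - t\<bar>) (SUP t\<in>{0..\<sigma>}. \<bar>x t - y (lam t)\<bar>)
                               | lam. lam \<in> time_changes \<sigma>}"

definition bounded_skorohod_continuous :: "real \<Rightarrow> ((real \<Rightarrow> real) \<Rightarrow> real) \<Rightarrow> bool" where
  "bounded_skorohod_continuous \<sigma> f \<longleftrightarrow>
     (\<exists>B. \<forall>x\<in>skorohod_D \<sigma>. \<bar>f x\<bar> \<le> B) \<and>
     (\<forall>x\<in>skorohod_D \<sigma>. \<forall>\<epsilon>>0. \<exists>\<delta>>0. \<forall>y\<in>skorohod_D \<sigma>.
         skorohod_dist \<sigma> x y < \<delta> \<longrightarrow> \<bar>f y - f x\<bar> < \<epsilon>)"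

section \<open>Brownian excursion of length sigma and its tilted version\<close>

definition gauss_kernel :: "real \<Rightarrow> real \<Rightarrow> real" where
  "gauss_kernel s u = exp (- u\<^sup>2 / (2 * s)) / sqrt (2 * pi * s)"

definition killed_kernel :: "real \<Rightarrow> real \<Rightarrow> real \<Rightarrow> real" where
  "killed_kernel s y z = gauss_kernel s (z - y) - gauss_kernel s (z + y)"

definition first_passage :: "real \<Rightarrow> real \<Rightarrow> real" where
  "first_passage s y = y / sqrt (2 * pi * s ^ 3) * exp (- y\<^sup>2 / (2 * s))"

text \<open>Joint density of (e(t_0),...,e(t_{k-1})) for 0 < t_0 < ... < t_{k-1} < sigma.\<close>

definition excursion_fdd_density :: "real \<Rightarrow> nat \<Rightarrow> (nat \<Rightarrow> real) \<Rightarrow> (nat \<Rightarrow> real) \<Rightarrow> real" where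
  "excursion_fdd_density \<sigma> k t x =
     (if (\<forall>i<k. 0 < x i) then
        2 * sqrt (2 * pi * \<sigma> ^ 3) * first_passage (t 0) (x 0)
          * (\<Prod>i<k - 1. killed_kernel (t (i + 1) - t i) (x i) (x (i + 1)))
          * first_passage (\<sigma> - t (k - 1)) (x (k - 1))
      else 0)"

text \<open>mu is the law of a Brownian excursion of length sigma on the space of bounded continuous
  paths R -> R (sup norm, Borel sets), paths extended by 0 outside [0,sigma].\<close>

definition brownian_excursion_law :: "real \<Rightarrow> (real \<Rightarrow>\<^sub>C real) measure \<Rightarrow> bool" where
  "brownian_excursion_law \<sigma> \<mu> \<longleftrightarrow>
     prob_space \<mu> \<and> sets \<mu> = sets borel \<and>
     (AE e in \<mu>. \<forall>t. (t \<le> 0 \<or> \<sigma> \<le> t) \<longrightarrow> apply_bcontfun e t = 0) \<and>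
     (\<forall>k \<ge> 1. \<forall>t :: nat \<Rightarrow> real. 0 < t 0 \<and> (\<forall>i. Suc i < k \<longrightarrow> t i < t (Suc i)) \<and> t (k - 1) < \<sigma> \<longrightarrow>
        distr \<mu> (PiM {..<k} (\<lambda>_. lborel)) (\<lambda>e. restrict (\<lambda>i. apply_bcontfun e (t i)) {..<k})
        = density (PiM {..<k} (\<lambda>_. lborel)) (\<lambda>x. ennreal (excursion_fdd_density \<sigma> k t x)))"

definition excursion_area :: "real \<Rightarrow> (real \<Rightarrow>\<^sub>C real) \<Rightarrow> real" where
  "excursion_area \<sigma> e = integral {0..\<sigma>} (apply_bcontfun e)"

definition tilted_excursion_law :: "real \<Rightarrow> (real \<Rightarrow>\<^sub>C real) measure \<Rightarrow> (real \<Rightarrow>\<^sub>C real) measure" where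
  "tilted_excursion_law \<sigma> \<mu> =
     density \<mu> (\<lambda>e. ennreal (exp (excursion_area \<sigma> e) / (\<integral>e'. exp (excursion_area \<sigma> e') \<partial>\<mu>)))"

end

theory Submission
  imports Defs "HOL-Library.Transitive_Closure_Table" "HOL-Real_Asymp.Real_Asymp"
begin

text \<open>Depth-first search encodes the trees on \<open>{1..m}\<close> by parking functions, whose queue-length walk is the
  depth-first walk. By the cycle lemma a uniform parking function is a uniform map \<open>{2..m} \<rightarrow> {0..<m}\<close> after
  a uniform rotation, so averages over trees of rotation invariant functionals are averages over the bridges
  of multinomial counts. On the continuous side, rotating a Brownian excursion at a uniform time gives a
  bridge: this is checked on the densities, via the first passage decomposition. A functional of the path is
  sandwiched by its Lipschitz envelope, the supremum over all rotations; the envelope is rotation invariant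
  and Lipschitz, hence a maximal inequality reduces it to finitely many times, where the central limit theorem
  for the binomial distribution applies. This yields convergence for the uniform tree. Finally
  \<open>(1 - p) powr (- area)\<close> is the exponential of \<open>(1 + o(1))\<close> times the integral of the rescaled walk, whose
  exponential moments are bounded because the integral is at most a multiple of the oscillation of the
  bridge, so the tilt passes to the limit.\<close>

section \<open>Trees and parking functions\<close>

text \<open>The tree walk is a bridge conditioned to stay nonnegative, an event of probability
  \<open>1 / m\<close>, so estimates for the unconditioned bridge say nothing about it directly.
  They become usable only for functionals that cannot see where the cycle is cut, and a functional
  \<open>h\<close> of the walk does see it. Rotating a bridge to its minimum would restore the cut,
  but that operation is discontinuous. The envelope therefore optimises over the cut instead of
  choosing it: paths close to some rotation compete, at a price \<open>L\<close> per unit of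
  distance. The result is an upper bound only; it suffices because it is applied to \<open>h\<close>
  and to \<open>- h\<close>. Parameters are chosen in a fixed order: \<open>L\<close> from the
  tolerance, then the number \<open>K\<close> of grid points, then \<open>m\<close>. The tilt enters
  at the end: \<open>m * p powr (2/3)\<close> tending to \<open>\<sigma>\<close> is what makes
  \<open>- ln (1 - p) * (m / \<sigma>) powr (3/2)\<close> tend to \<open>1\<close>.\<close>

definition below :: "nat set \<Rightarrow> (nat \<Rightarrow> nat) \<Rightarrow> nat \<Rightarrow> nat" where
  "below V g i = card {v \<in> V. g v < i}"

text \<open>\<open>g w\<close> will be the step at which the search discovers vertex
  \<open>w\<close>. The root \<open>1\<close> is never discovered, so there are only
  \<open>m - 1\<close> cars for the \<open>m\<close> spots of a circle; this one free spot is what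
  the cycle lemma exploits.\<close>

definition cars :: "nat \<Rightarrow> (nat \<Rightarrow> nat) set" where
  "cars m = {2..m} \<rightarrow>\<^sub>E {..<m}"

text \<open>Before step \<open>i\<close> the search has discovered the root and
  \<open>below {2..m} g i\<close> further vertices, and has explored \<open>i\<close> of them. The
  inequality says that one is left, so that \<open>hd\<close> in \<open>visited\<close> is
  meaningful.\<close>

definition parking :: "nat \<Rightarrow> (nat \<Rightarrow> nat) set" where
  "parking m = {g \<in> cars m. \<forall>i<m. i \<le> below {2..m} g i}"

definition pwalk :: "nat \<Rightarrow> (nat \<Rightarrow> nat) \<Rightarrow> nat \<Rightarrow> real" where
  "pwalk m g i = (if i < m then real (below {2..m} g i) - real i else 0)"

fun queue :: "nat \<Rightarrow> (nat \<Rightarrow> nat) \<Rightarrow> nat \<Rightarrow> nat list" where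
  "queue m g 0 = [1]"
| "queue m g (Suc i) = sorted_list_of_set {w \<in> {2..m}. g w = i} @ tl (queue m g i)"

definition visited :: "nat \<Rightarrow> (nat \<Rightarrow> nat) \<Rightarrow> nat \<Rightarrow> nat" where
  "visited m g i = hd (queue m g i)"

definition tree_of :: "nat \<Rightarrow> (nat \<Rightarrow> nat) \<Rightarrow> nat set set" where
  "tree_of m g = (\<lambda>w. {visited m g (g w), w}) ` {2..m}"

lemma sym_adj: "sym (adj T)"
  by (auto simp: sym_def adj_def insert_commute)

lemma adj_rtrancl_sym: "(a, b) \<in> (adj T)\<^sup>* \<Longrightarrow> (b, a) \<in> (adj T)\<^sup>*"
  by (metis sym_adj sym_rtrancl symD)

lemma rtrancl_path_adj_nth:
  "rtrancl_path r x xs y \<Longrightarrow> (\<forall>i<length xs. r ((x # xs) ! i) (xs ! i)) \<and> last (x # xs) = y"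
proof (induction rule: rtrancl_path.induct)
  case (step x y ys z)
  have "r ((x # y # ys) ! i) ((y # ys) ! i)" if "i < length (y # ys)" for i
    using step that by (cases i) auto
  with step show ?case by auto
qed auto

text \<open>A missing edge of \<open>T\<close> would close a simple \<open>U\<close>-path between
  its ends into a cycle of \<open>T\<close>. This replaces a count of edges when a tree is rebuilt
  from its code.\<close>

lemma connected_acyclic_maximal:
  assumes UT: "U \<subseteq> T" and con: "connected_on m U" and gr: "graph_on m T" and ac: "\<not> has_cycle T"
  shows "U = T"
proof (rule ccontr)
  assume "U \<noteq> T"
  then obtain e where e: "e \<in> T" "e \<notin> U" using UT by auto
  obtain a b where ab: "a \<noteq> b" "a \<in> {1..m}" "b \<in> {1..m}" "e = {a,b}"
    using gr e unfolding graph_on_def by blast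
  have "(a, b) \<in> (adj U)\<^sup>*" using con ab unfolding connected_on_def by auto
  then have "(\<lambda>x y. (x, y) \<in> adj U)\<^sup>*\<^sup>* a b" by (simp add: rtranclp_rtrancl_eq)
  then obtain xs0 where "rtrancl_path (\<lambda>x y. (x, y) \<in> adj U) a xs0 b"
    by (auto simp: rtranclp_eq_rtrancl_path)
  then obtain xs where xs: "rtrancl_path (\<lambda>x y. (x, y) \<in> adj U) a xs b" "distinct (a # xs)"
    by (rule rtrancl_path_distinct)
  note P = rtrancl_path_adj_nth[OF xs(1)]
  have ne: "xs \<noteq> []" using P ab by auto
  \<comment> \<open>A path of one step would be the missing edge itself; with two or more steps, the
    path and that edge form a cycle on at least three vertices.\<close>
  have len: "length xs \<ge> 2"
  proof (rule ccontr)
    assume "\<not> length xs \<ge> 2"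
    with ne have "length xs = 1" by (cases xs) (auto simp: not_le)
    then obtain y where "xs = [y]" by (auto simp: length_Suc_conv)
    with P have "(a, b) \<in> adj U" by auto
    with e ab show False by (auto simp: adj_def)
  qed
  have "{(a # xs) ! i, (a # xs) ! ((i + 1) mod length (a # xs))} \<in> T" if i: "i < length (a # xs)" for i
  proof (cases "i = length xs")
    case True
    then have "(a # xs) ! i = b" using P ne by (simp add: last_conv_nth)
    with True e ab show ?thesis by (simp add: insert_commute)
  next
    case False
    with i have "i < length xs" by simp
    with P UT show ?thesis by (auto simp: adj_def)
  qed
  with xs len have "has_cycle T" unfolding has_cycle_def by (intro exI[of _ "a # xs"]) auto
  with ac show False by simp
qed

section \<open>From a parking function to its tree\<close>

context
  fixes m :: nat and g :: "nat \<Rightarrow> nat"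
  assumes g: "g \<in> parking m" and m: "m \<ge> 1"
begin

lemma parking_range: "w \<in> {2..m} \<Longrightarrow> g w < m"
  using g unfolding parking_def cars_def by (auto simp: PiE_def Pi_def)

text \<open>Queue and explored vertices partition what has been discovered, so the length of the
  queue is a count. The parking inequality enters through this count: it keeps the queue nonempty,
  and the next vertex exists.\<close>

lemma queue_invariant:
  "i \<le> m \<Longrightarrow> distinct (queue m g i) \<and> set (queue m g i) \<inter> visited m g ` {..<i} = {} \<and>
    inj_on (visited m g) {..<i} \<and>
    set (queue m g i) \<union> visited m g ` {..<i} = insert 1 {w \<in> {2..m}. g w < i}"
proof (induction i)
  case 0
  then show ?case by auto
next
  case (Suc i)
  then have IH: "distinct (queue m g i)" "set (queue m g i) \<inter> visited m g ` {..<i} = {}"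
    "inj_on (visited m g) {..<i}"
    "set (queue m g i) \<union> visited m g ` {..<i} = insert 1 {w \<in> {2..m}. g w < i}" by auto
  let ?Q = "queue m g i"
  have "card (set ?Q) + i = card (insert 1 {w \<in> {2..m}. g w < i})"
    unfolding IH(4)[symmetric] using IH(2,3) by (subst card_Un_disjoint) (auto simp: card_image)
  also have "\<dots> = Suc (below {2..m} g i)" unfolding below_def by (subst card_insert_disjoint) auto
  finally have "card (set ?Q) + i = Suc (below {2..m} g i)" .
  moreover have "i \<le> below {2..m} g i" using g Suc.prems unfolding parking_def by auto
  ultimately have "card (set ?Q) > 0" by linarith
  then obtain v vs where Q: "?Q = v # vs" by (cases ?Q) auto
  have v: "visited m g i = v" by (simp add: visited_def Q)
  have S: "set (queue m g (Suc i)) = {w \<in> {2..m}. g w = i} \<union> set vs" by (simp add: Q)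
  have N: "{w \<in> {2..m}. g w = i} \<inter> (insert 1 {w \<in> {2..m}. g w < i}) = {}" by auto
  have I: "visited m g ` {..<Suc i} = insert v (visited m g ` {..<i})"
    by (simp add: lessThan_Suc v)
  have "distinct (queue m g (Suc i))"
    using IH N by (auto simp: Q)
  moreover have "set (queue m g (Suc i)) \<inter> visited m g ` {..<Suc i} = {}"
    unfolding S I using IH N Q by auto
  moreover have "inj_on (visited m g) {..<Suc i}"
    using IH Q v by (auto simp: lessThan_Suc inj_on_insert)
  moreover have "set (queue m g (Suc i)) \<union> visited m g ` {..<Suc i} = insert 1 {w \<in> {2..m}. g w < Suc i}"
  proof -
    have "set (queue m g (Suc i)) \<union> visited m g ` {..<Suc i} =
       {w \<in> {2..m}. g w = i} \<union> (set ?Q \<union> visited m g ` {..<i})" unfolding S I by (simp add: Q) blast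
    also have "\<dots> = insert 1 {w \<in> {2..m}. g w < Suc i}" unfolding IH(4) by (auto simp del: atLeastAtMost_iff)
    finally show ?thesis .
  qed
  ultimately show ?case by blast
qed

lemma length_queue: "i \<le> m \<Longrightarrow> length (queue m g i) + i = Suc (below {2..m} g i)"
proof -
  assume "i \<le> m"
  note I = queue_invariant[OF this]
  have "card (visited m g ` {..<i}) = i" "card (set (queue m g i)) = length (queue m g i)"
    using I by (simp_all add: card_image distinct_card)
  then have "length (queue m g i) + i = card (set (queue m g i) \<union> visited m g ` {..<i})"
    using I by (subst card_Un_disjoint) simp_all
  also have "\<dots> = Suc (below {2..m} g i)"
    using I unfolding below_def by (auto simp: card_insert_if)
  finally show ?thesis .
qed

lemma queue_ne: "i < m \<Longrightarrow> queue m g i \<noteq> []"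
  using length_queue[of i] g unfolding parking_def by fastforce

lemma visited_in_queue: "i < m \<Longrightarrow> visited m g i \<in> set (queue m g i)"
  unfolding visited_def using queue_ne by auto

lemma inj_visited: "inj_on (visited m g) {..<m}" using queue_invariant[of m] by auto

lemma visited_onto: "visited m g ` {..<m} = {1..m}"
proof -
  have *: "insert 1 {w \<in> {2..m}. g w < m} = {1..m}" using parking_range m by auto
  have "visited m g ` {..<m} \<subseteq> {1..m}" using queue_invariant[of m] unfolding * by auto
  moreover have "card (visited m g ` {..<m}) = card {1..m}" by (simp add: card_image inj_visited)
  ultimately show ?thesis by (intro card_subset_eq) auto
qed

text \<open>What is explored at step \<open>j\<close> lies in the queue at that time, hence was
  discovered strictly before. This orders parents before children and drives both connectivity and
  acyclicity.\<close>

lemma parent_earlier: "j < m \<Longrightarrow> visited m g j \<in> {2..m} \<Longrightarrow> g (visited m g j) < j"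
proof -
  assume j: "j < m" "visited m g j \<in> {2..m}"
  have "set (queue m g j) \<union> visited m g ` {..<j} = insert 1 {w \<in> {2..m}. g w < j}"
    using queue_invariant[of j] j by simp
  then have "visited m g j \<in> insert 1 {w \<in> {2..m}. g w < j}" using visited_in_queue[OF j(1)] by blast
  then show ?thesis using j by auto
qed

lemma tree_of_graph: "graph_on m (tree_of m g)"
  unfolding graph_on_def tree_of_def
proof (intro ballI, elim imageE)
  fix e w assume w: "w \<in> {2..m}" and e: "e = {visited m g (g w), w}"
  obtain j where j: "j < m" "w = visited m g j" using visited_onto w by force
  have "g w < j" using parent_earlier[of j] j w by auto
  with j have "visited m g (g w) \<noteq> w" using inj_visited by (metis inj_on_contraD lessThan_iff less_irrefl less_trans)
  moreover have "visited m g (g w) \<in> {1..m}" using visited_onto parking_range[OF w] by auto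
  ultimately show "\<exists>a b. a \<noteq> b \<and> a \<in> {1..m} \<and> b \<in> {1..m} \<and> e = {a, b}"
    using e w by (intro exI[of _ "visited m g (g w)"] exI[of _ w]) auto
qed

lemma tree_of_connected: "connected_on m (tree_of m g)"
proof -
  have *: "j < m \<Longrightarrow> (visited m g j, 1) \<in> (adj (tree_of m g))\<^sup>*" for j
  proof (induction j rule: less_induct)
    case (less j)
    show ?case
    proof (cases "visited m g j = 1")
      case False
      then have w: "visited m g j \<in> {2..m}" using visited_onto less.prems by force
      let ?w = "visited m g j"
      have "g ?w < j" using parent_earlier less.prems w by auto
      then have "(visited m g (g ?w), 1) \<in> (adj (tree_of m g))\<^sup>*" using less by auto
      moreover have "(?w, visited m g (g ?w)) \<in> adj (tree_of m g)"
        unfolding adj_def tree_of_def using w by (auto simp: insert_commute)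
      ultimately show ?thesis by (rule converse_rtrancl_into_rtrancl[rotated])
    qed auto
  qed
  have "(u, 1) \<in> (adj (tree_of m g))\<^sup>*" if "u \<in> {1..m}" for u
    using * that visited_onto by (metis imageE lessThan_iff)
  then show ?thesis unfolding connected_on_def
    by (meson adj_rtrancl_sym rtrancl_trans)
qed

text \<open>On a cycle, take the vertex explored last: both its cycle neighbours were explored
  earlier, and an edge to an earlier vertex must be the edge to the parent, so the two neighbours
  coincide.\<close>

lemma tree_of_acyclic: "\<not> has_cycle (tree_of m g)"
proof
  assume "has_cycle (tree_of m g)"
  then obtain vs where vs: "length vs \<ge> 3" "distinct vs"
    "\<And>i. i < length vs \<Longrightarrow> {vs ! i, vs ! ((i + 1) mod length vs)} \<in> tree_of m g"
    unfolding has_cycle_def by blast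
  let ?L = "length vs"
  have in_range: "vs ! i \<in> {1..m}" if i: "i < ?L" for i
  proof -
    obtain a b where "a \<in> {1..m}" "b \<in> {1..m}" "{vs ! i, vs ! ((i + 1) mod length vs)} = {a, b}"
      using vs(3)[OF i] tree_of_graph unfolding graph_on_def by meson
    then show ?thesis by (metis doubleton_eq_iff)
  qed
  define idx where "idx = the_inv_into {..<m} (visited m g)"
  have idx: "idx v < m" "visited m g (idx v) = v" if "v \<in> {1..m}" for v
    unfolding idx_def using that visited_onto inj_visited
    by (metis lessThan_iff the_inv_into_into order_refl, metis f_the_inv_into_f)
  have idx_eq: "idx v = j" if "v = visited m g j" "j < m" for v j
    unfolding idx_def using that inj_visited by (simp add: the_inv_into_f_f)
  define k where "k = arg_max_on (\<lambda>i. idx (vs ! i)) {..<?L}"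
  have "?L > 0" using vs(1) by linarith
  then have "0 \<in> {..<?L}" by simp
  then have fin: "finite {..<?L}" "{..<?L} \<noteq> {}" by blast+
  have k: "k < ?L" "\<And>i. i < ?L \<Longrightarrow> idx (vs ! i) \<le> idx (vs ! k)"
  proof -
    have "Max ((\<lambda>i. idx (vs ! i)) ` {..<?L}) \<in> (\<lambda>i. idx (vs ! i)) ` {..<?L}"
      using fin by (intro Max_in) auto
    then obtain k0 where k0: "k0 < ?L" "idx (vs ! k0) = Max ((\<lambda>i. idx (vs ! i)) ` {..<?L})" by auto
    have "is_arg_max (\<lambda>i. idx (vs ! i)) (\<lambda>i. i \<in> {..<?L}) k0"
      unfolding is_arg_max_linorder using k0 fin by auto
    then have "is_arg_max (\<lambda>i. idx (vs ! i)) (\<lambda>i. i \<in> {..<?L}) k"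
      unfolding k_def arg_max_on_def arg_max_def by (rule someI)
    then show "k < ?L" "\<And>i. i < ?L \<Longrightarrow> idx (vs ! i) \<le> idx (vs ! k)"
      unfolding is_arg_max_linorder by auto
  qed
  have par: "u = visited m g (g w) \<and> w \<in> {2..m}"
    if "{w, u} \<in> tree_of m g" "idx u \<le> idx w" "w \<in> {1..m}" "u \<in> {1..m}" for u w
  proof -
    have "{w, u} \<in> (\<lambda>w. {visited m g (g w), w}) ` {2..m}" using that(1) unfolding tree_of_def .
    then obtain w' where w': "{w, u} = {visited m g (g w'), w'}" "w' \<in> {2..m}" by (rule imageE)
    have lt: "g w' < idx w'" using parent_earlier[of "idx w'"] idx[of w'] w' by auto
    have "idx (visited m g (g w')) = g w'" using idx_eq parking_range w' by auto
    with lt w' that have "w' = w" by (auto simp: doubleton_eq_iff)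
    with w' show ?thesis by (auto simp: doubleton_eq_iff)
  qed
  \<comment> \<open>\<open>a\<close> and \<open>b\<close> are the successor and the predecessor of
    \<open>k\<close> along the cycle; adding \<open>length vs - 1\<close> modulo the length replaces
    a truncated subtraction.\<close>
  define a where "a = (k + 1) mod ?L"
  define b where "b = (k + (?L - 1)) mod ?L"
  have ab: "a < ?L" "b < ?L" unfolding a_def b_def using vs(1) by (auto intro!: mod_less_divisor)
  have bk: "(b + 1) mod ?L = k"
  proof -
    have "(b + 1) mod ?L = (k + (?L - 1) + 1) mod ?L" unfolding b_def by (rule mod_add_left_eq)
    also have "k + (?L - 1) + 1 = k + ?L" using vs(1) by linarith
    finally show ?thesis using k(1) by simp
  qed
  have "a \<noteq> b"
  proof
    assume "a = b"
    have "k + 1 < ?L \<Longrightarrow> False" using \<open>a = b\<close> bk vs(1) k(1) unfolding a_def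
      by (cases "k + 2 < ?L") (auto simp: mod_if split: if_splits)
    moreover have "k + 1 = ?L \<Longrightarrow> False" using \<open>a = b\<close> bk vs(1) k(1) unfolding a_def by auto
    ultimately show False using k(1) by linarith
  qed
  have "{vs ! k, vs ! a} \<in> tree_of m g" unfolding a_def using vs(3)[OF k(1)] .
  then have 1: "vs ! a = visited m g (g (vs ! k))" using par k ab in_range by auto
  have "{vs ! k, vs ! b} \<in> tree_of m g" using vs(3)[OF ab(2)] bk by (simp add: insert_commute)
  then have 2: "vs ! b = visited m g (g (vs ! k))" using par k ab in_range by auto
  from 1 2 have "vs ! a = vs ! b" by simp
  with vs(2) ab \<open>a \<noteq> b\<close> show False by (simp add: nth_eq_iff_index_eq)
qed

lemma tree_of_in_trees: "tree_of m g \<in> trees m"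
  unfolding trees_def is_tree_def using tree_of_graph tree_of_connected tree_of_acyclic by auto

text \<open>Besides the edges to the vertices of code \<open>i\<close>, the only edge at
  \<open>visited m g i\<close> leads to its parent, which is already explored.\<close>

lemma new_neighbours_tree_of:
  assumes i: "i < m"
  shows "{w. {visited m g i, w} \<in> tree_of m g \<and> w \<notin> visited m g ` {..<i} \<and> w \<notin> set (queue m g i)}
    = {w \<in> {2..m}. g w = i}" (is "?L = ?R")
proof
  note I = queue_invariant[of i]
  have seen: "w \<notin> visited m g ` {..<i} \<and> w \<notin> set (queue m g i) \<longleftrightarrow> w \<noteq> 1 \<and> \<not> (w \<in> {2..m} \<and> g w < i)" for w
  proof -
    have "set (queue m g i) \<union> visited m g ` {..<i} = insert 1 {w \<in> {2..m}. g w < i}" using I i by simp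
    then have "w \<in> set (queue m g i) \<union> visited m g ` {..<i} \<longleftrightarrow> w \<in> insert 1 {w \<in> {2..m}. g w < i}" by simp
    then show ?thesis by (simp del: atLeastAtMost_iff) blast
  qed
  show "?R \<subseteq> ?L" unfolding seen tree_of_def using i by auto
  show "?L \<subseteq> ?R"
  proof
    fix w assume w: "w \<in> ?L"
    then obtain w' where w': "w' \<in> {2..m}" "{visited m g i, w} = {visited m g (g w'), w'}"
      unfolding tree_of_def by auto
    then consider "visited m g i = visited m g (g w')" "w = w'" | "visited m g i = w'" "w = visited m g (g w')"
      by (auto simp: doubleton_eq_iff)
    then show "w \<in> ?R"
    proof cases
      case 1
      then have "i = g w'" using inj_visited i parking_range[OF w'(1)] by (auto simp: inj_on_def)
      with 1 w' show ?thesis by auto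
    next
      case 2
      then have "g w' < i" using parent_earlier[of i] i w' by auto
      then have "w \<in> visited m g ` {..<i}" using 2 by auto
      with w show ?thesis by auto
    qed
  qed
qed

lemma odfs_tree_of: "i \<le> m \<Longrightarrow> odfs_state (tree_of m g) i = (queue m g i, visited m g ` {..<i})"
proof (induction i)
  case 0
  then show ?case by (simp add: odfs_state_def)
next
  case (Suc i)
  have "odfs_state (tree_of m g) (Suc i) = odfs_step (tree_of m g) (odfs_state (tree_of m g) i)"
    by (simp add: odfs_state_def)
  also have "\<dots> = odfs_step (tree_of m g) (queue m g i, visited m g ` {..<i})" using Suc by simp
  also have "\<dots> = (sorted_list_of_set {w \<in> {2..m}. g w = i} @ tl (queue m g i), insert (visited m g i) (visited m g ` {..<i}))"
    using new_neighbours_tree_of[of i] Suc.prems unfolding odfs_step_def Let_def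
    by (simp add: visited_def[symmetric] del: Collect_mem_eq)
  finally show ?case by (simp add: lessThan_Suc)
qed

lemma dfwalk_tree_of: "dfwalk m (tree_of m g) = pwalk m g"
proof
  fix i
  show "dfwalk m (tree_of m g) i = pwalk m g i"
  proof (cases "i < m")
    case True
    then have "real (length (queue m g i)) + real i = 1 + real (below {2..m} g i)"
      using length_queue[of i] by (metis of_nat_Suc of_nat_add less_imp_le add.commute)
    with True show ?thesis by (simp add: dfwalk_def pwalk_def odfs_tree_of)
  qed (simp add: dfwalk_def pwalk_def)
qed

end

section \<open>From a tree to its parking function\<close>

context
  fixes m :: nat and T :: "nat set set"
  assumes T: "T \<in> trees m" and m: "m \<ge> 1"
begin

definition open_list where "open_list i = fst (odfs_state T i)"
definition closed_set where "closed_set i = snd (odfs_state T i)"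
definition fresh where "fresh i = {w. {hd (open_list i), w} \<in> T \<and> w \<notin> closed_set i \<and> w \<notin> set (open_list i)}"
definition seen where "seen i = set (open_list i) \<union> closed_set i"

lemma T_props: "graph_on m T" "connected_on m T" "\<not> has_cycle T"
  using T by (auto simp: trees_def is_tree_def)

lemma T_edge: "{a, b} \<in> T \<Longrightarrow> a \<in> {1..m} \<and> b \<in> {1..m} \<and> a \<noteq> b"
  using T_props(1) unfolding graph_on_def by (fastforce simp: doubleton_eq_iff)

lemma open_list_0: "open_list 0 = [1]" "closed_set 0 = {}" by (auto simp: open_list_def closed_set_def odfs_state_def)

lemma open_list_Suc: "open_list (Suc i) = sorted_list_of_set (fresh i) @ tl (open_list i)" "closed_set (Suc i) = insert (hd (open_list i)) (closed_set i)"
  by (auto simp: open_list_def closed_set_def fresh_def odfs_state_def odfs_step_def Let_def)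

lemma finite_fresh: "finite (fresh i)"
  by (rule finite_subset[of _ "{1..m}"]) (auto simp: fresh_def dest: T_edge)

text \<open>The neighbours of explored vertices are all discovered. Hence an empty list before step
  \<open>m\<close> would leave an explored set that contains \<open>1\<close> and is closed under
  adjacency; connectivity would make it all of \<open>{1..m}\<close>, although it has fewer than
  \<open>m\<close> elements.\<close>

lemma odfs_invariant:
  "i \<le> m \<Longrightarrow> distinct (open_list i) \<and> set (open_list i) \<inter> closed_set i = {} \<and> finite (closed_set i) \<and> card (closed_set i) = i \<and> 1 \<in> seen i
    \<and> seen i \<subseteq> {1..m} \<and> (\<forall>a\<in>closed_set i. \<forall>w. {a, w} \<in> T \<longrightarrow> w \<in> seen i) \<and> (i < m \<longrightarrow> open_list i \<noteq> [])"
proof (induction i)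
  case 0
  then show ?case using m by (auto simp: open_list_0 seen_def)
next
  case (Suc i)
  then have IH: "distinct (open_list i)" "set (open_list i) \<inter> closed_set i = {}" "finite (closed_set i)" "card (closed_set i) = i"
    "1 \<in> seen i" "seen i \<subseteq> {1..m}" "\<And>a w. a\<in>closed_set i \<Longrightarrow> {a, w} \<in> T \<Longrightarrow> w \<in> seen i" "open_list i \<noteq> []" by auto
  then obtain v vs where Q: "open_list i = v # vs" by (cases "open_list i") auto
  have fr: "fresh i \<inter> seen i = {}" by (auto simp: fresh_def seen_def)
  have sn: "seen (Suc i) = seen i \<union> fresh i" using finite_fresh by (auto simp: seen_def open_list_Suc Q)
  have 1: "distinct (open_list (Suc i))" using IH fr finite_fresh by (auto simp: open_list_Suc Q seen_def)
  have 2: "set (open_list (Suc i)) \<inter> closed_set (Suc i) = {}" using IH fr finite_fresh by (auto simp: open_list_Suc Q seen_def)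
  have 3: "finite (closed_set (Suc i))" "card (closed_set (Suc i)) = Suc i" using IH Q by (auto simp: open_list_Suc)
  have 4: "1 \<in> seen (Suc i)" "seen (Suc i) \<subseteq> {1..m}" using IH sn by (auto simp: fresh_def dest: T_edge)
  have 5: "w \<in> seen (Suc i)" if "a \<in> closed_set (Suc i)" "{a, w} \<in> T" for a w
    using that IH(7) unfolding sn by (auto simp: open_list_Suc Q fresh_def seen_def)
  have 6: "open_list (Suc i) \<noteq> []" if lt: "Suc i < m"
  proof
    assume E: "open_list (Suc i) = []"
    then have S: "seen (Suc i) = closed_set (Suc i)" by (simp add: seen_def)
    have "b \<in> seen (Suc i)" if "(1, b) \<in> (adj T)\<^sup>*" for b
      using that
    proof (induction rule: rtrancl_induct)
      case (step y z)
      then show ?case using 5[of y z] S by (auto simp: adj_def)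
    qed (use 4 in auto)
    moreover have "(1, b) \<in> (adj T)\<^sup>*" if "b \<in> {1..m}" for b
      using T_props(2) m that unfolding connected_on_def by (meson atLeastAtMost_iff order_refl)
    ultimately have "{1..m} \<subseteq> closed_set (Suc i)" using S by blast
    then have "card {1..m} \<le> Suc i" using card_mono[OF 3(1)] 3(2) by metis
    then have "m \<le> Suc i" by simp
    with lt show False by simp
  qed
  show ?case using 1 2 3 4 5 6 by blast
qed

lemma seen_Suc: "i < m \<Longrightarrow> seen (Suc i) = seen i \<union> fresh i"
  using odfs_invariant[of i] finite_fresh by (cases "open_list i") (auto simp: seen_def open_list_Suc)

lemma seen_mono: "i \<le> j \<Longrightarrow> j \<le> m \<Longrightarrow> seen i \<subseteq> seen j"
proof (induction j rule: dec_induct)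
  case (step n) then show ?case using seen_Suc[of n] by auto
qed auto

lemma seen_m: "seen m = {1..m}"
proof -
  have "closed_set m \<subseteq> {1..m}" "card (closed_set m) = m" using odfs_invariant[of m] by (auto simp: seen_def)
  then have "closed_set m = {1..m}" by (intro card_subset_eq) auto
  then show ?thesis using odfs_invariant[of m] by (auto simp: seen_def)
qed

text \<open>The discovery time of \<open>w\<close>. The successor in \<open>seen (Suc i)\<close>
  gives the value \<open>i\<close> to the vertices found while step \<open>i\<close> is carried
  out.\<close>

definition code where "code = (\<lambda>w\<in>{2..m}. LEAST i. w \<in> seen (Suc i))"

lemma code_less_iff: "w \<in> {2..m} \<Longrightarrow> i \<le> m \<Longrightarrow> code w < i \<longleftrightarrow> w \<in> seen i"
proof -
  assume w: "w \<in> {2..m}" and i: "i \<le> m"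
  have "w \<in> seen (Suc (m - 1))" using seen_m w m by auto
  then have L: "w \<in> seen (Suc (code w))" "code w \<le> m - 1"
    using w LeastI[of "\<lambda>i. w \<in> seen (Suc i)" "m - 1"] Least_le[of "\<lambda>i. w \<in> seen (Suc i)" "m - 1"]
    unfolding code_def by simp_all
  have "w \<in> seen i" if "code w < i" using seen_mono[of "Suc (code w)" i] L that i by auto
  moreover have "code w < i" if s: "w \<in> seen i"
  proof (cases i)
    case 0 with s w show ?thesis by (auto simp: seen_def open_list_0)
  next
    case (Suc j)
    with s have "code w \<le> j" unfolding code_def using w by (auto intro: Least_le)
    with Suc show ?thesis by simp
  qed
  ultimately show ?thesis by auto
qed

lemma fresh_eq: "i < m \<Longrightarrow> fresh i = {w \<in> {2..m}. code w = i}"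
proof -
  assume i: "i < m"
  have "fresh i = seen (Suc i) - seen i" using seen_Suc[OF i] by (auto simp: fresh_def seen_def)
  also have "\<dots> = {w \<in> {2..m}. code w < Suc i \<and> \<not> code w < i}"
  proof -
    have "seen (Suc i) \<subseteq> {1..m}" "1 \<in> seen i" using odfs_invariant[of "Suc i"] odfs_invariant[of i] i by auto
    then have "w \<in> seen (Suc i) - seen i \<longleftrightarrow> w \<in> {2..m} \<and> w \<in> seen (Suc i) \<and> w \<notin> seen i" for w
      by (cases "w = 1") auto
    then show ?thesis using code_less_iff[of _ "Suc i"] code_less_iff[of _ i] i by (auto simp del: atLeastAtMost_iff)
  qed
  finally show ?thesis by auto
qed

lemma open_list_eq: "i \<le> m \<Longrightarrow> open_list i = queue m code i"
  by (induction i) (auto simp: open_list_0 open_list_Suc fresh_eq)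

lemma code_parking: "code \<in> parking m"
proof -
  have "code \<in> cars m" unfolding cars_def
    using code_less_iff[of _ m] seen_m m by (auto simp: PiE_def code_def extensional_def)
  moreover have "i \<le> below {2..m} code i" if i: "i < m" for i
  proof -
    note I = odfs_invariant[of i]
    have "{w \<in> {2..m}. code w < i} = seen i - {1}"
      using code_less_iff i I by (auto simp: subset_iff) 
    then have "below {2..m} code i = card (seen i) - 1"
      unfolding below_def using I i by (simp add: card_Diff_singleton)
    also have "card (seen i) = length (open_list i) + i"
      unfolding seen_def using I i by (subst card_Un_disjoint) (auto simp: distinct_card)
    finally show ?thesis using I i by (cases "open_list i") auto
  qed
  ultimately show ?thesis unfolding parking_def by auto
qed

text \<open>Only one inclusion of edge sets is checked: the rebuilt graph is connected and sits
  inside the acyclic \<open>T\<close>, so it is all of \<open>T\<close>.\<close>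

lemma tree_of_code: "tree_of m code = T"
proof (rule connected_acyclic_maximal)
  show "tree_of m code \<subseteq> T"
    unfolding tree_of_def
  proof (intro image_subsetI)
    fix w assume w: "w \<in> {2..m}"
    have lt: "code w < m" using code_less_iff[OF w, of m] seen_m w by auto
    then have "w \<in> fresh (code w)" using fresh_eq w by auto
    then show "{visited m code (code w), w} \<in> T"
      using open_list_eq[of "code w"] lt by (auto simp: fresh_def visited_def)
  qed
  show "connected_on m (tree_of m code)" by (rule tree_of_connected[OF code_parking m])
qed (use T_props in auto)

end

text \<open>Injectivity holds because the search of \<open>tree_of m g\<close> reproduces the queue,
  and the new neighbours found at step \<open>i\<close> are the fibre of \<open>g\<close> over
  \<open>i\<close>.\<close>

theorem sum_trees_eq_sum_parking:
  assumes m: "m \<ge> 1"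
  shows "(\<Sum>T\<in>trees m. F (dfwalk m T)) = (\<Sum>g\<in>parking m. F (pwalk m g))"
proof -
  have inj: "inj_on (tree_of m) (parking m)"
  proof (rule inj_onI)
    fix g g' assume g: "g \<in> parking m" "g' \<in> parking m" and eq: "tree_of m g = tree_of m g'"
    have q: "queue m g i = queue m g' i" if "i \<le> m" for i
      using odfs_tree_of[OF g(1) m that] odfs_tree_of[OF g(2) m that] eq by auto
    have v: "visited m g i = visited m g' i" if "i \<le> m" for i using q[OF that] by (simp add: visited_def)
    have "g w = g' w" if w: "w \<in> {2..m}" for w
    proof -
      have lt: "g w < m" using parking_range[OF g(1) m w] .
      have "w \<in> {w \<in> {2..m}. g w = g w}" using w by auto
      have "{x \<in> {2..m}. g x = g w} = {x \<in> {2..m}. g' x = g w}"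
        using new_neighbours_tree_of[OF g(1) m lt] new_neighbours_tree_of[OF g(2) m lt] eq q[of "g w"] v lt
        by (simp add: image_def) 
      then have "w \<in> {x \<in> {2..m}. g' x = g w}" using w by auto
      then show ?thesis by simp
    qed
    moreover have "g \<in> {2..m} \<rightarrow>\<^sub>E {..<m}" "g' \<in> {2..m} \<rightarrow>\<^sub>E {..<m}"
      using g unfolding parking_def cars_def by auto
    ultimately show "g = g'" by (metis (no_types, lifting) PiE_ext)
  qed
  have "tree_of m ` parking m = trees m"
    using tree_of_in_trees[OF _ m] code_parking[OF _ m] tree_of_code[OF _ m] by (metis (no_types, lifting) image_iff subsetI subset_antisym image_subsetI)
  then have "(\<Sum>T\<in>trees m. F (dfwalk m T)) = (\<Sum>g\<in>parking m. F (dfwalk m (tree_of m g)))"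
    by (metis (no_types, lifting) inj sum.reindex_cong)
  also have "\<dots> = (\<Sum>g\<in>parking m. F (pwalk m g))"
    using dfwalk_tree_of[OF _ m] by (intro sum.cong) auto
  finally show ?thesis .
qed

section \<open>The cycle lemma\<close>

text \<open>Since \<open>m - 1\<close> cars fall on \<open>m\<close> spots, removing the drift
  \<open>(m - 1) / m\<close> per spot makes the count vanish again after a full turn. Reduction
  modulo \<open>m\<close> turns it into a periodic function on the integers, the discrete
  bridge.\<close>

definition loop :: "nat \<Rightarrow> (nat \<Rightarrow> nat) \<Rightarrow> int \<Rightarrow> real" where
  "loop m g i = real (below {2..m} g (nat (i mod int m))) - real_of_int (i mod int m) * (real (m - 1) / real m)"

text \<open>Every preference moves back by \<open>k\<close> around the circle; \<open>m - k\<close>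
  avoids a subtraction on naturals.\<close>

definition rotate_cars :: "nat \<Rightarrow> nat \<Rightarrow> (nat \<Rightarrow> nat) \<Rightarrow> nat \<Rightarrow> nat" where
  "rotate_cars m k g = (\<lambda>v\<in>{2..m}. (g v + (m - k)) mod m)"

lemma finite_cars [simp]: "finite (cars m)" unfolding cars_def by (intro finite_PiE) auto

lemma card_cars: "card (cars m) = m ^ (m - 1)"
  unfolding cars_def by (subst card_PiE) auto

lemma cars_less: "g \<in> cars m \<Longrightarrow> v \<in> {2..m} \<Longrightarrow> g v < m"
  unfolding cars_def by (auto simp: PiE_def Pi_def)

lemma below_0 [simp]: "below V g 0 = 0" by (simp add: below_def)

lemma below_full: "g \<in> cars m \<Longrightarrow> below {2..m} g m = m - 1"
proof -
  assume "g \<in> cars m"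
  then have "{v \<in> {2..m}. g v < m} = {2..m}" using cars_less[of g m] by auto
  then show ?thesis unfolding below_def by simp
qed

lemma loop_periodic: "loop m g (i + int m) = loop m g i" by (simp add: loop_def)

lemma loop_mod: "loop m g (i mod int m) = loop m g i" by (simp add: loop_def)

lemma loop_0 [simp]: "loop m g 0 = 0" by (simp add: loop_def)

lemma loop_nat: "i < m \<Longrightarrow> loop m g (int i) = real (below {2..m} g i) - real i * (real (m - 1) / real m)"
  by (simp add: loop_def)

lemma loop_nat_le: "g \<in> cars m \<Longrightarrow> m \<ge> 1 \<Longrightarrow> i \<le> m \<Longrightarrow>
    loop m g (int i) = real (below {2..m} g i) - real i * (real (m - 1) / real m)"
  by (cases "i = m") (simp_all add: loop_nat below_full loop_def)

lemma rotate_cars_in: "m \<ge> 1 \<Longrightarrow> rotate_cars m k g \<in> cars m"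
  unfolding rotate_cars_def cars_def by auto

lemma rotate_cars_0: "g \<in> cars m \<Longrightarrow> rotate_cars m 0 g = g"
  using cars_less[of g m] unfolding rotate_cars_def cars_def by (auto simp: PiE_def extensional_def fun_eq_iff)

lemma rotate_cars_back:
  assumes "g \<in> cars m" "k < m" "m \<ge> 1"
  shows "rotate_cars m ((m - k) mod m) (rotate_cars m k g) = g"
proof (cases "k = 0")
  case True then show ?thesis using assms by (simp add: rotate_cars_0)
next
  case False
  have "((g v + (m - k)) mod m + k) mod m = g v" if "v \<in> {2..m}" for v
    using cars_less[OF assms(1) that] assms by (simp add: mod_add_left_eq)
  then show ?thesis using False assms unfolding rotate_cars_def cars_def
    by (auto simp: PiE_def extensional_def fun_eq_iff)
qed

lemma bij_rotate_cars:
  assumes "k < m" shows "bij_betw (rotate_cars m k) (cars m) (cars m)"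
proof -
  have m: "m \<ge> 1" using assms by auto
  let ?k = "(m - k) mod m"
  have k': "?k < m" "(m - ?k) mod m = k" using assms by (auto simp: mod_if)
  show ?thesis
    by (rule bij_betw_byWitness[where f' = "rotate_cars m ?k"])
      (use rotate_cars_back[OF _ assms m] rotate_cars_back[OF _ k'(1) m] rotate_cars_in[OF m] k'(2) in auto)
qed

text \<open>The cars counted are those on the \<open>j\<close> spots from \<open>k\<close> onwards;
  the window falls into two pieces when it runs past \<open>m\<close>. Integers are used because
  differences occur.\<close>

lemma below_rotate_cars:
  assumes g: "g \<in> cars m" and k: "k < m" and j: "j \<le> m"
  shows "int (below {2..m} (rotate_cars m k g) j) =
    (if k + j \<le> m then int (below {2..m} g (k + j)) - int (below {2..m} g k)
     else int (m - 1) - int (below {2..m} g k) + int (below {2..m} g (k + j - m)))"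
proof -
  let ?V = "{2..m}"
  have rc: "(g v + (m - k)) mod m = (if g v < k then g v + (m - k) else g v - k)" if "v \<in> ?V" for v
    using cars_less[OF g that] k by (auto simp: mod_if)
  have S: "{v \<in> ?V. rotate_cars m k g v < j} = {v \<in> ?V. (if g v < k then g v + (m - k) else g v - k) < j}"
    using rc by (auto simp: rotate_cars_def)
  have sp: "card {v \<in> ?V. a \<le> g v \<and> g v < b} + card {v \<in> ?V. g v < a} = card {v \<in> ?V. g v < b}" if "a \<le> b" for a b
    using that by (subst card_Un_disjoint[symmetric]) (auto intro!: arg_cong[where f = card])
  show ?thesis
  proof (cases "k + j \<le> m")
    case True
    have "{v \<in> ?V. rotate_cars m k g v < j} = {v \<in> ?V. k \<le> g v \<and> g v < k + j}"
      unfolding S using True k by (auto split: if_splits)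
    with sp[of k "k + j"] True show ?thesis unfolding below_def by simp
  next
    case False
    have "{v \<in> ?V. rotate_cars m k g v < j} = {v \<in> ?V. k \<le> g v \<and> g v < m} \<union> {v \<in> ?V. g v < k + j - m}"
    proof -
      have "g v - k < j" if "v \<in> ?V" for v using cars_less[OF g that] False k by linarith
      then show ?thesis unfolding S using False k j cars_less[OF g] by (auto split: if_splits)
    qed
    moreover have "{v \<in> ?V. k \<le> g v \<and> g v < m} \<inter> {v \<in> ?V. g v < k + j - m} = {}" using j by auto
    ultimately have "card {v \<in> ?V. rotate_cars m k g v < j}
        = card {v \<in> ?V. k \<le> g v \<and> g v < m} + card {v \<in> ?V. g v < k + j - m}"
      by (simp add: card_Un_disjoint)
    moreover have "card {v \<in> ?V. g v < m} = m - 1" using below_full[OF g] unfolding below_def .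
    ultimately show ?thesis using sp[of k m] False k unfolding below_def by simp
  qed
qed

text \<open>When the window of spots runs past \<open>m\<close>, the count gains the full
  \<open>m - 1\<close>, and the drift over a full turn removes it. So wrapped and unwrapped windows
  obey one formula, that of a path restarted at \<open>k\<close>.\<close>

lemma loop_rotate_cars:
  assumes g: "g \<in> cars m" and k: "k < m"
  shows "loop m (rotate_cars m k g) i = loop m g (i + int k) - loop m g (int k)"
proof -
  define j where "j = nat (i mod int m)"
  have m: "m \<ge> 1" using k by auto
  have j: "j < m" "int j = i mod int m" unfolding j_def using k by (auto simp: nat_less_iff)
  have L: "loop m (rotate_cars m k g) i = real (below {2..m} (rotate_cars m k g) j) - real j * (real (m-1)/real m)"
    by (metis j(1,2) loop_mod loop_nat)
  have "(i + int k) mod int m = int (j + k) mod int m" by (simp add: j(2) mod_add_left_eq)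
  then have R: "loop m g (i + int k) = loop m g (int (j + k))" by (metis loop_mod)
  show ?thesis
  proof (cases "k + j \<le> m")
    case True
    then have "real (below {2..m} (rotate_cars m k g) j) = real (below {2..m} g (k + j)) - real (below {2..m} g k)"
      using below_rotate_cars[OF g k, of j] j
      by (simp only: less_imp_le if_True) (metis of_int_diff of_int_of_nat_eq)
    then show ?thesis using True unfolding L R
      by (subst loop_nat_le[OF g m]) (simp_all add: loop_nat_le[OF g m] k less_imp_le add.commute algebra_simps add_divide_distrib)
  next
    case False
    have "real_of_int (int (below {2..m} (rotate_cars m k g) j)) = real_of_int (int (m - 1) - int (below {2..m} g k) + int (below {2..m} g (k + j - m)))"
      using below_rotate_cars[OF g k, of j] j False by simp
    then have B: "real (below {2..m} (rotate_cars m k g) j) = real (m - 1) - real (below {2..m} g k) + real (below {2..m} g (k + j - m))"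
      by simp
    have "int (j + k) = int (k + j - m) + int m" using False by simp
    then have "loop m g (int (j + k)) = loop m g (int (k + j - m))" by (metis loop_periodic)
    also have "\<dots> = real (below {2..m} g (k + j - m)) - real (k + j - m) * (real (m - 1) / real m)"
      using loop_nat j k by simp
    also have "real (k + j - m) = real k + real j - real m" using False by simp
    finally show ?thesis unfolding L R B using k m
      by (simp add: loop_nat field_simps)
  qed
qed

lemma sum_cars_rotate:
  assumes "k < m"
  shows "(\<Sum>g\<in>cars m. F (loop m g)) = (\<Sum>g\<in>cars m. F (\<lambda>i. loop m g (i + int k) - loop m g (int k)))"
proof -
  have "(\<Sum>g\<in>cars m. F (loop m g)) = (\<Sum>g\<in>cars m. F (loop m (rotate_cars m k g)))"
    using sum.reindex_bij_betw[OF bij_rotate_cars[OF assms], of "\<lambda>g. F (loop m g)"] by simp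
  also have "\<dots> = (\<Sum>g\<in>cars m. F (\<lambda>i. loop m g (i + int k) - loop m g (int k)))"
    by (intro sum.cong refl arg_cong[where f = F] ext) (simp add: loop_rotate_cars assms)
  finally show ?thesis .
qed

text \<open>The loop exceeds the integer \<open>below {2..m} g i - i\<close> by
  \<open>i / m\<close>, which lies strictly between \<open>0\<close> and \<open>1\<close>; so strict
  positivity of the loop is nonnegativity of the integer.\<close>

lemma parking_iff_loop_pos:
  assumes g: "g \<in> cars m" and m: "m \<ge> 1"
  shows "g \<in> parking m \<longleftrightarrow> (\<forall>i. 0 < i \<and> i < m \<longrightarrow> loop m g (int i) > 0)"
proof -
  have "i \<le> below {2..m} g i \<longleftrightarrow> loop m g (int i) > 0" if i: "0 < i" "i < m" for i
  proof -
    have e: "loop m g (int i) = (real (below {2..m} g i) - real i) + real i / real m"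
      using i m by (simp add: loop_nat field_simps)
    have f: "0 < real i / real m" "real i / real m < 1" using i by auto
    show ?thesis
    proof
      assume "i \<le> below {2..m} g i" with e f show "loop m g (int i) > 0" by simp
    next
      assume "loop m g (int i) > 0"
      with e f have "real i - 1 < real (below {2..m} g i)" by linarith
      then show "i \<le> below {2..m} g i" using i by linarith
    qed
  qed
  then show ?thesis using g unfolding parking_def by (auto simp: not_less) (metis below_0 le0 not_gr_zero)+
qed

text \<open>\<open>m * loop m g i\<close> is an integer congruent to \<open>i\<close> modulo
  \<open>m\<close>, so the value determines the position.\<close>

lemma loop_inj:
  assumes g: "g \<in> cars m" and ij: "i < m" "j < m" "loop m g (int i) = loop m g (int j)"
  shows "i = j"
proof -
  have m: "real m > 0" using ij by simp
  have e: "real m * loop m g (int l) = real_of_int (int m * (int (below {2..m} g l) - int l) + int l)" if "l < m" for l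
    using that m by (simp add: loop_nat field_simps of_nat_diff)
  have "int m * (int (below {2..m} g i) - int i) + int i = int m * (int (below {2..m} g j) - int j) + int j"
    using e[OF ij(1)] e[OF ij(2)] ij(3) by (metis of_int_eq_iff)
  then have "(int m * (int (below {2..m} g i) - int i) + int i) mod int m = (int m * (int (below {2..m} g j) - int j) + int j) mod int m"
    by simp
  then show ?thesis using ij by simp
qed

text \<open>The multiples of \<open>1 / m\<close> taken by \<open>loop m g\<close> on \<open>{0..<m}\<close> are pairwise distinct, so the
  minimum is attained once, and exactly one rotation of \<open>g\<close> is a parking function.\<close>

lemma bij_rotate_parking:
  assumes m: "m \<ge> 1"
  shows "bij_betw (\<lambda>(k, g). rotate_cars m k g) ({..<m} \<times> parking m) (cars m)"
proof (rule bij_betw_imageI)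
  have park: "g \<in> cars m" if "g \<in> parking m" for g using that by (simp add: parking_def)
  have min0: "loop m g (int i) \<ge> 0" if "g \<in> parking m" "i < m" for g i
    using parking_iff_loop_pos[OF park[OF that(1)] m] that by (cases "i = 0") (auto intro: less_imp_le)
  \<comment> \<open>Rotating a parking function by \<open>k\<close> moves its unique minimum to
    \<open>- k\<close> modulo \<open>m\<close>; so \<open>k\<close>, and then the parking function,
    can be read off from the result.\<close>
  have minR: "loop m (rotate_cars m k g) (int ((m - k) mod m)) = - loop m g (int k)
      \<and> (\<forall>i. loop m (rotate_cars m k g) i \<ge> - loop m g (int k))"
    if "g \<in> parking m" "k < m" for g k
  proof
    have "(int ((m - k) mod m) + int k) mod int m = 0"
      using that(2) by (metis (no_types, lifting) add.commute le_add_diff_inverse less_imp_le mod_add_right_eq mod_self of_nat_add of_nat_mod of_nat_0 )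
    then have "loop m g (int ((m - k) mod m) + int k) = 0" by (metis loop_0 loop_mod)
    then show "loop m (rotate_cars m k g) (int ((m - k) mod m)) = - loop m g (int k)"
      using loop_rotate_cars[OF park[OF that(1)] that(2)] by simp
    show "\<forall>i. loop m (rotate_cars m k g) i \<ge> - loop m g (int k)"
    proof
      fix i
      have "loop m g ((i + int k) mod int m) \<ge> 0"
        using min0[OF that(1), of "nat ((i + int k) mod int m)"] m by (simp add: nat_less_iff)
      then show "loop m (rotate_cars m k g) i \<ge> - loop m g (int k)"
        using loop_rotate_cars[OF park[OF that(1)] that(2)] loop_mod by simp
    qed
  qed
  show "inj_on (\<lambda>(k, g). rotate_cars m k g) ({..<m} \<times> parking m)"
  proof (rule inj_onI, clarify)
    fix k g k' g' assume A: "k < m" "g \<in> parking m" "k' < m" "g' \<in> parking m"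
      and eq: "rotate_cars m k g = rotate_cars m k' g'"
    note M1 = minR[OF A(2,1)] and M2 = minR[OF A(4,3)]
    have "loop m (rotate_cars m k g) (int ((m - k) mod m)) = loop m (rotate_cars m k g) (int ((m - k') mod m))"
      using M1 M2 eq by (metis order_antisym)
    then have "(m - k) mod m = (m - k') mod m"
      using loop_inj[OF rotate_cars_in[OF m]] m by (metis mod_less_divisor less_le_trans zero_less_one)
    then have "k = k'" using A by (auto simp: mod_if split: if_splits)
    moreover from this have "g = g'"
      using eq A bij_rotate_cars[OF A(1)] park by (metis bij_betw_inv_into_left)
    ultimately show "k = k' \<and> g = g'" by simp
  qed
  show "(\<lambda>(k, g). rotate_cars m k g) ` ({..<m} \<times> parking m) = cars m"
  proof
    show "(\<lambda>(k, g). rotate_cars m k g) ` ({..<m} \<times> parking m) \<subseteq> cars m" using rotate_cars_in[OF m] by auto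
    show "cars m \<subseteq> (\<lambda>(k, g). rotate_cars m k g) ` ({..<m} \<times> parking m)"
    proof
      fix g assume g: "g \<in> cars m"
      have "0 \<in> {..<m}" using m by simp
      then have fin: "finite {..<m}" "{..<m} \<noteq> {}" by blast+
      have "Min ((\<lambda>i. loop m g (int i)) ` {..<m}) \<in> (\<lambda>i. loop m g (int i)) ` {..<m}"
        using fin by (intro Min_in) auto
      then obtain k where k: "k < m" "loop m g (int k) = Min ((\<lambda>i. loop m g (int i)) ` {..<m})" by auto
      have mn: "loop m g (int k) \<le> loop m g (int i)" if "i < m" for i unfolding k(2) using that by auto
      have mn': "loop m g (int k) \<le> loop m g i" for i
        using mn[of "nat (i mod int m)"] m loop_mod[of m g i] by (simp add: nat_less_iff)
      let ?h = "rotate_cars m k g"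
      have "loop m ?h (int i) > 0" if i: "0 < i" "i < m" for i
      proof -
        have "loop m g (int i + int k) \<noteq> loop m g (int k)"
        proof
          assume E: "loop m g (int i + int k) = loop m g (int k)"
          have "loop m g (int ((i + k) mod m)) = loop m g (int k)"
            using E by (metis loop_mod of_nat_add of_nat_mod)
          then have "(i + k) mod m = k" using loop_inj[OF g _ k(1)] m by (metis mod_less_divisor less_le_trans zero_less_one)
          then show False using i k(1) by (auto simp: mod_if split: if_splits)
        qed
        then show ?thesis using mn'[of "int i + int k"] loop_rotate_cars[OF g k(1)] by simp
      qed
      then have "?h \<in> parking m" using parking_iff_loop_pos[OF rotate_cars_in[OF m] m] by blast
      moreover have "g = rotate_cars m ((m - k) mod m) ?h" using rotate_cars_back[OF g k(1) m] by simp
      ultimately show "g \<in> (\<lambda>(k, g). rotate_cars m k g) ` ({..<m} \<times> parking m)"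
        using m by (intro image_eqI[of _ _ "((m - k) mod m, ?h)"]) auto
    qed
  qed
qed

text \<open>Each assignment is one of the \<open>m\<close> rotations of a parking function, and an
  \<open>F\<close> that is blind to the starting point takes the same value on all of them.\<close>

theorem sum_cars_eq_sum_parking:
  assumes m: "m \<ge> 1" and inv: "\<And>w k. F (\<lambda>i. w (i + int k) - w (int k)) = F w"
  shows "(\<Sum>g\<in>cars m. F (loop m g)) = real m * (\<Sum>g\<in>parking m. F (loop m g))"
proof -
  have "(\<Sum>g\<in>cars m. F (loop m g)) = (\<Sum>(k, g)\<in>{..<m} \<times> parking m. F (loop m (rotate_cars m k g)))"
    using sum.reindex_bij_betw[OF bij_rotate_parking[OF m], of "\<lambda>g. F (loop m g)"]
    by (simp add: case_prod_beta)
  also have "\<dots> = (\<Sum>(k, g)\<in>{..<m} \<times> parking m. F (loop m g))"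
  proof (intro sum.cong refl, clarify)
    fix k g assume "k < m" "g \<in> parking m"
    then have "loop m (rotate_cars m k g) = (\<lambda>i. loop m g (i + int k) - loop m g (int k))"
      by (intro ext loop_rotate_cars) (auto simp: parking_def)
    then show "F (loop m (rotate_cars m k g)) = F (loop m g)" using inv by simp
  qed
  also have "\<dots> = real m * (\<Sum>g\<in>parking m. F (loop m g))"
    by (simp add: sum.cartesian_product[symmetric])
  finally show ?thesis .
qed

text \<open>Cayley's count, kept in a form without the exponent \<open>m - 2\<close>, which would be
  truncated at \<open>m = 1\<close>.\<close>

lemma card_parking: "m \<ge> 1 \<Longrightarrow> real m * real (card (parking m)) = real m ^ (m - 1)"
  using sum_cars_eq_sum_parking[of m "\<lambda>_. 1"] by (simp add: card_cars)

section \<open>A maximal inequality\<close>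

lemma convex_exp_interp:
  fixes \<theta> q :: real
  assumes "0 \<le> q" "q \<le> 1"
  shows "exp (\<theta> * q) \<le> q * exp \<theta> + (1 - q)"
proof -
  have "exp ((1 - q) *\<^sub>R 0 + q *\<^sub>R \<theta>) \<le> (1 - q) * exp 0 + q * exp \<theta>"
    using assms by (intro convex_onD[OF exp_convex]) auto
  then show ?thesis by (simp add: algebra_simps)
qed

lemma exp_le_quadratic:
  fixes x :: real
  assumes "\<bar>x\<bar> \<le> 1"
  shows "exp x \<le> 1 + x + x\<^sup>2"
proof (cases "x \<ge> 0")
  case True
  then show ?thesis using exp_bound[of x] assms by simp
next
  case False
  define t where "t = - x"
  have t: "0 < t" "t \<le> 1" using False assms by (auto simp: t_def)
  have "1 \<le> (1 + t + t\<^sup>2 / 2) * (1 - t + t\<^sup>2)"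
  proof -
    have "(1 + t + t\<^sup>2 / 2) * (1 - t + t\<^sup>2) = 1 + (t\<^sup>2 + t ^ 3 + t ^ 4) / 2"
      by (simp add: field_simps power2_eq_square power3_eq_cube power4_eq_xxxx)
    then show ?thesis using t by simp
  qed
  also have "\<dots> \<le> exp t * (1 - t + t\<^sup>2)"
  proof (rule mult_right_mono)
    show "1 + t + t\<^sup>2 / 2 \<le> exp t" using exp_lower_Taylor_quadratic[of t] t by simp
    show "0 \<le> 1 - t + t\<^sup>2" using t by simp
  qed
  finally have "exp x * 1 \<le> exp x * (exp t * (1 - t + t\<^sup>2))" by (intro mult_left_mono) auto
  moreover have "exp x * exp t = 1" by (simp add: t_def exp_minus)
  ultimately have "exp x \<le> 1 - t + t\<^sup>2" by (simp flip: mult.assoc)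
  then show ?thesis by (simp add: t_def)
qed

lemma sum_cars_prod: "(\<Sum>g\<in>{2..m} \<rightarrow>\<^sub>E {..<m}. \<Prod>v\<in>{2..m}. \<phi> (g v)) = (\<Sum>k<m. \<phi> k :: real) ^ (m - 1)"
  by (subst prod_sum_PiE[symmetric]) auto

lemma exp_below: "finite V \<Longrightarrow> exp (\<theta> * real (below V g h)) = (\<Prod>v\<in>V. if g v < h then exp \<theta> else 1)"
proof -
  assume V: "finite V"
  have "(\<Prod>v\<in>V. if g v < h then exp \<theta> else 1) = exp \<theta> ^ card {v \<in> V. g v < h}"
    using V by (simp add: prod.If_cases Int_def)
  then show ?thesis unfolding below_def by (simp add: exp_of_nat_mult[symmetric] mult.commute)
qed

text \<open>Given the positions of the cars parked before \<open>j\<close>, the remaining ones are independent and uniform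
  on \<open>{j..<m}\<close>; averaging over them, Jensen's inequality plays the role of the optional stopping theorem.\<close>

lemma fibre_sum_exp:
  fixes \<theta> :: real
  assumes jh: "j \<le> h" "h < m" and c: "c \<in> cars m"
  shows "(\<Sum>g | g \<in> cars m \<and> (\<forall>v\<in>{2..m}. min (g v) j = min (c v) j). exp (\<theta> * loop m g (int h)))
    \<ge> real (card {g \<in> cars m. \<forall>v\<in>{2..m}. min (g v) j = min (c v) j})
        * exp (\<theta> * (loop m c (int j) * (real (m - h) / real (m - j))))"
proof -
  let ?V = "{2..m}"
  \<comment> \<open>The fibre is a product set: a car below \<open>j\<close> is pinned, every other
    one ranges freely over \<open>{j..<m}\<close>.\<close>
  define A where "A v = (if c v < j then {c v} else {j..<m})" for v
  have fib: "{g \<in> cars m. \<forall>v\<in>?V. min (g v) j = min (c v) j} = Pi\<^sub>E ?V A" (is "?F = _")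
  proof (intro set_eqI iffI)
    fix g assume g: "g \<in> ?F"
    have "g v \<in> A v" if v: "v \<in> ?V" for v
    proof -
      have "min (g v) j = min (c v) j" "g v < m" using g v cars_less[of g m v] by auto
      then show ?thesis unfolding A_def by (auto simp: min_def split: if_splits)
    qed
    then show "g \<in> Pi\<^sub>E ?V A" using g unfolding cars_def by (auto simp: PiE_def)
  next
    fix g assume g: "g \<in> Pi\<^sub>E ?V A"
    have "g v < m \<and> min (g v) j = min (c v) j" if v: "v \<in> ?V" for v
    proof -
      have "g v \<in> A v" using g v by auto
      then show ?thesis using cars_less[OF c v] unfolding A_def by (auto simp: min_def split: if_splits)
    qed
    then show "g \<in> ?F" using g unfolding cars_def by (auto simp: PiE_def)
  qed
  \<comment> \<open>The chance that a car still free at \<open>j\<close> falls before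
    \<open>h\<close>.\<close>
  define q where "q = real (h - j) / real (m - j)"
  have q: "0 \<le> q" "q \<le> 1" using jh by (auto simp: q_def field_simps)
  let ?N = "real (below ?V c j)"
  let ?n = "real (m - 1)"
  have cardA: "real (card (A v)) * (if c v < j then exp \<theta> else exp (\<theta> * q))
      \<le> (\<Sum>k\<in>A v. if k < h then exp \<theta> else 1)" for v
  proof (cases "c v < j")
    case True
    then show ?thesis using jh by (simp add: A_def)
  next
    case False
    have s: "{j..<m} \<inter> {k. k < h} = {j..<h}" "{j..<m} \<inter> - {k. k < h} = {h..<m}" using jh by auto
    have "(\<Sum>k\<in>{j..<m}. if k < h then exp \<theta> else 1) = real (h - j) * exp \<theta> + real (m - h)"
      by (subst sum.If_cases) (simp_all add: s)
    also have "\<dots> = real (m - j) * (q * exp \<theta> + (1 - q))"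
    proof -
      have "real (m - j) * q = real (h - j)" using jh unfolding q_def by simp
      then have "real (m - j) * (q * exp \<theta> + (1 - q)) = real (h - j) * exp \<theta> + real (m - j) - real (h - j)"
        by (simp add: algebra_simps flip: mult.assoc)
      then show ?thesis using jh by (simp add: of_nat_diff)
    qed
    also have "\<dots> \<ge> real (m - j) * exp (\<theta> * q)"
      by (intro mult_left_mono convex_exp_interp q) auto
    finally show ?thesis using False by (simp add: A_def)
  qed
  have "(\<Prod>v\<in>?V. real (card (A v))) * (\<Prod>v\<in>?V. if c v < j then exp \<theta> else exp (\<theta> * q))
     \<le> (\<Prod>v\<in>?V. \<Sum>k\<in>A v. if k < h then exp \<theta> else 1)"
    unfolding prod.distrib[symmetric] using cardA by (intro prod_mono) auto
  also have "\<dots> = (\<Sum>g\<in>Pi\<^sub>E ?V A. \<Prod>v\<in>?V. if g v < h then exp \<theta> else 1)"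
    by (subst prod_sum_PiE) (auto simp: A_def)
  also have "\<dots> = (\<Sum>g\<in>Pi\<^sub>E ?V A. exp (\<theta> * real (below ?V g h)))" by (simp add: exp_below)
  finally have *: "real (card (Pi\<^sub>E ?V A)) * (\<Prod>v\<in>?V. if c v < j then exp \<theta> else exp (\<theta> * q))
     \<le> (\<Sum>g\<in>Pi\<^sub>E ?V A. exp (\<theta> * real (below ?V g h)))" by (simp add: card_PiE)
  have "(\<Prod>v\<in>?V. if c v < j then exp \<theta> else exp (\<theta> * q)) =
      (\<Prod>v\<in>?V. exp (\<theta> * q) * (if c v < j then exp (\<theta> * (1 - q)) else 1))"
    by (intro prod.cong) (auto simp: exp_add[symmetric] algebra_simps)
  also have "\<dots> = exp (\<theta> * q) ^ (m - 1) * exp (\<theta> * (1 - q) * ?N)"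
    by (simp add: prod.distrib exp_below)
  also have "\<dots> = exp (\<theta> * (q * ?n + (1 - q) * ?N))"
    by (simp add: exp_of_nat_mult[symmetric] exp_add[symmetric] algebra_simps)
  finally have **: "(\<Prod>v\<in>?V. if c v < j then exp \<theta> else exp (\<theta> * q)) = exp (\<theta> * (q * ?n + (1 - q) * ?N))" .
  let ?d = "real h * (?n / real m)"
  \<comment> \<open>The left side is the mean of the loop at \<open>h\<close> given the cars before
    \<open>j\<close>; it is the current value shrunk linearly, as for a bridge.\<close>
  have id: "q * ?n + (1 - q) * ?N - ?d = loop m c (int j) * (real (m - h) / real (m - j))"
  proof -
    have "j < m" using jh by simp
    then have "loop m c (int j) = ?N - real j * (?n / real m)" by (simp add: loop_nat)
    moreover have d: "real (m - j) > 0" "real m > 0" "real (m - j) = real m - real j" "real (m - h) = real m - real h"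
      "real (h - j) = real h - real j" using jh by auto
    moreover have qd: "q * (real m - real j) = real h - real j" using d unfolding q_def by simp
    moreover have "real (m - h) / real (m - j) = 1 - q" using d unfolding q_def by (simp add: field_simps)
    moreover have "q - real h / real m + (1 - q) * (real j / real m) = 0"
    proof -
      have "q - real h / real m + (1 - q) * (real j / real m) = (q * real m - real h + (1 - q) * real j) / real m"
        using d by (simp add: add_divide_distrib diff_divide_distrib)
      also have "q * real m - real h + (1 - q) * real j = 0" using qd by (simp add: algebra_simps)
      finally show ?thesis by simp
    qed
    moreover have "q * n + (1 - q) * N - real h * (n / real m) = (N - real j * (n / real m)) * (1 - q)
        + n * (q - real h / real m + (1 - q) * (real j / real m))" for n N :: real
      by (simp add: algebra_simps)
    ultimately show ?thesis by (simp only: mult_zero_right add_0_right)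
  qed
  have "real (card (Pi\<^sub>E ?V A)) * exp (\<theta> * (loop m c (int j) * (real (m - h) / real (m - j))))
     = real (card (Pi\<^sub>E ?V A)) * exp (\<theta> * (q * ?n + (1 - q) * ?N)) * exp (- \<theta> * ?d)"
    unfolding id[symmetric] by (simp add: exp_add[symmetric] algebra_simps)
  also have "\<dots> \<le> (\<Sum>g\<in>Pi\<^sub>E ?V A. exp (\<theta> * real (below ?V g h))) * exp (- \<theta> * ?d)"
    using * unfolding ** by (intro mult_right_mono) auto
  also have "\<dots> = (\<Sum>g\<in>Pi\<^sub>E ?V A. exp (\<theta> * loop m g (int h)))"
    unfolding sum_distrib_right by (intro sum.cong refl)
      (simp only: loop_nat[OF jh(2)] diff_conv_add_uminus distrib_left exp_add mult_minus_left mult_minus_right)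
  finally show ?thesis unfolding fib[symmetric] by simp
qed

text \<open>Split by the first position \<open>j\<close> at which the level \<open>x\<close> is
  reached. Given the cars before that \<open>j\<close>, the mean at \<open>h\<close> is still at
  least \<open>x / 2\<close>, because \<open>2 * h \<le> m\<close> bounds the factor
  \<open>(m - h) / (m - j)\<close> below by \<open>1/2\<close>; this is the origin of the
  \<open>2\<close> in the exponent.\<close>

lemma maximal_inequality_one_sided:
  fixes \<theta> x :: real
  assumes h: "h < m" and \<theta>: "\<bar>s\<bar> = (1::real)" "\<theta> \<ge> 0" "x \<ge> 0" "2 * h \<le> m"
  shows "real (card {g \<in> cars m. \<exists>j\<le>h. s * loop m g (int j) \<ge> x}) * exp (\<theta> * x / 2)
    \<le> (\<Sum>g\<in>cars m. exp (\<theta> * s * loop m g (int h)))"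
proof -
  let ?V = "{2..m}"
  define hit where "hit g j \<longleftrightarrow> s * loop m g (int j) \<ge> x \<and> (\<forall>i<j. s * loop m g (int i) < x)" for g j
  define E where "E j = {g \<in> cars m. hit g j}" for j
  \<comment> \<open>Truncating preferences at \<open>j\<close> keeps exactly the information about
    the cars before \<open>j\<close>, and reaching the level first at \<open>j\<close> is decided by
    it.\<close>
  define cap where "cap j g = (\<lambda>v\<in>?V. min (g v) j)" for j and g :: "nat \<Rightarrow> nat"
  have cap_eq: "cap j g = cap j c \<longleftrightarrow> (\<forall>v\<in>?V. min (g v) j = min (c v) j)" for j g c
    unfolding cap_def by (auto simp: fun_eq_iff restrict_def)
  have hit_cap: "hit g j = hit c j" if "cap j g = cap j c" "j < m" for g c j
  proof -
    have "below ?V g i = below ?V c i" if i: "i \<le> j" for i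
    proof -
      have "g v < i \<longleftrightarrow> c v < i" if "v \<in> ?V" for v
      proof -
        have "min (g v) j = min (c v) j" using \<open>cap j g = cap j c\<close> that unfolding cap_eq by auto
        then show ?thesis using i by (auto simp: min_def split: if_splits)
      qed
      then show ?thesis unfolding below_def by (intro arg_cong[where f = card]) auto
    qed
    then have "loop m g (int i) = loop m c (int i)" if "i \<le> j" for i
      using that \<open>j < m\<close> by (simp add: loop_nat)
    then show ?thesis unfolding hit_def by auto
  qed
  have Ej: "real (card (E j)) * exp (\<theta> * x / 2) \<le> (\<Sum>g\<in>E j. exp (\<theta> * s * loop m g (int h)))" if j: "j \<le> h" for j
  proof -
    have finE: "finite (E j)" unfolding E_def by simp
    have fibre: "real (card {g \<in> E j. cap j g = y}) * exp (\<theta> * x / 2)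
        \<le> (\<Sum>g\<in>{g \<in> E j. cap j g = y}. exp (\<theta> * s * loop m g (int h)))" if y: "y \<in> cap j ` E j" for y
    proof -
      obtain c where c: "c \<in> E j" "y = cap j c" using y by auto
      have F: "{g \<in> E j. cap j g = y} = {g \<in> cars m. \<forall>v\<in>?V. min (g v) j = min (c v) j}"
      proof -
        have "g \<in> E j" if "g \<in> cars m" "cap j g = cap j c" for g
          using hit_cap[OF that(2)] c(1) that(1) j h unfolding E_def by simp
        moreover have "g \<in> cars m" if "g \<in> E j" for g using that unfolding E_def by simp
        ultimately show ?thesis unfolding cap_eq[symmetric] c(2) by blast
      qed
      have r: "real (m - h) / real (m - j) \<ge> 1/2" using j \<theta> h by (simp add: field_simps of_nat_diff)
      have "s * loop m c (int j) \<ge> x" using c unfolding E_def hit_def by auto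
      then have "x * (1/2) \<le> (s * loop m c (int j)) * (real (m - h) / real (m - j))"
        using r \<theta>(3) by (intro mult_mono) auto
      then have "\<theta> * x / 2 \<le> \<theta> * s * (loop m c (int j) * (real (m - h) / real (m - j)))"
        using mult_left_mono[OF _ \<theta>(2)] by (fastforce simp: algebra_simps)
      then have "real (card {g \<in> cars m. \<forall>v\<in>?V. min (g v) j = min (c v) j}) * exp (\<theta> * x / 2)
         \<le> real (card {g \<in> cars m. \<forall>v\<in>?V. min (g v) j = min (c v) j}) * exp (\<theta> * s * (loop m c (int j) * (real (m - h) / real (m - j))))"
        by (intro mult_left_mono) auto
      also have "\<dots> \<le> (\<Sum>g | g \<in> cars m \<and> (\<forall>v\<in>?V. min (g v) j = min (c v) j). exp (\<theta> * s * loop m g (int h)))"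
        using c by (intro fibre_sum_exp j h) (auto simp: E_def)
      finally show ?thesis unfolding F .
    qed
    have "real (card (E j)) * exp (\<theta> * x / 2) = (\<Sum>g\<in>E j. exp (\<theta> * x / 2))" by simp
    also have "\<dots> = (\<Sum>y\<in>cap j ` E j. \<Sum>g\<in>{g \<in> E j. cap j g = y}. exp (\<theta> * x / 2))"
      by (rule sum.image_gen[OF finE])
    also have "\<dots> \<le> (\<Sum>y\<in>cap j ` E j. \<Sum>g\<in>{g \<in> E j. cap j g = y}. exp (\<theta> * s * loop m g (int h)))"
      by (rule sum_mono, simp add: fibre)
    also have "\<dots> = (\<Sum>g\<in>E j. exp (\<theta> * s * loop m g (int h)))"
      by (rule sum.image_gen[OF finE, symmetric])
    finally show ?thesis .
  qed
  have disj: "E i \<inter> E j = {}" if "i \<noteq> j" for i j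
    using that unfolding E_def hit_def by (auto simp: not_le) (meson linorder_neqE_nat not_le)
  have U: "{g \<in> cars m. \<exists>j\<le>h. s * loop m g (int j) \<ge> x} = (\<Union>j\<le>h. E j)"
  proof (intro set_eqI iffI)
    fix g assume g: "g \<in> {g \<in> cars m. \<exists>j\<le>h. s * loop m g (int j) \<ge> x}"
    let ?j = "LEAST j. s * loop m g (int j) \<ge> x"
    obtain j where j: "j \<le> h" "s * loop m g (int j) \<ge> x" using g by auto
    have "?j \<le> j" using j by (intro Least_le)
    moreover have "hit g ?j" unfolding hit_def
      using LeastI[of "\<lambda>j. s * loop m g (int j) \<ge> x", OF j(2)] not_less_Least[of _ "\<lambda>j. s * loop m g (int j) \<ge> x"]
      by (meson not_le)
    ultimately show "g \<in> (\<Union>j\<le>h. E j)" using g j unfolding E_def by (intro UN_I[of ?j]) auto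
  qed (auto simp: E_def hit_def)
  have "real (card (\<Union>j\<le>h. E j)) * exp (\<theta> * x / 2) = (\<Sum>j\<le>h. real (card (E j)) * exp (\<theta> * x / 2))"
    using disj by (subst card_UN_disjoint) (auto simp: E_def sum_distrib_right)
  also have "\<dots> \<le> (\<Sum>j\<le>h. \<Sum>g\<in>E j. exp (\<theta> * s * loop m g (int h)))"
    using Ej by (intro sum_mono) auto
  also have "\<dots> = (\<Sum>g\<in>(\<Union>j\<le>h. E j). exp (\<theta> * s * loop m g (int h)))"
    using disj by (subst sum.UNION_disjoint) (auto simp: E_def)
  also have "\<dots> \<le> (\<Sum>g\<in>cars m. exp (\<theta> * s * loop m g (int h)))"
    by (intro sum_mono2) (auto simp: E_def)
  finally show ?thesis unfolding U .
qed

text \<open>The loop at \<open>h\<close> is a centred binomial count: its generating function is an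
  \<open>m - 1\<close>-fold power, \<open>1 + u \<le> exp u\<close> turns this into an exponential,
  and the drift cancels the linear term, leaving
  \<open>exp \<theta> - 1 - \<theta> \<le> \<theta>\<^sup>2\<close>.\<close>

lemma mgf_loop:
  fixes \<theta> :: real
  assumes h: "h < m" and \<theta>: "\<bar>\<theta>\<bar> \<le> 1"
  shows "(\<Sum>g\<in>cars m. exp (\<theta> * loop m g (int h))) \<le> real m ^ (m - 1) * exp (real h * \<theta>\<^sup>2)"
proof -
  let ?n = "m - 1"
  have m: "real m > 0" using h by simp
  let ?p = "real h / real m"
  have s: "{..<m} \<inter> {k. k < h} = {..<h}" "{..<m} \<inter> - {k. k < h} = {h..<m}" using h by auto
  have "(\<Sum>k<m. if k < h then exp \<theta> else 1) = real h * exp \<theta> + real (m - h)"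
    by (subst sum.If_cases) (simp_all add: s)
  also have "\<dots> = real m * (1 + ?p * (exp \<theta> - 1))" using h by (simp add: field_simps of_nat_diff)
  finally have S: "(\<Sum>k<m. if k < h then exp \<theta> else 1) = real m * (1 + ?p * (exp \<theta> - 1))" .
  have "(\<Sum>g\<in>cars m. exp (\<theta> * real (below {2..m} g h))) = (real m * (1 + ?p * (exp \<theta> - 1))) ^ ?n"
    unfolding S[symmetric] sum_cars_prod[symmetric] cars_def by (simp add: exp_below)
  also have "\<dots> = real m ^ ?n * (1 + ?p * (exp \<theta> - 1)) ^ ?n" by (simp add: power_mult_distrib)
  also have "\<dots> \<le> real m ^ ?n * exp (?p * (exp \<theta> - 1)) ^ ?n"
  proof (intro mult_left_mono power_mono)
    show "1 + ?p * (exp \<theta> - 1) \<le> exp (?p * (exp \<theta> - 1))" by (rule exp_ge_add_one_self)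
    have "0 \<le> (1 - ?p) + ?p * exp \<theta>" using h by (intro add_nonneg_nonneg mult_nonneg_nonneg) auto
    then show "0 \<le> 1 + ?p * (exp \<theta> - 1)" by (simp add: algebra_simps diff_divide_distrib)
  qed auto
  also have "exp (?p * (exp \<theta> - 1)) ^ ?n = exp (real ?n * (?p * (exp \<theta> - 1)))" by (simp only: exp_of_nat_mult)
  finally have A: "(\<Sum>g\<in>cars m. exp (\<theta> * real (below {2..m} g h))) \<le> real m ^ ?n * exp (real ?n * (?p * (exp \<theta> - 1)))" .
  let ?d = "real h * (real ?n / real m)"
  have "(\<Sum>g\<in>cars m. exp (\<theta> * loop m g (int h))) = (\<Sum>g\<in>cars m. exp (\<theta> * real (below {2..m} g h))) * exp (- \<theta> * ?d)"
    unfolding sum_distrib_right by (intro sum.cong refl)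
      (simp only: loop_nat[OF h] diff_conv_add_uminus distrib_left exp_add mult_minus_left mult_minus_right)
  also have "\<dots> \<le> real m ^ ?n * exp (real ?n * (?p * (exp \<theta> - 1))) * exp (- \<theta> * ?d)"
    using A by (intro mult_right_mono) auto
  also have "\<dots> = real m ^ ?n * exp (?d * (exp \<theta> - 1 - \<theta>))"
  proof -
    have eq: "a * (?p * (e - 1)) + - \<theta> * (real h * (a / real m)) = real h * (a / real m) * (e - 1 - \<theta>)"
      for a e :: real using m by (simp add: field_simps)
    show ?thesis by (subst mult.assoc, subst exp_add[symmetric], subst eq, rule refl)
  qed
  also have "\<dots> \<le> real m ^ ?n * exp (real h * \<theta>\<^sup>2)"
  proof -
    have "exp \<theta> - 1 - \<theta> \<le> \<theta>\<^sup>2"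
      using exp_le_quadratic[OF \<theta>] by simp
    moreover have "?d \<le> real h * 1" using m by (intro mult_left_mono) auto
    then have "?d \<le> real h" by simp
    moreover have "?d \<ge> 0" by simp
    moreover have "0 \<le> exp \<theta> - 1 - \<theta>" using exp_ge_add_one_self[of \<theta>] by linarith
    ultimately have "?d * (exp \<theta> - 1 - \<theta>) \<le> real h * \<theta>\<^sup>2" by (intro mult_mono) auto
    then show ?thesis by (intro mult_left_mono) auto
  qed
  finally show ?thesis .
qed

text \<open>The parameter stays free: \<open>1 / sqrt h\<close> gives the tail for one block of the
  grid, a constant over \<open>sqrt m\<close> gives the exponential moments of the area.\<close>

lemma maximal_inequality:
  fixes \<theta> x :: real
  assumes h: "h < m" "2 * h \<le> m" and \<theta>: "0 \<le> \<theta>" "\<theta> \<le> 1" and x: "x \<ge> 0"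
  shows "real (card {g \<in> cars m. \<exists>j\<le>h. \<bar>loop m g (int j)\<bar> \<ge> x})
    \<le> 2 * real m ^ (m - 1) * exp (real h * \<theta>\<^sup>2 - \<theta> * x / 2)"
proof -
  have one: "real (card {g \<in> cars m. \<exists>j\<le>h. s * loop m g (int j) \<ge> x}) \<le> real m ^ (m - 1) * exp (real h * \<theta>\<^sup>2 - \<theta> * x / 2)"
    if s: "\<bar>s\<bar> = 1" for s :: real
  proof -
    have "real (card {g \<in> cars m. \<exists>j\<le>h. s * loop m g (int j) \<ge> x}) * exp (\<theta> * x / 2) \<le> real m ^ (m - 1) * exp (real h * (\<theta> * s)\<^sup>2)"
      using maximal_inequality_one_sided[OF h(1) s \<theta>(1) x h(2)] mgf_loop[OF h(1), of "\<theta> * s"] \<theta> s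
      by (simp add: abs_mult)
    also have "(\<theta> * s)\<^sup>2 = \<theta>\<^sup>2" using s by (metis mult.right_neutral power2_abs power_mult_distrib power_one)
    finally have "real (card {g \<in> cars m. \<exists>j\<le>h. s * loop m g (int j) \<ge> x}) \<le> real m ^ (m - 1) * exp (real h * \<theta>\<^sup>2) / exp (\<theta> * x / 2)"
      by (simp add: field_simps)
    then show ?thesis by (simp add: exp_diff)
  qed
  have "{g \<in> cars m. \<exists>j\<le>h. \<bar>loop m g (int j)\<bar> \<ge> x} \<subseteq>
     {g \<in> cars m. \<exists>j\<le>h. 1 * loop m g (int j) \<ge> x} \<union> {g \<in> cars m. \<exists>j\<le>h. (-1) * loop m g (int j) \<ge> x}"
    by (auto simp: abs_if split: if_splits)
  then have "real (card {g \<in> cars m. \<exists>j\<le>h. \<bar>loop m g (int j)\<bar> \<ge> x}) \<le>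
     real (card {g \<in> cars m. \<exists>j\<le>h. 1 * loop m g (int j) \<ge> x}) + real (card {g \<in> cars m. \<exists>j\<le>h. (-1) * loop m g (int j) \<ge> x})"
    (is "real (card ?A) \<le> real (card ?B) + real (card ?C)")
  proof -
    assume "?A \<subseteq> ?B \<union> ?C"
    then have "card ?A \<le> card (?B \<union> ?C)" by (intro card_mono) auto
    also have "\<dots> \<le> card ?B + card ?C" by (rule card_Un_le)
    finally show ?thesis by linarith
  qed
  then show ?thesis using one[of 1] one[of "-1"] by simp
qed

section \<open>First passage kernels\<close>

definition gauss_cdf :: "real \<Rightarrow> real" where
  "gauss_cdf z = cdf std_normal_distribution z"

lemma gauss_cdf_limits: "(gauss_cdf \<longlongrightarrow> 1) at_top" "(gauss_cdf \<longlongrightarrow> 0) at_bot"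
proof -
  interpret real_distribution std_normal_distribution by (rule real_dist_normal_dist)
  show "(gauss_cdf \<longlongrightarrow> 1) at_top" unfolding gauss_cdf_def using cdf_lim_at_top_prob .
  show "(gauss_cdf \<longlongrightarrow> 0) at_bot" unfolding gauss_cdf_def using cdf_lim_at_bot .
qed

lemma gauss_cdf_deriv: "(gauss_cdf has_real_derivative exp (- z\<^sup>2 / 2) / sqrt (2 * pi)) (at z)"
proof -
  interpret real_distribution std_normal_distribution by (rule real_dist_normal_dist)
  define a where "a = z - 1"
  have cont: "continuous_on {a..z+1} std_normal_density"
    unfolding normal_density_def by (intro continuous_intros) auto
  have eq: "gauss_cdf y = gauss_cdf a + integral {a..y} std_normal_density" if y: "a < y" for y
  proof -
    have "gauss_cdf y - gauss_cdf a = measure std_normal_distribution {a<..y}"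
      unfolding gauss_cdf_def using cdf_diff_eq[OF y] .
    also have "\<dots> = (\<integral>x\<in>{a<..y}. std_normal_density x \<partial>lborel)"
    proof -
      have "measure std_normal_distribution {a<..y} = (\<integral>x. indicator {a<..y} x \<partial>std_normal_distribution)" by simp
      also have "\<dots> = (\<integral>x. std_normal_density x *\<^sub>R indicator {a<..y} x \<partial>lborel)"
        by (rule integral_density) auto
      finally show ?thesis by (simp add: set_lebesgue_integral_def mult.commute)
    qed
    also have "\<dots> = (\<integral>x\<in>{a..y}. std_normal_density x \<partial>lborel)"
    proof -
      have "AE x in lborel. indicator {a<..y} x *\<^sub>R std_normal_density x = indicator {a..y} x *\<^sub>R std_normal_density x"
        using AE_lborel_singleton[of a] by eventually_elim (auto simp: indicator_def)
      then show ?thesis unfolding set_lebesgue_integral_def by (rule integral_cong_AE[rotated 2]) auto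
    qed
    also have "\<dots> = integral {a..y} std_normal_density"
    proof -
      have "set_integrable lborel {a..y} std_normal_density"
        unfolding set_integrable_def by (rule integrable_mult_indicator) auto
      then show ?thesis by (rule set_borel_integral_eq_integral(2))
    qed
    finally show ?thesis by simp
  qed
  have "((\<lambda>y. integral {a..y} std_normal_density) has_real_derivative std_normal_density z) (at z within {a..z+1})"
    by (rule integral_has_real_derivative[OF cont]) (auto simp: a_def)
  then have "((\<lambda>y. integral {a..y} std_normal_density) has_real_derivative std_normal_density z) (at z)"
    by (subst (asm) at_within_interior) (auto simp: a_def)
  then have "((\<lambda>y. gauss_cdf a + integral {a..y} std_normal_density) has_real_derivative std_normal_density z) (at z)"
    by (auto intro!: derivative_eq_intros)
  then have "(gauss_cdf has_real_derivative std_normal_density z) (at z)"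
    by (rule has_field_derivative_transform_within_open[where S = "{a<..}"]) (simp_all add: eq, simp add: a_def)
  then show ?thesis by (simp add: normal_density_def field_simps)
qed

text \<open>Hitting the level \<open>x + y\<close> means hitting \<open>x\<close> and then climbing
  another \<open>y\<close>. The proof needs no process: it gives an explicit primitive in terms of
  \<open>gauss_cdf\<close>, suggested by the exponential factor of the integrand, which is a
  constant times \<open>exp (- (U v)\<^sup>2 / 2)\<close>.\<close>

lemma first_passage_convolution:
  assumes x: "x > 0" and y: "y > 0" and L: "L > 0"
  shows "(\<integral>\<^sup>+v\<in>{0<..<L}. ennreal (first_passage v x * first_passage (L - v) y) \<partial>lborel)
    = ennreal (first_passage L (x + y))"
proof -
  define U where "U v = (x * (L - v) - y * v) / sqrt (L * v * (L - v))" for v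
  define W where "W v = (x * (L - v) + y * v) / sqrt (L * v * (L - v))" for v
  define c where "c = 2 * exp (- (x + y)\<^sup>2 / (2 * L)) / sqrt (2 * pi * L ^ 3)"
  \<comment> \<open>With the shifts by \<open>1\<close> the primitive vanishes at \<open>0\<close>.
    At \<open>L\<close> the argument \<open>U\<close> has run down to minus infinity while
    \<open>W\<close> is back at plus infinity, so only the first term survives. The weights are
    those for which the two derivatives add up to the integrand.\<close>
  define F where "F v = - c * ((x + y) / 2 * (gauss_cdf (U v) - 1) + (y - x) / 2 * exp (2 * x * y / L) * (gauss_cdf (W v) - 1))" for v
  let ?f = "\<lambda>v. first_passage v x * first_passage (L - v) y"
  have U0: "filterlim U at_top (at_right 0)" unfolding U_def using x y L by real_asymp
  have W0: "filterlim W at_top (at_right 0)" unfolding W_def using x y L by real_asymp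
  have UL: "filterlim U at_bot (at_left L)" unfolding U_def using x y L by real_asymp
  have WL: "filterlim W at_top (at_left L)" unfolding W_def using x y L by real_asymp
  have F0: "(F \<longlongrightarrow> - c * ((x + y) / 2 * (1 - 1) + (y - x) / 2 * exp (2 * x * y / L) * (1 - 1))) (at_right 0)"
    unfolding F_def by (intro tendsto_intros filterlim_compose[OF gauss_cdf_limits(1) U0] filterlim_compose[OF gauss_cdf_limits(1) W0])
  have FL: "(F \<longlongrightarrow> - c * ((x + y) / 2 * (0 - 1) + (y - x) / 2 * exp (2 * x * y / L) * (1 - 1))) (at_left L)"
    unfolding F_def by (intro tendsto_intros filterlim_compose[OF gauss_cdf_limits(2) UL] filterlim_compose[OF gauss_cdf_limits(1) WL])
  have DF: "DERIV F v :> ?f v" if v: "0 < v" "v < L" for v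
  proof -
    define r where "r = sqrt (L * v * (L - v))"
    have r: "r > 0" "r\<^sup>2 = L * v * (L - v)" using v L by (auto simp: r_def)
    have dr: "((\<lambda>v. sqrt (L * v * (L - v))) has_real_derivative (L * (L - 2 * v) / (2 * r))) (at v)"
      unfolding r_def using v L by (auto intro!: derivative_eq_intros simp: field_simps)
    have dU: "(U has_real_derivative (- (L * L) * (x * (L - v) + y * v) / (2 * r ^ 3))) (at v)"
    proof -
      have "(U has_real_derivative ((- x - y) * r - (x * (L - v) - y * v) * (L * (L - 2 * v) / (2 * r))) / (r * r)) (at v)"
      proof -
        have "((\<lambda>v. x * (L - v) - y * v) has_real_derivative (- x - y)) (at v)"
          by (auto intro!: derivative_eq_intros)
        from DERIV_divide[OF this dr] show ?thesis
          unfolding U_def r_def[symmetric] using r(1) by simp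
      qed
      moreover have "((- x - y) * r - (x * (L - v) - y * v) * (L * (L - 2 * v) / (2 * r))) / (r * r)
         = ((- x - y) * 2 * r\<^sup>2 - (x * (L - v) - y * v) * (L * (L - 2 * v))) / (2 * r ^ 3)"
        using r(1) by (simp add: field_simps power2_eq_square power3_eq_cube)
      moreover have "(- x - y) * 2 * r\<^sup>2 - (x * (L - v) - y * v) * (L * (L - 2 * v)) = - (L * L) * (x * (L - v) + y * v)"
        unfolding r(2) by (simp add: algebra_simps)
      ultimately show ?thesis by simp
    qed
    have dW: "(W has_real_derivative (- (L * L) * (x * (L - v) - y * v) / (2 * r ^ 3))) (at v)"
    proof -
      have "(W has_real_derivative ((y - x) * r - (x * (L - v) + y * v) * (L * (L - 2 * v) / (2 * r))) / (r * r)) (at v)"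
      proof -
        have "((\<lambda>v. x * (L - v) + y * v) has_real_derivative (y - x)) (at v)"
          by (auto intro!: derivative_eq_intros)
        from DERIV_divide[OF this dr] show ?thesis
          unfolding W_def r_def[symmetric] using r(1) by simp
      qed
      moreover have "((y - x) * r - (x * (L - v) + y * v) * (L * (L - 2 * v) / (2 * r))) / (r * r)
         = ((y - x) * 2 * r\<^sup>2 - (x * (L - v) + y * v) * (L * (L - 2 * v))) / (2 * r ^ 3)"
        using r(1) by (simp add: field_simps power2_eq_square power3_eq_cube)
      moreover have "(y - x) * 2 * r\<^sup>2 - (x * (L - v) + y * v) * (L * (L - 2 * v)) = - (L * L) * (x * (L - v) - y * v)"
        unfolding r(2) by (simp add: algebra_simps)
      ultimately show ?thesis by simp
    qed
    define E where "E = exp (- (U v)\<^sup>2 / 2) / sqrt (2 * pi)"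
    have U2: "(U v)\<^sup>2 = x\<^sup>2 / v + y\<^sup>2 / (L - v) - (x + y)\<^sup>2 / L"
    proof -
      have "(U v)\<^sup>2 = (x * (L - v) - y * v)\<^sup>2 / (L * v * (L - v))"
        unfolding U_def using v L by (simp add: power_divide)
      also have "\<dots> = x\<^sup>2 / v + y\<^sup>2 / (L - v) - (x + y)\<^sup>2 / L"
        using v L by (simp add: divide_simps) (simp add: algebra_simps power2_eq_square)
      finally show ?thesis .
    qed
    \<comment> \<open>The constant gap between the squares is what the factor
      \<open>exp (2 * x * y / L)\<close> in \<open>F\<close> compensates: both terms of the
      derivative then carry the same Gaussian \<open>E\<close>.\<close>
    have "(W v)\<^sup>2 = (U v)\<^sup>2 + 4 * x * y / L"
    proof -
      have "(W v)\<^sup>2 = (x * (L - v) + y * v)\<^sup>2 / (L * v * (L - v))" "(U v)\<^sup>2 = (x * (L - v) - y * v)\<^sup>2 / (L * v * (L - v))"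
        unfolding U_def W_def using v L by (simp_all add: power_divide)
      moreover have "(x * (L - v) + y * v)\<^sup>2 = (x * (L - v) - y * v)\<^sup>2 + 4 * x * y * (v * (L - v))"
        by (simp add: algebra_simps power2_eq_square)
      ultimately show ?thesis using v L by (simp add: add_divide_distrib)
    qed
    then have W2: "exp (2 * x * y / L) * (exp (- (W v)\<^sup>2 / 2) / sqrt (2 * pi)) = E"
      unfolding E_def by (simp add: exp_add[symmetric] field_simps)
    have "DERIV F v :> - c * ((x + y) / 2 * (E * (- (L * L) * (x * (L - v) + y * v) / (2 * r ^ 3)))
        + (y - x) / 2 * exp (2 * x * y / L) * (exp (- (W v)\<^sup>2 / 2) / sqrt (2 * pi) * (- (L * L) * (x * (L - v) - y * v) / (2 * r ^ 3))))"
    proof -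
      note gU = DERIV_chain2[OF gauss_cdf_deriv dU] and gW = DERIV_chain2[OF gauss_cdf_deriv dW]
      have "((\<lambda>v. - c * (a * (gauss_cdf (U v) - 1) + b * (gauss_cdf (W v) - 1))) has_real_derivative
          - c * (a * A + b * B)) (at v)"
        if "((\<lambda>v. gauss_cdf (U v)) has_real_derivative A) (at v)" "((\<lambda>v. gauss_cdf (W v)) has_real_derivative B) (at v)"
        for a b A B by (auto intro!: derivative_eq_intros that)
      from this[OF gU gW] show ?thesis unfolding F_def E_def .
    qed
    also have "- c * ((x + y) / 2 * (E * (- (L * L) * (x * (L - v) + y * v) / (2 * r ^ 3)))
        + (y - x) / 2 * exp (2 * x * y / L) * (exp (- (W v)\<^sup>2 / 2) / sqrt (2 * pi) * (- (L * L) * (x * (L - v) - y * v) / (2 * r ^ 3))))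
      = - c * ((x + y) / 2 * (E * (- (L * L) * (x * (L - v) + y * v) / (2 * r ^ 3)))
        + (y - x) / 2 * (E * (- (L * L) * (x * (L - v) - y * v) / (2 * r ^ 3))))"
      unfolding W2[symmetric] by (simp only: mult.assoc)
    also have "\<dots> = c * E * (L * L) / (4 * r ^ 3) * ((x + y) * (x * (L - v) + y * v) + (y - x) * (x * (L - v) - y * v))"
      using r(1) by (simp add: field_simps)
    also have "(x + y) * (x * (L - v) + y * v) + (y - x) * (x * (L - v) - y * v) = 2 * x * y * L"
      by (simp add: algebra_simps)
    also have "c * E * (L * L) / (4 * r ^ 3) * (2 * x * y * L) = ?f v"
    proof -
      have e: "exp (- (x + y)\<^sup>2 / (2 * L)) * exp (- (U v)\<^sup>2 / 2) = exp (- x\<^sup>2 / (2 * v)) * exp (- y\<^sup>2 / (2 * (L - v)))"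
        unfolding exp_add[symmetric] U2 by (rule arg_cong[where f = exp])
          (simp add: add_divide_distrib diff_divide_distrib mult.commute)
      have r3: "r ^ 3 = sqrt (L ^ 3) * sqrt (v ^ 3) * sqrt ((L - v) ^ 3)"
        unfolding r_def using v L by (simp add: real_sqrt_mult[symmetric] real_sqrt_power[symmetric] power_mult_distrib)
      have l3: "sqrt (L ^ 3) * sqrt (L ^ 3) = L ^ 3" using L by simp
      have p2: "sqrt (2 * pi * a) = sqrt (2 * pi) * sqrt a" for a by (simp add: real_sqrt_mult)
      have s: "sqrt (L ^ 3) > 0" "sqrt (v ^ 3) > 0" "sqrt ((L - v) ^ 3) > 0" "sqrt (2 * pi) > 0" using v L by auto
      have gen1: "2 * e / (S * A) * (u / S) * (L * L) / (4 * (A * B * C)) * (2 * x * y * L)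
          = (e * u) * x * y * L ^ 3 / ((A * A) * S * S * B * C)" for e S A u B C :: real
        by (simp add: field_simps power3_eq_cube)
      have gen2: "(e * u) * x * y * k / (k * S * S * B * C) = x / (S * B) * e * (y / (S * C) * u)"
        if "k \<noteq> 0" for k e S u B C :: real
        using that by (simp add: field_simps)
      have "c * E * (L * L) / (4 * r ^ 3) * (2 * x * y * L)
        = (exp (- (x + y)\<^sup>2 / (2 * L)) * exp (- (U v)\<^sup>2 / 2)) * x * y * L ^ 3 /
           ((sqrt (L ^ 3) * sqrt (L ^ 3)) * sqrt (2 * pi) * sqrt (2 * pi) * sqrt (v ^ 3) * sqrt ((L - v) ^ 3))"
        unfolding c_def E_def r3 p2 by (rule gen1)
      also have "\<dots> = ?f v"
        unfolding e l3 first_passage_def p2 using L by (intro gen2) auto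
      finally show ?thesis .
    qed
    finally show ?thesis .
  qed
  have cont: "isCont ?f v" if "0 < v" "v < L" for v
    unfolding first_passage_def using that by (intro continuous_intros) auto
  have nn: "?f v \<ge> 0" if "0 < v" "v < L" for v
    unfolding first_passage_def using that x y by auto
  have ein: "einterval (ereal 0) (ereal L) = {0<..<L}" by (auto simp: einterval_def)
  have A: "((F \<circ> real_of_ereal) \<longlongrightarrow> 0) (at_right (ereal 0))"
    unfolding ereal_tendsto_simps1 using F0 by simp
  have B: "((F \<circ> real_of_ereal) \<longlongrightarrow> c * (x + y) / 2) (at_left (ereal L))"
    unfolding ereal_tendsto_simps1 using FL by (simp add: field_simps)
  have P: "ereal 0 < ereal L" "\<And>v. ereal 0 < ereal v \<Longrightarrow> ereal v < ereal L \<Longrightarrow> DERIV F v :> ?f v"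
    "\<And>v. ereal 0 < ereal v \<Longrightarrow> ereal v < ereal L \<Longrightarrow> isCont ?f v"
    "AE v in lborel. ereal 0 < ereal v \<longrightarrow> ereal v < ereal L \<longrightarrow> 0 \<le> ?f v"
    using L DF cont nn by simp_all
  note 1 = interval_integral_FTC_nonneg[OF P A B, unfolded ein]
  have "(LBINT v:{0<..<L}. ?f v) = c * (x + y) / 2"
    using 1(2) L by (simp add: interval_lebesgue_integral_def ein)
  moreover have "(\<integral>\<^sup>+v\<in>{0<..<L}. ennreal (?f v) \<partial>lborel) = ennreal (LBINT v:{0<..<L}. ?f v)"
    unfolding set_lebesgue_integral_def
    by (subst nn_integral_eq_integral[symmetric])
      (use 1(1) nn in \<open>auto simp: set_integrable_def indicator_def intro!: nn_integral_cong\<close>)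
  moreover have "c * (x + y) / 2 = first_passage L (x + y)" unfolding c_def first_passage_def by simp
  ultimately show ?thesis by simp
qed

section \<open>Products of Lebesgue measure: Fubini, translation, reindexing\<close>

interpretation lborel_prod: product_sigma_finite "\<lambda>_::nat. lborel :: real measure"
  by (rule product_sigma_finite.intro) (rule sigma_finite_lborel)

abbreviation LB :: "nat set \<Rightarrow> (nat \<Rightarrow> real) measure" where
  "LB I \<equiv> Pi\<^sub>M I (\<lambda>_. lborel)"

lemma measurable_LB_component [measurable]: "i \<in> I \<Longrightarrow> (\<lambda>x. x i) \<in> borel_measurable (LB I)"
  by (metis measurable_component_singleton measurable_lborel1)

lemma sigma_finite_LB: "finite I \<Longrightarrow> sigma_finite_measure (LB I)"
  by (rule lborel_prod.sigma_finite)

lemma LB_Fubini: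
  assumes "finite I" "case_prod f \<in> borel_measurable (lborel \<Otimes>\<^sub>M LB I)"
  shows "(\<integral>\<^sup>+v. (\<integral>\<^sup>+x. f v x \<partial>LB I) \<partial>lborel) = (\<integral>\<^sup>+x. (\<integral>\<^sup>+v. f v x \<partial>lborel) \<partial>LB I)"
proof -
  interpret pair_sigma_finite lborel "LB I"
    using sigma_finite_LB[OF assms(1)] by (simp add: pair_sigma_finite_def sigma_finite_lborel)
  show ?thesis by (rule Fubini'[OF assms(2), symmetric])
qed

lemma LB_translate:
  assumes I: "finite I" shows "distr (LB I) (LB I) (\<lambda>x. \<lambda>i\<in>I. x i + s) = LB I"
proof (rule lborel_prod.PiM_eqI[OF I])
  have meas: "(\<lambda>x. \<lambda>i\<in>I. x i + s) \<in> measurable (LB I) (LB I)"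
    by (intro measurable_restrict) simp
  fix A :: "nat \<Rightarrow> real set" assume A: "\<And>i. i \<in> I \<Longrightarrow> A i \<in> sets lborel"
  have pre: "(\<lambda>x. x + s) -` A i \<in> sets lborel" if "i \<in> I" for i
    using measurable_sets[of "\<lambda>x. x + s" borel borel "A i"] A[OF that] by simp
  have "emeasure (distr (LB I) (LB I) (\<lambda>x. \<lambda>i\<in>I. x i + s)) (Pi\<^sub>E I A)
      = emeasure (LB I) ((\<lambda>x. \<lambda>i\<in>I. x i + s) -` Pi\<^sub>E I A \<inter> space (LB I))"
    by (rule emeasure_distr[OF meas]) (rule sets_PiM_I_finite[OF I A])
  also have "(\<lambda>x. \<lambda>i\<in>I. x i + s) -` Pi\<^sub>E I A \<inter> space (LB I) = Pi\<^sub>E I (\<lambda>i. (\<lambda>x. x + s) -` A i)"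
    by (auto simp: space_PiM PiE_def Pi_def)
  also have "emeasure (LB I) \<dots> = (\<Prod>i\<in>I. emeasure lborel ((\<lambda>x. x + s) -` A i))"
    by (rule lborel_prod.emeasure_PiM[OF I pre])
  also have "\<dots> = (\<Prod>i\<in>I. emeasure lborel (A i))"
  proof (rule prod.cong[OF refl])
    fix i assume i: "i \<in> I"
    have "emeasure lborel (A i) = emeasure (distr lborel borel (\<lambda>x. s + x)) (A i)"
      using lborel_distr_plus[of s] by simp
    also have "\<dots> = emeasure lborel ((\<lambda>x. s + x) -` A i \<inter> space lborel)"
      using A[OF i] by (intro emeasure_distr) auto
    finally show "emeasure lborel ((\<lambda>x. x + s) -` A i) = emeasure lborel (A i)" by (simp add: add.commute)
  qed
  finally show "emeasure (distr (LB I) (LB I) (\<lambda>x. \<lambda>i\<in>I. x i + s)) (Pi\<^sub>E I A) = (\<Prod>i\<in>I. emeasure lborel (A i))" .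
qed simp

lemma LB_reindex:
  assumes I: "finite I" and p: "bij_betw p I I"
  shows "distr (LB I) (LB I) (\<lambda>x. \<lambda>i\<in>I. x (p i)) = LB I"
proof (rule lborel_prod.PiM_eqI[OF I])
  have pI: "p i \<in> I" if "i \<in> I" for i using p that by (auto simp: bij_betw_def)
  have meas: "(\<lambda>x. \<lambda>i\<in>I. x (p i)) \<in> measurable (LB I) (LB I)"
    using pI by (intro measurable_restrict) simp
  define q where "q = the_inv_into I p"
  have q: "q i \<in> I" "p (q i) = i" "q (p i) = i" if "i \<in> I" for i
    using p that unfolding q_def bij_betw_def
    by (auto simp: the_inv_into_f_f f_the_inv_into_f intro: the_inv_into_into)
  fix A :: "nat \<Rightarrow> real set" assume A: "\<And>i. i \<in> I \<Longrightarrow> A i \<in> sets lborel"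
  have "emeasure (distr (LB I) (LB I) (\<lambda>x. \<lambda>i\<in>I. x (p i))) (Pi\<^sub>E I A)
      = emeasure (LB I) ((\<lambda>x. \<lambda>i\<in>I. x (p i)) -` Pi\<^sub>E I A \<inter> space (LB I))"
    by (rule emeasure_distr[OF meas]) (rule sets_PiM_I_finite[OF I A])
  also have "(\<lambda>x. \<lambda>i\<in>I. x (p i)) -` Pi\<^sub>E I A \<inter> space (LB I) = Pi\<^sub>E I (\<lambda>i. A (q i))"
  proof (intro set_eqI iffI)
    fix x assume "x \<in> (\<lambda>x. \<lambda>i\<in>I. x (p i)) -` Pi\<^sub>E I A \<inter> space (LB I)"
    then have x: "x \<in> extensional I" "\<And>i. i \<in> I \<Longrightarrow> x (p i) \<in> A i" by (auto simp: space_PiM PiE_def Pi_def)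
    show "x \<in> Pi\<^sub>E I (\<lambda>i. A (q i))" using x(1) x(2)[OF q(1)] q(2) by (auto simp: PiE_def)
  next
    fix x assume "x \<in> Pi\<^sub>E I (\<lambda>i. A (q i))"
    then have x: "x \<in> extensional I" "\<And>i. i \<in> I \<Longrightarrow> x i \<in> A (q i)" by (auto simp: PiE_def Pi_def)
    show "x \<in> (\<lambda>x. \<lambda>i\<in>I. x (p i)) -` Pi\<^sub>E I A \<inter> space (LB I)"
      using x(1) x(2)[OF pI] q(3) by (auto simp: space_PiM PiE_def)
  qed
  also have "emeasure (LB I) \<dots> = (\<Prod>i\<in>I. emeasure lborel (A (q i)))"
    by (rule lborel_prod.emeasure_PiM[OF I]) (use A q in auto)
  also have "\<dots> = (\<Prod>i\<in>I. emeasure lborel (A i))"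
    using prod.reindex_bij_betw[OF p, of "\<lambda>i. emeasure lborel (A (q i))"] q(3) by simp
  finally show "emeasure (distr (LB I) (LB I) (\<lambda>x. \<lambda>i\<in>I. x (p i))) (Pi\<^sub>E I A) = (\<Prod>i\<in>I. emeasure lborel (A i))" .
qed simp

lemma nn_integral_LB_translate:
  assumes "finite I" "f \<in> borel_measurable (LB I)"
  shows "(\<integral>\<^sup>+x. f (\<lambda>i\<in>I. x i + s) \<partial>LB I) = (\<integral>\<^sup>+x. f x \<partial>LB I)"
proof -
  have "(\<integral>\<^sup>+x. f x \<partial>LB I) = (\<integral>\<^sup>+x. f x \<partial>distr (LB I) (LB I) (\<lambda>x. \<lambda>i\<in>I. x i + s))"
    by (simp add: LB_translate[OF assms(1)])
  also have "\<dots> = (\<integral>\<^sup>+x. f (\<lambda>i\<in>I. x i + s) \<partial>LB I)"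
    using assms by (intro nn_integral_distr measurable_restrict) simp_all
  finally show ?thesis by simp
qed

lemma nn_integral_LB_reindex:
  assumes "finite I" "bij_betw p I I" "f \<in> borel_measurable (LB I)"
  shows "(\<integral>\<^sup>+x. f (\<lambda>i\<in>I. x (p i)) \<partial>LB I) = (\<integral>\<^sup>+x. f x \<partial>LB I)"
proof -
  have pI: "p i \<in> I" if "i \<in> I" for i using assms(2) that by (auto simp: bij_betw_def)
  have "(\<integral>\<^sup>+x. f x \<partial>LB I) = (\<integral>\<^sup>+x. f x \<partial>distr (LB I) (LB I) (\<lambda>x. \<lambda>i\<in>I. x (p i)))"
    by (simp add: LB_reindex[OF assms(1,2)])
  also have "\<dots> = (\<integral>\<^sup>+x. f (\<lambda>i\<in>I. x (p i)) \<partial>LB I)"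
    using assms pI by (intro nn_integral_distr measurable_restrict) simp_all
  finally show ?thesis by simp
qed

section \<open>Free, killed and first passage kernels\<close>

lemma gauss_kernel_measurable [measurable]: "gauss_kernel s \<in> borel_measurable borel"
  unfolding gauss_kernel_def by measurable

lemma killed_kernel_measurable [measurable]: "(\<lambda>(x, y). killed_kernel s x y) \<in> borel_measurable (borel \<Otimes>\<^sub>M borel)"
  unfolding killed_kernel_def by measurable

lemma first_passage_measurable [measurable]: "(\<lambda>(s, y). first_passage s y) \<in> borel_measurable (borel \<Otimes>\<^sub>M borel)"
  unfolding first_passage_def by measurable

lemma gauss_kernel_antimono: "s > 0 \<Longrightarrow> \<bar>u\<bar> \<le> \<bar>v\<bar> \<Longrightarrow> gauss_kernel s v \<le> gauss_kernel s u"
  unfolding gauss_kernel_def by (intro divide_right_mono) (auto simp: abs_le_square_iff intro!: divide_right_mono)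

lemma gauss_kernel_pos: "s > 0 \<Longrightarrow> gauss_kernel s v > 0"
  unfolding gauss_kernel_def by simp

lemma killed_kernel_nonneg: "s > 0 \<Longrightarrow> 0 \<le> x \<Longrightarrow> 0 \<le> y \<Longrightarrow> 0 \<le> killed_kernel s x y"
  unfolding killed_kernel_def using gauss_kernel_antimono[of s "y - x" "y + x"] by simp

lemma first_passage_nonneg: "s > 0 \<Longrightarrow> 0 \<le> x \<Longrightarrow> 0 \<le> first_passage s x"
  unfolding first_passage_def by simp

text \<open>Translating both ends leaves the direct Gaussian fixed and moves only the reflected one.
  This is how a first passage density at the sum of two heights arises from killed kernels.\<close>

lemma killed_kernel_deriv:
  assumes s: "s > 0"
  shows "((\<lambda>y. killed_kernel s (a + y) (b + y)) has_real_derivative 2 * first_passage s (a + b + 2 * y)) (at y)"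
proof -
  have e: "killed_kernel s (a + y) (b + y) = gauss_kernel s (b - a) - exp (- (a + b + 2 * y)\<^sup>2 / (2 * s)) / sqrt (2 * pi * s)" for y
    unfolding killed_kernel_def gauss_kernel_def by (simp add: algebra_simps)
  have s3: "sqrt (2 * pi * s ^ 3) = s * sqrt (2 * pi * s)"
    using s by (simp add: power3_eq_cube real_sqrt_mult)
  have "((\<lambda>y. G - exp (- (a + b + 2 * y)\<^sup>2 / (2 * s)) / S) has_real_derivative
     - (exp (- (a + b + 2 * y)\<^sup>2 / (2 * s)) * (- (2 * (a + b + 2 * y) * 2) / (2 * s)) / S)) (at y)" for G S :: real
  proof -
    have "((\<lambda>y. exp (- (a + b + 2 * y)\<^sup>2 / (2 * s))) has_real_derivative
      exp (- (a + b + 2 * y)\<^sup>2 / (2 * s)) * (- (2 * (a + b + 2 * y) * 2) / (2 * s))) (at y)"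
      using s by (auto intro!: derivative_eq_intros simp: field_simps)
    from DERIV_diff[OF DERIV_const[of G] DERIV_cdivide[OF this, of S]] show ?thesis by simp
  qed
  moreover have "- (e * (- (2 * u * 2) / (2 * s)) / S) = 2 * (u / (s * S) * e)" for e u S :: real
    using s by (simp add: field_simps)
  ultimately show ?thesis unfolding e first_passage_def s3 by (metis DERIV_cong)
qed

text \<open>Far above \<open>0\<close> the reflected term dies out, and the kernel of free Brownian
  motion remains.\<close>

lemma killed_kernel_limit:
  assumes s: "s > 0"
  shows "((\<lambda>y. killed_kernel s (a + y) (b + y)) \<longlongrightarrow> gauss_kernel s (b - a)) at_top"
proof -
  have e: "killed_kernel s (a + y) (b + y) = gauss_kernel s (b - a) - exp (- (a + b + 2 * y)\<^sup>2 / (2 * s)) / sqrt (2 * pi * s)" for y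
    unfolding killed_kernel_def gauss_kernel_def by (simp add: algebra_simps)
  have "((\<lambda>y. exp (- (a + b + 2 * y)\<^sup>2 / (2 * s)) / sqrt (2 * pi * s)) \<longlongrightarrow> 0) at_top"
    using s by real_asymp
  then show ?thesis unfolding e by (auto intro: tendsto_eq_intros)
qed

section \<open>Rotated excursions and bridges on a cyclic grid\<close>

locale cyclic_grid =
  fixes K :: nat and \<delta> :: real
  assumes K: "K \<ge> 2" and \<delta>: "\<delta> > 0"
begin

definition cyc_next :: "nat \<Rightarrow> nat" where "cyc_next i = (i + 1) mod K"

text \<open>Up to a constant, the density at \<open>K\<close> cyclic grid points of an excursion
  rotated so that its zero falls in the cell from \<open>j\<close> to \<open>cyc_next j\<close>. The
  first factor is the contribution of that cell after integration over the place of the zero, as in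
  \<open>first_passage_convolution\<close>.\<close>

definition R :: "nat \<Rightarrow> (nat \<Rightarrow> real) \<Rightarrow> real" where
  "R j x = (if \<forall>i\<in>{..<K}. 0 < x i then first_passage \<delta> (x j + x (cyc_next j)) *
     (\<Prod>i\<in>{..<K} - {j}. killed_kernel \<delta> (x i) (x (cyc_next i))) else 0)"

lemma cyc_next_lt: "cyc_next i < K" using K by (auto simp: cyc_next_def)

lemma cyc_next_inj: "i < K \<Longrightarrow> j < K \<Longrightarrow> cyc_next i = cyc_next j \<Longrightarrow> i = j"
  unfolding cyc_next_def by (auto simp: mod_if split: if_splits)

lemma bij_cyc_next: "bij_betw cyc_next {..<K} {..<K}"
proof -
  have "inj_on cyc_next {..<K}" using cyc_next_inj by (auto simp: inj_on_def)
  then show ?thesis unfolding bij_betw_def using cyc_next_lt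
    by (intro conjI endo_inj_surj) auto
qed

lemma R_measurable [measurable]: "j < K \<Longrightarrow> R j \<in> borel_measurable (LB {..<K})"
proof -
  assume j: "j < K"
  have [measurable]: "(\<lambda>x. x i) \<in> borel_measurable (LB {..<K})" if "i < K" for i using that by simp
  have [measurable]: "(\<lambda>x. x (cyc_next i)) \<in> borel_measurable (LB {..<K})" for i using cyc_next_lt by simp
  have [measurable]: "(\<lambda>x. x j) \<in> borel_measurable (LB {..<K})" using j by simp
  have [measurable]: "Measurable.pred (LB {..<K}) (\<lambda>x. \<forall>i\<in>{..<K}. 0 < x i)"
    by (intro pred_intros_finite) (auto intro!: borel_measurable_less)
  show ?thesis unfolding R_def[abs_def]
    by (intro measurable_If borel_measurable_times borel_measurable_prod) measurable
qed

lemma R_nonneg: "R j x \<ge> 0" if "j < K"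
proof (cases "\<forall>i\<in>{..<K}. 0 < x i")
  case True
  then have "0 \<le> x i" if "i < K" for i using that by (simp add: less_imp_le)
  then have "0 \<le> first_passage \<delta> (x j + x (cyc_next j)) * (\<Prod>i\<in>{..<K} - {j}. killed_kernel \<delta> (x i) (x (cyc_next i)))"
    using cyc_next_lt that
    by (intro mult_nonneg_nonneg first_passage_nonneg[OF \<delta>] prod_nonneg killed_kernel_nonneg[OF \<delta>] add_nonneg_nonneg) auto
  with True show ?thesis by (simp add: R_def)
next
  case False
  then show ?thesis by (simp only: R_def if_False order_refl)
qed

lemma R_shift: "j < K \<Longrightarrow> R j (\<lambda>i\<in>{..<K}. x (cyc_next i)) = R (cyc_next j) x"
proof -
  assume j: "j < K"
  have pos: "(\<forall>i\<in>{..<K}. 0 < (\<lambda>i\<in>{..<K}. x (cyc_next i)) i) \<longleftrightarrow> (\<forall>i\<in>{..<K}. 0 < x i)"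
  proof -
    have "(\<forall>i\<in>{..<K}. 0 < x i) \<longleftrightarrow> (\<forall>i\<in>cyc_next ` {..<K}. 0 < x i)"
      using bij_cyc_next unfolding bij_betw_def by simp
    then show ?thesis by simp
  qed
  have bij: "bij_betw cyc_next ({..<K} - {j}) ({..<K} - {cyc_next j})"
  proof (rule bij_betw_imageI)
    show "inj_on cyc_next ({..<K} - {j})" using cyc_next_inj by (auto simp: inj_on_def)
    have "cyc_next ` ({..<K} - {j}) = cyc_next ` {..<K} - cyc_next ` {j}"
      using cyc_next_inj j by (intro inj_on_image_set_diff[of cyc_next "{..<K}"]) (auto simp: inj_on_def)
    then show "cyc_next ` ({..<K} - {j}) = {..<K} - {cyc_next j}" using bij_cyc_next by (simp add: bij_betw_def)
  qed
  have "(\<Prod>i\<in>{..<K} - {j}. killed_kernel \<delta> ((\<lambda>i\<in>{..<K}. x (cyc_next i)) i) ((\<lambda>i\<in>{..<K}. x (cyc_next i)) (cyc_next i)))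
     = (\<Prod>i\<in>{..<K} - {j}. killed_kernel \<delta> (x (cyc_next i)) (x (cyc_next (cyc_next i))))"
    by (intro prod.cong) (auto simp: cyc_next_lt)
  also have "\<dots> = (\<Prod>i\<in>{..<K} - {cyc_next j}. killed_kernel \<delta> (x i) (x (cyc_next i)))"
    by (rule prod.reindex_bij_betw[OF bij, of "\<lambda>i. killed_kernel \<delta> (x i) (x (cyc_next i))"])
  finally show ?thesis unfolding R_def pos using j by (simp add: cyc_next_lt)
qed

text \<open>By the product rule the sum over \<open>j\<close> is the derivative, in the common
  height \<open>y\<close>, of half the product of all killed kernels. That product is
  \<open>0\<close> when the lowest point touches the barrier and becomes the free product at
  infinity, so the integral over all heights is an instance of the fundamental theorem.\<close>

lemma integral_sum_R:
  assumes z: "\<And>i. i < K \<Longrightarrow> z i \<in> (UNIV :: real set)"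
  shows "(\<integral>\<^sup>+y. ennreal (\<Sum>j<K. R j (\<lambda>i\<in>{..<K}. z i + y)) \<partial>lborel)
    = ennreal ((\<Prod>i<K. gauss_kernel \<delta> (z (cyc_next i) - z i)) / 2)"
proof -
  \<comment> \<open>The height at which the lowest of the points \<open>z i + y\<close> reaches
    \<open>0\<close>.\<close>
  define a where "a = - Min (z ` {..<K})"
  have ne: "z ` {..<K} \<noteq> {}" using K by (auto simp: lessThan_empty_iff)
  have a_le: "- a \<le> z i" if "i < K" for i unfolding a_def using that by simp
  have "Min (z ` {..<K}) \<in> z ` {..<K}" using ne by (intro Min_in) auto
  then obtain i0 where i0: "i0 < K" "z i0 = - a" unfolding a_def by auto
  define F where "F y = (\<Prod>i<K. killed_kernel \<delta> (z i + y) (z (cyc_next i) + y)) / 2" for y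
  define f where "f y = (\<Sum>j<K. first_passage \<delta> (z j + z (cyc_next j) + 2 * y) *
     (\<Prod>i\<in>{..<K} - {j}. killed_kernel \<delta> (z i + y) (z (cyc_next i) + y)))" for y
  have "(\<integral>\<^sup>+y. ennreal (\<Sum>j<K. R j (\<lambda>i\<in>{..<K}. z i + y)) \<partial>lborel) = (\<integral>\<^sup>+y. ennreal (f y) * indicator {a..} y \<partial>lborel)"
  proof (rule nn_integral_cong_AE, use AE_lborel_singleton[of a] in eventually_elim)
    fix y assume y: "y \<noteq> a"
    have pos: "(\<forall>i\<in>{..<K}. 0 < (\<lambda>i\<in>{..<K}. z i + y) i) \<longleftrightarrow> a < y"
      using a_le i0 by (force simp: )
    have "R j (\<lambda>i\<in>{..<K}. z i + y) = (if a < y then first_passage \<delta> (z j + z (cyc_next j) + 2 * y) *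
     (\<Prod>i\<in>{..<K} - {j}. killed_kernel \<delta> (z i + y) (z (cyc_next i) + y)) else 0)" if "j < K" for j
    proof -
      have "(\<Prod>i\<in>{..<K} - {j}. killed_kernel \<delta> ((\<lambda>i\<in>{..<K}. z i + y) i) ((\<lambda>i\<in>{..<K}. z i + y) (cyc_next i)))
        = (\<Prod>i\<in>{..<K} - {j}. killed_kernel \<delta> (z i + y) (z (cyc_next i) + y))"
        by (intro prod.cong) (auto simp: cyc_next_lt)
      then show ?thesis unfolding R_def pos using that cyc_next_lt by (simp add: algebra_simps)
    qed
    then show "ennreal (\<Sum>j<K. R j (\<lambda>i\<in>{..<K}. z i + y)) = ennreal (f y) * indicator {a..} y"
      using y by (auto simp: f_def indicator_def)
  qed
  also have "\<dots> = ennreal ((\<Prod>i<K. gauss_kernel \<delta> (z (cyc_next i) - z i)) / 2 - F a)"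
  proof (rule nn_integral_FTC_atLeast)
    show "f \<in> borel_measurable borel" unfolding f_def[abs_def] by measurable
    show "DERIV F y :> f y" for y
    proof -
      have "((\<lambda>y. \<Prod>i<K. killed_kernel \<delta> (z i + y) (z (cyc_next i) + y)) has_real_derivative
         (\<Sum>j<K. (2 * first_passage \<delta> (z j + z (cyc_next j) + 2 * y)) * (\<Prod>i\<in>{..<K} - {j}. killed_kernel \<delta> (z i + y) (z (cyc_next i) + y)))) (at y)"
        by (rule has_field_derivative_prod) (rule killed_kernel_deriv[OF \<delta>])
      from DERIV_cdivide[OF this, of 2] show ?thesis
        unfolding F_def[abs_def] f_def by (rule DERIV_cong) (simp add: sum_divide_distrib mult.assoc)
    qed
    show "0 \<le> f y" if "a \<le> y" for y
    proof -
      have p: "0 \<le> z i + y" if "i < K" for i using a_le[OF that] \<open>a \<le> y\<close> by simp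
      have "0 \<le> z j + z (cyc_next j) + 2 * y" if "j < K" for j using p[OF that] p[OF cyc_next_lt, of j] by simp
      then show ?thesis unfolding f_def using p cyc_next_lt
        by (intro sum_nonneg mult_nonneg_nonneg prod_nonneg first_passage_nonneg[OF \<delta>] killed_kernel_nonneg[OF \<delta>]) auto
    qed
    show "(F \<longlongrightarrow> (\<Prod>i<K. gauss_kernel \<delta> (z (cyc_next i) - z i)) / 2) at_top"
      unfolding F_def[abs_def] by (intro tendsto_divide tendsto_prod killed_kernel_limit \<delta> tendsto_const) simp
  qed
  also have "F a = 0"
    unfolding F_def using i0 by (auto simp: killed_kernel_def add.commute intro!: bexI[of _ i0])
  finally show ?thesis by (simp only: diff_zero)
qed

text \<open>A grid version of the passage from excursion to bridge. Cyclic invariance of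
  \<open>\<Psi>\<close> makes the \<open>K\<close> possible cells of the zero equivalent, which
  gives the factor \<open>K\<close> and the sum over \<open>j\<close>; invariance under shifts then
  lets the height be integrated out.\<close>

theorem nn_integral_R_eq_bridge:
  assumes \<Psi>[measurable]: "\<Psi> \<in> borel_measurable (LB {..<K})"
    and cyc: "\<And>x. \<Psi> (\<lambda>i\<in>{..<K}. x (cyc_next i)) = \<Psi> (restrict x {..<K})"
    and sh: "\<And>x s. \<Psi> (\<lambda>i\<in>{..<K}. x i + s) = \<Psi> (restrict x {..<K})"
  shows "of_nat K * (\<integral>\<^sup>+x. \<Psi> x * ennreal (R (K - 1) x) \<partial>LB {..<K}) =
    (\<integral>\<^sup>+b. \<Psi> (b(0 := 0)) * ennreal ((\<Prod>i<K. gauss_kernel \<delta> ((b(0 := 0)) (cyc_next i) - (b(0 := 0)) i)) / 2) \<partial>LB {1..<K})"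
proof -
  let ?M = "LB {..<K}"
  have res: "restrict x {..<K} = x" if "x \<in> space ?M" for x
    using that by (auto simp: space_PiM PiE_def extensional_restrict)
  define J where "J j = (\<integral>\<^sup>+x. \<Psi> x * ennreal (R j x) \<partial>?M)" for j
  have step: "J (cyc_next j) = J j" if j: "j < K" for j
  proof -
    have "J j = (\<integral>\<^sup>+x. \<Psi> (\<lambda>i\<in>{..<K}. x (cyc_next i)) * ennreal (R j (\<lambda>i\<in>{..<K}. x (cyc_next i))) \<partial>?M)"
      unfolding J_def using j by (subst nn_integral_LB_reindex[OF _ bij_cyc_next, symmetric]) auto
    also have "\<dots> = J (cyc_next j)" unfolding J_def
      by (intro nn_integral_cong) (simp add: cyc R_shift[OF j] res)
    finally show ?thesis by simp
  qed
  have Jc: "J j = J 0" if "j < K" for j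
    using that
  proof (induction j)
    case (Suc j)
    then have "cyc_next j = Suc j" by (simp add: cyc_next_def)
    with step[of j] Suc show ?case by simp
  qed simp
  have ins: "{..<K} = insert 0 {1..<K}" using K by auto
  have "of_nat K * J (K - 1) = (\<Sum>j<K. J j)"
  proof -
    have "(\<Sum>j<K. J j) = (\<Sum>j<K. J 0)" by (rule sum.cong) (auto intro: Jc)
    moreover have "J (K - 1) = J 0" by (rule Jc) (use K in linarith)
    ultimately show ?thesis by simp
  qed
  also have "\<dots> = (\<integral>\<^sup>+x. (\<Sum>j<K. \<Psi> x * ennreal (R j x)) \<partial>?M)"
    unfolding J_def by (subst nn_integral_sum) auto
  also have "\<dots> = (\<integral>\<^sup>+x. \<Psi> x * ennreal (\<Sum>j<K. R j x) \<partial>?M)"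
    by (intro nn_integral_cong, simp only: sum_distrib_left[symmetric], subst sum_ennreal) (simp_all only: R_nonneg lessThan_iff)
  also have "\<dots> = (\<integral>\<^sup>+y. \<integral>\<^sup>+b. \<Psi> (b(0 := y)) * ennreal (\<Sum>j<K. R j (b(0 := y))) \<partial>LB {1..<K} \<partial>lborel)"
  proof -
    have m: "(\<lambda>x. \<Psi> x * ennreal (\<Sum>j<K. R j x)) \<in> borel_measurable ?M"
      by (intro borel_measurable_times_ennreal \<Psi> measurable_compose[OF _ measurable_ennreal] borel_measurable_sum R_measurable) simp
    show ?thesis
      by (subst (1) ins, rule lborel_prod.product_nn_integral_insert_rev) (use m ins in auto)
  qed
  \<comment> \<open>The other coordinates are recentred at the value \<open>y\<close> of coordinate
    \<open>0\<close>, by translation invariance of Lebesgue measure; \<open>\<Psi>\<close> then no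
    longer depends on \<open>y\<close>.\<close>
  also have "\<dots> = (\<integral>\<^sup>+y. \<integral>\<^sup>+b. \<Psi> (b(0 := 0)) * ennreal (\<Sum>j<K. R j (\<lambda>i\<in>{..<K}. (b(0 := 0)) i + y)) \<partial>LB {1..<K} \<partial>lborel)"
  proof (rule nn_integral_cong)
    fix y :: real
    have m1: "(\<lambda>b. b(0 := y)) \<in> measurable (LB {1..<K}) ?M"
      unfolding ins by (rule measurable_fun_upd[where J = "{1..<K}"]) auto
    have "(\<integral>\<^sup>+b. \<Psi> (b(0 := y)) * ennreal (\<Sum>j<K. R j (b(0 := y))) \<partial>LB {1..<K})
      = (\<integral>\<^sup>+b. \<Psi> ((\<lambda>i\<in>{1..<K}. b i + y)(0 := y)) * ennreal (\<Sum>j<K. R j ((\<lambda>i\<in>{1..<K}. b i + y)(0 := y))) \<partial>LB {1..<K})"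
      by (rule nn_integral_LB_translate[symmetric]) (use m1 in \<open>auto intro!: measurable_compose[OF m1]\<close>)
    also have "\<dots> = (\<integral>\<^sup>+b. \<Psi> (b(0 := 0)) * ennreal (\<Sum>j<K. R j (\<lambda>i\<in>{..<K}. (b(0 := 0)) i + y)) \<partial>LB {1..<K})"
    proof (rule nn_integral_cong)
      fix b assume b: "b \<in> space (LB {1..<K})"
      have e: "(\<lambda>i\<in>{1..<K}. b i + y)(0 := y) = (\<lambda>i\<in>{..<K}. (b(0 := 0)) i + y)"
        using K by (auto simp: fun_eq_iff)
      have "restrict (b(0 := 0)) {..<K} = b(0 := 0)"
        using b K by (auto simp: space_PiM PiE_def extensional_def fun_eq_iff)
      then show "\<Psi> ((\<lambda>i\<in>{1..<K}. b i + y)(0 := y)) * ennreal (\<Sum>j<K. R j ((\<lambda>i\<in>{1..<K}. b i + y)(0 := y)))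
        = \<Psi> (b(0 := 0)) * ennreal (\<Sum>j<K. R j (\<lambda>i\<in>{..<K}. (b(0 := 0)) i + y))"
        unfolding e using sh[of "b(0 := 0)" y] by simp
    qed
    finally show "(\<integral>\<^sup>+b. \<Psi> (b(0 := y)) * ennreal (\<Sum>j<K. R j (b(0 := y))) \<partial>LB {1..<K}) =
      (\<integral>\<^sup>+b. \<Psi> (b(0 := 0)) * ennreal (\<Sum>j<K. R j (\<lambda>i\<in>{..<K}. (b(0 := 0)) i + y)) \<partial>LB {1..<K})" .
  qed
  also have "\<dots> = (\<integral>\<^sup>+b. \<integral>\<^sup>+y. \<Psi> (b(0 := 0)) * ennreal (\<Sum>j<K. R j (\<lambda>i\<in>{..<K}. (b(0 := 0)) i + y)) \<partial>lborel \<partial>LB {1..<K})"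
  proof (rule LB_Fubini)
    have m0: "(\<lambda>b. b(0 := 0)) \<in> measurable (LB {1..<K}) ?M"
      unfolding ins by (rule measurable_fun_upd[where J = "{1..<K}"]) auto
    have m2: "(\<lambda>p. \<lambda>i\<in>{..<K}. ((snd p)(0 := 0)) i + fst p) \<in> measurable (lborel \<Otimes>\<^sub>M LB {1..<K}) ?M"
    proof (rule measurable_restrict)
      fix i assume i: "i \<in> {..<K}"
      show "(\<lambda>p. ((snd p)(0 := 0)) i + fst p) \<in> measurable (lborel \<Otimes>\<^sub>M LB {1..<K}) lborel"
        using i by (cases "i = 0") (auto intro!: borel_measurable_add measurable_compose[OF measurable_snd])
    qed
    show "(\<lambda>(y, b). \<Psi> (b(0 := 0)) * ennreal (\<Sum>j<K. R j (\<lambda>i\<in>{..<K}. (b(0 := 0)) i + y))) \<in> borel_measurable (lborel \<Otimes>\<^sub>M LB {1..<K})"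
      unfolding case_prod_beta
      by (intro borel_measurable_times_ennreal measurable_compose[OF _ measurable_ennreal] borel_measurable_sum
          measurable_compose[OF measurable_snd measurable_compose[OF m0 \<Psi>]] measurable_compose[OF m2 R_measurable]) auto
  qed simp
  also have "\<dots> = (\<integral>\<^sup>+b. \<Psi> (b(0 := 0)) * ennreal ((\<Prod>i<K. gauss_kernel \<delta> ((b(0 := 0)) (cyc_next i) - (b(0 := 0)) i)) / 2) \<partial>LB {1..<K})"
  proof (rule nn_integral_cong)
    fix b
    have m3: "(\<lambda>y. \<lambda>i\<in>{..<K}. (b(0 := 0)) i + y) \<in> measurable lborel ?M"
      by (intro measurable_restrict) simp
    have "(\<integral>\<^sup>+y. \<Psi> (b(0 := 0)) * ennreal (\<Sum>j<K. R j (\<lambda>i\<in>{..<K}. (b(0 := 0)) i + y)) \<partial>lborel)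
      = \<Psi> (b(0 := 0)) * (\<integral>\<^sup>+y. ennreal (\<Sum>j<K. R j (\<lambda>i\<in>{..<K}. (b(0 := 0)) i + y)) \<partial>lborel)"
      by (intro nn_integral_cmult measurable_compose[OF _ measurable_ennreal] borel_measurable_sum measurable_compose[OF m3 R_measurable]) auto
    then show "(\<integral>\<^sup>+y. \<Psi> (b(0 := 0)) * ennreal (\<Sum>j<K. R j (\<lambda>i\<in>{..<K}. (b(0 := 0)) i + y)) \<partial>lborel)
      = \<Psi> (b(0 := 0)) * ennreal ((\<Prod>i<K. gauss_kernel \<delta> ((b(0 := 0)) (cyc_next i) - (b(0 := 0)) i)) / 2)"
      by (simp add: integral_sum_R)
  qed
  finally show ?thesis unfolding J_def .
qed

end

section \<open>The rotated excursion\<close>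

lemma apply_bcontfun_measurable [measurable]: "(\<lambda>e :: real \<Rightarrow>\<^sub>C real. apply_bcontfun e t) \<in> borel_measurable borel"
proof (rule borel_measurable_continuous_onI)
  show "continuous_on UNIV (\<lambda>e :: real \<Rightarrow>\<^sub>C real. apply_bcontfun e t)"
    unfolding continuous_on_iff by (metis dist_bounded order.strict_trans1)
qed

lemma excursion_fdd_density_measurable [measurable]:
  assumes "k \<ge> 1"
  shows "excursion_fdd_density \<sigma> k t \<in> borel_measurable (LB {..<k})"
proof -
  have [measurable]: "(\<lambda>x. x i) \<in> borel_measurable (LB {..<k})" if "i < k" for i using that by simp
  have [measurable]: "(\<lambda>x. x 0) \<in> borel_measurable (LB {..<k})" "(\<lambda>x. x (k - 1)) \<in> borel_measurable (LB {..<k})"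
    using assms by simp_all
  have m: "(\<lambda>x. killed_kernel (t (i + 1) - t i) (x i) (x (i + 1))) \<in> borel_measurable (LB {..<k})" if "i < k - 1" for i
  proof -
    have [measurable]: "(\<lambda>x. x i) \<in> borel_measurable (LB {..<k})" "(\<lambda>x. x (i + 1)) \<in> borel_measurable (LB {..<k})"
      using that by simp_all
    show ?thesis unfolding killed_kernel_def by measurable
  qed
  have "Measurable.pred (LB {..<k}) (\<lambda>x. \<forall>i\<in>{..<k}. 0 < x i)"
    by (intro pred_intros_finite) (auto intro!: borel_measurable_less)
  then have [measurable]: "Measurable.pred (LB {..<k}) (\<lambda>x. \<forall>i<k. 0 < x i)" by (simp add: Ball_def)
  have [measurable]: "(\<lambda>x. \<Prod>i<k - 1. killed_kernel (t (i + 1) - t i) (x i) (x (i + 1))) \<in> borel_measurable (LB {..<k})"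
    using m by (intro borel_measurable_prod) auto
  have [measurable]: "(\<lambda>x. first_passage (t 0) (x 0)) \<in> borel_measurable (LB {..<k})"
    "(\<lambda>x. first_passage (\<sigma> - t (k - 1)) (x (k - 1))) \<in> borel_measurable (LB {..<k})"
    unfolding first_passage_def by measurable
  show ?thesis unfolding excursion_fdd_density_def[abs_def] by measurable
qed

locale excursion =
  fixes \<sigma> :: real and \<mu> :: "(real \<Rightarrow>\<^sub>C real) measure"
  assumes \<sigma>: "\<sigma> > 0" and law: "brownian_excursion_law \<sigma> \<mu>"
begin

sublocale prob_space \<mu> using law by (simp add: brownian_excursion_law_def)

lemma sets_mu [measurable_cong, simp]: "sets \<mu> = sets borel" using law by (simp add: brownian_excursion_law_def)

lemma space_mu [simp]: "space \<mu> = UNIV" using sets_eq_imp_space_eq[OF sets_mu] by simp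

lemma outside: "AE e in \<mu>. \<forall>t. t \<le> 0 \<or> \<sigma> \<le> t \<longrightarrow> apply_bcontfun e t = 0"
  using law by (simp add: brownian_excursion_law_def)

lemma nn_integral_fdd:
  assumes k: "k \<ge> 1" and t: "0 < t 0" "\<And>i. Suc i < k \<Longrightarrow> t i < t (Suc i)" "t (k - 1) < \<sigma>"
    and G [measurable]: "G \<in> borel_measurable (LB {..<k})"
  shows "(\<integral>\<^sup>+e. G (\<lambda>i\<in>{..<k}. apply_bcontfun e (t i)) \<partial>\<mu>)
    = (\<integral>\<^sup>+x. ennreal (excursion_fdd_density \<sigma> k t x) * G x \<partial>LB {..<k})"
proof -
  have D: "distr \<mu> (LB {..<k}) (\<lambda>e. restrict (\<lambda>i. apply_bcontfun e (t i)) {..<k})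
        = density (LB {..<k}) (\<lambda>x. ennreal (excursion_fdd_density \<sigma> k t x))"
    using law k t unfolding brownian_excursion_law_def by blast
  have m: "(\<lambda>e. restrict (\<lambda>i. apply_bcontfun e (t i)) {..<k}) \<in> measurable \<mu> (LB {..<k})"
    by (intro measurable_restrict) simp
  have "(\<integral>\<^sup>+e. G (\<lambda>i\<in>{..<k}. apply_bcontfun e (t i)) \<partial>\<mu>)
    = (\<integral>\<^sup>+x. G x \<partial>distr \<mu> (LB {..<k}) (\<lambda>e. restrict (\<lambda>i. apply_bcontfun e (t i)) {..<k}))"
    by (rule nn_integral_distr[OF m, symmetric]) simp
  also have "\<dots> = (\<integral>\<^sup>+x. ennreal (excursion_fdd_density \<sigma> k t x) * G x \<partial>LB {..<k})"
    unfolding D using k by (intro nn_integral_density) simp_all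
  finally show ?thesis .
qed

text \<open>The offset \<open>v\<close> occurs in the density only in the entrance factor
  \<open>first_passage v (x 0)\<close> and in the exit factor
  \<open>first_passage (\<delta> - v) (x (K - 1))\<close>. Integrating over \<open>v\<close>
  convolves the two into the cell that contains the zero, which yields
  \<open>R (K - 1)\<close>.\<close>

theorem excursion_grid_average:
  assumes K: "K \<ge> 2" and grid: "\<sigma> = real K * \<delta>"
    and \<Psi>[measurable]: "\<Psi> \<in> borel_measurable (LB {..<K})"
  shows "(\<integral>\<^sup>+v\<in>{0<..<\<delta>}. (\<integral>\<^sup>+e. \<Psi> (\<lambda>i\<in>{..<K}. apply_bcontfun e (v + real i * \<delta>)) \<partial>\<mu>) \<partial>lborel)
    = ennreal (2 * sqrt (2 * pi * \<sigma> ^ 3)) * (\<integral>\<^sup>+x. \<Psi> x * ennreal (cyclic_grid.R K \<delta> (K - 1) x) \<partial>LB {..<K})"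
proof -
  have dpos: "\<delta> > 0" using \<sigma> K unfolding grid by (simp add: zero_less_mult_iff)
  interpret cyclic_grid K \<delta> by standard (use K dpos in auto)
  let ?M = "LB {..<K}"
  define c where "c = 2 * sqrt (2 * pi * \<sigma> ^ 3)"
  have c: "c \<ge> 0" unfolding c_def using \<sigma> by simp
  define A where "A x = (if \<forall>i<K. 0 < x i then c * (\<Prod>i<K - 1. killed_kernel \<delta> (x i) (x (i + 1))) else 0)" for x :: "nat \<Rightarrow> real"
  have A_nn: "A x \<ge> 0" for x
  proof (cases "\<forall>i<K. 0 < x i")
    case True
    have "0 \<le> x i" if "i < K" for i using True that by (simp add: less_imp_le)
    then have "0 \<le> c * (\<Prod>i<K - 1. killed_kernel \<delta> (x i) (x (i + 1)))"
      by (intro mult_nonneg_nonneg c prod_nonneg ballI killed_kernel_nonneg[OF dpos]) auto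
    with True show ?thesis by (simp add: A_def)
  next
    case False
    then show ?thesis by (simp only: A_def if_False order_refl)
  qed
  have [measurable]: "A \<in> borel_measurable ?M"
  proof -
    have m: "(\<lambda>x. killed_kernel \<delta> (x i) (x (i + 1))) \<in> borel_measurable ?M" if "i < K - 1" for i
    proof -
      have [measurable]: "(\<lambda>x. x i) \<in> borel_measurable ?M" "(\<lambda>x. x (i + 1)) \<in> borel_measurable ?M"
        using that by simp_all
      show ?thesis unfolding killed_kernel_def by measurable
    qed
    have "Measurable.pred ?M (\<lambda>x. \<forall>i\<in>{..<K}. 0 < x i)"
      by (intro pred_intros_finite) (auto intro!: borel_measurable_less)
    then have [measurable]: "Measurable.pred ?M (\<lambda>x. \<forall>i<K. 0 < x i)" by (simp add: Ball_def)
    have [measurable]: "(\<lambda>x. \<Prod>i<K - 1. killed_kernel \<delta> (x i) (x (i + 1))) \<in> borel_measurable ?M"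
      using m by (intro borel_measurable_prod) auto
    show ?thesis unfolding A_def[abs_def] by measurable
  qed
  have x0: "(\<lambda>x. x 0) \<in> borel_measurable ?M" and xK: "(\<lambda>x. x (K - 1)) \<in> borel_measurable ?M" using K by simp_all
  have dens: "excursion_fdd_density \<sigma> K (\<lambda>i. v + real i * \<delta>) x = A x * (first_passage v (x 0) * first_passage (\<delta> - v) (x (K - 1)))" for v x
  proof -
    have e1: "\<sigma> - (v + real (K - 1) * \<delta>) = \<delta> - v" using grid K by (simp add: of_nat_diff algebra_simps)
    have e2: "v + real (i + 1) * \<delta> - (v + real i * \<delta>) = \<delta>" for i by (simp add: algebra_simps)
    show ?thesis
    proof (cases "\<forall>i<K. 0 < x i")
      case True
      then show ?thesis unfolding excursion_fdd_density_def A_def c_def e1 e2 by (simp add: mult_ac)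
    next
      case False
      then show ?thesis unfolding excursion_fdd_density_def A_def by (simp only: if_False mult_zero_left)
    qed
  qed
  have inner: "(\<integral>\<^sup>+e. \<Psi> (\<lambda>i\<in>{..<K}. apply_bcontfun e (v + real i * \<delta>)) \<partial>\<mu>)
    = (\<integral>\<^sup>+x. ennreal (A x * (first_passage v (x 0) * first_passage (\<delta> - v) (x (K - 1)))) * \<Psi> x \<partial>?M)" if v: "0 < v" "v < \<delta>" for v
  proof -
    have "v + real (K - 1) * \<delta> < \<sigma>" unfolding grid using K v by (simp add: of_nat_diff algebra_simps)
    then have "(\<integral>\<^sup>+e. \<Psi> (\<lambda>i\<in>{..<K}. apply_bcontfun e (v + real i * \<delta>)) \<partial>\<mu>)
      = (\<integral>\<^sup>+x. ennreal (excursion_fdd_density \<sigma> K (\<lambda>i. v + real i * \<delta>) x) * \<Psi> x \<partial>?M)"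
      using K v dpos by (intro nn_integral_fdd \<Psi>) simp_all
    then show ?thesis unfolding dens .
  qed
  let ?g = "\<lambda>v x. indicator {0<..<\<delta>} v * (ennreal (A x * (first_passage v (x 0) * first_passage (\<delta> - v) (x (K - 1)))) * \<Psi> x)"
  have "(\<integral>\<^sup>+v\<in>{0<..<\<delta>}. (\<integral>\<^sup>+e. \<Psi> (\<lambda>i\<in>{..<K}. apply_bcontfun e (v + real i * \<delta>)) \<partial>\<mu>) \<partial>lborel)
     = (\<integral>\<^sup>+v. (\<integral>\<^sup>+x. ?g v x \<partial>?M) \<partial>lborel)"
    by (intro nn_integral_cong) (auto simp: inner indicator_def)
  also have "\<dots> = (\<integral>\<^sup>+x. (\<integral>\<^sup>+v. ?g v x \<partial>lborel) \<partial>?M)"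
  proof (rule LB_Fubini)
    have [measurable]: "(\<lambda>p. snd p 0) \<in> borel_measurable (lborel \<Otimes>\<^sub>M ?M)" "(\<lambda>p. snd p (K - 1)) \<in> borel_measurable (lborel \<Otimes>\<^sub>M ?M)"
      using measurable_compose[OF measurable_snd x0] measurable_compose[OF measurable_snd xK] by auto
    have [measurable]: "(\<lambda>p. A (snd p)) \<in> borel_measurable (lborel \<Otimes>\<^sub>M ?M)"
      by (rule measurable_compose[OF measurable_snd]) simp
    have [measurable]: "(\<lambda>p. \<Psi> (snd p)) \<in> borel_measurable (lborel \<Otimes>\<^sub>M ?M)"
      by (rule measurable_compose[OF measurable_snd]) simp
    show "(\<lambda>(v, x). ?g v x) \<in> borel_measurable (lborel \<Otimes>\<^sub>M ?M)"
      unfolding case_prod_beta first_passage_def by measurable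
  qed simp
  also have "\<dots> = (\<integral>\<^sup>+x. ennreal c * (\<Psi> x * ennreal (R (K - 1) x)) \<partial>?M)"
  proof (rule nn_integral_cong)
    fix x assume "x \<in> space ?M"
    show "(\<integral>\<^sup>+v. ?g v x \<partial>lborel) = ennreal c * (\<Psi> x * ennreal (R (K - 1) x))"
    proof (cases "\<forall>i<K. 0 < x i")
      case True
      have fp: "(\<integral>\<^sup>+v\<in>{0<..<\<delta>}. ennreal (first_passage v (x 0) * first_passage (\<delta> - v) (x (K - 1))) \<partial>lborel) = ennreal (first_passage \<delta> (x 0 + x (K - 1)))"
        using True K dpos by (intro first_passage_convolution) auto
      have "(\<integral>\<^sup>+v. ?g v x \<partial>lborel) = (\<integral>\<^sup>+v. (\<Psi> x * ennreal (A x)) * (ennreal (first_passage v (x 0) * first_passage (\<delta> - v) (x (K - 1))) * indicator {0<..<\<delta>} v) \<partial>lborel)"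
        by (intro nn_integral_cong) (simp add: ennreal_mult'[OF A_nn] mult_ac)
      also have "\<dots> = (\<Psi> x * ennreal (A x)) * ennreal (first_passage \<delta> (x 0 + x (K - 1)))"
        unfolding fp[symmetric] by (rule nn_integral_cmult) (simp add: first_passage_def)
      also have "\<dots> = \<Psi> x * ennreal (A x * first_passage \<delta> (x 0 + x (K - 1)))"
        by (simp add: ennreal_mult'[OF A_nn] mult.assoc)
      also have "A x * first_passage \<delta> (x 0 + x (K - 1)) = c * R (K - 1) x"
      proof -
        have n: "cyc_next (K - 1) = 0" "{..<K} - {K - 1} = {..<K - 1}" using K by (auto simp: cyc_next_def)
        have "(\<Prod>i<K - 1. killed_kernel \<delta> (x i) (x (cyc_next i))) = (\<Prod>i<K - 1. killed_kernel \<delta> (x i) (x (i + 1)))"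
          by (intro prod.cong) (auto simp: cyc_next_def)
        then show ?thesis using True unfolding A_def R_def n by (simp add: mult_ac add.commute)
      qed
      finally show ?thesis using c by (simp add: ennreal_mult' mult_ac)
    next
      case False
      then have "A x = 0" "R (K - 1) x = 0" by (auto simp: A_def R_def)
      then show ?thesis by simp
    qed
  qed
  also have "\<dots> = ennreal c * (\<integral>\<^sup>+x. \<Psi> x * ennreal (R (K - 1) x) \<partial>?M)"
    using K by (intro nn_integral_cmult borel_measurable_times_ennreal \<Psi> measurable_compose[OF R_measurable measurable_ennreal]) auto
  finally show ?thesis unfolding c_def .
qed

text \<open>The exponential factor is the exact ratio of the two Gaussians; the linear prefactor
  only grows.\<close>

lemma first_passage_shift:
  assumes "s > 0" "z > 0" "\<epsilon> \<ge> 0"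
  shows "first_passage s z * exp (- (2 * z * \<epsilon> + \<epsilon>\<^sup>2) / (2 * s)) \<le> first_passage s (z + \<epsilon>)"
proof -
  have "- z\<^sup>2 / (2 * s) + - (2 * z * \<epsilon> + \<epsilon>\<^sup>2) / (2 * s) = - (z + \<epsilon>)\<^sup>2 / (2 * s)"
    by (simp add: power2_sum add_divide_distrib diff_divide_distrib)
  then have "exp (- z\<^sup>2 / (2 * s)) * exp (- (2 * z * \<epsilon> + \<epsilon>\<^sup>2) / (2 * s)) = exp (- (z + \<epsilon>)\<^sup>2 / (2 * s))"
    by (simp add: exp_add[symmetric])
  then have "first_passage s z * exp (- (2 * z * \<epsilon> + \<epsilon>\<^sup>2) / (2 * s)) = z / sqrt (2 * pi * s ^ 3) * exp (- (z + \<epsilon>)\<^sup>2 / (2 * s))"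
    unfolding first_passage_def by simp
  also have "\<dots> \<le> first_passage s (z + \<epsilon>)"
    unfolding first_passage_def using assms by (intro mult_right_mono divide_right_mono) auto
  finally show ?thesis .
qed

text \<open>Translating a positive path by \<open>\<epsilon>\<close> can only increase the transition densities of the killed motion,
  so only the two end factors cost something when all grid values are required to exceed \<open>\<epsilon>\<close>.\<close>

lemma grid_above:
  assumes k: "k \<ge> 1" and t: "0 < t 0" "\<And>i. Suc i < k \<Longrightarrow> t i < t (Suc i)" "t (k - 1) < \<sigma>" and \<epsilon>: "\<epsilon> \<ge> 0"
  shows "(\<integral>\<^sup>+e. ennreal (exp (- (2 * \<bar>apply_bcontfun e (t 0)\<bar> * \<epsilon> + \<epsilon>\<^sup>2) / (2 * t 0))
      * exp (- (2 * \<bar>apply_bcontfun e (t (k - 1))\<bar> * \<epsilon> + \<epsilon>\<^sup>2) / (2 * (\<sigma> - t (k - 1))))) \<partial>\<mu>)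
    \<le> emeasure \<mu> {e. \<forall>i<k. \<epsilon> < apply_bcontfun e (t i)}"
proof -
  let ?M = "LB {..<k}"
  let ?D = "excursion_fdd_density \<sigma> k t"
  define w where "w x = exp (- (2 * \<bar>x 0\<bar> * \<epsilon> + \<epsilon>\<^sup>2) / (2 * t 0)) * exp (- (2 * \<bar>x (k - 1)\<bar> * \<epsilon> + \<epsilon>\<^sup>2) / (2 * (\<sigma> - t (k - 1))))"
    for x :: "nat \<Rightarrow> real"
  have x0: "(\<lambda>x. x 0) \<in> borel_measurable ?M" "(\<lambda>x. x (k - 1)) \<in> borel_measurable ?M" using k by simp_all
  have w[measurable]: "w \<in> borel_measurable ?M" unfolding w_def[abs_def] using x0 by measurable
  have "Measurable.pred ?M (\<lambda>x. \<forall>i\<in>{..<k}. \<epsilon> < x i)"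
    by (intro pred_intros_finite) (auto intro!: borel_measurable_less)
  then have P[measurable]: "Measurable.pred ?M (\<lambda>x. \<forall>i<k. \<epsilon> < x i)" by (simp add: Ball_def)
  define I where "I x = (if \<forall>i<k. \<epsilon> < x i then 1 else 0 :: ennreal)" for x :: "nat \<Rightarrow> real"
  have I[measurable]: "I \<in> borel_measurable ?M" unfolding I_def[abs_def] by measurable
  have tm: "0 < t i" if "i < k" for i using that
  proof (induction i)
    case (Suc i) then show ?case using t(2)[of i] by simp
  qed (rule t(1))
  have key: "?D x * w x \<le> ?D (\<lambda>i\<in>{..<k}. x i + \<epsilon>)" if pos: "\<forall>i<k. 0 < x i" for x
  proof -
    let ?y = "\<lambda>i\<in>{..<k}. x i + \<epsilon>"
    have ypos: "\<forall>i<k. 0 < ?y i" using pos \<epsilon> by (simp add: add_pos_nonneg)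
    have kk: "killed_kernel (t (i + 1) - t i) (x i) (x (i + 1)) \<le> killed_kernel (t (i + 1) - t i) (?y i) (?y (i + 1))" if "i < k - 1" for i
    proof -
      have "t (i + 1) - t i > 0" using t(2)[of i] that by simp
      moreover have "0 < x i" "0 < x (i + 1)" using pos that by auto
      moreover have y: "?y i = x i + \<epsilon>" "?y (i + 1) = x (i + 1) + \<epsilon>" using that by auto
      ultimately show ?thesis using gauss_kernel_antimono[of "t (i + 1) - t i" "x (i+1) + x i" "x (i+1) + x i + 2 * \<epsilon>"] \<epsilon>
        unfolding killed_kernel_def y by (simp add: algebra_simps)
    qed
    have kk0: "0 \<le> killed_kernel (t (i + 1) - t i) (x i) (x (i + 1))" if "i < k - 1" for i
      using t(2)[of i] pos that by (intro killed_kernel_nonneg) (auto intro: less_imp_le)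
    let ?P = "\<lambda>x. \<Prod>i<k - 1. killed_kernel (t (i + 1) - t i) (x i) (x (i + 1))"
    let ?c = "2 * sqrt (2 * pi * \<sigma> ^ 3)"
    let ?f = "first_passage (t 0)" and ?h = "first_passage (\<sigma> - t (k - 1))"
    let ?u = "exp (- (2 * x 0 * \<epsilon> + \<epsilon>\<^sup>2) / (2 * t 0))" and ?v = "exp (- (2 * x (k-1) * \<epsilon> + \<epsilon>\<^sup>2) / (2 * (\<sigma> - t (k - 1))))"
    have f: "?f (x 0) * ?u \<le> ?f (?y 0)" using first_passage_shift[of "t 0" "x 0" \<epsilon>] t pos k \<epsilon> by simp
    have h: "?h (x (k-1)) * ?v \<le> ?h (?y (k-1))"
      using first_passage_shift[of "\<sigma> - t (k - 1)" "x (k-1)" \<epsilon>] t pos k \<epsilon> by simp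
    have nn: "0 \<le> ?f (x 0)" "0 \<le> ?h (x (k-1))" "0 \<le> ?c"
    proof -
      have "0 \<le> x 0" "0 \<le> x (k - 1)" using pos k by (simp_all add: less_imp_le)
      then show "0 \<le> ?f (x 0)" "0 \<le> ?h (x (k-1))" using t by (simp_all add: first_passage_nonneg)
      show "0 \<le> ?c" using \<sigma> by simp
    qed
    have "0 < x 0" "0 < x (k - 1)" using pos k by simp_all
    then have ab: "\<bar>x 0\<bar> = x 0" "\<bar>x (k - 1)\<bar> = x (k - 1)" by simp_all
    have "?D x * w x = ?c * ((?f (x 0) * ?u) * ?P x * (?h (x (k-1)) * ?v))"
      using pos unfolding excursion_fdd_density_def w_def ab by (simp add: mult_ac)
    also have "\<dots> \<le> ?c * (?f (?y 0) * ?P ?y * ?h (?y (k-1)))"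
    proof (intro mult_left_mono mult_mono f h nn(3))
      show "?P x \<le> ?P ?y" using kk kk0 by (intro prod_mono) auto
      show "0 \<le> ?P x" using kk0 by (intro prod_nonneg) auto
      show "0 \<le> ?f (?y 0)" using f nn by (smt (verit) exp_gt_zero mult_nonneg_nonneg)
      show "0 \<le> ?h (x (k-1)) * ?v" using nn by simp
      have "0 \<le> ?P ?y" by (intro prod_nonneg ballI order_trans[OF kk0 kk]) auto
      then show "0 \<le> ?f (?y 0) * ?P ?y" using \<open>0 \<le> ?f (?y 0)\<close> by simp
    qed
    also have "\<dots> = ?D ?y" using ypos unfolding excursion_fdd_density_def by (simp add: mult_ac)
    finally show ?thesis .
  qed
  have "(\<integral>\<^sup>+e. ennreal (exp (- (2 * \<bar>apply_bcontfun e (t 0)\<bar> * \<epsilon> + \<epsilon>\<^sup>2) / (2 * t 0))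
      * exp (- (2 * \<bar>apply_bcontfun e (t (k - 1))\<bar> * \<epsilon> + \<epsilon>\<^sup>2) / (2 * (\<sigma> - t (k - 1))))) \<partial>\<mu>)
    = (\<integral>\<^sup>+e. ennreal (w (\<lambda>i\<in>{..<k}. apply_bcontfun e (t i))) \<partial>\<mu>)"
    using k by (simp add: w_def)
  also have "\<dots> = (\<integral>\<^sup>+x. ennreal (?D x) * ennreal (w x) \<partial>?M)"
    by (rule nn_integral_fdd[OF k t]) simp_all
  also have "\<dots> \<le> (\<integral>\<^sup>+x. ennreal (?D (\<lambda>i\<in>{..<k}. x i + \<epsilon>)) * I (\<lambda>i\<in>{..<k}. x i + \<epsilon>) \<partial>?M)"
  proof (rule nn_integral_mono)
    fix x assume "x \<in> space ?M"
    show "ennreal (?D x) * ennreal (w x) \<le> ennreal (?D (\<lambda>i\<in>{..<k}. x i + \<epsilon>)) * I (\<lambda>i\<in>{..<k}. x i + \<epsilon>)"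
    proof (cases "\<forall>i<k. 0 < x i")
      case True
      then have "I (\<lambda>i\<in>{..<k}. x i + \<epsilon>) = 1" by (simp add: I_def)
      moreover have "ennreal (?D x) * ennreal (w x) = ennreal (?D x * w x)"
        by (rule ennreal_mult''[symmetric]) (simp add: w_def)
      ultimately show ?thesis using key[OF True] by (simp add: ennreal_leI)
    next
      case False
      then have "?D x = 0" by (simp only: excursion_fdd_density_def if_False)
      then show ?thesis by simp
    qed
  qed
  also have "\<dots> = (\<integral>\<^sup>+x. ennreal (?D x) * I x \<partial>?M)"
    using k by (intro nn_integral_LB_translate) simp_all
  also have "\<dots> = (\<integral>\<^sup>+e. I (\<lambda>i\<in>{..<k}. apply_bcontfun e (t i)) \<partial>\<mu>)"
    by (rule nn_integral_fdd[OF k t, symmetric]) simp_all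
  also have "\<dots> = (\<integral>\<^sup>+e. indicator {e. \<forall>i<k. \<epsilon> < apply_bcontfun e (t i)} e \<partial>\<mu>)"
    by (intro nn_integral_cong) (simp add: I_def indicator_def)
  also have "\<dots> = emeasure \<mu> {e. \<forall>i<k. \<epsilon> < apply_bcontfun e (t i)}"
    by (rule nn_integral_indicator) simp
  finally show ?thesis .
qed

text \<open>Finite-dimensional densities control only finitely many times. The bound of
  \<open>grid_above\<close> does not depend on the number of grid points, so it passes to all dyadic
  points, by continuity to the interval, and it tends to \<open>1\<close> as
  \<open>\<epsilon>\<close> goes to \<open>0\<close>.\<close>

lemma positive_on_interval:
  assumes ab: "0 < a" "a < b" "b < \<sigma>"
  shows "AE e in \<mu>. \<forall>t\<in>{a..b}. apply_bcontfun e t > 0"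
proof -
  \<comment> \<open>Nested dyadic grids that contain both ends, so that the two end factors do not
    change with \<open>n\<close>.\<close>
  define g where "g n i = a + real i * (b - a) / 2 ^ n" for n i :: nat
  define S where "S \<epsilon> n = {e :: real \<Rightarrow>\<^sub>C real. \<forall>i<2 ^ n + 1. \<epsilon> < apply_bcontfun e (g n i)}" for \<epsilon> n
  define q where "q \<epsilon> = (\<integral>\<^sup>+e. ennreal (exp (- (2 * \<bar>apply_bcontfun e a\<bar> * \<epsilon> + \<epsilon>\<^sup>2) / (2 * a))
      * exp (- (2 * \<bar>apply_bcontfun e b\<bar> * \<epsilon> + \<epsilon>\<^sup>2) / (2 * (\<sigma> - b)))) \<partial>\<mu>)" for \<epsilon>
  have Sm[measurable]: "S \<epsilon> n \<in> sets \<mu>" for \<epsilon> n unfolding S_def by simp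
  have qS: "q \<epsilon> \<le> emeasure \<mu> (S \<epsilon> n)" if "\<epsilon> \<ge> 0" for \<epsilon> n
  proof -
    have l: "g n (2 ^ n + 1 - 1) = b" "g n 0 = a" by (simp_all add: g_def)
    have mono: "g n i < g n (Suc i)" for i :: nat using ab by (simp add: g_def divide_strict_right_mono)
    show ?thesis using grid_above[of "2 ^ n + 1" "g n" \<epsilon>] that ab mono unfolding l q_def S_def by simp
  qed
  define T where "T \<epsilon> = (\<Inter>n. S \<epsilon> n)" for \<epsilon>
  have T[measurable]: "T \<epsilon> \<in> sets \<mu>" for \<epsilon> unfolding T_def by measurable
  have dec: "decseq (S \<epsilon>)" for \<epsilon>
  proof (rule decseq_SucI, unfold S_def, safe)
    fix n i :: nat and e :: "real \<Rightarrow>\<^sub>C real"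
    assume H: "\<forall>i<2 ^ Suc n + 1. \<epsilon> < apply_bcontfun e (g (Suc n) i)" and i: "i < 2 ^ n + 1"
    have "g n i = g (Suc n) (2 * i)" by (simp add: g_def)
    then show "\<epsilon> < apply_bcontfun e (g n i)" using H i by simp
  qed
  have qT: "q \<epsilon> \<le> emeasure \<mu> (T \<epsilon>)" if "\<epsilon> \<ge> 0" for \<epsilon>
  proof -
    have "(\<lambda>n. emeasure \<mu> (S \<epsilon> n)) \<longlonglongrightarrow> emeasure \<mu> (T \<epsilon>)"
      unfolding T_def by (rule Lim_emeasure_decseq) (use dec Sm in \<open>auto\<close>)
    then show ?thesis by (rule LIMSEQ_le_const) (use qS[OF that] in auto)
  qed
  have Tpos: "apply_bcontfun e t \<ge> \<epsilon>" if e: "e \<in> T \<epsilon>" and t: "t \<in> {a..b}" for e t \<epsilon>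
  proof -
    define i where "i n = nat \<lfloor>(t - a) / (b - a) * 2 ^ n\<rfloor>" for n :: nat
    have r: "0 \<le> (t - a) / (b - a)" "(t - a) / (b - a) \<le> 1" using t ab by auto
    have lim: "(\<lambda>n. g n (i n)) \<longlonglongrightarrow> t"
    proof -
      have bound: "\<bar>g n (i n) - t\<bar> \<le> (b - a) * (1 / 2) ^ n" for n
      proof -
        have "0 \<le> (t - a) / (b - a) * 2 ^ n" by (rule mult_nonneg_nonneg[OF r(1)]) simp
        then have "real (i n) = of_int \<lfloor>(t - a) / (b - a) * 2 ^ n\<rfloor>"
          unfolding i_def by (simp only: of_nat_nat zero_le_floor)
        then have "\<bar>real (i n) - (t - a) / (b - a) * 2 ^ n\<bar> \<le> 1" by linarith
        moreover have "g n (i n) - t = (real (i n) - (t - a) / (b - a) * 2 ^ n) * ((b - a) / 2 ^ n)"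
          using ab by (simp add: g_def field_simps)
        ultimately have "\<bar>g n (i n) - t\<bar> \<le> 1 * ((b - a) / 2 ^ n)"
          using ab by (simp only: abs_mult) (intro mult_mono, auto)
        then show ?thesis by (simp add: power_divide)
      qed
      have "(\<lambda>n. (b - a) * (1 / 2 :: real) ^ n) \<longlonglongrightarrow> (b - a) * 0"
        by (intro tendsto_intros LIMSEQ_realpow_zero) auto
      then have "(\<lambda>n. g n (i n) - t) \<longlonglongrightarrow> 0"
        by (intro Lim_null_comparison[of "\<lambda>n. g n (i n) - t"]) (use bound in auto)
      then show ?thesis using LIM_zero_iff[of "\<lambda>n. g n (i n)" t] by simp
    qed
    have "isCont (apply_bcontfun e) t"
    proof -
      have "continuous_on UNIV (apply_bcontfun e)" by (rule continuous_on_apply_bcontfun)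
      then show ?thesis using continuous_on_eq_continuous_at[OF open_UNIV, of "apply_bcontfun e"] by blast
    qed
    then have "(\<lambda>n. apply_bcontfun e (g n (i n))) \<longlonglongrightarrow> apply_bcontfun e t"
      using lim by (rule isCont_tendsto_compose)
    moreover have "\<epsilon> \<le> apply_bcontfun e (g n (i n))" for n
    proof -
      have "(t - a) / (b - a) * 2 ^ n \<le> 1 * 2 ^ n" using r by (intro mult_right_mono) auto
      then have "\<lfloor>(t - a) / (b - a) * 2 ^ n\<rfloor> \<le> \<lfloor>real (2 ^ n)\<rfloor>" by (intro floor_mono) simp
      then have "i n \<le> 2 ^ n" unfolding i_def by (simp only: floor_of_nat nat_le_iff)
      then show ?thesis using e unfolding T_def S_def by (auto intro: less_imp_le)
    qed
    ultimately show ?thesis by (intro LIMSEQ_le_const) auto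
  qed
  have qlim: "(\<lambda>j. q (1 / real (Suc j))) \<longlonglongrightarrow> 1"
  proof -
    have eps: "(\<lambda>j. 1 / real (Suc j)) \<longlonglongrightarrow> 0" by (rule LIMSEQ_Suc) (rule lim_1_over_n)
    have "(\<lambda>j. q (1 / real (Suc j))) \<longlonglongrightarrow> (\<integral>\<^sup>+e. 1 \<partial>\<mu>)"
      unfolding q_def
    proof (rule nn_integral_dominated_convergence[where w = "\<lambda>_. 1"])
      fix j
      let ?\<epsilon> = "1 / real (Suc j)"
      show "AE e in \<mu>. ennreal (exp (- (2 * \<bar>apply_bcontfun e a\<bar> * ?\<epsilon> + ?\<epsilon>\<^sup>2) / (2 * a))
        * exp (- (2 * \<bar>apply_bcontfun e b\<bar> * ?\<epsilon> + ?\<epsilon>\<^sup>2) / (2 * (\<sigma> - b)))) \<le> 1"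
      proof (rule AE_I2)
        fix e :: "real \<Rightarrow>\<^sub>C real"
        have "exp (- (2 * \<bar>apply_bcontfun e a\<bar> * ?\<epsilon> + ?\<epsilon>\<^sup>2) / (2 * a)) \<le> 1"
          "exp (- (2 * \<bar>apply_bcontfun e b\<bar> * ?\<epsilon> + ?\<epsilon>\<^sup>2) / (2 * (\<sigma> - b))) \<le> 1"
        proof -
          have P: "exp (- (2 * \<bar>x\<bar> * ?\<epsilon> + ?\<epsilon>\<^sup>2) / (2 * c)) \<le> 1" if "c > 0" for x c :: real
          proof -
            have "0 \<le> 2 * \<bar>x\<bar> * ?\<epsilon> + ?\<epsilon>\<^sup>2" by (intro add_nonneg_nonneg mult_nonneg_nonneg) auto
            then have "- (2 * \<bar>x\<bar> * ?\<epsilon> + ?\<epsilon>\<^sup>2) \<le> 0" by (simp only: neg_le_0_iff_le)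
            then have "- (2 * \<bar>x\<bar> * ?\<epsilon> + ?\<epsilon>\<^sup>2) / (2 * c) \<le> 0" by (rule divide_nonpos_pos) (use that in simp)
            then show ?thesis by (simp only: exp_le_one_iff)
          qed
          show "exp (- (2 * \<bar>apply_bcontfun e a\<bar> * ?\<epsilon> + ?\<epsilon>\<^sup>2) / (2 * a)) \<le> 1" by (rule P) (rule ab)
          show "exp (- (2 * \<bar>apply_bcontfun e b\<bar> * ?\<epsilon> + ?\<epsilon>\<^sup>2) / (2 * (\<sigma> - b))) \<le> 1" by (rule P) (use ab in simp)
        qed
        then show "ennreal (exp (- (2 * \<bar>apply_bcontfun e a\<bar> * ?\<epsilon> + ?\<epsilon>\<^sup>2) / (2 * a))
          * exp (- (2 * \<bar>apply_bcontfun e b\<bar> * ?\<epsilon> + ?\<epsilon>\<^sup>2) / (2 * (\<sigma> - b)))) \<le> 1"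
          by (metis ennreal_1 ennreal_leI exp_ge_zero mult_le_one)
      qed
    next
      show "AE e in \<mu>. (\<lambda>j. ennreal (exp (- (2 * \<bar>apply_bcontfun e a\<bar> * (1 / real (Suc j)) + (1 / real (Suc j))\<^sup>2) / (2 * a))
        * exp (- (2 * \<bar>apply_bcontfun e b\<bar> * (1 / real (Suc j)) + (1 / real (Suc j))\<^sup>2) / (2 * (\<sigma> - b))))) \<longlonglongrightarrow> 1"
      proof (rule AE_I2)
        fix e :: "real \<Rightarrow>\<^sub>C real"
        have "(\<lambda>j. exp (- (2 * x * (1 / real (Suc j)) + (1 / real (Suc j))\<^sup>2) / (2 * c))) \<longlonglongrightarrow> exp (- (2 * x * 0 + 0\<^sup>2) / (2 * c))" if "c > 0" for x c :: real
          using that by (intro tendsto_intros eps) auto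
        then have Q: "(\<lambda>j. exp (- (2 * x * (1 / real (Suc j)) + (1 / real (Suc j))\<^sup>2) / (2 * c))) \<longlonglongrightarrow> 1" if "c > 0" for x c :: real
          using that by simp
        have "(\<lambda>j. exp (- (2 * \<bar>apply_bcontfun e a\<bar> * (1 / real (Suc j)) + (1 / real (Suc j))\<^sup>2) / (2 * a))
           * exp (- (2 * \<bar>apply_bcontfun e b\<bar> * (1 / real (Suc j)) + (1 / real (Suc j))\<^sup>2) / (2 * (\<sigma> - b)))) \<longlonglongrightarrow> 1 * 1"
          by (intro tendsto_mult Q) (use ab in auto)
        from tendsto_ennrealI[OF this]
        show "(\<lambda>j. ennreal (exp (- (2 * \<bar>apply_bcontfun e a\<bar> * (1 / real (Suc j)) + (1 / real (Suc j))\<^sup>2) / (2 * a))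
        * exp (- (2 * \<bar>apply_bcontfun e b\<bar> * (1 / real (Suc j)) + (1 / real (Suc j))\<^sup>2) / (2 * (\<sigma> - b))))) \<longlonglongrightarrow> 1" by simp
      qed
    qed (simp_all add: emeasure_space_1[simplified])
    then show ?thesis using emeasure_space_1 by simp
  qed
  define U where "U = (\<Union>j. T (1 / real (Suc j)))"
  have U[measurable]: "U \<in> sets \<mu>" unfolding U_def by (rule sets.countable_UN) (use T in blast)
  have "emeasure \<mu> U \<ge> 1"
  proof (rule LIMSEQ_le_const2[OF qlim])
    have "q (1 / real (Suc j)) \<le> emeasure \<mu> U" for j
    proof (rule order_trans[OF qT])
      show "emeasure \<mu> (T (1 / real (Suc j))) \<le> emeasure \<mu> U"
        by (rule emeasure_mono[OF _ U]) (unfold U_def, blast)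
    qed simp
    then show "\<exists>N. \<forall>n\<ge>N. q (1 / real (Suc n)) \<le> emeasure \<mu> U" by auto
  qed
  then have "prob U = 1"
    by (metis U emeasure_eq_measure ennreal_ge_1 prob_le_1 antisym)
  then have "AE e in \<mu>. e \<in> U" using AE_in_set_eq_1[OF U] by simp
  then show ?thesis
  proof eventually_elim
    case (elim e)
    then obtain j where "e \<in> T (1 / real (Suc j))" unfolding U_def by auto
    then have "\<forall>t\<in>{a..b}. apply_bcontfun e t \<ge> 1 / real (Suc j)" using Tpos by auto
    then show ?case by (meson divide_pos_pos less_le_trans of_nat_0_less_iff zero_less_Suc zero_less_one)
  qed
qed

theorem positive_inside: "AE e in \<mu>. \<forall>t\<in>{0<..<\<sigma>}. apply_bcontfun e t > 0"
proof -
  \<comment> \<open>The summand \<open>3\<close> keeps these intervals nondegenerate for every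
    \<open>n\<close>.\<close>
  have "AE e in \<mu>. \<forall>n. \<forall>t\<in>{\<sigma> / (real n + 3)..\<sigma> - \<sigma> / (real n + 3)}. apply_bcontfun e t > 0"
    unfolding AE_all_countable
  proof
    fix n :: nat
    have "\<sigma> / (real n + 3) < \<sigma> / 2" using \<sigma> by (intro divide_strict_left_mono) auto
    then show "AE e in \<mu>. \<forall>t\<in>{\<sigma> / (real n + 3)..\<sigma> - \<sigma> / (real n + 3)}. apply_bcontfun e t > 0"
    proof (intro positive_on_interval)
      show "0 < \<sigma> / (real n + 3)" using \<sigma> by simp
      then show "\<sigma> - \<sigma> / (real n + 3) < \<sigma>" by simp
      show "\<sigma> / (real n + 3) < \<sigma> - \<sigma> / (real n + 3)" using \<open>\<sigma> / (real n + 3) < \<sigma> / 2\<close> by linarith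
    qed
  qed
  then show ?thesis
  proof eventually_elim
    case (elim e)
    show ?case
    proof
      fix t assume t: "t \<in> {0<..<\<sigma>}"
      define m where "m = min t (\<sigma> - t)"
      have m: "m > 0" using t by (simp add: m_def)
      obtain n :: nat where n: "\<sigma> / m < real n" using reals_Archimedean2 by blast
      then have "\<sigma> < real n * m" using m by (simp add: field_simps)
      also have "\<dots> \<le> (real n + 3) * m" using m by simp
      finally have "\<sigma> / (real n + 3) \<le> m" by (simp add: divide_le_eq mult.commute)
      then have "t \<in> {\<sigma> / (real n + 3)..\<sigma> - \<sigma> / (real n + 3)}" unfolding m_def by auto
      then show "apply_bcontfun e t > 0" using elim by auto
    qed
  qed
qed

end

section \<open>Binomial random walks\<close>

lemma binomial_char:
  assumes p: "p \<in> {0..1}"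
  shows "char (distr (measure_pmf (binomial_pmf n p)) borel (\<lambda>k. (real k - real n * p) / s)) t
    = (complex_of_real (1 - p) * iexp (t / s * (- p)) + complex_of_real p * iexp (t / s * (1 - p))) ^ n"
proof -
  let ?a = "complex_of_real p * iexp (t / s * (1 - p))" and ?b = "complex_of_real (1 - p) * iexp (t / s * (- p))"
  have trm: "pmf (binomial_pmf n p) k *\<^sub>R iexp (t * ((real k - real n * p) / s)) = of_nat (n choose k) * ?a ^ k * ?b ^ (n - k)"
    if k: "k \<le> n" for k
  proof -
    have "iexp (t * ((real k - real n * p) / s)) = iexp (real k * (t / s * (1 - p)) + real (n - k) * (t / s * (- p)))"
    proof (rule arg_cong[where f = iexp])
      have e: "real (n - k) = real n - real k" using k by (simp add: of_nat_diff)
      show "t * ((real k - real n * p) / s) = real k * (t / s * (1 - p)) + real (n - k) * (t / s * (- p))"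
        unfolding e by (simp add: diff_divide_distrib add_divide_distrib algebra_simps)
    qed
    also have "\<dots> = iexp (t / s * (1 - p)) ^ k * iexp (t / s * (- p)) ^ (n - k)"
    proof -
      have "iexp (real i * a + real l * b) = iexp a ^ i * iexp b ^ l" for i l and a b :: real
        by (simp add: exp_of_nat_mult[symmetric] exp_add[symmetric] distrib_left mult.left_commute)
      then show ?thesis .
    qed
    finally show ?thesis using p by (simp add: power_mult_distrib scaleR_conv_of_real mult_ac)
  qed
  have "char (distr (measure_pmf (binomial_pmf n p)) borel (\<lambda>k. (real k - real n * p) / s)) t
     = (\<integral>k. iexp (t * ((real k - real n * p) / s)) \<partial>measure_pmf (binomial_pmf n p))"
    unfolding char_def by (subst integral_distr) auto
  also have "\<dots> = (\<Sum>k\<le>n. pmf (binomial_pmf n p) k *\<^sub>R iexp (t * ((real k - real n * p) / s)))"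
    using p set_pmf_binomial_eq[of p n] by (intro integral_measure_pmf) (auto split: if_splits)
  also have "\<dots> = (\<Sum>k\<le>n. of_nat (n choose k) * ?a ^ k * ?b ^ (n - k))"
    using trm by (intro sum.cong) auto
  also have "\<dots> = (?a + ?b) ^ n" by (rule binomial_ring[symmetric])
  finally show ?thesis by (simp add: add.commute)
qed

lemma bernoulli_char_approx:
  assumes p: "p \<in> {0..1}"
  shows "cmod (complex_of_real (1 - p) * iexp (x * (- p)) + complex_of_real p * iexp (x * (1 - p)) - complex_of_real (1 - x\<^sup>2 * (p * (1 - p)) / 2)) \<le> \<bar>x\<bar> ^ 3 / 6"
proof -
  have ap: "cmod (iexp y - (1 + \<i> * y - y\<^sup>2 / 2)) \<le> \<bar>y\<bar> ^ 3 / 6" for y :: real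
  proof -
    have "(\<Sum>k\<le>2. (\<i> * y) ^ k / fact k) = 1 + \<i> * y - y\<^sup>2 / 2"
      by (simp add: numeral_2_eq_2 power_mult_distrib power2_eq_square)
    then show ?thesis using iexp_approx1[of y 2] by (simp add: fact_numeral eval_nat_numeral)
  qed
  let ?e0 = "iexp (x * (- p)) - (1 + \<i> * (x * (- p)) - (x * (- p))\<^sup>2 / 2)"
  let ?e1 = "iexp (x * (1 - p)) - (1 + \<i> * (x * (1 - p)) - (x * (1 - p))\<^sup>2 / 2)"
  have "complex_of_real (1 - p) * iexp (x * (- p)) + complex_of_real p * iexp (x * (1 - p)) - complex_of_real (1 - x\<^sup>2 * (p * (1 - p)) / 2)
     = complex_of_real (1 - p) * ?e0 + complex_of_real p * ?e1"
    by (simp add: field_simps power2_eq_square)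
  also have "cmod \<dots> \<le> (1 - p) * (\<bar>x * (- p)\<bar> ^ 3 / 6) + p * (\<bar>x * (1 - p)\<bar> ^ 3 / 6)"
  proof (rule order_trans[OF norm_triangle_ineq], rule add_mono)
    show "cmod (complex_of_real (1 - p) * ?e0) \<le> (1 - p) * (\<bar>x * (- p)\<bar> ^ 3 / 6)"
      using p ap[of "x * (- p)"] unfolding norm_mult norm_of_real by (intro mult_mono) auto
    show "cmod (complex_of_real p * ?e1) \<le> p * (\<bar>x * (1 - p)\<bar> ^ 3 / 6)"
      using p ap[of "x * (1 - p)"] unfolding norm_mult norm_of_real by (intro mult_mono) auto
  qed
  also have "\<dots> \<le> (1 - p) * (\<bar>x\<bar> ^ 3 / 6) + p * (\<bar>x\<bar> ^ 3 / 6)"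
  proof -
    have "\<bar>x * (- p)\<bar> ^ 3 \<le> \<bar>x\<bar> ^ 3" "\<bar>x * (1 - p)\<bar> ^ 3 \<le> \<bar>x\<bar> ^ 3"
      using p by (auto intro!: power_mono simp: abs_mult mult_left_le)
    then show ?thesis using p by (intro add_mono mult_left_mono divide_right_mono) auto
  qed
  also have "\<dots> = \<bar>x\<bar> ^ 3 / 6" unfolding distrib_right[symmetric] by simp
  finally show ?thesis .
qed

text \<open>The success probability varies with \<open>m\<close>, so the summands form a triangular
  array and the argument goes through characteristic functions: \<open>n\<close>-th powers of
  numbers of modulus at most \<open>1\<close> differ by at most \<open>n\<close> times the
  difference of the bases, which is here of order \<open>n powr (-3/2)\<close>.\<close>

lemma binomial_clt:
  fixes n :: "nat \<Rightarrow> nat" and p :: "nat \<Rightarrow> real"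
  assumes n: "filterlim n at_top sequentially" and p: "\<And>m. p m \<in> {0..1}" and lim: "p \<longlonglongrightarrow> p0" and p0: "0 < p0" "p0 < 1"
  shows "weak_conv_m (\<lambda>m. distr (measure_pmf (binomial_pmf (n m) (p m))) borel
      (\<lambda>k. (real k - real (n m) * p m) / sqrt (real (n m) * (p m * (1 - p m))))) std_normal_distribution"
proof (rule levy_continuity)
  fix t :: real
  let ?v = "\<lambda>m. p m * (1 - p m)"
  let ?s = "\<lambda>m. sqrt (real (n m) * ?v m)"
  let ?z = "\<lambda>m. complex_of_real (1 - p m) * iexp (t / ?s m * (- p m)) + complex_of_real (p m) * iexp (t / ?s m * (1 - p m))"
  \<comment> \<open>The second order Taylor value of \<open>?z\<close>, written in the form of the
    exponential limit.\<close>
  let ?w = "\<lambda>m. complex_of_real (1 + (- (t\<^sup>2 / 2)) / real (n m))"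
  have vlim: "?v \<longlonglongrightarrow> p0 * (1 - p0)" by (intro tendsto_intros lim)
  have v0: "p0 * (1 - p0) > 0" using p0 by simp
  have ev_v: "eventually (\<lambda>m. ?v m > p0 * (1 - p0) / 2) sequentially"
    using v0 by (intro order_tendstoD(1)[OF vlim]) linarith
  have ev_n: "eventually (\<lambda>m. real (n m) > max (t\<^sup>2) 1) sequentially"
  proof -
    have "eventually (\<lambda>m. n m \<ge> nat \<lceil>max (t\<^sup>2) 1\<rceil> + 1) sequentially" using n by (simp add: filterlim_at_top)
    then show ?thesis by eventually_elim linarith
  qed
  have main: "eventually (\<lambda>m. cmod (?z m ^ n m - ?w m ^ n m) \<le> \<bar>t\<bar> ^ 3 / (6 * (p0 * (1 - p0) / 2) * sqrt (p0 * (1 - p0) / 2)) / sqrt (real (n m))) sequentially"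
    using ev_v ev_n
  proof eventually_elim
    case (elim m)
    let ?c = "p0 * (1 - p0) / 2"
    have npos: "real (n m) > 0" "real (n m) > t\<^sup>2" using elim(2) by auto
    have vpos: "?v m > 0" using elim(1) v0 by linarith
    have z1: "cmod (?z m) \<le> 1"
    proof -
      have "cmod (?z m) \<le> cmod (complex_of_real (1 - p m) * iexp (t / ?s m * (- p m))) + cmod (complex_of_real (p m) * iexp (t / ?s m * (1 - p m)))"
        using norm_triangle_ineq by simp
      also have "\<dots> = \<bar>1 - p m\<bar> + \<bar>p m\<bar>" unfolding norm_mult norm_of_real by (simp add: norm_exp_i_times)
      also have "\<dots> = 1" using p[of m] by simp
      finally show ?thesis .
    qed
    have w1: "cmod (?w m) \<le> 1"
    proof -
      have "0 \<le> (t\<^sup>2 / 2) / real (n m)" "(t\<^sup>2 / 2) / real (n m) \<le> 2"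
        using npos by (auto simp: divide_le_eq)
      then show ?thesis unfolding norm_of_real by (simp only: minus_divide_left[symmetric] abs_le_iff) linarith
    qed
    have sq: "(t / ?s m)\<^sup>2 * ?v m = t\<^sup>2 / real (n m)"
    proof -
      have "(t / sqrt (N * v))\<^sup>2 * v = t\<^sup>2 / N" if "N > 0" "v > 0" for N v :: real
        using that by (simp add: power_divide)
      then show ?thesis using npos vpos by blast
    qed
    have we: "?w m = complex_of_real (1 - (t / ?s m)\<^sup>2 * ?v m / 2)" unfolding sq by simp
    have "cmod (?z m ^ n m - ?w m ^ n m) \<le> real (n m) * cmod (?z m - ?w m)"
      by (rule norm_power_diff[OF z1 w1])
    also have "\<dots> \<le> real (n m) * (\<bar>t / ?s m\<bar> ^ 3 / 6)"
      using bernoulli_char_approx[OF p[of m], of "t / ?s m"] unfolding we by (intro mult_left_mono) auto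
    also have "\<dots> = \<bar>t\<bar> ^ 3 / (6 * ?v m * sqrt (?v m)) / sqrt (real (n m))"
    proof -
      define A where "A = sqrt (?v m)"
      define B where "B = sqrt (real (n m))"
      have AB: "A > 0" "B > 0" "A * A = ?v m" "B * B = real (n m)" using npos vpos by (auto simp: A_def B_def)
      have "?s m = B * A" unfolding A_def B_def by (rule real_sqrt_mult)
      then have "\<bar>t / ?s m\<bar> = \<bar>t\<bar> / (B * A)" using AB(1,2) by (simp only: abs_divide abs_mult abs_of_pos)
      then have "real (n m) * (\<bar>t / ?s m\<bar> ^ 3 / 6) = (B * B) * ((\<bar>t\<bar> / (B * A)) ^ 3 / 6)" by (simp only: AB(4))
      also have "\<dots> = \<bar>t\<bar> ^ 3 / (6 * (A * A) * A) / B" using AB(1,2) by (simp add: field_simps power3_eq_cube)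
      finally show ?thesis using AB by (simp add: A_def B_def)
    qed
    also have "\<dots> \<le> \<bar>t\<bar> ^ 3 / (6 * ?c * sqrt ?c) / sqrt (real (n m))"
    proof -
      have "\<bar>t\<bar> ^ 3 / (6 * V * sqrt V) \<le> \<bar>t\<bar> ^ 3 / (6 * c * sqrt c)" if "0 < c" "c \<le> V" for c V :: real
        using that by (intro divide_left_mono mult_mono mult_pos_pos) auto
      from this[of ?c "?v m"] show ?thesis using elim(1) v0 by (intro divide_right_mono) auto
    qed
    finally show ?case .
  qed
  have B0: "(\<lambda>m. \<bar>t\<bar> ^ 3 / (6 * (p0 * (1 - p0) / 2) * sqrt (p0 * (1 - p0) / 2)) / sqrt (real (n m))) \<longlonglongrightarrow> 0"
    by (intro tendsto_divide_0[OF tendsto_const] filterlim_at_top_imp_at_infinity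
        filterlim_compose[OF sqrt_at_top] filterlim_compose[OF filterlim_real_sequentially n])
  have "(\<lambda>m. (1 + (- (t\<^sup>2 / 2)) / real (n m)) ^ n m) \<longlonglongrightarrow> exp (- (t\<^sup>2 / 2))"
    by (rule filterlim_compose[OF tendsto_exp_limit_sequentially n])
  from tendsto_of_real[OF this] have W: "(\<lambda>m. ?w m ^ n m) \<longlonglongrightarrow> complex_of_real (exp (- (t\<^sup>2 / 2)))" by (simp only: of_real_power)
  have "(\<lambda>m. ?z m ^ n m) \<longlonglongrightarrow> complex_of_real (exp (- (t\<^sup>2 / 2)))"
    by (rule Lim_transform[OF W]) (rule Lim_null_comparison[OF main B0])
  then show "(\<lambda>m. char (distr (measure_pmf (binomial_pmf (n m) (p m))) borel (\<lambda>k. (real k - real (n m) * p m) / ?s m)) t)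
      \<longlonglongrightarrow> char std_normal_distribution t"
    using p by (subst binomial_char) (auto simp: char_std_normal_distribution)
next
  show "real_distribution (distr (measure_pmf (binomial_pmf (n m) (p m))) borel
      (\<lambda>k. (real k - real (n m) * p m) / sqrt (real (n m) * (p m * (1 - p m)))))" for m
    by (intro prob_space.real_distribution_distr) (auto intro: prob_space_measure_pmf)
qed (rule real_dist_normal_dist)

text \<open>Skorohod's representation turns the central limit theorem into convergence of expectations of
  functionals that themselves vary with \<open>m\<close>, as long as they converge along convergent arguments.\<close>

lemma binomial_expectation_limit:
  fixes n :: "nat \<Rightarrow> nat" and p :: "nat \<Rightarrow> real" and F :: "nat \<Rightarrow> nat \<Rightarrow> real" and f :: "real \<Rightarrow> real"
  assumes n: "filterlim n at_top sequentially" and p: "\<And>m. p m \<in> {0..1}" and lim: "p \<longlonglongrightarrow> p0" and p0: "0 < p0" "p0 < 1"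
    and F: "\<And>k x. (\<And>m. k m \<le> n m) \<Longrightarrow>
        (\<lambda>m. (real (k m) - real (n m) * p m) / sqrt (real (n m) * (p m * (1 - p m)))) \<longlonglongrightarrow> x \<Longrightarrow> (\<lambda>m. F m (k m)) \<longlonglongrightarrow> f x"
    and bound: "\<And>m k. \<bar>F m k\<bar> \<le> B" and f: "f \<in> borel_measurable borel"
  shows "(\<lambda>m. measure_pmf.expectation (binomial_pmf (n m) (p m)) (F m)) \<longlonglongrightarrow> (\<integral>x. f x \<partial>std_normal_distribution)"
proof -
  let ?s = "\<lambda>m. sqrt (real (n m) * (p m * (1 - p m)))"
  let ?h = "\<lambda>m k. (real k - real (n m) * p m) / ?s m"
  let ?D = "\<lambda>m. distr (measure_pmf (binomial_pmf (n m) (p m))) borel (?h m)"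
  have rd: "real_distribution (?D m)" for m
    by (intro prob_space.real_distribution_distr) (auto intro: prob_space_measure_pmf)
  obtain \<Omega> :: "real measure" and Y and Y0 where Y: "prob_space \<Omega>" "\<And>m. Y m \<in> measurable \<Omega> borel"
    "\<And>m. distr \<Omega> borel (Y m) = ?D m" "Y0 \<in> measurable \<Omega> lborel" "distr \<Omega> borel Y0 = std_normal_distribution"
    "\<And>x. x \<in> space \<Omega> \<Longrightarrow> (\<lambda>m. Y m x) \<longlonglongrightarrow> Y0 x"
    using Skorohod[OF rd real_dist_normal_dist binomial_clt[OF n p lim p0]] by blast
  interpret prob_space \<Omega> by fact
  have [measurable]: "Y m \<in> borel_measurable \<Omega>" "Y0 \<in> borel_measurable \<Omega>" for m using Y by auto
  have ev: "eventually (\<lambda>m. ?s m > 0) sequentially"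
  proof -
    have "(\<lambda>m. p m * (1 - p m)) \<longlonglongrightarrow> p0 * (1 - p0)" by (intro tendsto_intros lim)
    then have "eventually (\<lambda>m. p m * (1 - p m) > 0) sequentially" by (rule order_tendstoD) (use p0 in simp)
    moreover have "eventually (\<lambda>m. n m \<ge> 1) sequentially" using n by (simp add: filterlim_at_top)
    ultimately show ?thesis by eventually_elim simp
  qed
  then obtain m0 where m0: "\<And>m. m \<ge> m0 \<Longrightarrow> ?s m > 0" by (auto simp: eventually_sequentially)
  \<comment> \<open>Inverts the standardisation on the lattice: \<open>1/2\<close> puts the argument
    of the floor midway between two integers, and the result is a measurable function of any real
    argument.\<close>
  define R where "R m y = nat \<lfloor>y * ?s m + real (n m) * p m + 1/2\<rfloor>" for m y
  have RR: "R m (?h m k) = k" if "m \<ge> m0" for m k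
  proof -
    have "y / S * S = y" if "S > 0" for y S :: real using that by simp
    from this[OF m0[OF that]] have "?h m k * ?s m + real (n m) * p m + 1/2 = real k + 1/2" by (simp only:)
    then have "\<lfloor>?h m k * ?s m + real (n m) * p m + 1/2\<rfloor> = int k" by linarith
    then show ?thesis unfolding R_def by simp
  qed
  have Rm[measurable]: "R m \<in> measurable borel (count_space UNIV)" for m
    unfolding R_def[abs_def] by measurable
  define G where "G m y = F m (R m y)" for m y
  have Gm[measurable]: "G m \<in> borel_measurable borel" for m
    unfolding G_def[abs_def] by (rule measurable_compose[OF Rm]) simp
  have E: "measure_pmf.expectation (binomial_pmf (n m) (p m)) (F m) = (\<integral>\<omega>. G m (Y m \<omega>) \<partial>\<Omega>)" if "m \<ge> m0" for m
  proof -
    have "(\<integral>\<omega>. G m (Y m \<omega>) \<partial>\<Omega>) = (\<integral>y. G m y \<partial>distr \<Omega> borel (Y m))" by (rule integral_distr[symmetric]) simp_all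
    also have "\<dots> = measure_pmf.expectation (binomial_pmf (n m) (p m)) (\<lambda>k. G m (?h m k))"
      unfolding Y(3) by (rule integral_distr) simp_all
    finally show ?thesis unfolding G_def RR[OF that] by simp
  qed
  \<comment> \<open>The copy on the new space is merely a real variable; almost surely it takes only
    lattice values, so that \<open>F\<close> can be evaluated along integers
    \<open>k m\<close>.\<close>
  have supp: "AE \<omega> in \<Omega>. \<exists>k\<le>n m. Y m \<omega> = ?h m k" for m
  proof -
    let ?S = "?h m ` {..n m}"
    have S: "?S \<in> sets borel" by (intro borel_closed finite_imp_closed) auto
    have "AE k in measure_pmf (binomial_pmf (n m) (p m)). ?h m k \<in> ?S"
      using set_pmf_binomial_eq[of "p m" "n m"] p[of m] by (auto simp: AE_measure_pmf_iff split: if_splits)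
    then have "AE y in ?D m. y \<in> ?S" using S by (subst AE_distr_iff) auto
    then have "AE y in distr \<Omega> borel (Y m). y \<in> ?S" unfolding Y(3) .
    then have "AE \<omega> in \<Omega>. Y m \<omega> \<in> ?S" using S by (subst (asm) AE_distr_iff) auto
    then show ?thesis by eventually_elim auto
  qed
  then have "AE \<omega> in \<Omega>. \<forall>m. \<exists>k\<le>n m. Y m \<omega> = ?h m k" by (simp add: AE_all_countable)
  then have AEconv: "AE \<omega> in \<Omega>. (\<lambda>m. G m (Y m \<omega>)) \<longlonglongrightarrow> f (Y0 \<omega>)"
    using AE_space
  proof eventually_elim
    case (elim \<omega>)
    then obtain k where k: "\<And>m. k m \<le> n m" "\<And>m. Y m \<omega> = ?h m (k m)" by metis
    have "(\<lambda>m. ?h m (k m)) \<longlonglongrightarrow> Y0 \<omega>" using Y(6)[OF elim(2)] unfolding k(2) .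
    from F[OF k(1) this] have "(\<lambda>m. F m (k m)) \<longlonglongrightarrow> f (Y0 \<omega>)" .
    moreover have "eventually (\<lambda>m. F m (k m) = G m (Y m \<omega>)) sequentially"
      using eventually_ge_at_top[of m0] by eventually_elim (simp add: G_def k(2) RR)
    ultimately show ?case by (rule Lim_transform_eventually)
  qed
  have "(\<lambda>m. \<integral>\<omega>. G m (Y m \<omega>) \<partial>\<Omega>) \<longlonglongrightarrow> (\<integral>\<omega>. f (Y0 \<omega>) \<partial>\<Omega>)"
  proof (rule integral_dominated_convergence[where w = "\<lambda>_. B"])
    show "(\<lambda>\<omega>. f (Y0 \<omega>)) \<in> borel_measurable \<Omega>" using f by measurable
    show "(\<lambda>\<omega>. G m (Y m \<omega>)) \<in> borel_measurable \<Omega>" for m by measurable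
    show "AE \<omega> in \<Omega>. norm (G m (Y m \<omega>)) \<le> B" for m using bound by (simp add: G_def)
  qed (use AEconv in auto)
  also have "(\<integral>\<omega>. f (Y0 \<omega>) \<partial>\<Omega>) = (\<integral>x. f x \<partial>std_normal_distribution)"
    unfolding Y(5)[symmetric] using f by (intro integral_distr[symmetric]) auto
  finally show ?thesis
    by (rule Lim_transform_eventually) (use eventually_ge_at_top[of m0] in eventually_elim, simp add: E)
qed

section \<open>Multinomial counts at the grid times\<close>

lemma sum_Pow_card:
  fixes f :: "nat \<Rightarrow> real"
  assumes "finite V"
  shows "(\<Sum>B\<in>Pow V. f (card B)) = (\<Sum>c\<le>card V. real (card V choose c) * f c)"
proof -
  have "(\<Sum>B\<in>Pow V. f (card B)) = (\<Sum>c\<le>card V. \<Sum>B\<in>{B\<in>Pow V. card B = c}. f (card B))"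
    using assms by (subst sum.group) (auto intro: card_mono)
  also have "\<dots> = (\<Sum>c\<le>card V. real (card V choose c) * f c)"
  proof (rule sum.cong[OF refl])
    fix c
    have "card {B \<in> Pow V. card B = c} = card V choose c"
      using n_subsets[OF assms, of c] by (simp add: Pow_def conj_commute)
    then show "(\<Sum>B\<in>{B\<in>Pow V. card B = c}. f (card B)) = real (card V choose c) * f c" by simp
  qed
  finally show ?thesis .
qed

text \<open>\<open>B\<close> collects the cars that fall before \<open>L'\<close>. The summand sees
  only which cars these are, so their positions contribute the bare factor
  \<open>(L' - L) ^ card B\<close>.\<close>

lemma sum_PiE_split:
  fixes H :: "nat set \<Rightarrow> (nat \<Rightarrow> nat) \<Rightarrow> real"
  assumes V: "finite V" and L: "L \<le> L'" "L' \<le> M"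
  shows "(\<Sum>g\<in>V \<rightarrow>\<^sub>E {L..<M}. H {v\<in>V. g v < L'} (restrict g (V - {v\<in>V. g v < L'})))
    = (\<Sum>B\<in>Pow V. real ((L' - L) ^ card B) * (\<Sum>g\<in>(V - B) \<rightarrow>\<^sub>E {L'..<M}. H B g))"
proof -
  let ?S = "SIGMA B:Pow V. (B \<rightarrow>\<^sub>E {L..<L'}) \<times> ((V - B) \<rightarrow>\<^sub>E {L'..<M})"
  have "(\<Sum>B\<in>Pow V. real ((L' - L) ^ card B) * (\<Sum>g\<in>(V - B) \<rightarrow>\<^sub>E {L'..<M}. H B g))
     = (\<Sum>B\<in>Pow V. \<Sum>q\<in>(B \<rightarrow>\<^sub>E {L..<L'}) \<times> ((V - B) \<rightarrow>\<^sub>E {L'..<M}). H B (snd q))"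
  proof (rule sum.cong[OF refl])
    fix B assume "B \<in> Pow V"
    then have "finite B" using V finite_subset by auto
    then have c: "card (B \<rightarrow>\<^sub>E {L..<L'}) = (L' - L) ^ card B" by (simp add: card_PiE)
    have "(\<Sum>q\<in>(B \<rightarrow>\<^sub>E {L..<L'}) \<times> ((V - B) \<rightarrow>\<^sub>E {L'..<M}). H B (snd q))
      = (\<Sum>g1\<in>B \<rightarrow>\<^sub>E {L..<L'}. \<Sum>g\<in>(V - B) \<rightarrow>\<^sub>E {L'..<M}. H B g)"
      by (subst sum.cartesian_product) (simp add: case_prod_beta)
    then show "real ((L' - L) ^ card B) * (\<Sum>g\<in>(V - B) \<rightarrow>\<^sub>E {L'..<M}. H B g)
      = (\<Sum>q\<in>(B \<rightarrow>\<^sub>E {L..<L'}) \<times> ((V - B) \<rightarrow>\<^sub>E {L'..<M}). H B (snd q))" by (simp add: c)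
  qed
  also have "\<dots> = (\<Sum>(B, q)\<in>?S. H B (snd q))"
    using V by (intro sum.Sigma) (auto intro!: finite_cartesian_product finite_PiE intro: finite_subset)
  also have "\<dots> = (\<Sum>g\<in>V \<rightarrow>\<^sub>E {L..<M}. H {v\<in>V. g v < L'} (restrict g (V - {v\<in>V. g v < L'})))"
  proof (rule sum.reindex_bij_witness[where
      i = "\<lambda>g. ({v\<in>V. g v < L'}, restrict g {v\<in>V. g v < L'}, restrict g (V - {v\<in>V. g v < L'}))" and
      j = "\<lambda>(B, g1, g2). \<lambda>v\<in>V. if v \<in> B then g1 v else g2 v"])
    fix a assume a: "a \<in> ?S"
    then obtain B g1 g2 where a_eq: "a = (B, g1, g2)" and B: "B \<subseteq> V" and g1: "g1 \<in> B \<rightarrow>\<^sub>E {L..<L'}" and g2: "g2 \<in> (V - B) \<rightarrow>\<^sub>E {L'..<M}"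
      by auto
    let ?g = "\<lambda>v\<in>V. if v \<in> B then g1 v else g2 v"
    have r1: "v \<in> B \<Longrightarrow> L \<le> g1 v \<and> g1 v < L'" and r2: "v \<in> V \<Longrightarrow> v \<notin> B \<Longrightarrow> L' \<le> g2 v \<and> g2 v < M" for v
      using g1 g2 by (auto simp: PiE_def Pi_def)
    have "?g v < L' \<longleftrightarrow> v \<in> B" if "v \<in> V" for v
      using r1[of v] r2[of v] that by (cases "v \<in> B") auto
    then have BB: "{v\<in>V. ?g v < L'} = B" using B by auto
    have e1: "restrict ?g B = g1" using g1 B by (auto simp: fun_eq_iff PiE_def extensional_def)
    have e2: "restrict ?g (V - B) = g2" using g2 B by (auto simp: fun_eq_iff PiE_def extensional_def)
    show "({v \<in> V. (case a of (B, g1, g2) \<Rightarrow> \<lambda>v\<in>V. if v \<in> B then g1 v else g2 v) v < L'},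
        restrict (case a of (B, g1, g2) \<Rightarrow> \<lambda>v\<in>V. if v \<in> B then g1 v else g2 v) {v \<in> V. (case a of (B, g1, g2) \<Rightarrow> \<lambda>v\<in>V. if v \<in> B then g1 v else g2 v) v < L'},
        restrict (case a of (B, g1, g2) \<Rightarrow> \<lambda>v\<in>V. if v \<in> B then g1 v else g2 v) (V - {v \<in> V. (case a of (B, g1, g2) \<Rightarrow> \<lambda>v\<in>V. if v \<in> B then g1 v else g2 v) v < L'})) = a"
      unfolding a_eq prod.case BB e1 e2 ..
    show "(case a of (B, g1, g2) \<Rightarrow> \<lambda>v\<in>V. if v \<in> B then g1 v else g2 v) \<in> V \<rightarrow>\<^sub>E {L..<M}"
      unfolding a_eq prod.case using r1 r2 L by fastforce
    show "H {v \<in> V. (case a of (B, g1, g2) \<Rightarrow> \<lambda>v\<in>V. if v \<in> B then g1 v else g2 v) v < L'}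
        (restrict (case a of (B, g1, g2) \<Rightarrow> \<lambda>v\<in>V. if v \<in> B then g1 v else g2 v) (V - {v \<in> V. (case a of (B, g1, g2) \<Rightarrow> \<lambda>v\<in>V. if v \<in> B then g1 v else g2 v) v < L'}))
       = (case a of (B, q) \<Rightarrow> H B (snd q))"
      unfolding a_eq prod.case BB e2 by simp
  next
    fix g assume g: "g \<in> V \<rightarrow>\<^sub>E {L..<M}"
    show "(case ({v \<in> V. g v < L'}, restrict g {v \<in> V. g v < L'}, restrict g (V - {v \<in> V. g v < L'})) of
        (B, g1, g2) \<Rightarrow> \<lambda>v\<in>V. if v \<in> B then g1 v else g2 v) = g"
      using g by (auto simp: fun_eq_iff PiE_def extensional_def)
    have "L \<le> g v \<and> g v < M" if "v \<in> V" for v using g that by (auto simp: PiE_def Pi_def)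
    then show "({v \<in> V. g v < L'}, restrict g {v \<in> V. g v < L'}, restrict g (V - {v \<in> V. g v < L'})) \<in> ?S"
      by (auto simp: not_less)
  qed
  finally show ?thesis by simp
qed

text \<open>The single continuity condition also says that \<open>\<Phi>\<close> depends on the
  coordinates below \<open>K\<close> only, since nothing is asked of the others.\<close>

locale grid_functional =
  fixes \<sigma> :: real and K :: nat and \<Phi> :: "(nat \<Rightarrow> real) \<Rightarrow> real" and B :: real
  assumes \<sigma>: "\<sigma> > 0" and K: "K \<ge> 2"
    and bounded: "\<And>z. \<bar>\<Phi> z\<bar> \<le> B"
    and cont: "\<And>zm z. (\<And>i. i < K \<Longrightarrow> (\<lambda>m. zm m i) \<longlonglongrightarrow> z i) \<Longrightarrow> (\<lambda>m::nat. \<Phi> (zm m)) \<longlonglongrightarrow> \<Phi> z"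
begin

definition grid_index :: "nat \<Rightarrow> nat \<Rightarrow> nat" where "grid_index m j = m * j div K"

definition grid_scale :: "nat \<Rightarrow> real" where "grid_scale m = (real m / \<sigma>) powr (-1/2)"

definition grid_val :: "nat \<Rightarrow> nat \<Rightarrow> nat \<Rightarrow> real" where
  "grid_val m j N = grid_scale m * (real N - real (grid_index m j) * (real (m - 1) / real m))"

text \<open>The conditional probability that a car not placed before the previous grid position
  falls before the present one.\<close>

definition step_prob :: "nat \<Rightarrow> nat \<Rightarrow> real" where
  "step_prob m j = real (grid_index m j - grid_index m (j - 1)) / real (m - grid_index m (j - 1))"

text \<open>Backward recursion over the last \<open>d\<close> grid times, with \<open>s\<close> cars still to be placed; \<open>gauss_expect\<close> is its
  limit, in which each binomial step becomes a step of the Brownian bridge.\<close>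

primrec bin_expect :: "nat \<Rightarrow> nat \<Rightarrow> nat \<Rightarrow> (nat \<Rightarrow> real) \<Rightarrow> real" where
  "bin_expect m 0 s z = \<Phi> z"
| "bin_expect m (Suc d) s z = measure_pmf.expectation (binomial_pmf s (step_prob m (K - Suc d)))
     (\<lambda>c. bin_expect m d (s - c) (z(K - Suc d := grid_val m (K - Suc d) (m - 1 - (s - c)))))"

text \<open>For a bridge with \<open>d + 2\<close> cells to go until its return to \<open>0\<close>,
  one step multiplies the conditional mean by this ratio, and the conditional variance of the step
  is the cell length times the same ratio.\<close>

definition bridge_ratio :: "nat \<Rightarrow> real" where "bridge_ratio d = real (d + 1) / real (d + 2)"

primrec gauss_expect :: "nat \<Rightarrow> (nat \<Rightarrow> real) \<Rightarrow> real" where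
  "gauss_expect 0 z = \<Phi> z"
| "gauss_expect (Suc d) z = (\<integral>x. gauss_expect d (z(K - Suc d := z (K - Suc d - 1) * bridge_ratio d + sqrt (\<sigma> / real K * bridge_ratio d) * x)) \<partial>std_normal_distribution)"

lemma grid_index_mono: "i \<le> j \<Longrightarrow> grid_index m i \<le> grid_index m j" unfolding grid_index_def by (intro div_le_mono mult_le_mono) auto

lemma grid_index_K: "grid_index m K = m" using K by (simp add: grid_index_def)

lemma grid_index_le: "j \<le> K \<Longrightarrow> grid_index m j \<le> m" using grid_index_mono[of j K m] grid_index_K by simp

lemma grid_index_less: "m \<ge> K \<Longrightarrow> j < K \<Longrightarrow> grid_index m j < m"
proof -
  assume m: "m \<ge> K" and j: "j < K"
  have "grid_index m j * K \<le> m * j" unfolding grid_index_def by simp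
  also have "m * j < m * K" using m j K by auto
  finally show ?thesis by simp
qed

lemma step_prob_range: "j \<le> K \<Longrightarrow> step_prob m j \<in> {0..1}"
  unfolding step_prob_def using grid_index_le[of j m] by (auto simp: divide_le_eq)

lemma bin_expect_bound: "d < K \<Longrightarrow> \<bar>bin_expect m d s z\<bar> \<le> B"
proof (induction d arbitrary: s z)
  case (Suc d)
  have q: "step_prob m (K - Suc d) \<in> {0..1}" by (rule step_prob_range) simp
  let ?M = "binomial_pmf s (step_prob m (K - Suc d))"
  let ?f = "\<lambda>c. bin_expect m d (s - c) (z(K - Suc d := grid_val m (K - Suc d) (m - 1 - (s - c))))"
  have "\<bar>measure_pmf.expectation ?M ?f\<bar> \<le> measure_pmf.expectation ?M (\<lambda>c. \<bar>?f c\<bar>)"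
    by (rule integral_abs_bound)
  also have "\<dots> \<le> measure_pmf.expectation ?M (\<lambda>c. B)"
    using Suc q by (intro integral_mono) auto
  finally show ?case by simp
qed (use bounded in simp)

text \<open>The \<open>s\<close> cars in \<open>V\<close> are still free, so
  \<open>m - 1 - s\<close> cars already lie before the grid point reached; they are added to the
  counts of the free ones in the last \<open>d\<close> coordinates.\<close>

definition over :: "nat \<Rightarrow> nat \<Rightarrow> nat \<Rightarrow> nat set \<Rightarrow> (nat \<Rightarrow> nat) \<Rightarrow> (nat \<Rightarrow> real) \<Rightarrow> nat \<Rightarrow> real" where
  "over m d s V g z = (\<lambda>i. if K - d \<le> i \<and> i < K then grid_val m i (m - 1 - s + below V g (grid_index m i)) else z i)"

text \<open>One step of the recursion conditions on which free cars land in the next cell. By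
  exchangeability only their number matters; it is binomial, and the remaining cars are uniform
  beyond that cell.\<close>

lemma bin_expect_eq_average:
  assumes m: "m \<ge> K"
  shows "d < K \<Longrightarrow> finite V \<Longrightarrow> card V = s \<Longrightarrow> s \<le> m - 1 \<Longrightarrow>
    (\<Sum>g\<in>V \<rightarrow>\<^sub>E {grid_index m (K - Suc d)..<m}. \<Phi> (over m d s V g z)) = real (m - grid_index m (K - Suc d)) ^ s * bin_expect m d s z"
proof (induction d arbitrary: V s z)
  case 0
  have "over m 0 s V g z = z" for g by (auto simp: over_def)
  then show ?case using 0 by (simp add: card_PiE)
next
  case (Suc d)
  define j where "j = K - Suc d"
  have j: "j < K" "j \<ge> 1" "j - 1 = K - Suc (Suc d)" using Suc.prems by (auto simp: j_def)
  let ?L = "grid_index m (j - 1)" and ?L' = "grid_index m j"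
  have L: "?L \<le> ?L'" "?L' < m" using grid_index_mono grid_index_less[OF m] j by auto
  define H where "H Bs g2 = \<Phi> (over m d (s - card Bs) (V - Bs) g2 (z(j := grid_val m j (m - 1 - (s - card Bs)))))" for Bs g2
  have eq: "\<Phi> (over m (Suc d) s V g z) = H {v\<in>V. g v < ?L'} (restrict g (V - {v\<in>V. g v < ?L'}))" for g
  proof -
    let ?B = "{v\<in>V. g v < ?L'}"
    have cB: "card ?B \<le> s" using Suc.prems by (auto intro: card_mono)
    have bel: "below V g (grid_index m i) = card ?B + below (V - ?B) (restrict g (V - ?B)) (grid_index m i)" if i: "j \<le> i" for i
    proof -
      have le: "?L' \<le> grid_index m i" using grid_index_mono[OF i] .
      have "{v\<in>V. g v < grid_index m i} = ?B \<union> {v\<in>V - ?B. restrict g (V - ?B) v < grid_index m i}"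
        using le by auto
      then show ?thesis unfolding below_def using Suc.prems(2) by (simp add: card_Un_disjoint disjoint_iff)
    qed
    have belj: "below V g (grid_index m j) = card ?B" by (simp add: below_def)
    have "over m (Suc d) s V g z = over m d (s - card ?B) (V - ?B) (restrict g (V - ?B)) (z(j := grid_val m j (m - 1 - (s - card ?B))))"
    proof
      fix i
      consider "i < j \<or> i \<ge> K" | "i = j" | "j < i" "i < K" by linarith
      then show "over m (Suc d) s V g z i = over m d (s - card ?B) (V - ?B) (restrict g (V - ?B)) (z(j := grid_val m j (m - 1 - (s - card ?B)))) i"
      proof cases
        case 1 then show ?thesis using j unfolding over_def j_def by auto
      next
        case 2
        have "m - 1 - s + card ?B = m - 1 - (s - card ?B)" using cB Suc.prems(4) by linarith
        then show ?thesis using 2 j belj unfolding over_def j_def by auto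
      next
        case 3
        have "m - 1 - s + below V g (grid_index m i) = m - 1 - (s - card ?B) + below (V - ?B) (restrict g (V - ?B)) (grid_index m i)"
          using bel[of i] cB Suc.prems(4) 3 by linarith
        then show ?thesis using 3 unfolding over_def j_def by auto
      qed
    qed
    then show ?thesis unfolding H_def by simp
  qed
  have IH: "(\<Sum>g\<in>(V - Bs) \<rightarrow>\<^sub>E {?L'..<m}. H Bs g) = real (m - ?L') ^ (s - card Bs) * bin_expect m d (s - card Bs) (z(j := grid_val m j (m - 1 - (s - card Bs))))"
    if "Bs \<in> Pow V" for Bs
  proof -
    have "card (V - Bs) = s - card Bs" using that Suc.prems by (auto intro: card_Diff_subset finite_subset)
    then show ?thesis unfolding H_def using Suc.IH[of "V - Bs" "s - card Bs"] Suc.prems by (simp add: j_def)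
  qed
  let ?q = "step_prob m j"
  let ?E = "\<lambda>c. bin_expect m d (s - c) (z(j := grid_val m j (m - 1 - (s - c))))"
  have mL: "real (m - ?L) > 0" using L by simp
  have q1: "real (m - ?L) * ?q = real (?L' - ?L)" using mL unfolding step_prob_def by simp
  have q2: "real (m - ?L) * (1 - ?q) = real (m - ?L')" using q1 L by (simp add: algebra_simps of_nat_diff)
  have "(\<Sum>g\<in>V \<rightarrow>\<^sub>E {?L..<m}. \<Phi> (over m (Suc d) s V g z)) =
     (\<Sum>Bs\<in>Pow V. real ((?L' - ?L) ^ card Bs) * (\<Sum>g\<in>(V - Bs) \<rightarrow>\<^sub>E {?L'..<m}. H Bs g))"
    unfolding eq using L Suc.prems by (intro sum_PiE_split) auto
  also have "\<dots> = (\<Sum>Bs\<in>Pow V. real ((?L' - ?L) ^ card Bs) * (real (m - ?L') ^ (s - card Bs) * ?E (card Bs)))"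
    using IH by (intro sum.cong) auto
  also have "\<dots> = (\<Sum>c\<le>s. real (s choose c) * (real ((?L' - ?L) ^ c) * (real (m - ?L') ^ (s - c) * ?E c)))"
    using sum_Pow_card[OF Suc.prems(2), of "\<lambda>c. real ((?L' - ?L) ^ c) * (real (m - ?L') ^ (s - c) * ?E c)"] Suc.prems(3) by simp
  also have "\<dots> = (\<Sum>c\<le>s. real (m - ?L) ^ s * ((real (s choose c) * ?q ^ c * (1 - ?q) ^ (s - c)) * ?E c))"
  proof (rule sum.cong[OF refl])
    fix c assume c: "c \<in> {..s}"
    have "real ((?L' - ?L) ^ c) * real (m - ?L') ^ (s - c) = real (m - ?L) ^ s * (?q ^ c * (1 - ?q) ^ (s - c))"
    proof -
      have "real ((?L' - ?L) ^ c) * real (m - ?L') ^ (s - c) = (real (m - ?L) * ?q) ^ c * (real (m - ?L) * (1 - ?q)) ^ (s - c)"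
        unfolding q1 q2 by simp
      also have "\<dots> = (real (m - ?L) ^ c * real (m - ?L) ^ (s - c)) * (?q ^ c * (1 - ?q) ^ (s - c))"
        by (simp add: power_mult_distrib)
      also have "real (m - ?L) ^ c * real (m - ?L) ^ (s - c) = real (m - ?L) ^ s"
        using c by (simp add: power_add[symmetric])
      finally show ?thesis .
    qed
    then show "real (s choose c) * (real ((?L' - ?L) ^ c) * (real (m - ?L') ^ (s - c) * ?E c))
      = real (m - ?L) ^ s * ((real (s choose c) * ?q ^ c * (1 - ?q) ^ (s - c)) * ?E c)" by (simp add: mult_ac)
  qed
  also have "\<dots> = real (m - ?L) ^ s * bin_expect m (Suc d) s z"
    unfolding bin_expect.simps j_def[symmetric] using step_prob_range[of j m] j
    by (subst expectation_binomial_pmf') (auto simp: sum_distrib_left)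
  finally show ?case unfolding j(3) .
qed

lemma average_grid:
  assumes m: "m \<ge> K"
  shows "(\<Sum>g\<in>cars m. \<Phi> (\<lambda>i. if 1 \<le> i \<and> i < K then grid_scale m * loop m g (int (grid_index m i)) else 0)) / real (card (cars m))
    = bin_expect m (K - 1) (m - 1) (\<lambda>_. 0)"
proof -
  have b0: "grid_index m (K - Suc (K - 1)) = 0" using K by (simp add: grid_index_def)
  have "m > 0" using m K by simp
  have ov: "over m (K - 1) (m - 1) {2..m} g (\<lambda>_. 0) = (\<lambda>i. if 1 \<le> i \<and> i < K then grid_scale m * loop m g (int (grid_index m i)) else 0)" for g
    using K grid_index_less[OF m] by (auto simp: over_def grid_val_def loop_nat fun_eq_iff)
  have "(\<Sum>g\<in>{2..m} \<rightarrow>\<^sub>E {grid_index m (K - Suc (K - 1))..<m}. \<Phi> (over m (K - 1) (m - 1) {2..m} g (\<lambda>_. 0))) = real (m - 0) ^ (m - 1) * bin_expect m (K - 1) (m - 1) (\<lambda>_. 0)"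
    unfolding b0[symmetric] using K by (intro bin_expect_eq_average[OF m]) auto
  then show ?thesis unfolding ov b0 using \<open>m > 0\<close>
    by (simp add: cars_def[symmetric] card_cars atLeast0LessThan)
qed

lemma measurable_Phi:
  assumes h: "\<And>i. i < K \<Longrightarrow> (\<lambda>x. h x i) \<in> borel_measurable M"
  shows "(\<lambda>x. \<Phi> (h x)) \<in> borel_measurable M"
proof -
  have c: "continuous_on UNIV \<Phi>"
  proof (rule continuous_on_sequentiallyI)
    fix u :: "nat \<Rightarrow> nat \<Rightarrow> real" and a
    assume "u \<longlonglongrightarrow> a"
    then have "(\<lambda>n. u n i) \<longlonglongrightarrow> a i" for i
      using continuous_on_product_coordinates[of i]
    proof -
      have "isCont (\<lambda>x :: nat \<Rightarrow> real. x i) a"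
        using continuous_on_product_coordinates[of i] continuous_on_eq_continuous_at[OF open_UNIV] by blast
      then show ?thesis using \<open>u \<longlonglongrightarrow> a\<close> by (rule isCont_tendsto_compose)
    qed
    then show "(\<lambda>n. \<Phi> (u n)) \<longlonglongrightarrow> \<Phi> a" by (rule cont)
  qed
  let ?h = "\<lambda>x i. if i < K then h x i else 0"
  have e: "\<Phi> (?h x) = \<Phi> (h x)" for x
  proof -
    have "(\<lambda>m::nat. \<Phi> (h x)) \<longlonglongrightarrow> \<Phi> (?h x)" by (rule cont) simp
    then show ?thesis by (simp add: LIMSEQ_const_iff)
  qed
  have "?h \<in> borel_measurable M"
  proof (rule measurable_coordinatewise_then_product)
    show "(\<lambda>x. if i < K then h x i else 0) \<in> borel_measurable M" for i
      by (cases "i < K") (simp_all add: h)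
  qed
  from measurable_compose[OF this borel_measurable_continuous_onI[OF c]] show ?thesis unfolding e .
qed

text \<open>Bound and continuity are proved together: dominated convergence under the normal
  integral needs both for the smaller \<open>d\<close>.\<close>

lemma gauss_expect_bound_cont:
  "d < K \<Longrightarrow> (\<forall>z. \<bar>gauss_expect d z\<bar> \<le> B) \<and>
    (\<forall>zm z. (\<forall>i<K - d. (\<lambda>m. zm m i) \<longlonglongrightarrow> z i) \<longrightarrow> (\<lambda>m::nat. gauss_expect d (zm m)) \<longlonglongrightarrow> gauss_expect d z)"
proof (induction d)
  case 0 then show ?case using bounded cont by auto
next
  case (Suc d)
  then have IHb: "\<And>z. \<bar>gauss_expect d z\<bar> \<le> B" and IHc: "\<And>zm z. (\<And>i. i < K - d \<Longrightarrow> (\<lambda>m. zm m i) \<longlonglongrightarrow> z i) \<Longrightarrow> (\<lambda>m::nat. gauss_expect d (zm m)) \<longlonglongrightarrow> gauss_expect d z"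
    by auto
  interpret N: prob_space std_normal_distribution by (rule prob_space_normal_density) simp
  let ?w = "\<lambda>z x. z(K - Suc d := z (K - Suc d - 1) * bridge_ratio d + sqrt (\<sigma> / real K * bridge_ratio d) * x)"
  have meas[measurable]: "(\<lambda>x. gauss_expect d (?w z x)) \<in> borel_measurable borel" for z
  proof (rule borel_measurable_continuous_onI, rule continuous_on_sequentiallyI)
    fix u :: "nat \<Rightarrow> real" and a assume u: "u \<longlonglongrightarrow> a"
    show "(\<lambda>n. gauss_expect d (?w z (u n))) \<longlonglongrightarrow> gauss_expect d (?w z a)"
      by (rule IHc) (auto intro!: tendsto_intros u)
  qed
  have m': "(\<lambda>x. gauss_expect d (?w z x)) \<in> borel_measurable std_normal_distribution" for z
    using meas[of z] by simp
  have "\<bar>gauss_expect (Suc d) z\<bar> \<le> B" for z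
  proof -
    have i: "integrable std_normal_distribution (\<lambda>x. \<bar>gauss_expect d (?w z x)\<bar>)"
      by (intro integrable_abs N.integrable_const_bound[where B = B] m') (simp add: IHb)
    have "\<bar>gauss_expect (Suc d) z\<bar> \<le> (\<integral>x. \<bar>gauss_expect d (?w z x)\<bar> \<partial>std_normal_distribution)" unfolding gauss_expect.simps by (rule integral_abs_bound)
    also have "\<dots> \<le> (\<integral>x. B \<partial>std_normal_distribution)"
      by (rule integral_mono[OF i N.integrable_const]) (rule IHb)
    also have "\<dots> = B" using N.prob_space by simp
    finally show ?thesis .
  qed
  moreover have "(\<lambda>m. gauss_expect (Suc d) (zm m)) \<longlonglongrightarrow> gauss_expect (Suc d) z" if c: "\<forall>i<K - Suc d. (\<lambda>m. zm m i) \<longlonglongrightarrow> z i" for zm :: "nat \<Rightarrow> nat \<Rightarrow> real" and z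
    unfolding gauss_expect.simps
  proof (rule integral_dominated_convergence[where w = "\<lambda>_. B"])
    show "AE x in std_normal_distribution. (\<lambda>m. gauss_expect d (?w (zm m) x)) \<longlonglongrightarrow> gauss_expect d (?w z x)"
    proof (rule AE_I2, rule IHc)
      fix x and i assume i: "i < K - d"
      show "(\<lambda>m. ?w (zm m) x i) \<longlonglongrightarrow> ?w z x i"
        using c i Suc.prems by (cases "i = K - Suc d") (auto intro!: tendsto_intros)
    qed
  next
    show "(\<lambda>x. gauss_expect d (?w z x)) \<in> borel_measurable std_normal_distribution" by (rule m')
    show "(\<lambda>x. gauss_expect d (?w (zm m) x)) \<in> borel_measurable std_normal_distribution" for m by (rule m')
    show "AE x in std_normal_distribution. norm (gauss_expect d (?w (zm m) x)) \<le> B" for m using IHb by simp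
  qed (rule N.integrable_const)
  ultimately show ?case by blast
qed

lemma grid_index_lim: "(\<lambda>m. real (grid_index m j) / real m) \<longlonglongrightarrow> real j / real K"
proof -
  have K0: "real K > 0" using K by simp
  have b: "\<bar>real (grid_index m j) / real m - real j / real K\<bar> \<le> 1 / real m" if m: "m \<ge> 1" for m
  proof -
    have "real (grid_index m j) \<le> real (m * j) / real K" unfolding grid_index_def by (rule of_nat_div_le_of_nat)
    moreover have "real (m * j) / real K < real (grid_index m j) + 1"
    proof -
      have "m * j < K + grid_index m j * K" unfolding grid_index_def using K by (intro dividend_less_div_times) simp
      then have "real (m * j) < real K + real (grid_index m j) * real K" by (metis of_nat_add of_nat_less_iff of_nat_mult)
      then show ?thesis using K0 by (simp add: divide_less_eq algebra_simps)
    qed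
    ultimately have "\<bar>real (grid_index m j) - real (m * j) / real K\<bar> \<le> 1" by linarith
    then have "\<bar>real (grid_index m j) - real (m * j) / real K\<bar> / real m \<le> 1 / real m" by (intro divide_right_mono) auto
    moreover have "(real (grid_index m j) - real (m * j) / real K) / real m = real (grid_index m j) / real m - real j / real K"
      using m by (simp add: diff_divide_distrib)
    ultimately show ?thesis by (metis abs_divide abs_of_nat)
  qed
  have "(\<lambda>m. real (grid_index m j) / real m - real j / real K) \<longlonglongrightarrow> 0"
    by (rule Lim_null_comparison[OF _ lim_1_over_n]) (use b in \<open>auto intro!: eventually_sequentiallyI[of 1]\<close>)
  then show ?thesis using LIM_zero_iff by blast
qed

lemma grid_scale_pos: "m > 0 \<Longrightarrow> grid_scale m > 0" unfolding grid_scale_def using \<sigma> by simp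

lemma grid_scale_sq: "m > 0 \<Longrightarrow> (grid_scale m)\<^sup>2 = \<sigma> / real m"
proof -
  assume m: "m > 0"
  have "(grid_scale m)\<^sup>2 = (real m / \<sigma>) powr (-1/2 + -1/2)" unfolding grid_scale_def power2_eq_square by (rule powr_add[symmetric])
  also have "\<dots> = \<sigma> / real m" using m \<sigma> by (simp add: powr_minus)
  finally show ?thesis .
qed

lemma grid_scale_lim: "(\<lambda>m. 1 / (grid_scale m * real m)) \<longlonglongrightarrow> 0"
proof -
  have "eventually (\<lambda>m. 1 / (sqrt \<sigma> * sqrt (real m)) = 1 / (grid_scale m * real m)) sequentially"
    using eventually_gt_at_top[of 0]
  proof eventually_elim
    case (elim m)
    have "grid_scale m = sqrt (\<sigma> / real m)" using grid_scale_sq[OF elim] grid_scale_pos[OF elim] by (metis less_imp_le real_sqrt_unique)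
    then have "grid_scale m * sqrt (real m) = sqrt \<sigma>"
      using elim by (simp add: real_sqrt_divide)
    then have "grid_scale m * (sqrt (real m) * sqrt (real m)) = sqrt \<sigma> * sqrt (real m)" by (simp only: mult.assoc[symmetric])
    then have "grid_scale m * real m = sqrt \<sigma> * sqrt (real m)" by simp
    then show ?case by simp
  qed
  moreover have "(\<lambda>m. 1 / (sqrt \<sigma> * sqrt (real m))) \<longlonglongrightarrow> 0"
    using \<sigma> by real_asymp
  ultimately show ?thesis by (rule Lim_transform_eventually[rotated])
qed

text \<open>The last premise ties the number \<open>s m\<close> of free cars to the current grid
  value. As that value converges, \<open>s m\<close> is to first order the fraction
  \<open>(d + 1) / K\<close> of \<open>m\<close>, so a binomial step has a nondegenerate success
  probability in the limit and the central limit theorem applies to it.\<close>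

lemma bin_expect_limit:
  "d < K \<Longrightarrow> (\<And>m. s m \<le> m - 1) \<Longrightarrow> (\<And>i. i < K - d \<Longrightarrow> (\<lambda>m. zm m i) \<longlonglongrightarrow> z i) \<Longrightarrow>
    (\<And>m. m \<ge> K \<Longrightarrow> zm m (K - Suc d) = grid_val m (K - Suc d) (m - 1 - s m)) \<Longrightarrow>
    (\<lambda>m. bin_expect m d (s m) (zm m)) \<longlonglongrightarrow> gauss_expect d z"
proof (induction d arbitrary: s zm z)
  case 0
  then show ?case by (auto intro: cont)
next
  case (Suc d)
  define j where "j = K - Suc d"
  have j: "j < K" "j \<ge> 1" "j - 1 = K - Suc (Suc d)" "K - d = Suc j" "real K - real (j - 1) = real (d + 2)" using Suc.prems(1)
    by (auto simp: j_def of_nat_diff)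
  let ?q = "\<lambda>m. step_prob m j"
  let ?n = "\<lambda>m. real (m - 1)"
  have K0: "real K > 0" using K by simp
  have zj: "(\<lambda>m. zm m (j - 1)) \<longlonglongrightarrow> z (j - 1)" using Suc.prems(3)[of "j - 1"] j by auto
  have cons: "zm m (j - 1) = grid_scale m * (?n m - real (s m) - real (grid_index m (j - 1)) * (?n m / real m))" if "m \<ge> K" for m
  proof -
    have e: "real (m - 1 - s m) = ?n m - real (s m)" using Suc.prems(2)[of m] by (rule of_nat_diff)
    show ?thesis using Suc.prems(4)[OF that] unfolding j(3) grid_val_def e .
  qed
  have n1: "(\<lambda>m. ?n m / real m) \<longlonglongrightarrow> 1" by real_asymp
  \<comment> \<open>The relation between grid value and free cars, solved for \<open>s m\<close>;
    the fluctuation of the value enters with weight \<open>1 / (grid_scale m * m)\<close> and is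
    negligible.\<close>
  have sm: "real (s m) / real m = ?n m / real m * (1 - real (grid_index m (j - 1)) / real m) - zm m (j - 1) * (1 / (grid_scale m * real m))" if m: "m \<ge> K" for m
  proof -
    have m0: "m > 0" using m K by simp
    have "zm m (j - 1) / grid_scale m = ?n m - real (s m) - real (grid_index m (j - 1)) * (?n m / real m)"
      using cons[OF m] grid_scale_pos[OF m0] by simp
    then have "real (s m) = ?n m * (1 - real (grid_index m (j - 1)) / real m) - zm m (j - 1) / grid_scale m"
      by (simp add: algebra_simps)
    moreover have "(n * (1 - b) - zz / S) / M = n / M * (1 - b) - zz * (1 / (S * M))" for n b zz S M :: real
      by (simp add: diff_divide_distrib)
    ultimately show ?thesis by (simp only:)
  qed
  have slim: "(\<lambda>m. real (s m) / real m) \<longlonglongrightarrow> real (d + 2) / real K"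
  proof -
    have "(\<lambda>m. ?n m / real m * (1 - real (grid_index m (j - 1)) / real m) - zm m (j - 1) * (1 / (grid_scale m * real m)))
      \<longlonglongrightarrow> 1 * (1 - real (j - 1) / real K) - z (j - 1) * 0"
      by (intro tendsto_intros n1 grid_index_lim zj grid_scale_lim)
    also have "1 * (1 - real (j - 1) / real K) - z (j - 1) * 0 = real (d + 2) / real K"
      using j(5) K0 by (simp add: field_simps)
    finally show ?thesis
      by (rule Lim_transform_eventually) (use eventually_ge_at_top[of K] in eventually_elim, simp only: sm)
  qed
  have s_inf: "filterlim s at_top sequentially"
  proof -
    have "filterlim (\<lambda>m. real (s m) / real m * real m) at_top sequentially"
      by (rule filterlim_tendsto_pos_mult_at_top[OF slim _ filterlim_real_sequentially]) (use K0 in simp)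
    then have "filterlim (\<lambda>m. real (s m)) at_top sequentially"
      by (rule filterlim_at_top_mono) (simp add: always_eventually)
    then show ?thesis by (simp add: filterlim_sequentially_iff_filterlim_real)
  qed
  have qlim: "?q \<longlonglongrightarrow> 1 / real (d + 2)"
  proof -
    have "(\<lambda>m. (real (grid_index m j) / real m - real (grid_index m (j - 1)) / real m) / (1 - real (grid_index m (j - 1)) / real m))
      \<longlonglongrightarrow> (real j / real K - real (j - 1) / real K) / (1 - real (j - 1) / real K)"
      using j(5) K0 by (intro tendsto_intros grid_index_lim) (auto simp: field_simps)
    also have "(real j / real K - real (j - 1) / real K) / (1 - real (j - 1) / real K) = 1 / real (d + 2)"
    proof -
      have "real j / real K - real (j - 1) / real K = 1 / real K" using j(2) by (simp add: diff_divide_distrib[symmetric] of_nat_diff)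
      moreover have "1 - real (j - 1) / real K = real (d + 2) / real K" using j(5) K0 by (simp add: field_simps)
      ultimately show ?thesis using K0 by simp
    qed
    finally show ?thesis
    proof (rule Lim_transform_eventually)
      show "eventually (\<lambda>m. (real (grid_index m j) / real m - real (grid_index m (j - 1)) / real m) / (1 - real (grid_index m (j - 1)) / real m) = ?q m) sequentially"
        using eventually_ge_at_top[of K]
      proof eventually_elim
        case (elim m)
        have m0: "real m > 0" using elim K by simp
        have "real (grid_index m j - grid_index m (j - 1)) = real (grid_index m j) - real (grid_index m (j - 1))" "real (m - grid_index m (j - 1)) = real m - real (grid_index m (j - 1))"
          using grid_index_mono[of "j - 1" j m] grid_index_le[of "j - 1" m] j by (auto simp: of_nat_diff)
        moreover have "(real (grid_index m j) / real m - real (grid_index m (j - 1)) / real m) = (real (grid_index m j) - real (grid_index m (j - 1))) / real m"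
          "1 - real (grid_index m (j - 1)) / real m = (real m - real (grid_index m (j - 1))) / real m" using m0 by (simp_all add: diff_divide_distrib)
        ultimately show ?case using m0 unfolding step_prob_def by simp
      qed
    qed
  qed
  let ?w = "\<lambda>x. z(j := z (j - 1) * bridge_ratio d + sqrt (\<sigma> / real K * bridge_ratio d) * x)"
  have IdSuc: "gauss_expect (Suc d) z = (\<integral>x. gauss_expect d (?w x) \<partial>std_normal_distribution)" unfolding gauss_expect.simps j_def[symmetric] ..
  have "(\<lambda>m. measure_pmf.expectation (binomial_pmf (s m) (?q m)) (\<lambda>c. bin_expect m d (s m - c) ((zm m)(j := grid_val m j (m - 1 - (s m - c))))))
     \<longlonglongrightarrow> (\<integral>x. gauss_expect d (?w x) \<partial>std_normal_distribution)"
  proof (rule binomial_expectation_limit[OF s_inf step_prob_range qlim])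
    show "j \<le> K" using j by simp
    show "0 < 1 / real (d + 2)" "1 / real (d + 2) < 1" by simp_all
    show "\<bar>bin_expect m d (s m - k) ((zm m)(j := grid_val m j (m - 1 - (s m - k))))\<bar> \<le> B" for m k
      using Suc.prems(1) by (intro bin_expect_bound) simp
    show "(\<lambda>x. gauss_expect d (?w x)) \<in> borel_measurable borel"
    proof (rule borel_measurable_continuous_onI, rule continuous_on_sequentiallyI)
      fix u :: "nat \<Rightarrow> real" and a assume u: "u \<longlonglongrightarrow> a"
      have "\<forall>i<K - d. (\<lambda>n. ?w (u n) i) \<longlonglongrightarrow> ?w a i" by (auto intro!: tendsto_intros u)
      then show "(\<lambda>n. gauss_expect d (?w (u n))) \<longlonglongrightarrow> gauss_expect d (?w a)" using gauss_expect_bound_cont[of d] Suc.prems(1) by auto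
    qed
    fix k :: "nat \<Rightarrow> nat" and x
    assume k: "\<And>m. k m \<le> s m"
      and x: "(\<lambda>m. (real (k m) - real (s m) * ?q m) / sqrt (real (s m) * (?q m * (1 - ?q m)))) \<longlonglongrightarrow> x"
    let ?x = "\<lambda>m. (real (k m) - real (s m) * ?q m) / sqrt (real (s m) * (?q m * (1 - ?q m)))"
    show "(\<lambda>m. bin_expect m d (s m - k m) ((zm m)(j := grid_val m j (m - 1 - (s m - k m))))) \<longlonglongrightarrow> gauss_expect d (?w x)"
    proof (rule Suc.IH)
      show "d < K" using Suc.prems(1) by simp
      show "s m - k m \<le> m - 1" for m using Suc.prems(2)[of m] by simp
      show "((zm m)(j := grid_val m j (m - 1 - (s m - k m)))) (K - Suc d) = grid_val m (K - Suc d) (m - 1 - (s m - k m))" for m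
        by (simp add: j_def)
      fix i assume i: "i < K - d"
      show "(\<lambda>m. ((zm m)(j := grid_val m j (m - 1 - (s m - k m)))) i) \<longlonglongrightarrow> ?w x i"
      proof (cases "i = j")
        case False
        then show ?thesis using i j Suc.prems(3)[of i] by (auto simp: j_def)
      next
        case True
        have vlim: "(\<lambda>m. sqrt (\<sigma> * (real (s m) / real m) * (?q m * (1 - ?q m)))) \<longlonglongrightarrow> sqrt (\<sigma> / real K * bridge_ratio d)"
        proof -
          have "(\<lambda>m. sqrt (\<sigma> * (real (s m) / real m) * (?q m * (1 - ?q m)))) \<longlonglongrightarrow> sqrt (\<sigma> * (real (d + 2) / real K) * (1 / real (d + 2) * (1 - 1 / real (d + 2))))"
            by (intro tendsto_intros slim qlim)
          also have "\<sigma> * (real (d + 2) / real K) * (1 / real (d + 2) * (1 - 1 / real (d + 2))) = \<sigma> / real K * bridge_ratio d"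
          proof -
            have "1 - 1 / real (d + 2) = bridge_ratio d" unfolding bridge_ratio_def by (simp add: field_simps)
            then show ?thesis by simp
          qed
          finally show ?thesis .
        qed
        have r: "bridge_ratio d = 1 - 1 / real (d + 2)" unfolding bridge_ratio_def by (simp add: field_simps)
        have L: "(\<lambda>m. zm m (j - 1) * (1 - ?q m) + sqrt (\<sigma> * (real (s m) / real m) * (?q m * (1 - ?q m))) * ?x m)
          \<longlonglongrightarrow> z (j - 1) * bridge_ratio d + sqrt (\<sigma> / real K * bridge_ratio d) * x"
          unfolding r by (intro tendsto_intros zj qlim vlim[unfolded r] x)
        have "eventually (\<lambda>m. ?q m > 0 \<and> ?q m < 1) sequentially"
          using order_tendstoD(1)[OF qlim, of 0] order_tendstoD(2)[OF qlim, of 1]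
          by (auto elim: eventually_elim2)
        moreover have "eventually (\<lambda>m. s m \<ge> 1) sequentially" using s_inf by (simp add: filterlim_at_top)
        ultimately have "eventually (\<lambda>m. zm m (j - 1) * (1 - ?q m) + sqrt (\<sigma> * (real (s m) / real m) * (?q m * (1 - ?q m))) * ?x m
          = grid_val m j (m - 1 - (s m - k m))) sequentially"
          using eventually_ge_at_top[of K]
        proof eventually_elim
          case (elim m)
          have m0: "m > 0" using elim K by simp
          define v where "v = real (s m) * (?q m * (1 - ?q m))"
          have v: "v > 0" unfolding v_def using elim by simp
          have "sqrt (\<sigma> * (real (s m) / real m) * (?q m * (1 - ?q m))) = sqrt ((grid_scale m)\<^sup>2 * v)"
            unfolding grid_scale_sq[OF m0] v_def by (simp add: mult_ac)
          also have "\<dots> = grid_scale m * sqrt v" using grid_scale_pos[OF m0] by (simp add: real_sqrt_mult)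
          finally have "sqrt (\<sigma> * (real (s m) / real m) * (?q m * (1 - ?q m))) * ?x m = grid_scale m * (real (k m) - real (s m) * ?q m)"
            using v unfolding v_def[symmetric] by simp
          moreover have "zm m (j - 1) * (1 - ?q m) + grid_scale m * (real (k m) - real (s m) * ?q m) = grid_val m j (m - 1 - (s m - k m))"
          proof -
            have mL: "real m - real (grid_index m (j - 1)) > 0" using grid_index_less[OF elim(3), of "j - 1"] j by simp
            have "real (grid_index m j - grid_index m (j - 1)) = real (grid_index m j) - real (grid_index m (j - 1))" "real (m - grid_index m (j - 1)) = real m - real (grid_index m (j - 1))"
              using grid_index_mono[of "j - 1" j m] grid_index_le[of "j - 1" m] j by (auto simp: of_nat_diff)
            then have qm: "?q m * (real m - real (grid_index m (j - 1))) = real (grid_index m j) - real (grid_index m (j - 1))"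
              unfolding step_prob_def using mL by simp
            have nk: "real (m - 1 - (s m - k m)) = ?n m - real (s m) + real (k m)"
              using k[of m] Suc.prems(2)[of m] by (simp add: of_nat_diff)
            \<comment> \<open>Exact decomposition of the next grid value: the old one times
              \<open>1 - q\<close>, plus the centred binomial count. No error term has to be
              estimated.\<close>
            have alg: "S * (n - s - b * (n / M)) * (1 - q) + S * (k - s * q) = S * (n - s + k - b' * (n / M))"
              if "q * (M - b) = b' - b" "M > 0" for S n s b M q k b' :: real
            proof -
              have "b' = b + q * M - q * b" using that by (simp add: algebra_simps)
              then have "(n - s - b * (n / M)) * (1 - q) + (k - s * q) = n - s + k - b' * (n / M)"
                using that(2) by (simp only:) (simp add: field_simps)
              then show ?thesis by (metis (no_types, opaque_lifting) distrib_left mult.assoc)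
            qed
            show ?thesis unfolding cons[OF elim(3)] grid_val_def nk using m0 by (intro alg qm) simp
          qed
          ultimately show ?case by simp
        qed
        from Lim_transform_eventually[OF L this] show ?thesis using True by simp
      qed
    qed
  qed
  then show ?case unfolding IdSuc bin_expect.simps j_def[symmetric] .
qed

theorem grid_limit:
  "(\<lambda>m. (\<Sum>g\<in>cars m. \<Phi> (\<lambda>i. if 1 \<le> i \<and> i < K then grid_scale m * loop m g (int (grid_index m i)) else 0)) / real (card (cars m)))
    \<longlonglongrightarrow> gauss_expect (K - 1) (\<lambda>_. 0)"
proof -
  have "(\<lambda>m. bin_expect m (K - 1) (m - 1) (\<lambda>_. 0)) \<longlonglongrightarrow> gauss_expect (K - 1) (\<lambda>_. 0)"
    using K by (intro bin_expect_limit) (auto simp: grid_val_def grid_index_def)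
  then show ?thesis
    by (rule Lim_transform_eventually) (rule eventually_sequentiallyI[of K], rule average_grid[symmetric])
qed

end

section \<open>The Gaussian recursion as a bridge density\<close>

lemma gauss_kernel_minus: "gauss_kernel s (- u) = gauss_kernel s u"
  by (simp add: gauss_kernel_def)

text \<open>Conditioning formula for a bridge: the step density times the density of returning to
  \<open>0\<close> from \<open>x\<close> over \<open>d + 2\<close> cells is a free step times the
  return density from \<open>y\<close> over \<open>d + 1\<close> cells. Both sides are Gaussian, so
  it amounts to completing the square.\<close>

lemma bridge_transition:
  fixes x y \<delta> :: real and d :: nat
  assumes \<delta>: "\<delta> > 0" and r: "r = real (d + 1) / real (d + 2)"
  shows "normal_density (x * r) (sqrt (\<delta> * r)) y * gauss_kernel (real (d + 2) * \<delta>) x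
    = gauss_kernel \<delta> (y - x) * gauss_kernel (real (d + 1) * \<delta>) y"
proof -
  have r0: "r > 0" unfolding r by simp
  have r1: "r + 1 / real (d + 2) = 1" unfolding r by (simp add: field_simps)
  have r2: "1 / r = 1 + 1 / real (d + 1)" unfolding r by (simp add: field_simps)
  have ex: "(y - x * r)\<^sup>2 / (2 * (\<delta> * r)) + x\<^sup>2 / (2 * (real (d + 2) * \<delta>))
     = (y - x)\<^sup>2 / (2 * \<delta>) + y\<^sup>2 / (2 * (real (d + 1) * \<delta>))"
  proof -
    have "(y - x * r)\<^sup>2 / (2 * (\<delta> * r)) + x\<^sup>2 / (2 * (real (d + 2) * \<delta>))
      = (y\<^sup>2 * (1 / r) - 2 * x * y + x\<^sup>2 * (r + 1 / real (d + 2))) / (2 * \<delta>)"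
    proof -
      have "(y - x * r)\<^sup>2 / (2 * (\<delta> * r)) + x\<^sup>2 / (2 * (D * \<delta>))
        = (y\<^sup>2 * (1 / r) - 2 * x * y + x\<^sup>2 * (r + 1 / D)) / (2 * \<delta>)" if "D > 0" for D
        using r0 \<delta> that by (simp add: field_simps power2_eq_square)
      then show ?thesis by simp
    qed
    also have "\<dots> = (y\<^sup>2 * (1 + 1 / real (d + 1)) - 2 * x * y + x\<^sup>2) / (2 * \<delta>)" unfolding r1 r2 by simp
    also have "\<dots> = (y - x)\<^sup>2 / (2 * \<delta>) + y\<^sup>2 / (2 * (real (d + 1) * \<delta>))"
    proof -
      have "(y\<^sup>2 * (1 + 1 / D) - 2 * x * y + x\<^sup>2) / (2 * \<delta>) = (y - x)\<^sup>2 / (2 * \<delta>) + y\<^sup>2 / (2 * (D * \<delta>))" if "D > 0" for D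
        using \<delta> that by (simp add: field_simps power2_eq_square)
      then show ?thesis by simp
    qed
    finally show ?thesis .
  qed
  have e: "exp (- (y - x * r)\<^sup>2 / (2 * (\<delta> * r))) * exp (- x\<^sup>2 / (2 * (real (d + 2) * \<delta>)))
     = exp (- (y - x)\<^sup>2 / (2 * \<delta>)) * exp (- y\<^sup>2 / (2 * (real (d + 1) * \<delta>)))"
    unfolding exp_add[symmetric] using ex by (intro arg_cong[where f = exp]) linarith
  have s: "sqrt (2 * pi * (\<delta> * r)) * sqrt (2 * pi * (real (d + 2) * \<delta>)) = sqrt (2 * pi * \<delta>) * sqrt (2 * pi * (real (d + 1) * \<delta>))"
    unfolding real_sqrt_mult[symmetric] r by (rule arg_cong[where f = sqrt]) (simp add: field_simps)
  have sq: "(sqrt (\<delta> * r))\<^sup>2 = \<delta> * r" using r0 \<delta> by simp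
  have "normal_density (x * r) (sqrt (\<delta> * r)) y * gauss_kernel (real (d + 2) * \<delta>) x
    = (exp (- (y - x * r)\<^sup>2 / (2 * (\<delta> * r))) * exp (- x\<^sup>2 / (2 * (real (d + 2) * \<delta>))))
      / (sqrt (2 * pi * (\<delta> * r)) * sqrt (2 * pi * (real (d + 2) * \<delta>)))"
    unfolding normal_density_def gauss_kernel_def sq by simp
  also have "\<dots> = gauss_kernel \<delta> (y - x) * gauss_kernel (real (d + 1) * \<delta>) y"
    unfolding e s gauss_kernel_def by simp
  finally show ?thesis .
qed

lemma std_normal_affine:
  assumes f[measurable]: "f \<in> borel_measurable borel" and \<tau>: "\<tau> > 0"
  shows "(\<integral>\<^sup>+x. f (a + \<tau> * x) \<partial>std_normal_distribution) = (\<integral>\<^sup>+y. f y * ennreal (normal_density a \<tau> y) \<partial>lborel)"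
proof -
  have "(\<integral>\<^sup>+y. f y * ennreal (normal_density a \<tau> y) \<partial>lborel)
     = ennreal \<bar>\<tau>\<bar> * (\<integral>\<^sup>+x. f (a + \<tau> * x) * ennreal (normal_density a \<tau> (a + \<tau> * x)) \<partial>lborel)"
    using \<tau> by (intro nn_integral_real_affine) auto
  also have "\<dots> = (\<integral>\<^sup>+x. ennreal \<bar>\<tau>\<bar> * (f (a + \<tau> * x) * ennreal (normal_density a \<tau> (a + \<tau> * x))) \<partial>lborel)"
    by (rule nn_integral_cmult[symmetric]) simp
  also have "\<dots> = (\<integral>\<^sup>+x. ennreal (std_normal_density x) * f (a + \<tau> * x) \<partial>lborel)"
  proof (rule nn_integral_cong)
    fix x
    have "\<tau> * normal_density a \<tau> (a + \<tau> * x) = std_normal_density x"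
      unfolding normal_density_def using \<tau> by (simp add: power_mult_distrib real_sqrt_mult field_simps)
    then have "ennreal \<bar>\<tau>\<bar> * ennreal (normal_density a \<tau> (a + \<tau> * x)) = ennreal (std_normal_density x)"
      using \<tau> by (simp add: ennreal_mult'[symmetric])
    then show "ennreal \<bar>\<tau>\<bar> * (f (a + \<tau> * x) * ennreal (normal_density a \<tau> (a + \<tau> * x))) = ennreal (std_normal_density x) * f (a + \<tau> * x)"
      by (metis mult.assoc mult.commute)
  qed
  also have "\<dots> = (\<integral>\<^sup>+x. f (a + \<tau> * x) \<partial>std_normal_distribution)"
    by (rule nn_integral_density[symmetric]) simp_all
  finally show ?thesis by simp
qed

locale nonneg_grid_functional = grid_functional +
  assumes nonneg: "\<And>z. 0 \<le> \<Phi> z"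
begin

definition \<delta> :: real where "\<delta> = \<sigma> / real K"

lemma delta_pos: "\<delta> > 0" using \<sigma> K by (simp add: \<delta>_def)

lemma Phi_cong: "(\<And>i. i < K \<Longrightarrow> z i = z' i) \<Longrightarrow> \<Phi> z = \<Phi> z'"
proof -
  assume e: "\<And>i. i < K \<Longrightarrow> z i = z' i"
  have "(\<lambda>m::nat. \<Phi> z) \<longlonglongrightarrow> \<Phi> z'" by (rule cont) (simp add: e)
  then show ?thesis by (simp add: LIMSEQ_const_iff)
qed

lemma gauss_expect_nonneg: "0 \<le> gauss_expect d z"
  by (induction d arbitrary: z) (auto simp: nonneg intro!: integral_nonneg)

definition replace_tail :: "nat \<Rightarrow> (nat \<Rightarrow> real) \<Rightarrow> (nat \<Rightarrow> real) \<Rightarrow> nat \<Rightarrow> real" where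
  "replace_tail d z x = (\<lambda>i. if K - d \<le> i \<and> i < K then x i else z i)"

text \<open>The value \<open>0\<close> past the last index closes the bridge, so that
  \<open>d + 1\<close> kernels belong to \<open>d\<close> free coordinates.\<close>

definition kernel_prod :: "nat \<Rightarrow> (nat \<Rightarrow> real) \<Rightarrow> real" where
  "kernel_prod d w = (\<Prod>i\<in>{K - Suc d..<K}. gauss_kernel \<delta> ((if Suc i < K then w (Suc i) else 0) - w i))"

lemma replace_tail_measurable: "(\<lambda>x. replace_tail d z x i) \<in> borel_measurable (LB {K - d..<K})"
  by (cases "K - d \<le> i \<and> i < K") (auto simp: replace_tail_def)

lemma kernel_prod_replace_tail_measurable [measurable]: "(\<lambda>x. kernel_prod e (replace_tail d z x)) \<in> borel_measurable (LB {K - d..<K})"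
  unfolding kernel_prod_def
proof (rule borel_measurable_prod)
  fix i
  have [measurable]: "(\<lambda>x. replace_tail d z x i) \<in> borel_measurable (LB {K - d..<K})" for i by (rule replace_tail_measurable)
  show "(\<lambda>x. gauss_kernel \<delta> ((if Suc i < K then replace_tail d z x (Suc i) else 0) - replace_tail d z x i)) \<in> borel_measurable (LB {K - d..<K})"
    by measurable
qed

lemma Phi_replace_tail_measurable [measurable]: "(\<lambda>x. \<Phi> (replace_tail d z x)) \<in> borel_measurable (LB {K - d..<K})"
  by (rule measurable_Phi) (rule replace_tail_measurable)

lemma kernel_prod_nonneg: "0 \<le> kernel_prod d w"
  unfolding kernel_prod_def using gauss_kernel_pos[OF delta_pos] by (intro prod_nonneg) (auto intro: less_imp_le)

text \<open>The kernel on the left is the normalisation of the bridge that starts at the present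
  grid value; multiplying by it turns the nested conditional expectations into one integral against
  a product of free kernels.\<close>

lemma gauss_expect_bridge:
  "d < K \<Longrightarrow> ennreal (gauss_expect d z * gauss_kernel (real (d + 1) * \<delta>) (z (K - Suc d)))
    = (\<integral>\<^sup>+x. ennreal (\<Phi> (replace_tail d z x) * kernel_prod d (replace_tail d z x)) \<partial>LB {K - d..<K})"
proof (induction d arbitrary: z)
  case 0
  have "replace_tail 0 z x = z" for x by (auto simp: replace_tail_def)
  moreover have "{K - Suc 0..<K} = {K - 1}" using K by auto
  ultimately show ?case using K
    by (simp add: PiM_empty nn_integral_count_space_finite kernel_prod_def gauss_kernel_minus)
next
  case (Suc d)
  define j where "j = K - Suc d"
  have j: "j < K" "j \<ge> 1" "j - 1 = K - Suc (Suc d)" "K - d = Suc j" "Suc (j - 1) = j" using Suc.prems by (auto simp: j_def)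
  let ?r = "bridge_ratio d"
  let ?a = "z (j - 1) * ?r" and ?t = "sqrt (\<delta> * ?r)"
  have t: "?t > 0" using delta_pos by (simp add: bridge_ratio_def)
  let ?f = "\<lambda>y. gauss_expect d (z(j := y))"
  have fb: "gauss_expect d w \<le> B" for w using gauss_expect_bound_cont[of d] Suc.prems by (auto simp: abs_le_iff)
  have fm[measurable]: "?f \<in> borel_measurable borel"
  proof (rule borel_measurable_continuous_onI, rule continuous_on_sequentiallyI)
    fix u :: "nat \<Rightarrow> real" and a assume u: "u \<longlonglongrightarrow> a"
    have "\<forall>i<K - d. (\<lambda>n. (z(j := u n)) i) \<longlonglongrightarrow> (z(j := a)) i" using u by auto
    then show "(\<lambda>n. ?f (u n)) \<longlonglongrightarrow> ?f a" using gauss_expect_bound_cont[of d] Suc.prems by auto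
  qed
  interpret N: prob_space std_normal_distribution by (rule prob_space_normal_density) simp
  let ?g = "gauss_kernel (real (Suc d + 1) * \<delta>) (z (j - 1))"
  have g0: "0 \<le> ?g" using gauss_kernel_pos[of "real (Suc d + 1) * \<delta>"] delta_pos by (simp add: less_imp_le)
  have "ennreal (gauss_expect (Suc d) z) = ennreal (\<integral>x. ?f (?a + ?t * x) \<partial>std_normal_distribution)"
    unfolding gauss_expect.simps j_def[symmetric] \<delta>_def ..
  also have "\<dots> = (\<integral>\<^sup>+x. ennreal (?f (?a + ?t * x)) \<partial>std_normal_distribution)"
    by (rule nn_integral_eq_integral[symmetric], rule N.integrable_const_bound[where B = B]) (simp_all add: fb gauss_expect_nonneg)
  also have "\<dots> = (\<integral>\<^sup>+y. ennreal (?f y) * ennreal (normal_density ?a ?t y) \<partial>lborel)"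
    by (rule std_normal_affine[OF _ t]) simp
  finally have I: "ennreal (gauss_expect (Suc d) z) = (\<integral>\<^sup>+y. ennreal (?f y) * ennreal (normal_density ?a ?t y) \<partial>lborel)" .
  have "ennreal (gauss_expect (Suc d) z * ?g) = (\<integral>\<^sup>+y. (ennreal (?f y) * ennreal (normal_density ?a ?t y)) * ennreal ?g \<partial>lborel)"
    unfolding ennreal_mult''[OF g0] I by (rule nn_integral_multc[symmetric]) simp
  also have "\<dots> = (\<integral>\<^sup>+y. ennreal (gauss_kernel \<delta> (y - z (j - 1))) * (\<integral>\<^sup>+x. ennreal (\<Phi> (replace_tail d (z(j := y)) x) * kernel_prod d (replace_tail d (z(j := y)) x)) \<partial>LB {K - d..<K}) \<partial>lborel)"
  proof (rule nn_integral_cong)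
    fix y
    have "normal_density ?a ?t y * ?g = gauss_kernel \<delta> (y - z (j - 1)) * gauss_kernel (real (d + 1) * \<delta>) y"
      using bridge_transition[OF delta_pos, of ?r d "z (j - 1)" y] by (simp add: bridge_ratio_def)
    then have E: "?f y * (normal_density ?a ?t y * ?g) = gauss_kernel \<delta> (y - z (j - 1)) * (?f y * gauss_kernel (real (d + 1) * \<delta>) ((z(j := y)) (K - Suc d)))"
      by (simp add: j_def)
    have "ennreal (?f y * (normal_density ?a ?t y * ?g)) = ennreal (gauss_kernel \<delta> (y - z (j - 1))) * ennreal (?f y * gauss_kernel (real (d + 1) * \<delta>) ((z(j := y)) (K - Suc d)))"
      unfolding E by (rule ennreal_mult') (rule less_imp_le[OF gauss_kernel_pos[OF delta_pos]])
    moreover have "ennreal (?f y * (normal_density ?a ?t y * ?g)) = (ennreal (?f y) * ennreal (normal_density ?a ?t y)) * ennreal ?g"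
      using g0 by (simp add: ennreal_mult gauss_expect_nonneg mult.assoc)
    ultimately show "(ennreal (?f y) * ennreal (normal_density ?a ?t y)) * ennreal ?g
      = ennreal (gauss_kernel \<delta> (y - z (j - 1))) * (\<integral>\<^sup>+x. ennreal (\<Phi> (replace_tail d (z(j := y)) x) * kernel_prod d (replace_tail d (z(j := y)) x)) \<partial>LB {K - d..<K})"
      unfolding Suc.IH[OF Suc_lessD[OF Suc.prems], of "z(j := y)", symmetric] by metis
  qed
  also have "\<dots> = (\<integral>\<^sup>+y. (\<integral>\<^sup>+x. ennreal (\<Phi> (replace_tail (Suc d) z (x(j := y))) * kernel_prod (Suc d) (replace_tail (Suc d) z (x(j := y)))) \<partial>LB {K - d..<K}) \<partial>lborel)"
  proof (rule nn_integral_cong)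
    fix y
    have "ennreal (gauss_kernel \<delta> (y - z (j - 1))) * (\<integral>\<^sup>+x. ennreal (\<Phi> (replace_tail d (z(j := y)) x) * kernel_prod d (replace_tail d (z(j := y)) x)) \<partial>LB {K - d..<K})
      = (\<integral>\<^sup>+x. ennreal (gauss_kernel \<delta> (y - z (j - 1))) * ennreal (\<Phi> (replace_tail d (z(j := y)) x) * kernel_prod d (replace_tail d (z(j := y)) x)) \<partial>LB {K - d..<K})"
      by (rule nn_integral_cmult[symmetric]) measurable
    also have "\<dots> = (\<integral>\<^sup>+x. ennreal (\<Phi> (replace_tail (Suc d) z (x(j := y))) * kernel_prod (Suc d) (replace_tail (Suc d) z (x(j := y)))) \<partial>LB {K - d..<K})"
    proof (rule nn_integral_cong)
      fix x
      have m: "replace_tail d (z(j := y)) x = replace_tail (Suc d) z (x(j := y))"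
        using j Suc.prems by (auto simp: replace_tail_def fun_eq_iff j_def)
      let ?w = "replace_tail (Suc d) z (x(j := y))"
      have w: "?w j = y" "?w (j - 1) = z (j - 1)" using j by (auto simp: replace_tail_def j_def)
      have "{K - Suc (Suc d)..<K} = insert (j - 1) {K - Suc d..<K}" using j by (auto simp: j_def)
      then have "kernel_prod (Suc d) ?w = gauss_kernel \<delta> (?w j - ?w (j - 1)) * kernel_prod d ?w"
        unfolding kernel_prod_def using j by (simp add: j_def)
      then have G: "gauss_kernel \<delta> (y - z (j - 1)) * (\<Phi> ?w * kernel_prod d ?w) = \<Phi> ?w * kernel_prod (Suc d) ?w"
        unfolding w by (simp only: mult.left_commute mult.assoc)
      show "ennreal (gauss_kernel \<delta> (y - z (j - 1))) * ennreal (\<Phi> (replace_tail d (z(j := y)) x) * kernel_prod d (replace_tail d (z(j := y)) x))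
        = ennreal (\<Phi> ?w * kernel_prod (Suc d) ?w)"
        unfolding m G[symmetric] by (rule ennreal_mult'[symmetric]) (rule less_imp_le[OF gauss_kernel_pos[OF delta_pos]])
    qed
    finally show "ennreal (gauss_kernel \<delta> (y - z (j - 1))) * (\<integral>\<^sup>+x. ennreal (\<Phi> (replace_tail d (z(j := y)) x) * kernel_prod d (replace_tail d (z(j := y)) x)) \<partial>LB {K - d..<K})
      = (\<integral>\<^sup>+x. ennreal (\<Phi> (replace_tail (Suc d) z (x(j := y))) * kernel_prod (Suc d) (replace_tail (Suc d) z (x(j := y)))) \<partial>LB {K - d..<K})" .
  qed
  also have "\<dots> = (\<integral>\<^sup>+x. ennreal (\<Phi> (replace_tail (Suc d) z x) * kernel_prod (Suc d) (replace_tail (Suc d) z x)) \<partial>LB {K - Suc d..<K})"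
  proof -
    have ins: "{K - Suc d..<K} = insert j {K - d..<K}" using j by (auto simp: j_def)
    have m: "(\<lambda>x. ennreal (\<Phi> (replace_tail (Suc d) z x) * kernel_prod (Suc d) (replace_tail (Suc d) z x))) \<in> borel_measurable (LB {K - Suc d..<K})"
      by measurable
    show ?thesis unfolding ins
      by (rule lborel_prod.product_nn_integral_insert_rev[symmetric]) (use m ins j in auto)
  qed
  finally show ?case unfolding j(3) .
qed

text \<open>The point where the excursion meets the limit of the loops:
  \<open>excursion_grid_average\<close> and \<open>nn_integral_R_eq_bridge\<close> lead from the
  excursion to a bridge density, and \<open>gauss_expect_bridge\<close> recognises that density in
  the recursion.\<close>

theorem excursion_average_eq:
  assumes exc: "excursion \<sigma> \<mu>"
    and cyc: "\<And>x. \<Phi> (\<lambda>i. x ((i + 1) mod K)) = \<Phi> x"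
    and sh: "\<And>x s. \<Phi> (\<lambda>i. x i + s) = \<Phi> x"
  shows "(\<integral>\<^sup>+v\<in>{0<..<\<delta>}. (\<integral>\<^sup>+e. ennreal (\<Phi> (\<lambda>i. apply_bcontfun e (v + real i * \<delta>))) \<partial>\<mu>) \<partial>lborel)
    = ennreal (\<delta> * gauss_expect (K - 1) (\<lambda>_. 0))"
proof -
  interpret excursion \<sigma> \<mu> by fact
  interpret cyclic_grid K \<delta> by standard (use K delta_pos in auto)
  let ?\<Psi> = "\<lambda>x. ennreal (\<Phi> x)"
  let ?I = "gauss_expect (K - 1) (\<lambda>_. 0)"
  have sd: "\<sigma> = real K * \<delta>" using K by (simp add: \<delta>_def)
  have \<Psi>m: "?\<Psi> \<in> borel_measurable (LB {..<K})"
    by (rule measurable_compose[OF _ measurable_ennreal], rule measurable_Phi) simp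
  have res: "\<Phi> (restrict x {..<K}) = \<Phi> x" for x by (rule Phi_cong) simp
  let ?A = "\<integral>\<^sup>+v\<in>{0<..<\<delta>}. (\<integral>\<^sup>+e. ?\<Psi> (\<lambda>i. apply_bcontfun e (v + real i * \<delta>)) \<partial>\<mu>) \<partial>lborel"
  have A: "?A = ennreal (2 * sqrt (2 * pi * \<sigma> ^ 3)) * (\<integral>\<^sup>+x. ?\<Psi> x * ennreal (R (K - 1) x) \<partial>LB {..<K})"
    using excursion_grid_average[OF K sd \<Psi>m] by (simp add: res)
  have B1: "of_nat K * (\<integral>\<^sup>+x. ?\<Psi> x * ennreal (R (K - 1) x) \<partial>LB {..<K}) =
    (\<integral>\<^sup>+b. ?\<Psi> (b(0 := 0)) * ennreal ((\<Prod>i<K. gauss_kernel \<delta> ((b(0 := 0)) (cyc_next i) - (b(0 := 0)) i)) / 2) \<partial>LB {1..<K})"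
  proof (rule nn_integral_R_eq_bridge[OF \<Psi>m])
    fix x s
    have "\<Phi> (\<lambda>i\<in>{..<K}. x (cyc_next i)) = \<Phi> x" using cyc[of x] res[of "\<lambda>i. x (cyc_next i)"] by (simp add: cyc_next_def)
    then show "?\<Psi> (\<lambda>i\<in>{..<K}. x (cyc_next i)) = ?\<Psi> (restrict x {..<K})" by (simp add: res)
    have "\<Phi> (\<lambda>i\<in>{..<K}. x i + s) = \<Phi> x" using sh[of x s] res[of "\<lambda>i. x i + s"] by simp
    then show "?\<Psi> (\<lambda>i\<in>{..<K}. x i + s) = ?\<Psi> (restrict x {..<K})" by (simp add: res)
  qed
  have B2: "\<dots> = ennreal (1/2) * ennreal (?I * gauss_kernel \<sigma> 0)"
  proof -
    have K1: "K - (K - 1) = 1" "K - Suc (K - 1) = 0" using K by auto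
    have "ennreal (?I * gauss_kernel \<sigma> 0) = (\<integral>\<^sup>+x. ennreal (\<Phi> (replace_tail (K - 1) (\<lambda>_. 0) x) * kernel_prod (K - 1) (replace_tail (K - 1) (\<lambda>_. 0) x)) \<partial>LB {1..<K})"
    proof -
      have "real (K - 1 + 1) * \<delta> = \<sigma>" using K by (simp add: \<delta>_def)
      then show ?thesis using gauss_expect_bridge[of "K - 1" "\<lambda>_. 0"] K unfolding K1 by simp
    qed
    then have "ennreal (1/2) * ennreal (?I * gauss_kernel \<sigma> 0)
       = (\<integral>\<^sup>+x. ennreal (1/2) * ennreal (\<Phi> (replace_tail (K - 1) (\<lambda>_. 0) x) * kernel_prod (K - 1) (replace_tail (K - 1) (\<lambda>_. 0) x)) \<partial>LB {1..<K})"
      using nn_integral_cmult[of "\<lambda>x. ennreal (\<Phi> (replace_tail (K - 1) (\<lambda>_. 0) x) * kernel_prod (K - 1) (replace_tail (K - 1) (\<lambda>_. 0) x))" "LB {1..<K}" "ennreal (1/2)"]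
        Phi_replace_tail_measurable[of "K - 1" "\<lambda>_. 0"] kernel_prod_replace_tail_measurable[of "K - 1" "K - 1" "\<lambda>_. 0"] unfolding K1 by simp
    also have "\<dots> = (\<integral>\<^sup>+b. ?\<Psi> (b(0 := 0)) * ennreal ((\<Prod>i<K. gauss_kernel \<delta> ((b(0 := 0)) (cyc_next i) - (b(0 := 0)) i)) / 2) \<partial>LB {1..<K})"
    proof (rule nn_integral_cong)
      fix b
      let ?w = "replace_tail (K - 1) (\<lambda>_. 0) b"
      have w: "?w i = (b(0 := 0)) i" if "i < K" for i using that by (auto simp: replace_tail_def K1)
      have "\<Phi> ?w = \<Phi> (b(0 := 0))" by (rule Phi_cong) (rule w)
      moreover have "kernel_prod (K - 1) ?w = (\<Prod>i<K. gauss_kernel \<delta> ((b(0 := 0)) (cyc_next i) - (b(0 := 0)) i))"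
        unfolding kernel_prod_def K1 atLeast0LessThan
      proof (rule prod.cong[OF refl])
        fix i assume i: "i \<in> {..<K}"
        have "(if Suc i < K then ?w (Suc i) else 0) = (b(0 := 0)) (cyc_next i)"
          using i w[of "Suc i"] by (auto simp: cyc_next_def mod_Suc)
        then show "gauss_kernel \<delta> ((if Suc i < K then ?w (Suc i) else 0) - ?w i) = gauss_kernel \<delta> ((b(0 := 0)) (cyc_next i) - (b(0 := 0)) i)"
          using w[of i] i by simp
      qed
      moreover have "ennreal (1/2) * ennreal (p * q) = ennreal p * ennreal (q / 2)" if "0 \<le> p" "0 \<le> q" for p q :: real
      proof -
        have "ennreal (1/2) * ennreal (p * q) = ennreal (1/2 * (p * q))" by (rule ennreal_mult'[symmetric]) simp
        also have "1/2 * (p * q) = p * (q / 2)" by simp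
        also have "ennreal \<dots> = ennreal p * ennreal (q / 2)" by (rule ennreal_mult'[OF that(1)])
        finally show ?thesis .
      qed
      ultimately show "ennreal (1/2) * ennreal (\<Phi> ?w * kernel_prod (K - 1) ?w)
        = ?\<Psi> (b(0 := 0)) * ennreal ((\<Prod>i<K. gauss_kernel \<delta> ((b(0 := 0)) (cyc_next i) - (b(0 := 0)) i)) / 2)"
        using nonneg kernel_prod_nonneg by metis
    qed
    finally show ?thesis by simp
  qed
  have "of_nat K * ?A = ennreal (2 * sqrt (2 * pi * \<sigma> ^ 3)) * (ennreal (1/2) * ennreal (?I * gauss_kernel \<sigma> 0))"
    unfolding A B2[symmetric] B1[symmetric] by (simp only: mult.left_commute)
  also have "\<dots> = ennreal (sqrt (2 * pi * \<sigma> ^ 3) * (?I * gauss_kernel \<sigma> 0))"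
  proof -
    have "ennreal (2 * s) * (ennreal (1/2) * ennreal x) = ennreal (s * x)" if "0 \<le> s" for s x :: real
    proof -
      have "ennreal (1/2) * ennreal x = ennreal (1/2 * x)" by (rule ennreal_mult'[symmetric]) simp
      moreover have "ennreal (2 * s) * ennreal (1/2 * x) = ennreal (2 * s * (1/2 * x))"
        by (rule ennreal_mult'[symmetric]) (use that in simp)
      moreover have "2 * s * (1/2 * x) = s * x" by simp
      ultimately show ?thesis by metis
    qed
    then show ?thesis using \<sigma> by simp
  qed
  \<comment> \<open>The normalising constant of the excursion density is matched by the free kernel
    at \<open>0\<close>; the factors \<open>2\<close> and \<open>1/2\<close> have cancelled, and
    \<open>\<sigma> = K * \<delta>\<close> remains.\<close>
  also have "sqrt (2 * pi * \<sigma> ^ 3) * (?I * gauss_kernel \<sigma> 0) = \<sigma> * ?I"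
  proof -
    have "sqrt (2 * pi * \<sigma> ^ 3) = \<sigma> * sqrt (2 * pi * \<sigma>)" using \<sigma> by (simp add: power3_eq_cube real_sqrt_mult)
    moreover have "sqrt (2 * pi * \<sigma>) > 0" using \<sigma> by simp
    ultimately show ?thesis by (simp add: gauss_kernel_def)
  qed
  finally have KA: "of_nat K * ?A = ennreal (\<sigma> * ?I)" .
  have "?A = ennreal (1 / real K) * (of_nat K * ?A)"
  proof -
    have "ennreal (1 / real K) * of_nat K = 1" using K by (simp add: ennreal_of_nat_eq_real_of_nat ennreal_mult'[symmetric])
    then show ?thesis by (simp add: mult.assoc[symmetric])
  qed
  also have "\<dots> = ennreal (\<delta> * ?I)"
    unfolding KA using K \<sigma> gauss_expect_nonneg by (subst ennreal_mult'[symmetric]) (auto simp: \<delta>_def)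
  finally show ?thesis .
qed

end

section \<open>Lipschitz envelopes over rotations\<close>

text \<open>A class that contains the rescaled walks and, almost surely, the excursions.
  Nonnegativity is what lets the envelope recognise the right cut; integrability makes the area a
  functional on the class.\<close>

definition paths :: "real \<Rightarrow> (real \<Rightarrow> real) set" where
  "paths \<sigma> = {y \<in> skorohod_D \<sigma>. (\<forall>t. 0 \<le> y t) \<and> bounded (range y) \<and> y integrable_on {0..\<sigma>}}"

definition periodic :: "real \<Rightarrow> (real \<Rightarrow>\<^sub>C real) \<Rightarrow> real \<Rightarrow> real" where
  "periodic \<sigma> e t = apply_bcontfun e (t - \<sigma> * of_int \<lfloor>t / \<sigma>\<rfloor>)"

text \<open>Continuity is asked in the sup norm and at continuous paths only: the limit is
  continuous, and Skorohod continuity will be reduced to this. The lower bound \<open>0\<close>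
  costs nothing, since a constant can be added.\<close>

locale path_functional =
  fixes \<sigma> :: real and h :: "(real \<Rightarrow> real) \<Rightarrow> real" and B :: real
  assumes \<sigma>: "\<sigma> > 0"
    and h_range: "\<And>y. y \<in> paths \<sigma> \<Longrightarrow> 0 \<le> h y \<and> h y \<le> B"
    and h_cont: "\<And>x \<eta>. x \<in> paths \<sigma> \<Longrightarrow> continuous_on {0..\<sigma>} x \<Longrightarrow> \<eta> > 0 \<Longrightarrow>
      \<exists>\<gamma>>0. \<forall>y\<in>paths \<sigma>. (\<forall>t\<in>{0..\<sigma>}. \<bar>y t - x t\<bar> \<le> \<gamma>) \<longrightarrow> \<bar>h y - h x\<bar> < \<eta>"
    and B0: "0 \<le> B"
begin

text \<open>\<open>u\<close> is the cut, and \<open>r\<close> bounds the distance of the competitor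
  \<open>y\<close> from the path restarted at \<open>u\<close>. The inserted \<open>0\<close> keeps
  the set nonempty and makes the envelope nonnegative.\<close>

definition env_set :: "real \<Rightarrow> (real \<Rightarrow> real) \<Rightarrow> real set" where
  "env_set L x = insert 0 {h y - L * r | u y r. y \<in> paths \<sigma> \<and> (\<forall>t\<in>{0..\<sigma>}. \<bar>y t - (x (u + t) - x u)\<bar> \<le> r)}"

text \<open>A Lipschitz upper envelope of \<open>h\<close> over all rotations \<open>x (u + \<cdot>) - x u\<close> of a cyclic path. Since only
  nonnegative paths \<open>y\<close> compete, a large \<open>L\<close> forces \<open>u\<close> to be close to the location of the minimum of \<open>x\<close>.\<close>

definition env :: "real \<Rightarrow> (real \<Rightarrow> real) \<Rightarrow> real" where
  "env L x = Sup (env_set L x)"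

lemma env_set_le: assumes "L \<ge> 0" "a \<in> env_set L x" shows "a \<le> B"
  using assms(2) unfolding env_set_def
proof (elim insertE)
  assume "a \<in> {h y - L * r | u y r. y \<in> paths \<sigma> \<and> (\<forall>t\<in>{0..\<sigma>}. \<bar>y t - (x (u + t) - x u)\<bar> \<le> r)}"
  then obtain u y r where y: "y \<in> paths \<sigma>" "\<forall>t\<in>{0..\<sigma>}. \<bar>y t - (x (u + t) - x u)\<bar> \<le> r" "a = h y - L * r" by blast
  have "0 \<le> r" using y(2)[rule_format, of 0] \<sigma> by (auto intro: order_trans[OF abs_ge_zero])
  then have "0 \<le> L * r" using assms(1) by simp
  then show ?thesis using y(3) h_range[OF y(1)] by linarith
qed (use B0 in simp)

lemma env_bdd: "L \<ge> 0 \<Longrightarrow> bdd_above (env_set L x)"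
  using env_set_le by (auto intro!: bdd_aboveI)

lemma env_range: "L \<ge> 0 \<Longrightarrow> 0 \<le> env L x \<and> env L x \<le> B"
proof
  assume L: "L \<ge> 0"
  show "0 \<le> env L x" unfolding env_def by (rule cSup_upper[OF _ env_bdd[OF L]]) (simp add: env_set_def)
  show "env L x \<le> B" unfolding env_def by (rule cSup_least) (auto simp: env_set_def[of L x] intro: env_set_le[OF L, of _ x, unfolded env_set_def])
qed

lemma env_upper:
  assumes L: "L \<ge> 0" and y: "y \<in> paths \<sigma>" and r: "\<And>t. t \<in> {0..\<sigma>} \<Longrightarrow> \<bar>y t - (x (u + t) - x u)\<bar> \<le> r"
  shows "h y \<le> env L x + L * r"
proof -
  have "h y - L * r \<in> env_set L x" unfolding env_set_def using y r by blast
  then have "h y - L * r \<le> env L x" unfolding env_def by (rule cSup_upper[OF _ env_bdd[OF L]])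
  then show ?thesis by simp
qed

lemma env_least:
  assumes L: "L \<ge> 0" and c: "0 \<le> c"
    and least: "\<And>u y r. y \<in> paths \<sigma> \<Longrightarrow> (\<And>t. t \<in> {0..\<sigma>} \<Longrightarrow> \<bar>y t - (x (u + t) - x u)\<bar> \<le> r) \<Longrightarrow> h y - L * r \<le> c"
  shows "env L x \<le> c"
  unfolding env_def
proof (rule cSup_least)
  fix a assume "a \<in> env_set L x"
  then consider "a = 0" | u y r where "a = h y - L * r" "y \<in> paths \<sigma>" "\<forall>t\<in>{0..\<sigma>}. \<bar>y t - (x (u + t) - x u)\<bar> \<le> r"
    unfolding env_set_def by blast
  then show "a \<le> c"
  proof cases
    case 2
    then show ?thesis using least by blast
  qed (use c in simp)
qed (simp add: env_set_def)

text \<open>A rotated path contains \<open>x\<close> twice, at \<open>u + t\<close> and at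
  \<open>u\<close>, whence the factor \<open>2\<close>.\<close>

lemma env_lipschitz_le:
  assumes L: "L \<ge> 0" and d: "\<And>t. \<bar>x t - x' t\<bar> \<le> \<eta>"
  shows "env L x \<le> env L x' + 2 * L * \<eta>"
proof (rule env_least[OF L])
  have "0 \<le> \<eta>" using d[of 0] by linarith
  then show "0 \<le> env L x' + 2 * L * \<eta>" using env_range[OF L, of x'] L by simp
  fix u y r assume y: "y \<in> paths \<sigma>" and r: "\<And>t. t \<in> {0..\<sigma>} \<Longrightarrow> \<bar>y t - (x (u + t) - x u)\<bar> \<le> r"
  have "\<bar>y t - (x' (u + t) - x' u)\<bar> \<le> r + 2 * \<eta>" if "t \<in> {0..\<sigma>}" for t
    using r[OF that] d[of "u + t"] d[of u] by linarith
  from env_upper[OF L y this] have "h y \<le> env L x' + L * (r + 2 * \<eta>)" .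
  then show "h y - L * r \<le> env L x' + 2 * L * \<eta>" by (simp add: algebra_simps)
qed

lemma env_lipschitz:
  assumes L: "L \<ge> 0" and d: "\<And>t. \<bar>x t - x' t\<bar> \<le> \<eta>"
  shows "\<bar>env L x - env L x'\<bar> \<le> 2 * L * \<eta>"
proof -
  have "env L x \<le> env L x' + 2 * L * \<eta>" by (rule env_lipschitz_le[OF L d])
  moreover have "env L x' \<le> env L x + 2 * L * \<eta>"
    by (rule env_lipschitz_le[OF L]) (use d in \<open>simp add: abs_minus_commute\<close>)
  ultimately show ?thesis by linarith
qed

lemma env_shift: "env L (\<lambda>t. x (t + v)) = env L x"
proof -
  have "env_set L (\<lambda>t. x (t + v)) = env_set L x"
  proof -
    have 1: "env_set L (\<lambda>t. x (t + v)) \<subseteq> env_set L x" for x :: "real \<Rightarrow> real" and v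
    proof -
      have "\<exists>u' y' r'. h y - L * r = h y' - L * r' \<and> y' \<in> paths \<sigma> \<and> (\<forall>t\<in>{0..\<sigma>}. \<bar>y' t - (x (u' + t) - x u')\<bar> \<le> r')"
        if "y \<in> paths \<sigma>" "\<forall>t\<in>{0..\<sigma>}. \<bar>y t - (x (u + t + v) - x (u + v))\<bar> \<le> r" for u y r
        using that by (intro exI[of _ "u + v"] exI[of _ y] exI[of _ r]) (simp add: ac_simps)
      then show ?thesis unfolding env_set_def by blast
    qed
    from 1[of "\<lambda>t. x (t + v)" "- v"] 1[of x v] show ?thesis by auto
  qed
  then show ?thesis by (simp add: env_def)
qed

lemma env_add_const: "env L (\<lambda>t. x t + c) = env L x"
  unfolding env_def env_set_def by simp

text \<open>Values on a cyclic grid, spread to a periodic step function. The jumps are harmless,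
  because the envelope is Lipschitz in the sup norm.\<close>

definition grid_fun :: "real \<Rightarrow> nat \<Rightarrow> (nat \<Rightarrow> real) \<Rightarrow> real" where
  "grid_fun L K z = env L (\<lambda>t. z (nat (\<lfloor>real K * t / \<sigma>\<rfloor> mod int K)))"

lemma grid_fun_nonneg_grid_functional:
  assumes L: "L \<ge> 0" and K: "K \<ge> 2"
  shows "nonneg_grid_functional \<sigma> K (grid_fun L K) B"
proof
  show "\<sigma> > 0" by (rule \<sigma>)
  show "2 \<le> K" by (rule K)
  show "\<bar>grid_fun L K z\<bar> \<le> B" "0 \<le> grid_fun L K z" for z
    unfolding grid_fun_def using env_range[OF L] by (auto simp: abs_le_iff intro: order_trans[OF _ B0])
  fix zm :: "nat \<Rightarrow> nat \<Rightarrow> real" and z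
  assume c: "\<And>i. i < K \<Longrightarrow> (\<lambda>m. zm m i) \<longlonglongrightarrow> z i"
  let ?d = "\<lambda>m. \<Sum>i<K. \<bar>zm m i - z i\<bar>"
  have "\<bar>grid_fun L K (zm m) - grid_fun L K z\<bar> \<le> 2 * L * ?d m" for m
    unfolding grid_fun_def
  proof (rule env_lipschitz[OF L])
    fix t
    have "nat (\<lfloor>real K * t / \<sigma>\<rfloor> mod int K) < K" using K by (simp add: nat_less_iff)
    then show "\<bar>zm m (nat (\<lfloor>real K * t / \<sigma>\<rfloor> mod int K)) - z (nat (\<lfloor>real K * t / \<sigma>\<rfloor> mod int K))\<bar> \<le> ?d m"
      by (intro member_le_sum) auto
  qed
  moreover have "(\<lambda>m. 2 * L * ?d m) \<longlonglongrightarrow> 2 * L * (\<Sum>i<K. \<bar>z i - z i\<bar>)"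
  proof (rule tendsto_mult[OF tendsto_const], rule tendsto_sum)
    fix i assume "i \<in> {..<K}"
    then have "(\<lambda>m. zm m i) \<longlonglongrightarrow> z i" using c by simp
    then show "(\<lambda>m. \<bar>zm m i - z i\<bar>) \<longlonglongrightarrow> \<bar>z i - z i\<bar>" by (rule tendsto_rabs[OF tendsto_diff[OF _ tendsto_const]])
  qed
  then have lim: "(\<lambda>m. 2 * L * ?d m) \<longlonglongrightarrow> 0" by simp
  ultimately have "(\<lambda>m. grid_fun L K (zm m) - grid_fun L K z) \<longlonglongrightarrow> 0"
    using Lim_null_comparison[OF _ lim, of "\<lambda>m. grid_fun L K (zm m) - grid_fun L K z"] by simp
  then show "(\<lambda>m. grid_fun L K (zm m)) \<longlonglongrightarrow> grid_fun L K z" by (simp add: LIM_zero_iff)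
qed

lemma grid_fun_cyclic:
  assumes K: "K \<ge> 2" shows "grid_fun L K (\<lambda>i. z ((i + 1) mod K)) = grid_fun L K z"
proof -
  have "(nat (\<lfloor>real K * t / \<sigma>\<rfloor> mod int K) + 1) mod K = nat (\<lfloor>real K * (t + \<sigma> / real K) / \<sigma>\<rfloor> mod int K)" for t
  proof -
    have "real K * (t + \<sigma> / real K) / \<sigma> = real K * t / \<sigma> + 1" using \<sigma> K by (simp add: field_simps)
    then have "\<lfloor>real K * (t + \<sigma> / real K) / \<sigma>\<rfloor> = \<lfloor>real K * t / \<sigma>\<rfloor> + 1" by simp
    moreover have "int ((nat (\<lfloor>real K * t / \<sigma>\<rfloor> mod int K) + 1) mod K) = (\<lfloor>real K * t / \<sigma>\<rfloor> mod int K + 1) mod int K"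
      using K by (simp add: zmod_int add.commute)
    then have "int ((nat (\<lfloor>real K * t / \<sigma>\<rfloor> mod int K) + 1) mod K) = (\<lfloor>real K * t / \<sigma>\<rfloor> + 1) mod int K"
      by (simp only: mod_add_left_eq)
    ultimately show ?thesis by (metis nat_int)
  qed
  then show ?thesis unfolding grid_fun_def
    using env_shift[of L "\<lambda>t. z (nat (\<lfloor>real K * t / \<sigma>\<rfloor> mod int K))" "\<sigma> / real K"] by simp
qed

lemma grid_fun_shift: "grid_fun L K (\<lambda>i. z i + s) = grid_fun L K z"
  unfolding grid_fun_def by (rule env_add_const)

section \<open>Approximation of the loop by its values on the grid\<close>

definition scale :: "nat \<Rightarrow> real" where "scale m = (real m / \<sigma>) powr (-1/2)"

definition cpath :: "nat \<Rightarrow> (int \<Rightarrow> real) \<Rightarrow> real \<Rightarrow> real" where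
  "cpath m w t = scale m * w \<lfloor>real m / \<sigma> * t\<rfloor>"

lemma scale_pos: "m > 0 \<Longrightarrow> scale m > 0" unfolding scale_def using \<sigma> by simp

lemma scale_eq: "m > 0 \<Longrightarrow> scale m = sqrt (\<sigma> / real m)"
  unfolding scale_def using \<sigma> by (simp add: powr_minus powr_half_sqrt real_sqrt_divide divide_powr_uminus)

lemma scale_lim: "scale \<longlonglongrightarrow> 0"
proof -
  have "(\<lambda>m. sqrt (\<sigma> / real m)) \<longlonglongrightarrow> 0" using \<sigma> by real_asymp
  then show ?thesis
    by (rule Lim_transform_eventually) (rule eventually_sequentiallyI[of 1], simp add: scale_eq)
qed

text \<open>Where the fine grid with \<open>m\<close> points meets the coarse one with
  \<open>K\<close>: rounding both positions adds at most one to the offset, hence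
  \<open>m div K + 1\<close>.\<close>

lemma block_position:
  fixes t :: real
  assumes m: "m > 0" and K: "K > 0"
  defines "j \<equiv> nat (\<lfloor>real K * t / \<sigma>\<rfloor> mod int K)"
  shows "\<exists>l\<le>m div K + 1. \<lfloor>real m / \<sigma> * t\<rfloor> mod int m = int (m * j div K + l) mod int m \<and> j < K"
proof -
  define q where "q = \<lfloor>t / \<sigma>\<rfloor>"
  define s where "s = t / \<sigma> - of_int q"
  have s: "0 \<le> s" "s < 1" unfolding s_def q_def by linarith+
  have fl: "\<lfloor>real n / \<sigma> * t\<rfloor> = \<lfloor>real n * s\<rfloor> + int n * q" for n :: nat
  proof -
    have "real n / \<sigma> * t = real n * s + of_int (int n * q)" unfolding s_def by (simp add: algebra_simps)
    then show ?thesis by (simp only: floor_add_int)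
  qed
  have rng: "0 \<le> \<lfloor>real n * s\<rfloor>" "\<lfloor>real n * s\<rfloor> < int n" if "n > 0" for n :: nat
    using s that by (auto simp: floor_less_iff mult_less_cancel_left1)
  have "\<lfloor>real K * t / \<sigma>\<rfloor> = \<lfloor>real K / \<sigma> * t\<rfloor>" by simp
  then have jj: "int j = \<lfloor>real K * s\<rfloor>" unfolding j_def using fl[of K] rng[OF K] by simp
  have jK: "j < K" using jj rng[OF K] by linarith
  define i where "i = nat \<lfloor>real m * s\<rfloor>"
  have ii: "int i = \<lfloor>real m * s\<rfloor>" unfolding i_def using rng[OF m] by simp
  have K0: "real K > 0" using K by simp
  have js: "real j \<le> real K * s" "real K * s < real j + 1" using jj by linarith+
  have iss: "real i \<le> real m * s" "real m * s < real i + 1" using ii by linarith+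
  have lo: "m * j div K \<le> i"
  proof -
    have "real (m * j div K) \<le> real (m * j) / real K" by (rule of_nat_div_le_of_nat)
    also have "\<dots> \<le> real m * s"
    proof -
      have "real m * real j \<le> real m * (real K * s)" using js by (intro mult_left_mono) auto
      then show ?thesis using K0 by (simp add: divide_le_eq mult_ac)
    qed
    finally have "real (m * j div K) < real i + 1" using iss by linarith
    then show ?thesis by linarith
  qed
  have hi: "i \<le> m * j div K + (m div K + 1)"
  proof -
    have "real m * s \<le> real m * ((real j + 1) / real K)" using js K0 by (intro mult_left_mono) (auto simp: le_divide_eq mult.commute)
    then have "real i \<le> real (m * j + m) / real K" using iss by (simp add: algebra_simps add_divide_distrib)
    then have "real (i * K) \<le> real (m * j + m)" using K0 by (simp add: le_divide_eq)
    then have "i * K \<le> m * j + m" by (simp only: of_nat_le_iff)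
    also have "m * j + m < (m * j div K) * K + K + ((m div K) * K + K)"
      using dividend_less_div_times[OF K, of "m * j"] dividend_less_div_times[OF K, of m] by linarith
    also have "\<dots> = (m * j div K + (m div K + 1) + 1) * K" by (simp add: algebra_simps)
    finally have "i < m * j div K + (m div K + 1) + 1" by (simp only: mult_less_cancel2)
    then show ?thesis by linarith
  qed
  have "\<lfloor>real m / \<sigma> * t\<rfloor> mod int m = int (m * j div K + (i - m * j div K)) mod int m"
    unfolding fl[of m] using lo ii by simp
  moreover have "i - m * j div K \<le> m div K + 1" using hi by linarith
  ultimately show ?thesis using jK by blast
qed

lemma cpath_grid_close:
  assumes m: "m > 0" and K: "K > 0"
    and good: "\<And>j l. j < K \<Longrightarrow> l \<le> m div K + 1 \<Longrightarrow> \<bar>loop m g (int (m * j div K + l)) - loop m g (int (m * j div K))\<bar> \<le> x"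
  shows "\<bar>cpath m (loop m g) t - scale m * loop m g (int (m * nat (\<lfloor>real K * t / \<sigma>\<rfloor> mod int K) div K))\<bar> \<le> scale m * x"
proof -
  let ?j = "nat (\<lfloor>real K * t / \<sigma>\<rfloor> mod int K)"
  obtain l where l: "l \<le> m div K + 1" "\<lfloor>real m / \<sigma> * t\<rfloor> mod int m = int (m * ?j div K + l) mod int m" "?j < K"
    using block_position[OF m K, of t] by blast
  have "loop m g \<lfloor>real m / \<sigma> * t\<rfloor> = loop m g (int (m * ?j div K + l))" using l(2) by (metis loop_mod)
  then have "\<bar>cpath m (loop m g) t - scale m * loop m g (int (m * ?j div K))\<bar>
    = scale m * \<bar>loop m g (int (m * ?j div K + l)) - loop m g (int (m * ?j div K))\<bar>"
  proof -
    have "\<bar>c * a - c * b\<bar> = c * \<bar>a - b\<bar>" if "c > 0" for a b c :: real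
      using that by (simp only: right_diff_distrib[symmetric] abs_mult abs_of_pos)
    then show ?thesis unfolding cpath_def \<open>loop m g \<lfloor>real m / \<sigma> * t\<rfloor> = _\<close> using scale_pos[OF m] by blast
  qed
  also have "\<dots> \<le> scale m * x" using good[OF l(3,1)] scale_pos[OF m] by (intro mult_left_mono) auto
  finally show ?thesis .
qed

text \<open>By rotation invariance every block looks like the first, so a union bound over
  \<open>K\<close> copies of the maximal inequality suffices. \<open>K \<ge> 4\<close> makes a
  block, with its extra point, at most half of the cycle.\<close>

lemma bad_blocks:
  assumes K: "K \<ge> 4" and m: "m \<ge> K" and x: "x \<ge> 0"
  shows "real (card {g \<in> cars m. \<exists>j<K. \<exists>l\<le>m div K + 1. \<bar>loop m g (int (m * j div K + l)) - loop m g (int (m * j div K))\<bar> > x})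
    \<le> real K * (2 * real m ^ (m - 1) * exp (1 - x / (2 * sqrt (real (m div K + 1)))))"
proof -
  let ?h = "m div K + 1"
  have Kh: "(m div K) * K \<le> m" by simp
  have mK: "1 \<le> m div K" using div_le_mono[OF m, of K] K by simp
  have "4 * (m div K) \<le> K * (m div K)" using K by simp
  then have "4 * (m div K) \<le> m" using Kh by (simp only: mult.commute[of K])
  moreover have "2 * (d + 1) \<le> m" if "4 * d \<le> m" "1 \<le> d" for d :: nat using that by arith
  ultimately have h: "2 * ?h \<le> m" using mK by blast
  moreover have "a + 1 < m" if "2 * (a + 1) \<le> m" for a :: nat using that by arith
  ultimately have h': "?h < m" by blast
  \<comment> \<open>With this value the quadratic term \<open>?h * ?\<theta>\<^sup>2\<close> in the
    exponent is \<open>1\<close>.\<close>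
  let ?\<theta> = "1 / sqrt (real ?h)"
  have th: "0 \<le> ?\<theta>" "?\<theta> \<le> 1" by auto
  define A where "A j = {g \<in> cars m. \<exists>l\<le>?h. \<bar>loop m g (int (m * j div K + l)) - loop m g (int (m * j div K))\<bar> > x}" for j
  define A0 where "A0 = {g \<in> cars m. \<exists>l\<le>?h. \<bar>loop m g (int l)\<bar> \<ge> x}"
  have Aj: "card (A j) \<le> card A0" if j: "j < K" for j
  proof -
    have k: "m * j div K < m"
    proof -
      have "m * j < m * K" using j m K by auto
      then show ?thesis by (simp add: div_less_iff_less_mult K)
    qed
    define P where "P w \<longleftrightarrow> (\<exists>l\<le>?h. \<bar>w (int l)\<bar> > x)" for w :: "int \<Rightarrow> real"
    have c: "(\<Sum>g\<in>cars m. if Q g then 1 else 0 :: real) = real (card {g \<in> cars m. Q g})" for Q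
      by (simp add: sum.If_cases Int_def)
    have "(\<Sum>g\<in>cars m. (\<lambda>w. if P w then 1 else 0 :: real) (loop m g))
      = (\<Sum>g\<in>cars m. (\<lambda>w. if P w then 1 else 0 :: real) (\<lambda>i. loop m g (i + int (m * j div K)) - loop m g (int (m * j div K))))"
      by (rule sum_cars_rotate[OF k])
    then have "real (card {g \<in> cars m. P (loop m g)}) = real (card {g \<in> cars m. P (\<lambda>i. loop m g (i + int (m * j div K)) - loop m g (int (m * j div K)))})"
      by (simp only: c)
    moreover have "{g \<in> cars m. P (\<lambda>i. loop m g (i + int (m * j div K)) - loop m g (int (m * j div K)))} = A j"
      unfolding A_def P_def by (simp add: add.commute)
    ultimately have "card (A j) = card {g \<in> cars m. P (loop m g)}" by simp
    also have "\<dots> \<le> card A0" unfolding A0_def P_def by (intro card_mono) (auto intro: less_imp_le)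
    finally show ?thesis .
  qed
  have "{g \<in> cars m. \<exists>j<K. \<exists>l\<le>?h. \<bar>loop m g (int (m * j div K + l)) - loop m g (int (m * j div K))\<bar> > x} = (\<Union>j<K. A j)"
    unfolding A_def by auto
  then have "card {g \<in> cars m. \<exists>j<K. \<exists>l\<le>?h. \<bar>loop m g (int (m * j div K + l)) - loop m g (int (m * j div K))\<bar> > x} \<le> (\<Sum>j<K. card (A j))"
    by (simp add: card_UN_le)
  also have "\<dots> \<le> (\<Sum>j<K. card A0)" using Aj by (intro sum_mono) auto
  also have "\<dots> = K * card A0" by simp
  finally have "card {g \<in> cars m. \<exists>j<K. \<exists>l\<le>?h. \<bar>loop m g (int (m * j div K + l)) - loop m g (int (m * j div K))\<bar> > x} \<le> K * card A0" .
  from of_nat_mono[OF this, where 'a = real]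
  have 1: "real (card {g \<in> cars m. \<exists>j<K. \<exists>l\<le>?h. \<bar>loop m g (int (m * j div K + l)) - loop m g (int (m * j div K))\<bar> > x}) \<le> real K * real (card A0)"
    by (simp only: of_nat_mult)
  have "real (card A0) \<le> 2 * real m ^ (m - 1) * exp (real ?h * ?\<theta>\<^sup>2 - ?\<theta> * x / 2)"
    unfolding A0_def by (rule maximal_inequality[OF h' h th x])
  also have "real ?h * ?\<theta>\<^sup>2 = 1" by (simp add: power_divide)
  also have "?\<theta> * x / 2 = x / (2 * sqrt (real ?h))" by simp
  finally show ?thesis using 1 by (meson mult_left_mono of_nat_0_le_iff order_trans)
qed

definition loop_avg :: "nat \<Rightarrow> ((int \<Rightarrow> real) \<Rightarrow> real) \<Rightarrow> real" where
  "loop_avg m F = (\<Sum>g\<in>cars m. F (loop m g)) / real (card (cars m))"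

text \<open>Off the bad event the path is within \<open>\<eta>\<close> of its grid version; on it
  the envelopes differ by at most \<open>B\<close>. Blocks of \<open>m / K\<close> points fluctuate
  like \<open>sqrt (m / K)\<close>, so the bound for one block is exponentially small in
  \<open>sqrt K\<close>, uniformly in \<open>m\<close>, and beats the factor
  \<open>K\<close>.\<close>

lemma grid_approx_loops:
  assumes L: "L \<ge> 0" and K: "K \<ge> 4" and m: "m \<ge> K" and \<eta>: "\<eta> > 0"
  shows "\<bar>loop_avg m (\<lambda>w. env L (cpath m w)) - loop_avg m (\<lambda>w. grid_fun L K (\<lambda>i. if 1 \<le> i \<and> i < K then scale m * w (int (m * i div K)) else 0))\<bar>
    \<le> 2 * L * \<eta> + 2 * B * (real K * exp (1 - \<eta> * sqrt (real K / (8 * \<sigma>))))"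
proof -
  have m0: "m > 0" "K > 0" using m K by auto
  let ?x = "\<eta> / scale m"
  have x0: "?x \<ge> 0" using \<eta> scale_pos[OF m0(1)] by simp
  let ?G = "\<lambda>g. grid_fun L K (\<lambda>i. if 1 \<le> i \<and> i < K then scale m * loop m g (int (m * i div K)) else 0)"
  define Bad where "Bad = {g \<in> cars m. \<exists>j<K. \<exists>l\<le>m div K + 1. \<bar>loop m g (int (m * j div K + l)) - loop m g (int (m * j div K))\<bar> > ?x}"
  let ?N = "real (card (cars m))"
  have N: "?N = real m ^ (m - 1)" "?N > 0" using m0 by (simp_all add: card_cars)
  have G: "?G g = env L (\<lambda>t. scale m * loop m g (int (m * nat (\<lfloor>real K * t / \<sigma>\<rfloor> mod int K) div K)))" for g
  proof -
    have "(if 1 \<le> i \<and> i < K then scale m * loop m g (int (m * i div K)) else 0) = scale m * loop m g (int (m * i div K))" if "i < K" for i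
      using that by (cases "i = 0") auto
    moreover have "nat (\<lfloor>real K * t / \<sigma>\<rfloor> mod int K) < K" for t using m0 by (simp add: nat_less_iff)
    ultimately show ?thesis unfolding grid_fun_def by simp
  qed
  have diff: "\<bar>env L (cpath m (loop m g)) - ?G g\<bar> \<le> 2 * L * \<eta> + B * (if g \<in> Bad then 1 else 0)" if g: "g \<in> cars m" for g
  proof (cases "g \<in> Bad")
    case True
    have "\<bar>env L (cpath m (loop m g)) - ?G g\<bar> \<le> B"
      unfolding G using env_range[OF L] by (smt (verit))
    then show ?thesis using True L \<eta> by (simp add: add_increasing)
  next
    case False
    have good: "\<bar>loop m g (int (m * j div K + l)) - loop m g (int (m * j div K))\<bar> \<le> ?x" if "j < K" "l \<le> m div K + 1" for j l
    proof -
      have "\<not> (\<exists>j<K. \<exists>l\<le>m div K + 1. \<bar>loop m g (int (m * j div K + l)) - loop m g (int (m * j div K))\<bar> > ?x)"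
        using False g unfolding Bad_def by simp
      then show ?thesis using that by (meson not_less)
    qed
    have "\<bar>env L (cpath m (loop m g)) - ?G g\<bar> \<le> 2 * L * (scale m * ?x)"
      unfolding G by (rule env_lipschitz[OF L cpath_grid_close[OF m0 good]])
    also have "scale m * ?x = \<eta>" using scale_pos[OF m0(1)] by simp
    finally show ?thesis using False by simp
  qed
  have "\<bar>loop_avg m (\<lambda>w. env L (cpath m w)) - loop_avg m (\<lambda>w. grid_fun L K (\<lambda>i. if 1 \<le> i \<and> i < K then scale m * w (int (m * i div K)) else 0))\<bar>
    = \<bar>\<Sum>g\<in>cars m. env L (cpath m (loop m g)) - ?G g\<bar> / ?N"
    unfolding loop_avg_def by (simp add: diff_divide_distrib[symmetric] sum_subtractf)
  also have "\<dots> \<le> (\<Sum>g\<in>cars m. 2 * L * \<eta> + B * (if g \<in> Bad then 1 else 0)) / ?N"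
    using diff by (intro divide_right_mono order_trans[OF sum_abs] sum_mono) auto
  also have "(\<Sum>g\<in>cars m. 2 * L * \<eta> + B * (if g \<in> Bad then 1 else 0)) = ?N * (2 * L * \<eta>) + B * real (card Bad)"
  proof -
    have "Bad \<subseteq> cars m" by (auto simp: Bad_def)
    then have "cars m \<inter> Bad = Bad" by auto
    then have "(\<Sum>g\<in>cars m. (if g \<in> Bad then 1 else 0 :: real)) = real (card Bad)"
      by (simp add: sum.If_cases)
    then have "(\<Sum>g\<in>cars m. B * (if g \<in> Bad then 1 else 0 :: real)) = B * real (card Bad)"
      by (simp only: sum_distrib_left[symmetric])
    then show ?thesis by (simp only: sum.distrib sum_constant)
  qed
  also have "(?N * (2 * L * \<eta>) + B * real (card Bad)) / ?N = 2 * L * \<eta> + B * (real (card Bad) / ?N)"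
  proof -
    have "(n * a + b * c) / n = a + b * (c / n)" if "n > 0" for n a b c :: real
      using that by (simp add: add_divide_distrib)
    then show ?thesis using N(2) by blast
  qed
  finally have main: "\<bar>loop_avg m (\<lambda>w. env L (cpath m w)) - loop_avg m (\<lambda>w. grid_fun L K (\<lambda>i. if 1 \<le> i \<and> i < K then scale m * w (int (m * i div K)) else 0))\<bar>
    \<le> 2 * L * \<eta> + B * (real (card Bad) / ?N)" .
  have "real (card Bad) / ?N \<le> 2 * (real K * exp (1 - \<eta> * sqrt (real K / (8 * \<sigma>))))"
  proof -
    have "real (card Bad) / ?N \<le> real K * (2 * ?N * exp (1 - ?x / (2 * sqrt (real (m div K + 1))))) / ?N"
      unfolding Bad_def N(1) using bad_blocks[OF K m x0] by (intro divide_right_mono) auto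
    also have "\<dots> = 2 * (real K * exp (1 - ?x / (2 * sqrt (real (m div K + 1)))))"
    proof -
      have "a * (2 * n * b) / n = 2 * (a * b)" if "n > 0" for a b n :: real using that by simp
      then show ?thesis using N(2) by blast
    qed
    also have "\<dots> \<le> 2 * (real K * exp (1 - \<eta> * sqrt (real K / (8 * \<sigma>))))"
    proof -
      have "real (m div K) \<le> real m / real K" by (rule of_nat_div_le_of_nat)
      moreover have "1 \<le> real m / real K" using m K by simp
      ultimately have "real (m div K + 1) \<le> 2 * real m / real K" by simp
      then have "2 * sqrt (real (m div K + 1)) \<le> 2 * sqrt (2 * real m / real K)" by simp
      then have "?x / (2 * sqrt (2 * real m / real K)) \<le> ?x / (2 * sqrt (real (m div K + 1)))"
        using x0 by (intro divide_left_mono) (auto simp: add_pos_nonneg)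
      moreover have "?x / (2 * sqrt (2 * real m / real K)) = \<eta> * sqrt (real K / (8 * \<sigma>))"
      proof -
        have "2 * sqrt (2 * real m / real K) = sqrt (8 * real m / real K)"
          using real_sqrt_mult[of 4 "2 * real m / real K"] by simp
        then have "scale m * (2 * sqrt (2 * real m / real K)) = sqrt (8 * \<sigma> / real K)"
          unfolding scale_eq[OF m0(1)] using m0 by (simp add: real_sqrt_mult[symmetric])
        then have "?x / (2 * sqrt (2 * real m / real K)) = \<eta> / sqrt (8 * \<sigma> / real K)"
          by (metis divide_divide_eq_left)
        also have "\<dots> = \<eta> * sqrt (real K / (8 * \<sigma>))" by (simp add: real_sqrt_divide)
        finally show ?thesis .
      qed
      ultimately have "exp (1 - ?x / (2 * sqrt (real (m div K + 1)))) \<le> exp (1 - \<eta> * sqrt (real K / (8 * \<sigma>)))" by simp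
      then show ?thesis by (intro mult_left_mono) auto
    qed
    finally show ?thesis .
  qed
  then have "B * (real (card Bad) / ?N) \<le> B * (2 * (real K * exp (1 - \<eta> * sqrt (real K / (8 * \<sigma>)))))"
    using B0 by (rule mult_left_mono)
  with main show ?thesis by (simp add: mult_ac)
qed

end

section \<open>The envelope of the excursion and the limit over loops\<close>

lemma uniformly_continuous_excursion:
  fixes e :: "real \<Rightarrow>\<^sub>C real"
  assumes \<sigma>: "\<sigma> > 0" and out: "\<forall>t. t \<le> 0 \<or> \<sigma> \<le> t \<longrightarrow> apply_bcontfun e t = 0" and \<eta>: "\<eta> > 0"
  shows "\<exists>d>0. \<forall>s t. \<bar>s - t\<bar> \<le> d \<longrightarrow> \<bar>apply_bcontfun e s - apply_bcontfun e t\<bar> \<le> \<eta>"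
proof -
  have "uniformly_continuous_on {-1..\<sigma>+1} (apply_bcontfun e)"
    by (rule compact_uniformly_continuous) auto
  then obtain d where d: "d > 0" "\<And>s t. s \<in> {-1..\<sigma>+1} \<Longrightarrow> t \<in> {-1..\<sigma>+1} \<Longrightarrow> \<bar>s - t\<bar> < d \<Longrightarrow> \<bar>apply_bcontfun e s - apply_bcontfun e t\<bar> < \<eta>"
    using \<eta> unfolding uniformly_continuous_on_def dist_real_def by (metis abs_minus_commute)
  have "\<bar>apply_bcontfun e s - apply_bcontfun e t\<bar> \<le> \<eta>" if st: "\<bar>s - t\<bar> \<le> min (d / 2) 1" for s t
  proof (cases "s \<in> {-1..\<sigma>+1} \<and> t \<in> {-1..\<sigma>+1}")
    case True
    then show ?thesis using d(2)[of s t] st d(1) by (auto intro: less_imp_le)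
  next
    case False
    then have "(s \<le> 0 \<or> \<sigma> \<le> s) \<and> (t \<le> 0 \<or> \<sigma> \<le> t)" using st \<sigma> by (auto simp: abs_le_iff)
    then show ?thesis using out \<eta> by auto
  qed
  then show ?thesis using d(1) by (intro exI[of _ "min (d / 2) 1"]) auto
qed

locale path_excursion = path_functional \<sigma> h B + excursion \<sigma> \<mu> for \<sigma> h B \<mu>
begin

lemma periodic_in: "0 \<le> t \<Longrightarrow> t < \<sigma> \<Longrightarrow> periodic \<sigma> e t = apply_bcontfun e t"
proof -
  assume "0 \<le> t" "t < \<sigma>"
  then have "\<lfloor>t / \<sigma>\<rfloor> = 0" by (simp add: floor_eq_iff)
  then show ?thesis by (simp add: periodic_def)
qed

lemma periodic_shift: "periodic \<sigma> e (t + \<sigma> * of_int n) = periodic \<sigma> e t"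
proof -
  have "(t + \<sigma> * of_int n) / \<sigma> = t / \<sigma> + of_int n" using \<sigma> by (simp add: add_divide_distrib)
  then have "\<lfloor>(t + \<sigma> * of_int n) / \<sigma>\<rfloor> = \<lfloor>t / \<sigma>\<rfloor> + n" by simp
  then show ?thesis unfolding periodic_def by (simp add: algebra_simps)
qed

text \<open>The event that the modulus of continuity at mesh \<open>\<sigma> / Suc K\<close> is at
  most \<open>\<eta>\<close>; the mesh is that of a grid of \<open>Suc K\<close> points.\<close>

definition modset :: "real \<Rightarrow> nat \<Rightarrow> (real \<Rightarrow>\<^sub>C real) set" where
  "modset \<eta> K = {e. \<forall>s t. \<bar>s - t\<bar> \<le> \<sigma> / real (Suc K) \<longrightarrow> \<bar>apply_bcontfun e s - apply_bcontfun e t\<bar> \<le> \<eta>}"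

lemma continuous_apply: "continuous_on UNIV (\<lambda>e :: real \<Rightarrow>\<^sub>C real. apply_bcontfun e t)"
  unfolding continuous_on_iff by (metis dist_bounded order.strict_trans1)

text \<open>An uncountable intersection, but of closed sets.\<close>

lemma modset_measurable [measurable]: "modset \<eta> K \<in> sets \<mu>"
proof -
  have "closed {e :: real \<Rightarrow>\<^sub>C real. \<bar>s - t\<bar> \<le> \<sigma> / real (Suc K) \<longrightarrow> \<bar>apply_bcontfun e s - apply_bcontfun e t\<bar> \<le> \<eta>}" for s t
  proof (cases "\<bar>s - t\<bar> \<le> \<sigma> / real (Suc K)")
    case True
    have "closed {e :: real \<Rightarrow>\<^sub>C real. \<bar>apply_bcontfun e s - apply_bcontfun e t\<bar> \<le> \<eta>}"
      by (intro closed_Collect_le continuous_on_rabs continuous_on_diff continuous_apply continuous_on_const)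
    then show ?thesis using True by simp
  qed simp
  then have "closed (modset \<eta> K)" unfolding modset_def by (intro closed_Collect_all)
  then show ?thesis by simp
qed

lemma modset_lim:
  assumes \<eta>: "\<eta> > 0" shows "(\<lambda>K. prob (modset \<eta> K)) \<longlonglongrightarrow> 1"
proof -
  have inc: "incseq (modset \<eta>)"
  proof (rule incseq_SucI)
    fix K
    have "\<sigma> / real (Suc (Suc K)) \<le> \<sigma> / real (Suc K)" using \<sigma> by (intro divide_left_mono) auto
    then show "modset \<eta> K \<subseteq> modset \<eta> (Suc K)" unfolding modset_def by (auto intro: order_trans)
  qed
  have "(\<lambda>K. prob (modset \<eta> K)) \<longlonglongrightarrow> prob (\<Union>K. modset \<eta> K)"
    by (rule finite_Lim_measure_incseq[OF _ inc]) (use modset_measurable in blast)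
  moreover have "prob (\<Union>K. modset \<eta> K) = 1"
  proof -
    have m: "(\<Union>K. modset \<eta> K) \<in> sets \<mu>" by (rule sets.countable_UN) (use modset_measurable in blast)
    have "AE e in \<mu>. e \<in> (\<Union>K. modset \<eta> K)"
      using outside
    proof eventually_elim
      case (elim e)
      obtain d where d: "d > 0" "\<forall>s t. \<bar>s - t\<bar> \<le> d \<longrightarrow> \<bar>apply_bcontfun e s - apply_bcontfun e t\<bar> \<le> \<eta>"
        using uniformly_continuous_excursion[OF \<sigma> elim \<eta>] by blast
      obtain K :: nat where "\<sigma> / d < real K" using reals_Archimedean2 by blast
      then have "\<sigma> / d < real (Suc K)" by simp
      then have "\<sigma> / real (Suc K) \<le> d" using d(1) by (simp add: field_simps)
      then have "e \<in> modset \<eta> K" unfolding modset_def using d(2) by auto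
      then show ?case by blast
    qed
    then show ?thesis using AE_in_set_eq_1[OF m] by simp
  qed
  ultimately show ?thesis by simp
qed

lemma env_periodic_measurable:
  assumes L: "L \<ge> 0" shows "(\<lambda>e. env L (periodic \<sigma> e)) \<in> borel_measurable borel"
proof (rule borel_measurable_continuous_onI, unfold continuous_on_iff, intro ballI allI impI)
  fix e :: "real \<Rightarrow>\<^sub>C real" and \<epsilon> :: real assume \<epsilon>: "0 < \<epsilon>"
  show "\<exists>d>0. \<forall>e'\<in>UNIV. dist e' e < d \<longrightarrow> dist (env L (periodic \<sigma> e')) (env L (periodic \<sigma> e)) < \<epsilon>"
  proof (intro exI[of _ "\<epsilon> / (2 * L + 1)"] conjI ballI impI)
    show "0 < \<epsilon> / (2 * L + 1)" using \<epsilon> L by simp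
    fix e' assume d: "dist e' e < \<epsilon> / (2 * L + 1)"
    have "\<bar>env L (periodic \<sigma> e') - env L (periodic \<sigma> e)\<bar> \<le> 2 * L * dist e' e"
      by (rule env_lipschitz[OF L]) (unfold periodic_def dist_real_def[symmetric], rule dist_bounded)
    also have "\<dots> \<le> (2 * L + 1) * dist e' e" by (intro mult_right_mono) auto
    also have "\<dots> < \<epsilon>" using d L by (simp add: less_divide_eq mult.commute)
    finally show "dist (env L (periodic \<sigma> e')) (env L (periodic \<sigma> e)) < \<epsilon>" by (simp add: dist_real_def)
  qed
qed

text \<open>The grid with offset \<open>v\<close> is compared with the periodic path advanced by
  \<open>v\<close>, which has the same envelope. Within one period the mesh bounds the difference;
  across the end of the period both values are within \<open>\<eta>\<close> of the common value
  \<open>0\<close>.\<close>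

lemma grid_periodic_close:
  assumes L: "L \<ge> 0" and K: "K \<ge> 1" and e: "e \<in> modset \<eta> K"
    and out: "\<forall>t. t \<le> 0 \<or> \<sigma> \<le> t \<longrightarrow> apply_bcontfun e t = 0" and v: "0 < v" "v < \<sigma> / real (Suc K)"
  shows "\<bar>grid_fun L (Suc K) (\<lambda>i. apply_bcontfun e (v + real i * (\<sigma> / real (Suc K)))) - env L (periodic \<sigma> e)\<bar> \<le> 4 * L * \<eta>"
proof -
  let ?K = "Suc K" and ?\<delta> = "\<sigma> / real (Suc K)"
  have sm: "\<bar>apply_bcontfun e s - apply_bcontfun e t\<bar> \<le> \<eta>" if "\<bar>s - t\<bar> \<le> ?\<delta>" for s t
    using e that unfolding modset_def by blast
  have d0: "?\<delta> > 0" using \<sigma> by simp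
  have Kd: "real ?K * ?\<delta> = \<sigma>" by simp
  have "\<bar>apply_bcontfun e (v + real (nat (\<lfloor>real ?K * t / \<sigma>\<rfloor> mod int ?K)) * ?\<delta>) - periodic \<sigma> e (t + v)\<bar> \<le> 2 * \<eta>" for t
  proof -
    define q where "q = \<lfloor>t / \<sigma>\<rfloor>"
    define s where "s = t - \<sigma> * of_int q"
    define j where "j = nat (\<lfloor>real ?K * t / \<sigma>\<rfloor> mod int ?K)"
    have "of_int q \<le> t / \<sigma>" "t / \<sigma> < of_int q + 1" unfolding q_def by linarith+
    then have s: "0 \<le> s" "s < \<sigma>" unfolding s_def using \<sigma> by (simp_all add: le_divide_eq divide_less_eq algebra_simps)
    have "real ?K * t / \<sigma> = real ?K * s / \<sigma> + of_int (int ?K * q)" unfolding s_def using \<sigma> by (simp add: field_simps)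
    then have "\<lfloor>real ?K * t / \<sigma>\<rfloor> = \<lfloor>real ?K * s / \<sigma>\<rfloor> + int ?K * q" by (simp only: floor_add_int)
    moreover have r: "0 \<le> \<lfloor>real ?K * s / \<sigma>\<rfloor>" "\<lfloor>real ?K * s / \<sigma>\<rfloor> < int ?K"
    proof -
      have "0 \<le> real ?K * s / \<sigma>" using s \<sigma> by simp
      then show "0 \<le> \<lfloor>real ?K * s / \<sigma>\<rfloor>" by linarith
      have "real ?K * s / \<sigma> < real ?K" using s \<sigma> by (simp add: divide_less_eq del: of_nat_Suc)
      then show "\<lfloor>real ?K * s / \<sigma>\<rfloor> < int ?K" by linarith
    qed
    ultimately have jj: "int j = \<lfloor>real ?K * s / \<sigma>\<rfloor>" unfolding j_def by simp
    then have "real j \<le> real ?K * s / \<sigma>" "real ?K * s / \<sigma> < real j + 1" by linarith+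
    then have js: "real j * ?\<delta> \<le> s" "s < real j * ?\<delta> + ?\<delta>" using \<sigma>
      by (simp_all add: field_simps del: of_nat_Suc)
    have jK: "real j * ?\<delta> + ?\<delta> \<le> \<sigma>"
    proof -
      have "j + 1 \<le> ?K" using jj r by linarith
      then have "real (j + 1) * ?\<delta> \<le> real ?K * ?\<delta>" using d0 by (intro mult_right_mono) auto
      then show ?thesis unfolding Kd by (simp only: of_nat_add of_nat_1 distrib_right mult_1)
    qed
    have pe: "periodic \<sigma> e (t + v) = periodic \<sigma> e (s + v)"
      using periodic_shift[of e "s + v" q] unfolding s_def by (simp add: algebra_simps)
    show ?thesis unfolding j_def[symmetric]
    proof (cases "s + v < \<sigma>")
      case True
      then have "periodic \<sigma> e (t + v) = apply_bcontfun e (s + v)" unfolding pe using s v by (intro periodic_in) auto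
      moreover have "\<bar>apply_bcontfun e (v + real j * ?\<delta>) - apply_bcontfun e (s + v)\<bar> \<le> \<eta>"
      proof (rule sm)
        have "\<bar>v + a - (s + v)\<bar> \<le> D" if "a \<le> s" "s < a + D" for a D :: real using that by linarith
        then show "\<bar>v + real j * ?\<delta> - (s + v)\<bar> \<le> ?\<delta>" using js by blast
      qed
      ultimately show "\<bar>apply_bcontfun e (v + real j * ?\<delta>) - periodic \<sigma> e (t + v)\<bar> \<le> 2 * \<eta>"
        using abs_ge_zero[of "apply_bcontfun e (v + real j * ?\<delta>) - apply_bcontfun e (s + v)"] by linarith
    next
      case False
      have ds: "?\<delta> \<le> \<sigma>" using jK d0 by (smt (verit) js(1) mult_nonneg_nonneg of_nat_0_le_iff)
      have "periodic \<sigma> e (s + v) = periodic \<sigma> e (s + v - \<sigma>)" using periodic_shift[of e "s + v - \<sigma>" 1] by simp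
      also have "\<dots> = apply_bcontfun e (s + v - \<sigma>)" using False s v ds by (intro periodic_in) linarith+
      finally have "periodic \<sigma> e (t + v) = apply_bcontfun e (s + v - \<sigma>)" unfolding pe .
      moreover have "\<bar>apply_bcontfun e (s + v - \<sigma>) - apply_bcontfun e 0\<bar> \<le> \<eta>" using False s v by (intro sm) linarith
      moreover have "\<bar>apply_bcontfun e (v + real j * ?\<delta>) - apply_bcontfun e \<sigma>\<bar> \<le> \<eta>" using False js jK v by (intro sm) linarith
      moreover have "apply_bcontfun e 0 = 0" "apply_bcontfun e \<sigma> = 0" using out by auto
      ultimately show "\<bar>apply_bcontfun e (v + real j * ?\<delta>) - periodic \<sigma> e (t + v)\<bar> \<le> 2 * \<eta>" by linarith
    qed
  qed
  then have "\<bar>grid_fun L ?K (\<lambda>i. apply_bcontfun e (v + real i * ?\<delta>)) - env L (\<lambda>t. periodic \<sigma> e (t + v))\<bar> \<le> 2 * L * (2 * \<eta>)"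
    unfolding grid_fun_def by (rule env_lipschitz[OF L])
  then show ?thesis using env_shift[of L "periodic \<sigma> e" v] by simp
qed

definition grid_value :: "real \<Rightarrow> nat \<Rightarrow> real" where
  "grid_value L K = grid_functional.gauss_expect \<sigma> K (grid_fun L K) (K - 1) (\<lambda>_. 0)"

lemma integrable_env: "L \<ge> 0 \<Longrightarrow> integrable \<mu> (\<lambda>e. env L (periodic \<sigma> e))"
  using env_periodic_measurable[of L] env_range[of L]
  by (intro integrable_const_bound[where B = B]) auto

text \<open>Only the average over the offset \<open>v\<close> is known exactly, by
  \<open>excursion_average_eq\<close>. As for every \<open>v\<close> the expectation is close to
  that of the envelope of the whole path, so is the average.\<close>

lemma grid_value_close:
  assumes L: "L \<ge> 0" and K: "K \<ge> 1" and \<eta>: "\<eta> > 0"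
  shows "\<bar>grid_value L (Suc K) - (\<integral>e. env L (periodic \<sigma> e) \<partial>\<mu>)\<bar> \<le> 4 * L * \<eta> + B * (1 - prob (modset \<eta> K))"
proof -
  interpret G: nonneg_grid_functional \<sigma> "Suc K" "grid_fun L (Suc K)" B
    using K by (intro grid_fun_nonneg_grid_functional[OF L]) simp
  have exc: "excursion \<sigma> \<mu>" by unfold_locales
  let ?\<delta> = "\<sigma> / real (Suc K)"
  have del: "G.\<delta> = ?\<delta>" by (simp add: G.\<delta>_def)
  have d0: "?\<delta> > 0" using \<sigma> by simp
  let ?g = "\<lambda>v e. grid_fun L (Suc K) (\<lambda>i. apply_bcontfun e (v + real i * ?\<delta>))"
  let ?I = "grid_value L (Suc K)" and ?P = "\<integral>e. env L (periodic \<sigma> e) \<partial>\<mu>"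
  let ?\<epsilon> = "4 * L * \<eta> + B * (1 - prob (modset \<eta> K))"
  have A: "(\<integral>\<^sup>+v\<in>{0<..<?\<delta>}. (\<integral>\<^sup>+e. ennreal (?g v e) \<partial>\<mu>) \<partial>lborel) = ennreal (?\<delta> * ?I)"
    using G.excursion_average_eq[OF exc] grid_fun_cyclic[of "Suc K" L] grid_fun_shift[of L "Suc K"] K
    unfolding del grid_value_def by simp
  have I0: "0 \<le> ?I" unfolding grid_value_def by (rule G.gauss_expect_nonneg)
  have gm: "?g v \<in> borel_measurable \<mu>" for v by (rule G.measurable_Phi) simp
  have gr: "0 \<le> ?g v e \<and> ?g v e \<le> B" for v e unfolding grid_fun_def by (rule env_range[OF L])
  have gi: "integrable \<mu> (?g v)" for v by (rule integrable_const_bound[where B = B]) (use gm gr in auto)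
  have close: "\<bar>(\<integral>e. ?g v e \<partial>\<mu>) - ?P\<bar> \<le> ?\<epsilon>" if v: "0 < v" "v < ?\<delta>" for v
  proof -
    have "\<bar>(\<integral>e. ?g v e \<partial>\<mu>) - ?P\<bar> = \<bar>\<integral>e. ?g v e - env L (periodic \<sigma> e) \<partial>\<mu>\<bar>"
      by (subst Bochner_Integration.integral_diff) (simp_all only: gi integrable_env[OF L])
    also have "\<dots> \<le> (\<integral>e. \<bar>?g v e - env L (periodic \<sigma> e)\<bar> \<partial>\<mu>)" by (rule integral_abs_bound)
    also have "\<dots> \<le> (\<integral>e. 4 * L * \<eta> + B * indicator (space \<mu> - modset \<eta> K) e \<partial>\<mu>)"
    proof (rule integral_mono_AE)
      show "integrable \<mu> (\<lambda>e. \<bar>?g v e - env L (periodic \<sigma> e)\<bar>)"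
        by (intro integrable_abs Bochner_Integration.integrable_diff gi integrable_env[OF L])
      show "integrable \<mu> (\<lambda>e. 4 * L * \<eta> + B * indicator (space \<mu> - modset \<eta> K) e)"
        by (intro Bochner_Integration.integrable_add integrable_const integrable_mult_right integrable_real_indicator sets.compl_sets modset_measurable)
          (simp add: emeasure_eq_measure)
      show "AE e in \<mu>. \<bar>?g v e - env L (periodic \<sigma> e)\<bar> \<le> 4 * L * \<eta> + B * indicator (space \<mu> - modset \<eta> K) e"
        using outside
      proof eventually_elim
        case (elim e)
        show ?case
        proof (cases "e \<in> modset \<eta> K")
          case True
          then show ?thesis using grid_periodic_close[OF L K True elim v] by simp
        next
          case False
          have "\<bar>?g v e - env L (periodic \<sigma> e)\<bar> \<le> B" using gr[of e v] env_range[OF L, of "periodic \<sigma> e"] by linarith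
          moreover have "0 \<le> 4 * L * \<eta>" using L \<eta> by simp
          ultimately show ?thesis using False by simp
        qed
      qed
    qed
    also have "\<dots> = ?\<epsilon>"
    proof -
      have "(\<integral>e. 4 * L * \<eta> + B * indicator (space \<mu> - modset \<eta> K) e \<partial>\<mu>) = 4 * L * \<eta> + B * prob (space \<mu> - modset \<eta> K)"
        using sets.compl_sets[OF modset_measurable, of \<eta> K]
        by (subst Bochner_Integration.integral_add) (auto simp: prob_space[simplified] emeasure_eq_measure intro!: integrable_real_indicator)
      then show ?thesis by (simp only: prob_compl[OF modset_measurable])
    qed
    finally show ?thesis .
  qed
  have inner: "(\<integral>\<^sup>+e. ennreal (?g v e) \<partial>\<mu>) = ennreal (\<integral>e. ?g v e \<partial>\<mu>)" for v
    using gr by (intro nn_integral_eq_integral gi) auto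
  have eps0: "0 \<le> ?\<epsilon>" using L \<eta> B0 prob_le_1 by simp
  have const: "(\<integral>\<^sup>+v\<in>{0<..<?\<delta>}. ennreal c \<partial>lborel) = ennreal (?\<delta> * c)" if "0 \<le> c" for c
  proof -
    have "(\<integral>\<^sup>+v\<in>{0<..<?\<delta>}. ennreal c \<partial>lborel) = ennreal c * emeasure lborel {0<..<?\<delta>}"
      by (rule nn_integral_cmult_indicator) simp
    also have "emeasure lborel {0<..<?\<delta>} = ennreal ?\<delta>" using d0 by simp
    also have "ennreal c * ennreal ?\<delta> = ennreal (?\<delta> * c)"
      by (subst mult.commute[of ?\<delta>]) (rule ennreal_mult'[symmetric, OF that])
    finally show ?thesis .
  qed
  have P0: "0 \<le> ?P" by (rule Bochner_Integration.integral_nonneg) (simp add: env_range[OF L])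
  have "ennreal (?\<delta> * ?I) \<le> (\<integral>\<^sup>+v\<in>{0<..<?\<delta>}. ennreal (?P + ?\<epsilon>) \<partial>lborel)"
    unfolding A[symmetric]
  proof (rule nn_integral_mono)
    fix v
    show "(\<integral>\<^sup>+e. ennreal (?g v e) \<partial>\<mu>) * indicator {0<..<?\<delta>} v \<le> ennreal (?P + ?\<epsilon>) * indicator {0<..<?\<delta>} v"
      using close[of v] unfolding inner by (auto simp: indicator_def intro!: ennreal_leI)
  qed
  also have "\<dots> = ennreal (?\<delta> * (?P + ?\<epsilon>))" using P0 eps0 by (intro const) simp
  finally have le1: "ennreal (?\<delta> * ?I) \<le> ennreal (?\<delta> * (?P + ?\<epsilon>))" .
  have nn1: "0 \<le> ?\<delta> * (?P + ?\<epsilon>)" by (intro mult_nonneg_nonneg add_nonneg_nonneg less_imp_le[OF d0] P0 eps0)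
  have "?\<delta> * ?I \<le> ?\<delta> * (?P + ?\<epsilon>)" using le1 by (simp only: ennreal_le_iff[OF nn1])
  then have u: "?I \<le> ?P + ?\<epsilon>" using d0 by (simp only: mult_le_cancel_left_pos)
  \<comment> \<open>The maximum with \<open>0\<close> guards against a negative lower bound, which
    \<open>ennreal\<close> would truncate.\<close>
  have "ennreal (?\<delta> * max 0 (?P - ?\<epsilon>)) = (\<integral>\<^sup>+v\<in>{0<..<?\<delta>}. ennreal (max 0 (?P - ?\<epsilon>)) \<partial>lborel)" by (rule const[symmetric]) simp
  also have "\<dots> \<le> ennreal (?\<delta> * ?I)"
    unfolding A[symmetric]
  proof (rule nn_integral_mono)
    fix v
    have "0 \<le> (\<integral>e. ?g v e \<partial>\<mu>)" by (rule Bochner_Integration.integral_nonneg) (rule conjunct1[OF gr])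
    then show "ennreal (max 0 (?P - ?\<epsilon>)) * indicator {0<..<?\<delta>} v \<le> (\<integral>\<^sup>+e. ennreal (?g v e) \<partial>\<mu>) * indicator {0<..<?\<delta>} v"
      using close[of v] unfolding inner by (auto simp: indicator_def intro!: ennreal_leI)
  qed
  finally have le2: "ennreal (?\<delta> * max 0 (?P - ?\<epsilon>)) \<le> ennreal (?\<delta> * ?I)" .
  have nn2: "0 \<le> ?\<delta> * ?I" by (intro mult_nonneg_nonneg less_imp_le[OF d0] I0)
  have "?\<delta> * max 0 (?P - ?\<epsilon>) \<le> ?\<delta> * ?I" using le2 by (simp only: ennreal_le_iff[OF nn2])
  then have "max 0 (?P - ?\<epsilon>) \<le> ?I" using d0 by (simp only: mult_le_cancel_left_pos)
  with u show ?thesis by linarith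
qed

text \<open>\<open>K\<close> is chosen from \<open>L\<close> and the tolerance before
  \<open>m\<close>: the error of the grid on the loop side is uniform in \<open>m\<close>, and for
  the chosen \<open>K\<close> the grid averages converge.\<close>

theorem env_limit:
  assumes L: "L \<ge> 0"
  shows "(\<lambda>m. loop_avg m (\<lambda>w. env L (cpath m w))) \<longlonglongrightarrow> (\<integral>e. env L (periodic \<sigma> e) \<partial>\<mu>)"
proof (rule LIMSEQ_I)
  fix r :: real assume r: "0 < r"
  let ?P = "\<integral>e. env L (periodic \<sigma> e) \<partial>\<mu>"
  \<comment> \<open>The \<open>6\<close> adds the losses \<open>2 * L * \<eta>\<close> on the loop
    side and \<open>4 * L * \<eta>\<close> on the excursion side; the \<open>+ 1\<close> covers
    \<open>L = 0\<close>.\<close>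
  define \<eta> where "\<eta> = r / (8 * (6 * L + 1))"
  have \<eta>: "\<eta> > 0" "6 * L * \<eta> \<le> r / 8"
  proof -
    show "\<eta> > 0" unfolding \<eta>_def using r L by simp
    then have "6 * L * \<eta> \<le> (6 * L + 1) * \<eta>" by (intro mult_right_mono) auto
    also have "\<dots> = r / 8" unfolding \<eta>_def using L by (simp add: field_simps)
    finally show "6 * L * \<eta> \<le> r / 8" .
  qed
  have l1: "(\<lambda>K. 2 * B * (real (Suc K) * exp (1 - \<eta> * sqrt (real (Suc K) / (8 * \<sigma>))))) \<longlonglongrightarrow> 2 * B * 0"
  proof (rule tendsto_mult[OF tendsto_const])
    show "(\<lambda>K. real (Suc K) * exp (1 - \<eta> * sqrt (real (Suc K) / (8 * \<sigma>)))) \<longlonglongrightarrow> 0"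
      using \<eta>(1) \<sigma> by real_asymp
  qed
  have l2: "(\<lambda>K. B * (1 - prob (modset \<eta> K))) \<longlonglongrightarrow> B * (1 - 1)"
    by (rule tendsto_mult[OF tendsto_const tendsto_diff[OF tendsto_const modset_lim[OF \<eta>(1)]]])
  have "eventually (\<lambda>K. 2 * B * (real (Suc K) * exp (1 - \<eta> * sqrt (real (Suc K) / (8 * \<sigma>)))) < r / 4) sequentially"
    using r by (intro order_tendstoD(2)[OF l1]) simp
  moreover have "eventually (\<lambda>K. B * (1 - prob (modset \<eta> K)) < r / 4) sequentially"
    using r by (intro order_tendstoD(2)[OF l2]) simp
  moreover have "eventually (\<lambda>K. 3 \<le> K) sequentially" by (rule eventually_ge_at_top)
  ultimately have "eventually (\<lambda>K. 2 * B * (real (Suc K) * exp (1 - \<eta> * sqrt (real (Suc K) / (8 * \<sigma>)))) < r / 4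
      \<and> B * (1 - prob (modset \<eta> K)) < r / 4 \<and> 3 \<le> K) sequentially"
    by eventually_elim simp
  then obtain K where K: "2 * B * (real (Suc K) * exp (1 - \<eta> * sqrt (real (Suc K) / (8 * \<sigma>)))) < r / 4"
    "B * (1 - prob (modset \<eta> K)) < r / 4" "3 \<le> K"
    by (metis (no_types, lifting) eventually_sequentially order_refl)
  interpret G: nonneg_grid_functional \<sigma> "Suc K" "grid_fun L (Suc K)" B
    using K(3) by (intro grid_fun_nonneg_grid_functional[OF L]) simp
  let ?A = "\<lambda>m. loop_avg m (\<lambda>w. grid_fun L (Suc K) (\<lambda>i. if 1 \<le> i \<and> i < Suc K then scale m * w (int (m * i div Suc K)) else 0))"
  have "?A \<longlonglongrightarrow> grid_value L (Suc K)"
    using G.grid_limit unfolding grid_value_def loop_avg_def G.grid_scale_def scale_def G.grid_index_def .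
  then obtain m0 where m0: "\<And>m. m \<ge> m0 \<Longrightarrow> \<bar>?A m - grid_value L (Suc K)\<bar> < r / 4"
  proof -
    assume lim: "?A \<longlonglongrightarrow> grid_value L (Suc K)"
    have "0 < r / 4" using r by simp
    from LIMSEQ_D[OF lim this] show thesis using that unfolding real_norm_def by blast
  qed
  have P: "\<bar>grid_value L (Suc K) - ?P\<bar> \<le> 4 * L * \<eta> + B * (1 - prob (modset \<eta> K))"
    using K(3) by (intro grid_value_close[OF L _ \<eta>(1)]) simp
  show "\<exists>no. \<forall>n\<ge>no. norm (loop_avg n (\<lambda>w. env L (cpath n w)) - ?P) < r"
  proof (intro exI[of _ "max m0 (Suc K)"] allI impI)
    fix m assume m: "max m0 (Suc K) \<le> m"
    have "\<bar>loop_avg m (\<lambda>w. env L (cpath m w)) - ?A m\<bar> \<le> 2 * L * \<eta> + 2 * B * (real (Suc K) * exp (1 - \<eta> * sqrt (real (Suc K) / (8 * \<sigma>))))"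
      using K(3) m by (intro grid_approx_loops[OF L _ _ \<eta>(1)]) auto
    then show "norm (loop_avg m (\<lambda>w. env L (cpath m w)) - ?P) < r"
      unfolding real_norm_def using m0[of m] m P K(1,2) \<eta>(2) r by linarith
  qed
qed

end

section \<open>Limits of averages over trees\<close>

definition step_path :: "real \<Rightarrow> nat \<Rightarrow> (nat \<Rightarrow> real) \<Rightarrow> real \<Rightarrow> real" where
  "step_path \<sigma> m d t = (if 0 \<le> t \<and> t \<le> \<sigma> then (real m / \<sigma>) powr (-1/2) * d (nat \<lfloor>(real m / \<sigma>) * t\<rfloor>) else 0)"

lemma scaled_walk_step_path: "scaled_walk \<sigma> m T = step_path \<sigma> m (dfwalk m T)"
  by (simp add: fun_eq_iff scaled_walk_def step_path_def)

lemma floor_eventually_right: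
  fixes c t :: real assumes "c > 0"
  shows "eventually (\<lambda>s. \<lfloor>c * s\<rfloor> = \<lfloor>c * t\<rfloor>) (at_right t)"
proof -
  have "t < (of_int \<lfloor>c * t\<rfloor> + 1) / c" using assms by (simp add: less_divide_eq mult.commute)
  from this show ?thesis
  proof (rule eventually_at_rightI[rotated])
    fix s assume "s \<in> {t<..<(of_int \<lfloor>c * t\<rfloor> + 1) / c}"
    then have "c * t < c * s" "c * s < of_int \<lfloor>c * t\<rfloor> + 1" using assms by (simp_all add: less_divide_eq mult.commute)
    then show "\<lfloor>c * s\<rfloor> = \<lfloor>c * t\<rfloor>" by linarith
  qed
qed

lemma floor_eventually_left:
  fixes c t :: real assumes "c > 0"
  shows "eventually (\<lambda>s. \<lfloor>c * s\<rfloor> = \<lceil>c * t\<rceil> - 1) (at_left t)"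
proof (rule eventually_at_leftI)
  have "of_int \<lceil>c * t\<rceil> - 1 < c * t" by linarith
  then show "(of_int \<lceil>c * t\<rceil> - 1) / c < t" using assms by (simp add: divide_less_eq mult.commute)
  fix s assume "s \<in> {(of_int \<lceil>c * t\<rceil> - 1) / c<..<t}"
  then have "of_int \<lceil>c * t\<rceil> - 1 < c * s" "c * s < c * t" using assms by (simp_all add: divide_less_eq mult.commute)
  then show "\<lfloor>c * s\<rfloor> = \<lceil>c * t\<rceil> - 1" by linarith
qed

lemma step_path_in_paths:
  assumes \<sigma>: "\<sigma> > 0" and m: "m > 0" and d: "\<And>i. 0 \<le> d i" "\<And>i. d i \<le> D"
  shows "step_path \<sigma> m d \<in> paths \<sigma>"
proof -
  let ?c = "real m / \<sigma>" and ?a = "(real m / \<sigma>) powr (-1/2)"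
  have c: "?c > 0" using \<sigma> m by simp
  let ?y = "step_path \<sigma> m d"
  have r: "(?y \<longlongrightarrow> ?y t) (at_right t)" if t: "t \<in> {0..<\<sigma>}" for t
  proof -
    have "eventually (\<lambda>s. s \<in> {t<..<\<sigma>}) (at_right t)" using t by (intro eventually_at_rightI[of t \<sigma>]) auto
    then have "eventually (\<lambda>s. ?y t = ?y s) (at_right t)"
      using floor_eventually_right[OF c, of t]
    proof eventually_elim
      case (elim s)
      have "?y s = ?a * d (nat \<lfloor>?c * s\<rfloor>)" "?y t = ?a * d (nat \<lfloor>?c * t\<rfloor>)" using elim(1) t by (auto simp: step_path_def)
      then show ?case by (simp only: elim(2))
    qed
    then show ?thesis by (rule Lim_transform_eventually[OF tendsto_const])
  qed
  have l: "\<exists>l. (?y \<longlongrightarrow> l) (at_left t)" if t: "t \<in> {0<..\<sigma>}" for t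
  proof -
    have "eventually (\<lambda>s. s \<in> {0<..<t}) (at_left t)" using t by (intro eventually_at_leftI[of 0 t]) auto
    then have "eventually (\<lambda>s. ?a * d (nat (\<lceil>?c * t\<rceil> - 1)) = ?y s) (at_left t)"
      using floor_eventually_left[OF c, of t]
    proof eventually_elim
      case (elim s)
      have "?y s = ?a * d (nat \<lfloor>?c * s\<rfloor>)" using elim(1) t by (auto simp: step_path_def)
      then show ?case by (simp only: elim(2))
    qed
    then show ?thesis by (intro exI) (rule Lim_transform_eventually[OF tendsto_const])
  qed
  have y0: "0 \<le> ?y t" "?y t \<le> ?a * D" for t
  proof -
    have "0 \<le> D" using d(1)[of 0] d(2)[of 0] by linarith
    then show "0 \<le> ?y t" "?y t \<le> ?a * D" unfolding step_path_def using d by (auto intro: mult_left_mono)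
  qed
  have bounded_y: "bounded (range ?y)" unfolding bounded_iff using y0 by (intro exI[of _ "?a * D"]) auto
  have fm: "(\<lambda>t. \<lfloor>?c * t\<rfloor>) \<in> measurable borel (count_space UNIV)"
    by (rule measurable_compose[OF _ measurable_real_floor]) simp
  have "(\<lambda>t. d (nat \<lfloor>?c * t\<rfloor>)) \<in> borel_measurable borel"
    by (rule measurable_compose[OF fm, of "\<lambda>k. d (nat k)"]) simp
  then have "(\<lambda>t. indicator {0..\<sigma>} t * (?a * d (nat \<lfloor>?c * t\<rfloor>))) \<in> borel_measurable borel"
    by (intro borel_measurable_times borel_measurable_indicator borel_measurable_const) auto
  moreover have "?y = (\<lambda>t. indicator {0..\<sigma>} t * (?a * d (nat \<lfloor>?c * t\<rfloor>)))"
    by (simp add: step_path_def fun_eq_iff indicator_def)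
  ultimately have meas: "?y \<in> borel_measurable borel" by (simp only:)
  have "set_integrable lborel {0..\<sigma>} ?y"
    unfolding set_integrable_def
  proof (rule Bochner_Integration.integrable_bound)
    show "integrable lborel (\<lambda>t. indicator {0..\<sigma>} t *\<^sub>R (?a * D))"
      by (intro integrable_scaleR_left integrable_real_indicator) (auto simp: emeasure_lborel_Icc_eq)
    show "(\<lambda>t. indicator {0..\<sigma>} t *\<^sub>R ?y t) \<in> borel_measurable lborel"
      using meas by (intro borel_measurable_scaleR borel_measurable_indicator) auto
    show "AE t in lborel. norm (indicator {0..\<sigma>} t *\<^sub>R ?y t) \<le> norm (indicator {0..\<sigma>} t *\<^sub>R (?a * D))"
    proof (rule AE_I2)
      fix t
      have "\<bar>?y t\<bar> \<le> \<bar>?a * D\<bar>" using y0[of t] by linarith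
      then show "norm (indicator {0..\<sigma>} t *\<^sub>R ?y t) \<le> norm (indicator {0..\<sigma>} t *\<^sub>R (?a * D))"
        by (simp add: indicator_def)
    qed
  qed
  then have "?y integrable_on {0..\<sigma>}" by (rule set_borel_integral_eq_integral(1))
  then show ?thesis unfolding paths_def skorohod_D_def using r l y0(1) bounded_y by (auto simp: step_path_def)
qed

lemma pwalk_range:
  assumes "g \<in> parking m" shows "0 \<le> pwalk m g i" "pwalk m g i \<le> real m"
proof -
  show "0 \<le> pwalk m g i" using assms by (auto simp: pwalk_def parking_def)
  have "below {2..m} g i \<le> card {2..m}" unfolding below_def by (intro card_mono) auto
  then show "pwalk m g i \<le> real m" by (auto simp: pwalk_def)
qed

text \<open>Loop and walk differ by \<open>i / m\<close> only; at \<open>i = m\<close> both are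
  \<open>0\<close>.\<close>

lemma loop_pwalk:
  assumes g: "g \<in> parking m" and i: "i \<le> m" and m: "m \<ge> 1"
  shows "\<bar>pwalk m g i - loop m g (int i)\<bar> \<le> 1"
proof (cases "i = m")
  case True
  then show ?thesis by (simp add: pwalk_def loop_def)
next
  case False
  then have im: "i < m" using i by simp
  have "loop m g (int i) = pwalk m g i + real i / real m"
    using im m by (simp add: loop_nat pwalk_def field_simps of_nat_diff)
  then show ?thesis using im by simp
qed

definition tree_avg :: "nat \<Rightarrow> (nat set set \<Rightarrow> real) \<Rightarrow> real" where
  "tree_avg m F = (\<Sum>T\<in>trees m. F T) / real (card (trees m))"

lemma tree_avg_eq_parking:
  assumes "m \<ge> 1"
  shows "tree_avg m (\<lambda>T. F (dfwalk m T)) = (\<Sum>g\<in>parking m. F (pwalk m g)) / real (card (parking m))"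
  using sum_trees_eq_sum_parking[OF assms, of F] sum_trees_eq_sum_parking[OF assms, of "\<lambda>_. 1 :: real"]
  unfolding tree_avg_def by simp

lemma parking_avg_eq_loop_avg:
  assumes m: "m \<ge> 1" and inv: "\<And>w k. F (\<lambda>i. w (i + int k) - w (int k)) = F w"
  shows "(\<Sum>g\<in>parking m. F (loop m g)) / real (card (parking m)) = (\<Sum>g\<in>cars m. F (loop m g)) / real (card (cars m))"
proof -
  have "S / P = (n * S) / (n * P)" if "n \<noteq> 0" for S P n :: real using that by simp
  moreover have "real (card (cars m)) = real m * real (card (parking m))" unfolding card_parking[OF m] card_cars by simp
  ultimately show ?thesis unfolding sum_cars_eq_sum_parking[where F = F, OF m inv] using m by simp
qed

context path_functional
begin

text \<open>Restarting the discrete loop at \<open>k\<close> is a time shift by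
  \<open>k * \<sigma> / m\<close> together with a constant, and the envelope ignores both.\<close>

lemma env_cpath_invariant:
  assumes m: "m \<ge> 1"
  shows "env L (cpath m (\<lambda>i. w (i + int k) - w (int k))) = env L (cpath m w)"
proof -
  have "cpath m (\<lambda>i. w (i + int k) - w (int k)) = (\<lambda>t. cpath m w (t + real k * \<sigma> / real m) + - (scale m * w (int k)))"
  proof
    fix t
    have "real m / \<sigma> * (t + real k * \<sigma> / real m) = real m / \<sigma> * t + of_int (int k)" using m \<sigma> by (simp add: field_simps)
    then have "\<lfloor>real m / \<sigma> * (t + real k * \<sigma> / real m)\<rfloor> = \<lfloor>real m / \<sigma> * t\<rfloor> + int k" by (simp only: floor_add_int)
    then show "cpath m (\<lambda>i. w (i + int k) - w (int k)) t = cpath m w (t + real k * \<sigma> / real m) + - (scale m * w (int k))"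
      unfolding cpath_def by (simp add: algebra_simps)
  qed
  show ?thesis unfolding \<open>cpath m _ = _\<close> by (rule trans[OF env_add_const env_shift])
qed

text \<open>A parking walk is itself nonnegative, so it may compete against its own loop with the
  cut \<open>u = 0\<close>; the price is \<open>L\<close> times their distance, at most one unit
  before rescaling. As the envelope is rotation invariant, the restriction to parking functions can
  then be dropped.\<close>

lemma tree_avg_le_env:
  assumes m: "m \<ge> 1" and L: "L \<ge> 0"
  shows "tree_avg m (\<lambda>T. h (scaled_walk \<sigma> m T)) \<le> loop_avg m (\<lambda>w. env L (cpath m w)) + L * scale m"
proof -
  let ?n = "real (card (parking m))"
  have n: "?n > 0" using card_parking[OF m] m by (metis mult_zero_right of_nat_0_less_iff of_nat_0 neq0_conv not_one_le_zero power_not_zero of_nat_eq_0_iff)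
  have each: "h (step_path \<sigma> m (pwalk m g)) \<le> env L (cpath m (loop m g)) + L * scale m" if g: "g \<in> parking m" for g
  proof (rule env_upper[OF L, where u = 0])
    show "step_path \<sigma> m (pwalk m g) \<in> paths \<sigma>"
      using m pwalk_range[OF g] by (intro step_path_in_paths[OF \<sigma>]) auto
    fix t assume t: "t \<in> {0..\<sigma>}"
    have "real m / \<sigma> * t \<le> real m" using t \<sigma> by (simp add: divide_le_eq mult_left_mono)
    moreover have "0 \<le> real m / \<sigma> * t" using t \<sigma> by simp
    ultimately have fl: "0 \<le> \<lfloor>real m / \<sigma> * t\<rfloor>" "nat \<lfloor>real m / \<sigma> * t\<rfloor> \<le> m" by linarith+
    let ?i = "nat \<lfloor>real m / \<sigma> * t\<rfloor>"
    have "cpath m (loop m g) t = scale m * loop m g (int ?i)" unfolding cpath_def using fl by simp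
    moreover have "cpath m (loop m g) 0 = 0" by (simp add: cpath_def)
    moreover have "step_path \<sigma> m (pwalk m g) t = scale m * pwalk m g ?i" using t by (simp add: step_path_def scale_def)
    ultimately have "\<bar>step_path \<sigma> m (pwalk m g) t - (cpath m (loop m g) (0 + t) - cpath m (loop m g) 0)\<bar> = scale m * \<bar>pwalk m g ?i - loop m g (int ?i)\<bar>"
      using scale_pos[of m] m by (simp add: right_diff_distrib[symmetric] abs_mult)
    also have "\<dots> \<le> scale m * 1" using loop_pwalk[OF g fl(2) m] scale_pos[of m] m by (intro mult_left_mono) auto
    finally show "\<bar>step_path \<sigma> m (pwalk m g) t - (cpath m (loop m g) (0 + t) - cpath m (loop m g) 0)\<bar> \<le> scale m" by simp
  qed
  have "tree_avg m (\<lambda>T. h (scaled_walk \<sigma> m T)) = (\<Sum>g\<in>parking m. h (step_path \<sigma> m (pwalk m g))) / ?n"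
    unfolding scaled_walk_step_path by (rule tree_avg_eq_parking[OF m, of "\<lambda>d. h (step_path \<sigma> m d)"])
  also have "\<dots> \<le> (\<Sum>g\<in>parking m. env L (cpath m (loop m g)) + L * scale m) / ?n"
    using each by (intro divide_right_mono sum_mono) auto
  also have "\<dots> = (\<Sum>g\<in>parking m. env L (cpath m (loop m g))) / ?n + L * scale m"
  proof -
    have "(S + c * b) / c = S / c + b" if "c > 0" for S c b :: real using that by (simp add: add_divide_distrib)
    then show ?thesis using n by (simp only: sum.distrib sum_constant)
  qed
  also have "(\<Sum>g\<in>parking m. env L (cpath m (loop m g))) / ?n = loop_avg m (\<lambda>w. env L (cpath m w))"
    unfolding loop_avg_def by (rule parking_avg_eq_loop_avg[OF m env_cpath_invariant[OF m]])
  finally show ?thesis .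
qed

end

context path_excursion
begin

lemma restr_in_paths:
  assumes out: "\<forall>t. t \<le> 0 \<or> \<sigma> \<le> t \<longrightarrow> apply_bcontfun e t = 0" and pos: "\<forall>t\<in>{0<..<\<sigma>}. apply_bcontfun e t > 0"
  shows "restr \<sigma> (apply_bcontfun e) = apply_bcontfun e" "apply_bcontfun e \<in> paths \<sigma>"
proof -
  show "restr \<sigma> (apply_bcontfun e) = apply_bcontfun e" using out by (auto simp: restr_def fun_eq_iff)
  have ic: "isCont (apply_bcontfun e) t" for t
  proof -
    have "continuous_on UNIV (apply_bcontfun e)" by (rule continuous_on_apply_bcontfun)
    then show ?thesis using continuous_on_eq_continuous_at[OF open_UNIV, of "apply_bcontfun e"] by blast
  qed
  have nn: "0 \<le> apply_bcontfun e t" for t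
    using out pos by (cases "t \<le> 0 \<or> \<sigma> \<le> t") (auto intro: less_imp_le)
  have "apply_bcontfun e integrable_on {0..\<sigma>}"
    by (rule integrable_continuous_real) simp
  moreover have "(apply_bcontfun e \<longlongrightarrow> apply_bcontfun e t) (at_right t)" "(apply_bcontfun e \<longlongrightarrow> apply_bcontfun e t) (at_left t)" for t
    using ic[of t] unfolding isCont_def by (auto intro: filterlim_mono[OF _ order_refl at_le])
  ultimately show "apply_bcontfun e \<in> paths \<sigma>"
    unfolding paths_def skorohod_D_def using nn out by auto
qed

text \<open>For large \<open>L\<close> only competitors with small \<open>r\<close> count. At the
  time when the periodic path returns to its zero, a competitor cut at \<open>s\<close> faces the
  value \<open>- e s\<close> and is itself nonnegative, so \<open>e s \<le> r\<close>. Since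
  \<open>e\<close> is positive inside, \<open>s\<close> is near an end of the period, the rotation
  is nearly the identity, and \<open>h_cont\<close> applies.\<close>

lemma env_periodic_upper:
  assumes out: "\<forall>t. t \<le> 0 \<or> \<sigma> \<le> t \<longrightarrow> apply_bcontfun e t = 0" and pos: "\<forall>t\<in>{0<..<\<sigma>}. apply_bcontfun e t > 0"
  shows "(\<lambda>n. env (real n) (periodic \<sigma> e)) \<longlonglongrightarrow> h (apply_bcontfun e)"
proof (rule LIMSEQ_I)
  let ?e = "apply_bcontfun e"
  note inp = restr_in_paths[OF out pos]
  have pe: "periodic \<sigma> e t = ?e t" if "t \<in> {0..\<sigma>}" for t
  proof (cases "t = \<sigma>")
    case True
    then show ?thesis using out periodic_shift[of e 0 1] periodic_in[of 0 e] \<sigma> by simp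
  qed (use that periodic_in in auto)
  have e0: "?e 0 = 0" "?e \<sigma> = 0" using out by auto
  have lower: "h ?e \<le> env L (periodic \<sigma> e)" if "L \<ge> 0" for L
  proof -
    have "h ?e \<le> env L (periodic \<sigma> e) + L * 0"
      by (rule env_upper[OF that inp(2), where u = 0]) (use pe \<sigma> e0 in simp)
    then show ?thesis by simp
  qed
  have nn: "0 \<le> ?e t" for t using inp(2) by (auto simp: paths_def)
  fix \<eta> :: real assume \<eta>: "0 < \<eta>"
  obtain \<gamma> where \<gamma>: "\<gamma> > 0" "\<And>y. y \<in> paths \<sigma> \<Longrightarrow> (\<And>t. t \<in> {0..\<sigma>} \<Longrightarrow> \<bar>y t - ?e t\<bar> \<le> \<gamma>) \<Longrightarrow> \<bar>h y - h ?e\<bar> < \<eta> / 2"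
    using h_cont[OF inp(2) _ half_gt_zero[OF \<eta>]] by (metis continuous_on_apply_bcontfun continuous_on_subset subset_UNIV)
  obtain d where d: "d > 0" "\<And>s t. \<bar>s - t\<bar> \<le> d \<Longrightarrow> \<bar>?e s - ?e t\<bar> \<le> \<gamma> / 8"
    using uniformly_continuous_excursion[OF \<sigma> out, of "\<gamma> / 8"] \<gamma>(1) by auto
  define d' where "d' = min d (\<sigma> / 4)"
  have d': "d' > 0" "d' \<le> d" "d' \<le> \<sigma> / 4" using d \<sigma> by (auto simp: d'_def)
  \<comment> \<open>The step \<open>a\<close> may cross an end of the period on either side; there
    both values are within \<open>\<gamma> / 8\<close> of \<open>0\<close>.\<close>
  have per_close: "\<bar>periodic \<sigma> e (t + a) - periodic \<sigma> e t\<bar> \<le> \<gamma> / 4" if a: "\<bar>a\<bar> \<le> d'" for t a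
  proof -
    define q where "q = \<lfloor>t / \<sigma>\<rfloor>"
    define s where "s = t - \<sigma> * of_int q"
    have "of_int q \<le> t / \<sigma>" "t / \<sigma> < of_int q + 1" unfolding q_def by linarith+
    then have s: "0 \<le> s" "s < \<sigma>" unfolding s_def using \<sigma> by (simp_all add: le_divide_eq divide_less_eq algebra_simps)
    have p1: "periodic \<sigma> e t = ?e s" using periodic_shift[of e s q] periodic_in[OF s] unfolding s_def by simp
    have p2: "periodic \<sigma> e (t + a) = periodic \<sigma> e (s + a)" using periodic_shift[of e "s + a" q] unfolding s_def by (simp add: algebra_simps)
    have c: "\<bar>?e x - ?e y\<bar> \<le> \<gamma> / 8" if "\<bar>x - y\<bar> \<le> d'" for x y using d(2) d'(2) that by auto
    consider "0 \<le> s + a \<and> s + a < \<sigma>" | "s + a < 0" | "\<sigma> \<le> s + a" by linarith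
    then show ?thesis
    proof cases
      case 1
      then have "periodic \<sigma> e (s + a) = ?e (s + a)" by (intro periodic_in) auto
      then show ?thesis unfolding p1 p2 using c[of "s + a" s] a \<gamma>(1) by auto
    next
      case 2
      have "periodic \<sigma> e (s + a) = periodic \<sigma> e (s + a + \<sigma>)" using periodic_shift[of e "s + a" 1] by simp
      also have "\<dots> = ?e (s + a + \<sigma>)" using 2 s a d' by (intro periodic_in) auto
      finally have "periodic \<sigma> e (s + a) = ?e (s + a + \<sigma>)" .
      moreover have "\<bar>?e (s + a + \<sigma>)\<bar> \<le> \<gamma> / 8" using c[of "s + a + \<sigma>" \<sigma>] 2 s a e0 by auto
      moreover have "\<bar>?e s\<bar> \<le> \<gamma> / 8" using c[of s 0] 2 s a e0 by auto
      ultimately show ?thesis unfolding p1 p2 by linarith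
    next
      case 3
      have "periodic \<sigma> e (s + a) = periodic \<sigma> e (s + a - \<sigma>)" using periodic_shift[of e "s + a - \<sigma>" 1] by simp
      also have "\<dots> = ?e (s + a - \<sigma>)" using 3 s a d' by (intro periodic_in) auto
      finally have "periodic \<sigma> e (s + a) = ?e (s + a - \<sigma>)" .
      moreover have "\<bar>?e (s + a - \<sigma>)\<bar> \<le> \<gamma> / 8" using c[of "s + a - \<sigma>" 0] 3 s a e0 by auto
      moreover have "\<bar>?e s\<bar> \<le> \<gamma> / 8" using c[of s \<sigma>] 3 s a e0 by auto
      ultimately show ?thesis unfolding p1 p2 by linarith
    qed
  qed
  have "compact (?e ` {d'..\<sigma> - d'})" by (intro compact_continuous_image) auto
  moreover have "?e ` {d'..\<sigma> - d'} \<noteq> {}" using d' by auto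
  ultimately obtain a0 where a0: "a0 \<in> ?e ` {d'..\<sigma> - d'}" "\<forall>b\<in>?e ` {d'..\<sigma> - d'}. a0 \<le> b"
    using compact_attains_inf by metis
  have a0p: "a0 > 0" using a0(1) pos d' by auto
  \<comment> \<open>Below \<open>a0 / 2\<close> the cut is excluded from
    \<open>{d'..\<sigma> - d'}\<close>; below \<open>\<gamma> / 4\<close> the competitor is
    uniformly close. For \<open>r \<ge> r0\<close> the penalty with \<open>n \<ge> N\<close> exceeds
    \<open>B + 1\<close>.\<close>
  define r0 where "r0 = min (a0 / 2) (\<gamma> / 4)"
  have r0: "r0 > 0" using a0p \<gamma>(1) by (simp add: r0_def)
  obtain N :: nat where N: "(B + 1) / r0 < real N" using reals_Archimedean2 by blast
  have upper: "env (real n) (periodic \<sigma> e) \<le> h ?e + \<eta> / 2" if n: "n \<ge> N" for n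
  proof (rule env_least)
    show "0 \<le> h ?e + \<eta> / 2" using h_range[OF inp(2)] \<eta> by simp
    fix u y r assume y: "y \<in> paths \<sigma>" and r: "\<And>t. t \<in> {0..\<sigma>} \<Longrightarrow> \<bar>y t - (periodic \<sigma> e (u + t) - periodic \<sigma> e u)\<bar> \<le> r"
    show "h y - real n * r \<le> h ?e + \<eta> / 2"
    proof (cases "r < r0")
      case False
      have "B + 1 < real N * r0" using N r0 by (simp add: divide_less_eq)
      also have "\<dots> \<le> real n * r" using n False r0 by (intro mult_mono) auto
      finally show ?thesis using h_range[OF y] h_range[OF inp(2)] \<eta> by simp
    next
      case True
      define q where "q = \<lfloor>u / \<sigma>\<rfloor>"
      define s where "s = u - \<sigma> * of_int q"
      have "of_int q \<le> u / \<sigma>" "u / \<sigma> < of_int q + 1" unfolding q_def by linarith+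
      then have s: "0 \<le> s" "s < \<sigma>" unfolding s_def using \<sigma> by (simp_all add: le_divide_eq divide_less_eq algebra_simps)
      have pu: "periodic \<sigma> e (u + t) = periodic \<sigma> e (s + t)" for t using periodic_shift[of e "s + t" q] unfolding s_def by (simp add: algebra_simps)
      have pu0: "periodic \<sigma> e u = ?e s" using pu[of 0] periodic_in[OF s] by simp
      have "periodic \<sigma> e (u + (\<sigma> - s)) = 0" using pu[of "\<sigma> - s"] pe[of \<sigma>] \<sigma> e0 by simp
      moreover have "0 \<le> y (\<sigma> - s)" using y by (simp add: paths_def)
      ultimately have es: "?e s \<le> r" using r[of "\<sigma> - s"] s pu0 by simp
      have "\<not> (d' \<le> s \<and> s \<le> \<sigma> - d')"
      proof
        assume "d' \<le> s \<and> s \<le> \<sigma> - d'"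
        then have "a0 \<le> ?e s" using a0(2) by auto
        then show False using es True a0p by (simp add: r0_def)
      qed
      then obtain a where a: "\<bar>a\<bar> \<le> d'" "\<And>t. periodic \<sigma> e (s + t) = periodic \<sigma> e (t + a)"
      proof (cases "s < d'")
        case True
        show ?thesis by (rule that[of s]) (use True s in \<open>auto simp: add.commute\<close>)
      next
        case False
        assume "\<not> (d' \<le> s \<and> s \<le> \<sigma> - d')"
        then have "\<sigma> - d' < s" using False by auto
        moreover have "periodic \<sigma> e (s + t) = periodic \<sigma> e (t + (s - \<sigma>))" for t
          using periodic_shift[of e "t + (s - \<sigma>)" 1] by (simp add: algebra_simps)
        ultimately show ?thesis using s by (intro that[of "s - \<sigma>"]) auto
      qed
      have "\<bar>y t - ?e t\<bar> \<le> \<gamma>" if t: "t \<in> {0..\<sigma>}" for t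
      proof -
        have "\<bar>periodic \<sigma> e (u + t) - ?e t\<bar> \<le> \<gamma> / 4" unfolding pu a(2) pe[OF t, symmetric] by (rule per_close[OF a(1)])
        moreover have "r < \<gamma> / 4" using True by (simp add: r0_def)
        moreover have "\<bar>y t - (periodic \<sigma> e (u + t) - ?e s)\<bar> \<le> r" using r[OF t] unfolding pu0 .
        ultimately show ?thesis using es nn[of s] by linarith
      qed
      then have "\<bar>h y - h ?e\<bar> < \<eta> / 2" by (rule \<gamma>(2)[OF y])
      moreover have "0 \<le> r" using r[of 0] \<sigma> by (auto intro: order_trans[OF abs_ge_zero])
      then have "0 \<le> real n * r" by simp
      ultimately show ?thesis by linarith
    qed
  qed simp
  show "\<exists>no. \<forall>n\<ge>no. norm (env (real n) (periodic \<sigma> e) - h ?e) < \<eta>"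
  proof (intro exI[of _ N] allI impI)
    fix n assume "N \<le> n"
    from upper[OF this] lower[of "real n"] \<eta> show "norm (env (real n) (periodic \<sigma> e) - h ?e) < \<eta>" by simp
  qed
qed

text \<open>Only a bound from above comes out, because the envelope dominates \<open>h\<close>; in
  the proof \<open>n\<close> plays the role of \<open>L\<close> and is fixed before
  \<open>m\<close>.\<close>

theorem tree_avg_limsup:
  assumes meas: "(\<lambda>e. h (restr \<sigma> (apply_bcontfun e))) \<in> borel_measurable borel" and \<epsilon>: "\<epsilon> > 0"
  shows "eventually (\<lambda>m. tree_avg m (\<lambda>T. h (scaled_walk \<sigma> m T)) < (\<integral>e. h (restr \<sigma> (apply_bcontfun e)) \<partial>\<mu>) + \<epsilon>) sequentially"
proof -
  let ?I = "\<integral>e. h (restr \<sigma> (apply_bcontfun e)) \<partial>\<mu>"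
  have "(\<lambda>n. \<integral>e. env (real n) (periodic \<sigma> e) \<partial>\<mu>) \<longlonglongrightarrow> ?I"
  proof (rule integral_dominated_convergence[where w = "\<lambda>_. B"])
    show "(\<lambda>e. h (restr \<sigma> (apply_bcontfun e))) \<in> borel_measurable \<mu>" using meas by simp
    show "(\<lambda>e. env (real n) (periodic \<sigma> e)) \<in> borel_measurable \<mu>" for n using env_periodic_measurable[of "real n"] by simp
    show "integrable \<mu> (\<lambda>_. B)" by (rule integrable_const)
    show "AE e in \<mu>. (\<lambda>n. env (real n) (periodic \<sigma> e)) \<longlonglongrightarrow> h (restr \<sigma> (apply_bcontfun e))"
      using outside positive_inside
    proof eventually_elim
      case (elim e)
      show ?case unfolding restr_in_paths(1)[OF elim] by (rule env_periodic_upper[OF elim])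
    qed
    show "AE e in \<mu>. norm (env (real n) (periodic \<sigma> e)) \<le> B" for n using env_range[of "real n"] by simp
  qed
  then have "eventually (\<lambda>n. (\<integral>e. env (real n) (periodic \<sigma> e) \<partial>\<mu>) < ?I + \<epsilon> / 3) sequentially"
    using \<epsilon> by (intro order_tendstoD(2)) auto
  then obtain n where n: "(\<integral>e. env (real n) (periodic \<sigma> e) \<partial>\<mu>) < ?I + \<epsilon> / 3"
    by (metis (no_types, lifting) eventually_sequentially order_refl)
  have "eventually (\<lambda>m. loop_avg m (\<lambda>w. env (real n) (cpath m w)) < ?I + \<epsilon> / 3) sequentially"
    by (rule order_tendstoD(2)[OF env_limit n]) simp
  moreover have "(\<lambda>m. real n * scale m) \<longlonglongrightarrow> real n * 0" by (rule tendsto_mult[OF tendsto_const scale_lim])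
  then have "eventually (\<lambda>m. real n * scale m < \<epsilon> / 3) sequentially" using \<epsilon> by (intro order_tendstoD(2)) auto
  moreover have "eventually (\<lambda>m. m \<ge> 1) sequentially" by (rule eventually_ge_at_top)
  ultimately show ?thesis
  proof eventually_elim
    case (elim m)
    then show ?case using tree_avg_le_env[OF elim(3), of "real n"] \<epsilon> by linarith
  qed
qed

end

text \<open>The upper bound is applied to \<open>h + B\<close> and to \<open>B - h\<close>, both
  with values in \<open>{0..2 * B}\<close> on \<open>paths \<sigma>\<close>; together they give the
  limit.\<close>

theorem tree_avg_limit:
  fixes h :: "(real \<Rightarrow> real) \<Rightarrow> real"
  assumes \<sigma>: "\<sigma> > 0" and law: "brownian_excursion_law \<sigma> \<mu>"
    and bound: "\<And>y. y \<in> paths \<sigma> \<Longrightarrow> \<bar>h y\<bar> \<le> B"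
    and cont: "\<And>x \<eta>. x \<in> paths \<sigma> \<Longrightarrow> continuous_on {0..\<sigma>} x \<Longrightarrow> \<eta> > 0 \<Longrightarrow>
      \<exists>\<gamma>>0. \<forall>y\<in>paths \<sigma>. (\<forall>t\<in>{0..\<sigma>}. \<bar>y t - x t\<bar> \<le> \<gamma>) \<longrightarrow> \<bar>h y - h x\<bar> < \<eta>"
    and meas: "(\<lambda>e. h (restr \<sigma> (apply_bcontfun e))) \<in> borel_measurable borel"
  shows "(\<lambda>m. tree_avg m (\<lambda>T. h (scaled_walk \<sigma> m T))) \<longlonglongrightarrow> (\<integral>e. h (restr \<sigma> (apply_bcontfun e)) \<partial>\<mu>)"
proof -
  interpret excursion \<sigma> \<mu> by (rule excursion.intro[OF \<sigma> law])
  let ?I = "\<integral>e. h (restr \<sigma> (apply_bcontfun e)) \<partial>\<mu>"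
  let ?A = "\<lambda>m. tree_avg m (\<lambda>T. h (scaled_walk \<sigma> m T))"
  have "(\<lambda>_. 0) \<in> paths \<sigma>" by (auto simp: paths_def skorohod_D_def)
  then have B0: "0 \<le> B" using bound by (meson abs_ge_zero order_trans)
  have in_paths: "AE e in \<mu>. restr \<sigma> (apply_bcontfun e) \<in> paths \<sigma>"
  proof -
    interpret P0: path_functional \<sigma> "\<lambda>_. 0" 0 by standard (auto simp: \<sigma> intro: exI[of _ 1])
    interpret P1: path_excursion \<sigma> "\<lambda>_. 0" 0 \<mu> by unfold_locales
    show ?thesis using outside positive_inside
      by eventually_elim (use P1.restr_in_paths in simp)
  qed
  have ih: "integrable \<mu> (\<lambda>e. h (restr \<sigma> (apply_bcontfun e)))"
  proof (rule integrable_const_bound[where B = B])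
    show "AE e in \<mu>. norm (h (restr \<sigma> (apply_bcontfun e))) \<le> B" using in_paths by eventually_elim (simp add: bound)
  qed (use meas in simp)
  have tree_ne: "real (card (trees m)) > 0" if "m \<ge> 1" for m
  proof -
    have "real m * real (card (parking m)) > 0" using card_parking[OF that] that by simp
    then show ?thesis using sum_trees_eq_sum_parking[OF that, of "\<lambda>_. 1 :: real"] by (simp add: zero_less_mult_iff)
  qed
  have side: "eventually (\<lambda>m. s * ?A m < s * ?I + \<epsilon>) sequentially" if \<epsilon>: "\<epsilon> > 0" and s: "s = 1 \<or> s = -1" for \<epsilon> s
  proof -
    have "path_functional \<sigma> (\<lambda>y. s * h y + B) (2 * B)"
    proof
      show "0 \<le> s * h y + B \<and> s * h y + B \<le> 2 * B" if "y \<in> paths \<sigma>" for y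
        using bound[OF that] s by (auto simp: abs_le_iff)
      show "\<exists>\<gamma>>0. \<forall>y\<in>paths \<sigma>. (\<forall>t\<in>{0..\<sigma>}. \<bar>y t - x t\<bar> \<le> \<gamma>) \<longrightarrow> \<bar>s * h y + B - (s * h x + B)\<bar> < \<eta>"
        if "x \<in> paths \<sigma>" "continuous_on {0..\<sigma>} x" "0 < \<eta>" for x \<eta>
      proof -
        have "\<bar>s * a + B - (s * b + B)\<bar> = \<bar>a - b\<bar>" for a b using s by auto
        then show ?thesis using cont[OF that] by simp
      qed
    qed (use \<sigma> B0 in auto)
    then interpret P: path_excursion \<sigma> "\<lambda>y. s * h y + B" "2 * B" \<mu>
      unfolding path_excursion_def by (simp add: excursion_axioms)
    have ev: "eventually (\<lambda>m. tree_avg m (\<lambda>T. s * h (scaled_walk \<sigma> m T) + B) < (\<integral>e. s * h (restr \<sigma> (apply_bcontfun e)) + B \<partial>\<mu>) + \<epsilon>) sequentially"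
      using meas by (intro P.tree_avg_limsup \<epsilon>) simp
    have i1: "(\<integral>e. s * h (restr \<sigma> (apply_bcontfun e)) + B \<partial>\<mu>) = s * ?I + B"
    proof -
      have "(\<integral>e. s * h (restr \<sigma> (apply_bcontfun e)) + B \<partial>\<mu>) = (\<integral>e. s * h (restr \<sigma> (apply_bcontfun e)) \<partial>\<mu>) + (\<integral>e. B \<partial>\<mu>)"
        by (rule Bochner_Integration.integral_add) (intro integrable_mult_right ih, rule integrable_const)
      then show ?thesis by (simp add: prob_space[simplified])
    qed
    have i2: "tree_avg m (\<lambda>T. s * h (scaled_walk \<sigma> m T) + B) = s * ?A m + B" if "m \<ge> 1" for m
    proof -
      have "(s * S + c * b) / c = s * (S / c) + b" if "c > 0" for S c b :: real using that by (simp add: add_divide_distrib)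
      then show ?thesis
        unfolding tree_avg_def using tree_ne[OF that] by (simp only: sum.distrib sum_constant sum_distrib_left[symmetric])
    qed
    show ?thesis using ev eventually_ge_at_top[of 1]
    proof eventually_elim
      case (elim m)
      then show ?case unfolding i1 i2[OF elim(2)] by linarith
    qed
  qed
  show ?thesis
  proof (rule order_tendstoI)
    fix a assume "a < ?I"
    then show "eventually (\<lambda>m. a < ?A m) sequentially" using side[of "?I - a" "-1"] by (auto elim: eventually_mono)
  next
    fix a assume "?I < a"
    then show "eventually (\<lambda>m. ?A m < a) sequentially" using side[of "a - ?I" 1] by (auto elim: eventually_mono)
  qed
qed

section \<open>Exponential moments of the area\<close>

text \<open>Unlike a maximum taken relative to a fixed start, the oscillation does not change under
  rotation; this allows the passage from parking functions to all assignments of cars.\<close>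

definition osc :: "(int \<Rightarrow> real) \<Rightarrow> real" where
  "osc w = Sup {w i - w j | i j. True}"

text \<open>Restricted to half of the cycle because the maximal inequality requires
  \<open>2 * h \<le> m\<close>.\<close>

definition half_max :: "nat \<Rightarrow> (int \<Rightarrow> real) \<Rightarrow> real" where
  "half_max m w = Max ((\<lambda>j. \<bar>w (int j)\<bar>) ` {..m div 2})"

lemma osc_shift: "osc (\<lambda>i. w (i + int k) - w (int k)) = osc w"
proof -
  have "{w (i + int k) - w (int k) - (w (j + int k) - w (int k)) | i j. True} = {w i - w j | i j. True}"
  proof (intro equalityI subsetI)
    fix x assume "x \<in> {w i - w j | i j. True}"
    then obtain i j where "x = w i - w j" by auto
    then have "x = w (i - int k + int k) - w (int k) - (w (j - int k + int k) - w (int k))" by simp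
    then show "x \<in> {w (i + int k) - w (int k) - (w (j + int k) - w (int k)) | i j. True}" by blast
  next
    fix x assume "x \<in> {w (i + int k) - w (int k) - (w (j + int k) - w (int k)) | i j. True}"
    then obtain i j where "x = w (i + int k) - w (j + int k)" by auto
    then show "x \<in> {w i - w j | i j. True}" by blast
  qed
  then show ?thesis unfolding osc_def by simp
qed

lemma half_max_ge: "j \<le> m div 2 \<Longrightarrow> \<bar>w (int j)\<bar> \<le> half_max m w"
  unfolding half_max_def by (intro Max_ge) auto

lemma half_max_nonneg: "0 \<le> half_max m w"
  using half_max_ge[of 0 m w] by linarith

lemma half_max_ge_iff: "x \<le> half_max m w \<longleftrightarrow> (\<exists>j\<le>m div 2. \<bar>w (int j)\<bar> \<ge> x)"
  unfolding half_max_def by (subst Max_ge_iff) auto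

text \<open>The second half of the cycle is reached from the midpoint, where the rotated loop
  starts; the value at the midpoint itself belongs to the first half.\<close>

lemma loop_le_half_max:
  assumes m: "m \<ge> 1"
  shows "\<bar>loop m g i\<bar> \<le> half_max m (loop m g)
    + half_max m (\<lambda>i. loop m g (i + int (m div 2)) - loop m g (int (m div 2)))" (is "_ \<le> ?U + ?V")
proof -
  define r where "r = nat (i mod int m)"
  have r: "int r = i mod int m" "r < m" using m by (auto simp: r_def nat_less_iff)
  have l: "loop m g i = loop m g (int r)" unfolding r(1) by (rule loop_mod[symmetric])
  show ?thesis
  proof (cases "r \<le> m div 2")
    case True
    then show ?thesis unfolding l using half_max_ge[of r m "loop m g"] half_max_nonneg by (smt (verit))
  next
    case False
    then have "r - m div 2 \<le> m div 2" using r(2) by linarith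
    from half_max_ge[OF this, of "\<lambda>i. loop m g (i + int (m div 2)) - loop m g (int (m div 2))"]
    have "\<bar>loop m g (int (r - m div 2) + int (m div 2)) - loop m g (int (m div 2))\<bar> \<le> ?V" .
    then have "\<bar>loop m g (int r) - loop m g (int (m div 2))\<bar> \<le> ?V"
    proof -
      have "int (r - m div 2) + int (m div 2) = int r" using False by linarith
      then show ?thesis using \<open>\<bar>loop m g (int (r - m div 2) + _) - _\<bar> \<le> ?V\<close> by (simp only:)
    qed
    moreover have "\<bar>loop m g (int (m div 2))\<bar> \<le> ?U" by (rule half_max_ge) simp
    moreover have "\<bar>x\<bar> \<le> U + V" if "\<bar>x - y\<bar> \<le> V" "\<bar>y\<bar> \<le> U" for x y U V :: real using that by linarith
    ultimately show ?thesis unfolding l by metis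
  qed
qed

lemma osc_loop:
  assumes m: "m \<ge> 1"
  shows "osc (loop m g) \<le> 2 * (half_max m (loop m g)
      + half_max m (\<lambda>i. loop m g (i + int (m div 2)) - loop m g (int (m div 2))))" (is "_ \<le> 2 * ?U")
    and "loop m g i \<le> osc (loop m g)"
proof -
  have le: "loop m g i - loop m g j \<le> 2 * ?U" for i j
  proof -
    have "x - y \<le> 2 * U" if "\<bar>x\<bar> \<le> U" "\<bar>y\<bar> \<le> U" for x y U :: real using that by linarith
    then show ?thesis using loop_le_half_max[OF m, of g i] loop_le_half_max[OF m, of g j] by metis
  qed
  show "osc (loop m g) \<le> 2 * ?U" unfolding osc_def by (rule cSup_least) (use le in auto)
  have "bdd_above {loop m g i - loop m g j | i j. True}"
    by (rule bdd_aboveI[of _ "2 * ?U"]) (use le in blast)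
  then have "loop m g i - loop m g 0 \<le> osc (loop m g)"
    unfolding osc_def by (intro cSup_upper) blast+
  then show "loop m g i \<le> osc (loop m g)" by simp
qed

text \<open>Summation over integer levels \<open>k\<close> of the rescaled maximum. With
  \<open>\<theta> = b / sqrt m\<close> the tail decays like \<open>exp (- b * k / 2)\<close>, and
  \<open>b = 2 * (q + 1)\<close> beats \<open>exp (q * k)\<close> by \<open>exp (- k)\<close>,
  leaving a geometric series. The lower bound on \<open>m\<close> is the condition
  \<open>\<theta> \<le> 1\<close>.\<close>

lemma half_max_exp_moment:
  fixes q :: real assumes q: "q \<ge> 0"
  obtains C where "C \<ge> 0" "\<And>m. m \<ge> 1 \<Longrightarrow> (2 * (q + 1))\<^sup>2 \<le> real m \<Longrightarrow>
    (\<Sum>g\<in>cars m. exp (q * (half_max m (loop m g) / sqrt (real m)))) \<le> C * real (card (cars m))"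
proof -
  define b where "b = 2 * (q + 1)"
  define S where "S = (\<Sum>k. exp (-1 :: real) ^ k)"
  have sm: "summable (\<lambda>k. exp (-1 :: real) ^ k)" by (rule summable_geometric) simp
  have S0: "0 \<le> S" unfolding S_def by (rule suminf_nonneg[OF sm]) simp
  show thesis
  proof (rule that)
    show "0 \<le> 2 * exp (q + b\<^sup>2 / 2) * S" using S0 by simp
    fix m :: nat assume m: "m \<ge> 1" and bm: "(2 * (q + 1))\<^sup>2 \<le> real m"
    let ?s = "sqrt (real m)" and ?h = "m div 2" and ?N = "real m ^ (m - 1)"
    let ?V = "\<lambda>g. half_max m (loop m g) / ?s"
    have s: "?s > 0" using m by simp
    have V0: "0 \<le> ?V g" for g using half_max_nonneg s by simp
    have b0: "0 < b" using q by (simp add: b_def)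
    have bs: "b \<le> ?s" using bm b0 unfolding b_def[symmetric] by (simp add: real_le_rsqrt)
    define K where "K = nat \<lfloor>\<Sum>g\<in>cars m. ?V g\<rfloor> + 1"
    have VK: "nat \<lfloor>?V g\<rfloor> < K" if "g \<in> cars m" for g
    proof -
      have "?V g \<le> (\<Sum>g\<in>cars m. ?V g)" using that V0 by (intro member_le_sum) auto
      then have "\<lfloor>?V g\<rfloor> \<le> \<lfloor>\<Sum>g\<in>cars m. ?V g\<rfloor>" by (rule floor_mono)
      then show ?thesis unfolding K_def by linarith
    qed
    have tail: "real (card {g \<in> cars m. real k \<le> ?V g}) \<le> 2 * ?N * exp (b\<^sup>2 / 2 - (q + 1) * real k)" for k
    proof -
      have eq: "{g \<in> cars m. real k \<le> ?V g} = {g \<in> cars m. \<exists>j\<le>?h. \<bar>loop m g (int j)\<bar> \<ge> real k * ?s}"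
        using s by (simp add: le_divide_eq half_max_ge_iff)
      have "real (card {g \<in> cars m. \<exists>j\<le>?h. \<bar>loop m g (int j)\<bar> \<ge> real k * ?s})
        \<le> 2 * ?N * exp (real ?h * (b / ?s)\<^sup>2 - (b / ?s) * (real k * ?s) / 2)"
        using m b0 bs s by (intro maximal_inequality) auto
      also have "\<dots> \<le> 2 * ?N * exp (b\<^sup>2 / 2 - (q + 1) * real k)"
      proof -
        have "real ?h * (b / ?s)\<^sup>2 = (2 * real ?h) * b\<^sup>2 / (2 * real m)" using m by (simp add: power_divide)
        also have "\<dots> \<le> real m * b\<^sup>2 / (2 * real m)"
        proof (intro divide_right_mono mult_right_mono)
          have "2 * ?h \<le> m" by simp
          then show "2 * real ?h \<le> real m" by linarith
        qed auto
        also have "\<dots> = b\<^sup>2 / 2" using m by simp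
        finally have "real ?h * (b / ?s)\<^sup>2 \<le> b\<^sup>2 / 2" .
        moreover have "(b / ?s) * (real k * ?s) / 2 = (q + 1) * real k" using s by (simp add: b_def)
        ultimately show ?thesis by (intro mult_left_mono) auto
      qed
      finally show ?thesis unfolding eq .
    qed
    have "exp (q * ?V g) \<le> (\<Sum>k<K. exp (q * (real k + 1)) * of_bool (real k \<le> ?V g))" if g: "g \<in> cars m" for g
    proof -
      let ?k = "nat \<lfloor>?V g\<rfloor>"
      have k: "real ?k \<le> ?V g" "?V g \<le> real ?k + 1" using V0[of g] by linarith+
      have "exp (q * ?V g) \<le> exp (q * (real ?k + 1)) * of_bool (real ?k \<le> ?V g)"
        unfolding eqTrueI[OF k(1)] using mult_left_mono[OF k(2) q] by (simp only: of_bool_eq mult_1_right exp_le_cancel_iff)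
      also have "\<dots> \<le> (\<Sum>k<K. exp (q * (real k + 1)) * of_bool (real k \<le> ?V g))"
        using VK[OF g] by (intro member_le_sum[of ?k "{..<K}" "\<lambda>k. exp (q * (real k + 1)) * of_bool (real k \<le> ?V g)"]) auto
      finally show ?thesis .
    qed
    then have "(\<Sum>g\<in>cars m. exp (q * ?V g)) \<le> (\<Sum>g\<in>cars m. \<Sum>k<K. exp (q * (real k + 1)) * of_bool (real k \<le> ?V g))"
      by (rule sum_mono)
    also have "\<dots> = (\<Sum>k<K. \<Sum>g\<in>cars m. exp (q * (real k + 1)) * of_bool (real k \<le> ?V g))"
      by (rule sum.swap)
    also have "\<dots> = (\<Sum>k<K. exp (q * (real k + 1)) * real (card {g \<in> cars m. real k \<le> ?V g}))"
    proof (rule sum.cong[OF refl])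
      fix k
      have "(\<Sum>g\<in>cars m. of_bool (real k \<le> ?V g)) = real (card {g \<in> cars m. real k \<le> ?V g})"
        by (subst sum_of_bool_eq) (auto intro: arg_cong[of _ _ card])
      then show "(\<Sum>g\<in>cars m. exp (q * (real k + 1)) * of_bool (real k \<le> ?V g)) = exp (q * (real k + 1)) * real (card {g \<in> cars m. real k \<le> ?V g})"
        by (simp only: sum_distrib_left[symmetric])
    qed
    also have "\<dots> \<le> (\<Sum>k<K. exp (q * (real k + 1)) * (2 * ?N * exp (b\<^sup>2 / 2 - (q + 1) * real k)))"
      by (intro sum_mono mult_left_mono tail) simp
    also have "\<dots> = (\<Sum>k<K. 2 * ?N * exp (q + b\<^sup>2 / 2) * exp (-1) ^ k)"
    proof (rule sum.cong[OF refl])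
      fix k
      have "exp (q * (real k + 1)) * exp (b\<^sup>2 / 2 - (q + 1) * real k) = exp (q + b\<^sup>2 / 2) * exp (- real k)"
        unfolding exp_add[symmetric] by (rule arg_cong[of _ _ exp]) (simp add: algebra_simps)
      moreover have "exp (- real k) = exp (-1) ^ k" using exp_of_nat_mult[of k "-1 :: real"] by simp
      ultimately show "exp (q * (real k + 1)) * (2 * ?N * exp (b\<^sup>2 / 2 - (q + 1) * real k)) = 2 * ?N * exp (q + b\<^sup>2 / 2) * exp (-1) ^ k"
        by (simp only: mult.assoc mult.left_commute[of "exp (q * (real k + 1))"])
    qed
    also have "\<dots> = 2 * ?N * exp (q + b\<^sup>2 / 2) * (\<Sum>k<K. exp (-1) ^ k)" by (rule sum_distrib_left[symmetric])
    also have "\<dots> \<le> 2 * ?N * exp (q + b\<^sup>2 / 2) * S"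
      unfolding S_def by (intro mult_left_mono sum_le_suminf sm) auto
    also have "\<dots> = 2 * exp (q + b\<^sup>2 / 2) * S * real (card (cars m))" by (simp add: card_cars)
    finally show "(\<Sum>g\<in>cars m. exp (q * ?V g)) \<le> 2 * exp (q + b\<^sup>2 / 2) * S * real (card (cars m))" .
  qed
qed

text \<open>The oscillation is at most twice the sum of two half maxima, which have equal moments by
  rotation. The inequality \<open>2 * u * v \<le> u\<^sup>2 + v\<^sup>2\<close> separates them and
  doubles the exponent again, whence \<open>4 * q\<close>.\<close>

lemma osc_exp_moment:
  fixes q :: real assumes q: "q \<ge> 0"
  obtains C where "\<And>m. m \<ge> 1 \<Longrightarrow> (2 * (4 * q + 1))\<^sup>2 \<le> real m \<Longrightarrow>
    (\<Sum>g\<in>cars m. exp (q * (osc (loop m g) / sqrt (real m)))) \<le> C * real (card (cars m))"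
proof -
  obtain C where C: "\<And>m. m \<ge> 1 \<Longrightarrow> (2 * (4 * q + 1))\<^sup>2 \<le> real m \<Longrightarrow>
    (\<Sum>g\<in>cars m. exp (4 * q * (half_max m (loop m g) / sqrt (real m)))) \<le> C * real (card (cars m))"
    using half_max_exp_moment[of "4 * q"] q by (metis mult_nonneg_nonneg zero_le_numeral)
  show thesis
  proof (rule that)
    fix m :: nat assume m: "m \<ge> 1" and qm: "(2 * (4 * q + 1))\<^sup>2 \<le> real m"
    let ?s = "sqrt (real m)"
    let ?a = "\<lambda>w. exp (4 * q * (half_max m w / ?s))"
    let ?w = "\<lambda>g i. loop m g (i + int (m div 2)) - loop m g (int (m div 2))"
    have s: "?s > 0" using m by simp
    have each: "exp (q * (osc (loop m g) / ?s)) \<le> ?a (loop m g) / 2 + ?a (?w g) / 2" for g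
    proof -
      let ?u = "2 * q * (half_max m (loop m g) / ?s)" and ?v = "2 * q * (half_max m (?w g) / ?s)"
      have "q * (osc (loop m g) / ?s) \<le> q * ((2 * (half_max m (loop m g) + half_max m (?w g))) / ?s)"
        using osc_loop(1)[OF m, of g] q s by (intro mult_left_mono divide_right_mono) auto
      also have "\<dots> = ?u + ?v" by (simp add: algebra_simps add_divide_distrib)
      finally have "exp (q * (osc (loop m g) / ?s)) \<le> exp ?u * exp ?v" by (simp add: exp_add[symmetric])
      also have "\<dots> \<le> (exp ?u)\<^sup>2 / 2 + (exp ?v)\<^sup>2 / 2"
        using sum_squares_bound[of "exp ?u" "exp ?v"] by simp
      also have "(exp ?u)\<^sup>2 = ?a (loop m g)" by (simp add: exp_double[symmetric])
      also have "(exp ?v)\<^sup>2 = ?a (?w g)" by (simp add: exp_double[symmetric])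
      finally show ?thesis .
    qed
    have "(\<Sum>g\<in>cars m. exp (q * (osc (loop m g) / ?s))) \<le> (\<Sum>g\<in>cars m. ?a (loop m g) / 2 + ?a (?w g) / 2)"
      by (intro sum_mono each)
    also have "\<dots> = (\<Sum>g\<in>cars m. ?a (loop m g)) / 2 + (\<Sum>g\<in>cars m. ?a (?w g)) / 2"
      by (simp add: sum.distrib sum_divide_distrib)
    also have "(\<Sum>g\<in>cars m. ?a (?w g)) = (\<Sum>g\<in>cars m. ?a (loop m g))"
      by (rule sum_cars_rotate[where F = ?a, symmetric]) (use m in simp)
    also have "(\<Sum>g\<in>cars m. ?a (loop m g)) / 2 + (\<Sum>g\<in>cars m. ?a (loop m g)) / 2 = (\<Sum>g\<in>cars m. ?a (loop m g))" by simp
    also have "\<dots> \<le> C * real (card (cars m))" by (rule C[OF m qm])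
    finally show "(\<Sum>g\<in>cars m. exp (q * (osc (loop m g) / ?s))) \<le> C * real (card (cars m))" .
  qed
qed

lemma step_path_integral:
  assumes \<sigma>: "\<sigma> > 0" and m: "m \<ge> 1"
  shows "integral {0..\<sigma>} (step_path \<sigma> m d) = (\<sigma> / real m) * (real m / \<sigma>) powr (-1/2) * (\<Sum>i<m. d i)"
proof -
  let ?a = "(real m / \<sigma>) powr (-1/2)" and ?b = "\<sigma> / real m"
  have b: "?b > 0" using \<sigma> m by simp
  have "(step_path \<sigma> m d has_integral ?b * ?a * (\<Sum>i<k. d i)) {0..real k * ?b}" if "k \<le> m" for k
    using that
  proof (induction k)
    case 0
    then show ?case by (simp add: has_integral_refl)
  next
    case (Suc k)
    let ?l = "real k * ?b" and ?r = "real (Suc k) * ?b"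
    have "0 \<le> real k * \<beta> \<and> real k * \<beta> \<le> real (Suc k) * \<beta> \<and> real (Suc k) * \<beta> - real k * \<beta> = \<beta>" if "\<beta> > 0" for \<beta> :: real
      using that by (simp add: algebra_simps)
    from this[OF b] have lr: "0 \<le> ?l" "?l \<le> ?r" "?r - ?l = ?b" by blast+
    have r\<sigma>: "?r \<le> \<sigma>"
    proof -
      have "?r \<le> real m * ?b" using Suc.prems b by (intro mult_right_mono) auto
      then show ?thesis using m by simp
    qed
    have "((\<lambda>_. ?a * d k) has_integral (?r - ?l) *\<^sub>R (?a * d k)) {?l..?r}"
      using has_integral_const_real[of "?a * d k" ?l ?r] lr by simp
    then have "(step_path \<sigma> m d has_integral (?r - ?l) *\<^sub>R (?a * d k)) {?l..?r}"
    proof (rule has_integral_spike_finite[of "{?l, ?r}", rotated 2])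
      fix t assume t: "t \<in> {?l..?r} - {?l, ?r}"
      then have "?l < t" "t < ?r" by auto
      then have "real k < real m / \<sigma> * t" "real m / \<sigma> * t < real k + 1" using \<sigma> m by (simp_all add: field_simps)
      then have "\<lfloor>real m / \<sigma> * t\<rfloor> = int k" by linarith
      moreover have "0 \<le> t" "t \<le> \<sigma>" using t lr r\<sigma> by auto
      ultimately show "step_path \<sigma> m d t = ?a * d k" by (simp add: step_path_def)
    qed simp
    then have "(step_path \<sigma> m d has_integral ?b * ?a * (\<Sum>i<k. d i) + (?r - ?l) *\<^sub>R (?a * d k)) {0..?r}"
      using Suc by (intro has_integral_combine[OF lr(1,2)]) auto
    moreover have "?b * ?a * (\<Sum>i<k. d i) + (?r - ?l) *\<^sub>R (?a * d k) = ?b * ?a * (\<Sum>i<Suc k. d i)"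
      unfolding lr(3) by (simp only: sum.lessThan_Suc real_scaleR_def distrib_left mult.assoc)
    ultimately show ?case by (simp only:)
  qed
  from this[of m] have "(step_path \<sigma> m d has_integral ?b * ?a * (\<Sum>i<m. d i)) {0..\<sigma>}" using m by simp
  then show ?thesis by (rule integral_unique)
qed

lemma pwalk_le_loop: "m \<ge> 1 \<Longrightarrow> i < m \<Longrightarrow> pwalk m g i \<le> loop m g (int i)"
  by (simp add: loop_nat pwalk_def field_simps of_nat_diff)

text \<open>The area is at most \<open>m\<close> times the oscillation, which is rotation invariant,
  so the moment over trees becomes one over unconditioned loops.\<close>

theorem walk_exp_moment:
  assumes \<sigma>: "\<sigma> > 0" and \<kappa>: "\<kappa> \<ge> 0"
  obtains C where "eventually (\<lambda>m. tree_avg m (\<lambda>T. exp (\<kappa> * integral {0..\<sigma>} (scaled_walk \<sigma> m T))) \<le> C) sequentially"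
proof -
  \<comment> \<open>Time scale \<open>\<sigma> / m\<close> and space scale
    \<open>sqrt (\<sigma> / m)\<close> turn \<open>m * osc\<close> into
    \<open>\<sigma> powr (3/2) * osc / sqrt m\<close>.\<close>
  define q where "q = \<kappa> * \<sigma> powr (3/2)"
  have q: "q \<ge> 0" using \<kappa> by (simp add: q_def)
  obtain C where C: "\<And>m. m \<ge> 1 \<Longrightarrow> (2 * (4 * q + 1))\<^sup>2 \<le> real m \<Longrightarrow>
    (\<Sum>g\<in>cars m. exp (q * (osc (loop m g) / sqrt (real m)))) \<le> C * real (card (cars m))"
    using osc_exp_moment[OF q] by metis
  have "eventually (\<lambda>m. tree_avg m (\<lambda>T. exp (\<kappa> * integral {0..\<sigma>} (scaled_walk \<sigma> m T))) \<le> C) sequentially"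
    using eventually_ge_at_top[of 1] eventually_ge_at_top[of "nat \<lceil>(2 * (4 * q + 1))\<^sup>2\<rceil>"]
  proof eventually_elim
    case (elim m)
    have m: "m \<ge> 1" and qm: "(2 * (4 * q + 1))\<^sup>2 \<le> real m" using elim by linarith+
    have each: "\<kappa> * integral {0..\<sigma>} (step_path \<sigma> m (pwalk m g)) \<le> q * (osc (loop m g) / sqrt (real m))" for g
    proof -
      have "(\<Sum>i<m. pwalk m g i) \<le> (\<Sum>i<m. osc (loop m g))"
        using pwalk_le_loop[OF m] osc_loop(2)[OF m] by (intro sum_mono) (meson lessThan_iff order_trans)
      then have "(\<Sum>i<m. pwalk m g i) \<le> real m * osc (loop m g)" by simp
      then have "integral {0..\<sigma>} (step_path \<sigma> m (pwalk m g)) \<le> (\<sigma> / real m) * (real m / \<sigma>) powr (-1/2) * (real m * osc (loop m g))"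
        unfolding step_path_integral[OF \<sigma> m] using \<sigma> by (intro mult_left_mono) auto
      also have "\<dots> = \<sigma> powr (3/2) * (osc (loop m g) / sqrt (real m))"
      proof -
        have "(real m / \<sigma>) powr (-1/2) = sqrt \<sigma> / sqrt (real m)"
          using \<sigma> m by (simp add: powr_minus powr_half_sqrt real_sqrt_divide)
        moreover have "\<sigma> powr (3/2) = \<sigma> * sqrt \<sigma>"
          using \<sigma> powr_add[of \<sigma> 1 "1/2"] by (simp add: powr_half_sqrt)
        ultimately show ?thesis using m by simp
      qed
      finally have "integral {0..\<sigma>} (step_path \<sigma> m (pwalk m g)) \<le> \<sigma> powr (3/2) * (osc (loop m g) / sqrt (real m))" .
      then show ?thesis unfolding q_def mult.assoc using \<kappa> by (rule mult_left_mono)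
    qed
    have "tree_avg m (\<lambda>T. exp (\<kappa> * integral {0..\<sigma>} (scaled_walk \<sigma> m T)))
      = (\<Sum>g\<in>parking m. exp (\<kappa> * integral {0..\<sigma>} (step_path \<sigma> m (pwalk m g)))) / real (card (parking m))"
      unfolding scaled_walk_step_path by (rule tree_avg_eq_parking[OF m, of "\<lambda>d. exp (\<kappa> * integral {0..\<sigma>} (step_path \<sigma> m d))"])
    also have "\<dots> \<le> (\<Sum>g\<in>parking m. exp (q * (osc (loop m g) / sqrt (real m)))) / real (card (parking m))"
      using each by (intro divide_right_mono sum_mono) auto
    also have "\<dots> = (\<Sum>g\<in>cars m. exp (q * (osc (loop m g) / sqrt (real m)))) / real (card (cars m))"
      by (rule parking_avg_eq_loop_avg[OF m, of "\<lambda>w. exp (q * (osc w / sqrt (real m)))"]) (simp only: osc_shift)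
    also have "\<dots> \<le> C"
      using C[OF m qm] m by (simp add: divide_le_eq card_cars)
    finally show ?case .
  qed
  then show thesis by (rule that)
qed

section \<open>The tilted trees\<close>

definition walk_avg :: "real \<Rightarrow> nat \<Rightarrow> ((real \<Rightarrow> real) \<Rightarrow> real) \<Rightarrow> real" where
  "walk_avg \<sigma> m G = tree_avg m (\<lambda>T. G (scaled_walk \<sigma> m T))"

lemma walk_avg_eq:
  "m \<ge> 1 \<Longrightarrow> walk_avg \<sigma> m G = (\<Sum>g\<in>parking m. G (step_path \<sigma> m (pwalk m g))) / real (card (parking m))"
  unfolding walk_avg_def scaled_walk_step_path by (rule tree_avg_eq_parking[of m "\<lambda>d. G (step_path \<sigma> m d)"])

lemma parking_step_path_in_paths:
  "\<sigma> > 0 \<Longrightarrow> m \<ge> 1 \<Longrightarrow> g \<in> parking m \<Longrightarrow> step_path \<sigma> m (pwalk m g) \<in> paths \<sigma>"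
  using pwalk_range[of g m] by (intro step_path_in_paths) auto

lemma walk_avg_mono:
  assumes "\<sigma> > 0" "m \<ge> 1" "\<And>y. y \<in> paths \<sigma> \<Longrightarrow> G y \<le> G' y"
  shows "walk_avg \<sigma> m G \<le> walk_avg \<sigma> m G'"
  unfolding walk_avg_eq[OF assms(2)]
  by (intro divide_right_mono sum_mono assms(3) parking_step_path_in_paths assms) auto

lemma walk_avg_diff:
  assumes \<sigma>: "\<sigma> > 0" and m: "m \<ge> 1" and d: "\<And>y. y \<in> paths \<sigma> \<Longrightarrow> \<bar>G y - G' y\<bar> \<le> c * H y"
  shows "\<bar>walk_avg \<sigma> m G - walk_avg \<sigma> m G'\<bar> \<le> c * walk_avg \<sigma> m H"
proof -
  let ?y = "\<lambda>g. step_path \<sigma> m (pwalk m g)" and ?n = "real (card (parking m))"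
  have "walk_avg \<sigma> m G - walk_avg \<sigma> m G' = (\<Sum>g\<in>parking m. G (?y g) - G' (?y g)) / ?n"
    unfolding walk_avg_eq[OF m] by (simp add: sum_subtractf diff_divide_distrib)
  also have "\<bar>\<dots>\<bar> = \<bar>\<Sum>g\<in>parking m. G (?y g) - G' (?y g)\<bar> / ?n" by simp
  also have "\<dots> \<le> (\<Sum>g\<in>parking m. c * H (?y g)) / ?n"
    by (intro divide_right_mono order_trans[OF sum_abs] sum_mono d parking_step_path_in_paths \<sigma> m) auto
  also have "\<dots> = c * walk_avg \<sigma> m H" unfolding walk_avg_eq[OF m] by (simp add: sum_distrib_left)
  finally show ?thesis .
qed

text \<open>The exponent \<open>3/2\<close> is one for time and one half for space. The sum in
  \<open>area\<close> omits the index \<open>0\<close>, where the walk vanishes.\<close>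

lemma area_eq_integral:
  assumes \<sigma>: "\<sigma> > 0" and m: "m \<ge> 1"
  shows "area m T = (real m / \<sigma>) powr (3/2) * integral {0..\<sigma>} (scaled_walk \<sigma> m T)"
proof -
  let ?N = "real m / \<sigma>"
  have N: "?N > 0" using \<sigma> m by simp
  have "{..<m} = insert 0 {1..m - 1}" using m by auto
  moreover have "dfwalk m T 0 = 0" by (simp add: dfwalk_def odfs_state_def)
  ultimately have s: "(\<Sum>i<m. dfwalk m T i) = area m T" unfolding area_def by simp
  have "?N powr (3/2) * (\<sigma> / real m * ?N powr (-1/2)) = ?N powr (3/2) * (?N powr (-1) * ?N powr (-1/2))"
    using N \<sigma> m by (simp add: powr_minus_divide)
  also have "\<dots> = ?N powr 0" by (simp only: powr_add[symmetric]) simp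
  also have "\<dots> = 1" using \<sigma> m by simp
  finally have "?N powr (3/2) * (\<sigma> / real m * ?N powr (-1/2)) = 1" .
  then show ?thesis unfolding scaled_walk_step_path step_path_integral[OF \<sigma> m] s
    by (simp only: mult.assoc[symmetric] mult_1_left)
qed

lemma tilted_expect_eq:
  assumes \<sigma>: "\<sigma> > 0" and m: "m \<ge> 1" and p: "0 < p" "p < 1"
  defines "c \<equiv> - ln (1 - p) * (real m / \<sigma>) powr (3/2)"
  shows "tilted_expect m p (\<lambda>T. f (scaled_walk \<sigma> m T))
    = walk_avg \<sigma> m (\<lambda>y. f y * exp (c * integral {0..\<sigma>} y)) / walk_avg \<sigma> m (\<lambda>y. exp (c * integral {0..\<sigma>} y))"
proof -
  have w: "(1 - p) powr (- area m T) = exp (c * integral {0..\<sigma>} (scaled_walk \<sigma> m T))" for T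
    using p by (simp add: powr_def area_eq_integral[OF \<sigma> m] c_def algebra_simps)
  \<comment> \<open>If \<open>card\<close> is \<open>0\<close>, the set is empty or infinite and the
    sum in the numerator is \<open>0\<close> as well, so the common denominator cancels in every
    case.\<close>
  have q: "S / n / (W / n) = S / W" if "n = 0 \<Longrightarrow> S = 0" for S W n :: real using that by (cases "n = 0") auto
  show ?thesis
    unfolding tilted_expect_def w walk_avg_def tree_avg_def
    by (subst q) (auto simp: mult.commute card_eq_0_iff)
qed

text \<open>The premise forces \<open>p\<close> to \<open>0\<close>, so \<open>- ln (1 - p)\<close>
  may be replaced by \<open>p\<close>; then \<open>p * (m / \<sigma>) powr (3/2)\<close> is the
  power \<open>3/2\<close> of \<open>m * p powr (2/3) / \<sigma>\<close>, which tends to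
  \<open>1\<close>.\<close>

lemma tilt_exponent_limit:
  assumes \<sigma>: "\<sigma> > 0" and p: "\<And>m. 0 < p m \<and> p m < (1 :: real)"
    and lim: "(\<lambda>m. real m * p m powr (2/3)) \<longlonglongrightarrow> \<sigma>"
  shows "(\<lambda>m. - ln (1 - p m) * (real m / \<sigma>) powr (3/2)) \<longlonglongrightarrow> 1"
proof -
  have root: "(p m powr (2/3)) powr (3/2) = p m" for m using p[of m] by (simp add: powr_powr)
  have "(\<lambda>m. real m * p m powr (2/3) * (1 / real m)) \<longlonglongrightarrow> \<sigma> * 0"
    by (intro tendsto_mult lim lim_1_over_n)
  moreover have "eventually (\<lambda>m. real m * p m powr (2/3) * (1 / real m) = p m powr (2/3)) sequentially"
    using eventually_gt_at_top[of 0] by eventually_elim simp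
  ultimately have "(\<lambda>m. p m powr (2/3)) \<longlonglongrightarrow> 0" by (simp add: filterlim_cong)
  then have "(\<lambda>m. (p m powr (2/3)) powr (3/2)) \<longlonglongrightarrow> 0 powr (3/2)"
    by (rule tendsto_powr'[OF _ tendsto_const]) auto
  then have "p \<longlonglongrightarrow> 0" by (simp add: root)
  then have "filterlim p (at_right 0) sequentially"
    unfolding filterlim_at using p by (auto intro!: always_eventually) (metis less_irrefl)
  moreover have "((\<lambda>x :: real. - ln (1 - x) / x) \<longlongrightarrow> 1) (at_right 0)" by real_asymp
  ultimately have l1: "(\<lambda>m. - ln (1 - p m) / p m) \<longlonglongrightarrow> 1" by (rule filterlim_compose[rotated])
  have "(\<lambda>m. (real m * p m powr (2/3) / \<sigma>) powr (3/2)) \<longlonglongrightarrow> (\<sigma> / \<sigma>) powr (3/2)"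
    using \<sigma> by (intro tendsto_powr tendsto_divide lim tendsto_const) auto
  from tendsto_mult[OF l1 this]
  have "(\<lambda>m. - ln (1 - p m) / p m * (real m * p m powr (2/3) / \<sigma>) powr (3/2)) \<longlonglongrightarrow> 1" using \<sigma> by simp
  moreover have "- ln (1 - p m) / p m * (real m * p m powr (2/3) / \<sigma>) powr (3/2) = - ln (1 - p m) * (real m / \<sigma>) powr (3/2)" for m
  proof -
    have "(real m * p m powr (2/3) / \<sigma>) powr (3/2) = (real m / \<sigma> * p m powr (2/3)) powr (3/2)" by simp
    also have "\<dots> = (real m / \<sigma>) powr (3/2) * p m" using \<sigma> by (simp only: powr_mult root)
    finally show ?thesis using p[of m] by simp
  qed
  ultimately show ?thesis by simp
qed

section \<open>The area functional and its exponential\<close>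

lemma excursion_area_lipschitz:
  assumes \<sigma>: "\<sigma> > 0"
  shows "\<bar>excursion_area \<sigma> e - excursion_area \<sigma> e'\<bar> \<le> \<sigma> * dist e e'"
proof -
  have "excursion_area \<sigma> e - excursion_area \<sigma> e' = integral {0..\<sigma>} (\<lambda>t. apply_bcontfun e t - apply_bcontfun e' t)"
    unfolding excursion_area_def by (intro integral_diff[symmetric] integrable_continuous_real) auto
  also have "norm \<dots> \<le> dist e e' * (\<sigma> - 0)"
  proof (rule integral_bound)
    show "norm (apply_bcontfun e t - apply_bcontfun e' t) \<le> dist e e'" for t
      using dist_bounded[of e t e'] by (simp add: dist_norm)
  qed (use \<sigma> in \<open>auto intro!: continuous_intros\<close>)
  finally show ?thesis by (simp add: mult.commute)
qed

lemma excursion_area_measurable: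
  assumes "\<sigma> > 0"
  shows "excursion_area \<sigma> \<in> borel_measurable borel"
proof (rule borel_measurable_continuous_onI)
  have "\<sigma>-lipschitz_on UNIV (excursion_area \<sigma>)"
    using excursion_area_lipschitz[OF assms] assms by (intro lipschitz_onI) (auto simp: dist_real_def)
  then show "continuous_on UNIV (excursion_area \<sigma>)" by (rule lipschitz_on_continuous_on)
qed

lemma integral_restr: "integral {0..\<sigma>} (restr \<sigma> (apply_bcontfun e)) = excursion_area \<sigma> e"
  unfolding excursion_area_def by (rule integral_cong) (simp add: restr_def)

lemma AE_restr_in_paths:
  assumes \<sigma>: "\<sigma> > 0" and law: "brownian_excursion_law \<sigma> \<mu>"
  shows "AE e in \<mu>. restr \<sigma> (apply_bcontfun e) \<in> paths \<sigma>"
proof -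
  interpret excursion \<sigma> \<mu> by (rule excursion.intro[OF \<sigma> law])
  interpret P0: path_functional \<sigma> "\<lambda>_. 0" 0 by standard (auto simp: \<sigma> intro: exI[of _ 1])
  interpret P1: path_excursion \<sigma> "\<lambda>_. 0" 0 \<mu> by unfold_locales
  show ?thesis using outside positive_inside
    by eventually_elim (use P1.restr_in_paths in simp)
qed

lemma paths_integral_nonneg: "y \<in> paths \<sigma> \<Longrightarrow> 0 \<le> integral {0..\<sigma>} y"
  by (rule Henstock_Kurzweil_Integration.integral_nonneg) (auto simp: paths_def)

lemma AE_excursion_area_nonneg:
  assumes \<sigma>: "\<sigma> > 0" and law: "brownian_excursion_law \<sigma> \<mu>"
  shows "AE e in \<mu>. 0 \<le> excursion_area \<sigma> e"
  using AE_restr_in_paths[OF assms] by eventually_elim (metis paths_integral_nonneg integral_restr)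

lemma paths_integral_diff:
  assumes \<sigma>: "\<sigma> > 0" and xy: "x \<in> paths \<sigma>" "y \<in> paths \<sigma>" and d: "\<forall>t\<in>{0..\<sigma>}. \<bar>y t - x t\<bar> \<le> \<gamma>"
  shows "\<bar>integral {0..\<sigma>} y - integral {0..\<sigma>} x\<bar> \<le> \<gamma> * \<sigma>"
proof -
  have i: "x integrable_on {0..\<sigma>}" "y integrable_on {0..\<sigma>}" using xy by (auto simp: paths_def)
  have "norm (integral {0..\<sigma>} (\<lambda>t. y t - x t)) \<le> integral {0..\<sigma>} (\<lambda>_. \<gamma>)"
    by (rule integral_norm_bound_integral) (use i d in \<open>auto intro!: integrable_diff\<close>)
  also have "integral {0..\<sigma>} (\<lambda>t. y t - x t) = integral {0..\<sigma>} y - integral {0..\<sigma>} x" by (rule integral_diff[OF i(2,1)])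
  also have "integral {0..\<sigma>} (\<lambda>_. \<gamma>) = \<gamma> * \<sigma>" using \<sigma> by simp
  finally show ?thesis by simp
qed

text \<open>One estimate for two errors: the exponent \<open>c\<close> in place of \<open>1\<close>,
  and the truncation at \<open>R\<close>. The range \<open>c \<le> 2\<close> gives
  \<open>exp (2 * a)\<close>; the third \<open>a\<close> absorbs the factor \<open>a\<close> of the
  mean value bound when \<open>a \<le> R\<close>, and pays for \<open>exp (- R)\<close>
  otherwise.\<close>

lemma exp_tilt_error:
  fixes a c R :: real
  assumes a: "0 \<le> a" and c: "0 \<le> c" "c \<le> 2"
  shows "\<bar>exp (c * a) - exp (min R a)\<bar> \<le> (\<bar>c - 1\<bar> + exp (- R)) * exp (3 * a)"
proof (cases "a \<le> R")
  case True
  have one: "exp u - exp v \<le> \<bar>u - v\<bar> * exp (2 * a)" if "u \<le> 2 * a" for u v :: real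
  proof -
    have "exp u - exp v = exp u * (1 - exp (v - u))" by (simp add: exp_diff right_diff_distrib)
    also have "\<dots> \<le> exp u * \<bar>u - v\<bar>"
    proof (rule mult_left_mono)
      show "1 - exp (v - u) \<le> \<bar>u - v\<bar>" using exp_ge_add_one_self[of "v - u"] by linarith
    qed simp
    also have "\<dots> \<le> exp (2 * a) * \<bar>u - v\<bar>" using that by (intro mult_right_mono) auto
    also have "\<dots> = \<bar>u - v\<bar> * exp (2 * a)" by (rule mult.commute)
    finally show ?thesis .
  qed
  have "c * a \<le> 2 * a" "a \<le> 2 * a" using a c by (auto intro: mult_right_mono)
  from one[OF this(1), of a] one[OF this(2), of "c * a"]
  have "\<bar>exp (c * a) - exp a\<bar> \<le> \<bar>c * a - a\<bar> * exp (2 * a)" by (simp add: abs_le_iff abs_minus_commute)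
  also have "c * a - a = (c - 1) * a" by (simp add: left_diff_distrib)
  also have "\<bar>(c - 1) * a\<bar> = \<bar>c - 1\<bar> * a" using a by (simp add: abs_mult)
  also have "\<bar>c - 1\<bar> * a * exp (2 * a) \<le> \<bar>c - 1\<bar> * exp a * exp (2 * a)"
  proof (intro mult_right_mono mult_left_mono)
    show "a \<le> exp a" using exp_ge_add_one_self[of a] by linarith
  qed auto
  also have "\<dots> = \<bar>c - 1\<bar> * exp (3 * a)" by (simp add: exp_add[symmetric] mult.assoc)
  also have "\<dots> \<le> (\<bar>c - 1\<bar> + exp (- R)) * exp (3 * a)" by (simp add: distrib_right)
  finally show ?thesis using True by (simp add: min_absorb2)
next
  case False
  have "c * a \<le> 2 * a" using a c by (intro mult_right_mono) auto
  then have "exp (c * a) \<le> exp (2 * a)" "exp (min R a) \<le> exp (2 * a)" using a by auto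
  then have "\<bar>exp (c * a) - exp (min R a)\<bar> \<le> exp (2 * a)"
    using exp_gt_zero[of "c * a"] exp_gt_zero[of "min R a"] by linarith
  also have "\<dots> \<le> exp (- R) * exp (3 * a)" using False by (simp add: exp_add[symmetric])
  also have "\<dots> \<le> (\<bar>c - 1\<bar> + exp (- R)) * exp (3 * a)" by (simp add: distrib_right)
  finally show ?thesis .
qed

lemma exp_tilt_measurable:
  fixes k R :: real
  assumes "X \<in> borel_measurable M"
  shows "(\<lambda>e. exp (k * min R (X e))) \<in> borel_measurable M" "(\<lambda>e. exp (X e)) \<in> borel_measurable M"
    "(\<lambda>e. exp (k * X e)) \<in> borel_measurable M"
proof -
  have m: "(\<lambda>e. F (X e)) \<in> borel_measurable M" if "continuous_on UNIV F" for F :: "real \<Rightarrow> real"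
    by (rule measurable_compose[OF assms borel_measurable_continuous_onI[OF that]])
  show "(\<lambda>e. exp (k * min R (X e))) \<in> borel_measurable M" by (rule m) (intro continuous_intros)
  show "(\<lambda>e. exp (X e)) \<in> borel_measurable M" by (rule m) (intro continuous_intros)
  show "(\<lambda>e. exp (k * X e)) \<in> borel_measurable M" by (rule m) (intro continuous_intros)
qed

locale path_observable = excursion \<sigma> \<mu> for \<sigma> \<mu> +
  fixes f :: "(real \<Rightarrow> real) \<Rightarrow> real" and B :: real
  assumes bound: "\<And>y. y \<in> paths \<sigma> \<Longrightarrow> \<bar>f y\<bar> \<le> B"
    and cont: "\<And>x \<eta>. x \<in> paths \<sigma> \<Longrightarrow> continuous_on {0..\<sigma>} x \<Longrightarrow> \<eta> > 0 \<Longrightarrow>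
      \<exists>\<gamma>>0. \<forall>y\<in>paths \<sigma>. (\<forall>t\<in>{0..\<sigma>}. \<bar>y t - x t\<bar> \<le> \<gamma>) \<longrightarrow> \<bar>f y - f x\<bar> < \<eta>"
    and meas: "(\<lambda>e. f (restr \<sigma> (apply_bcontfun e))) \<in> borel_measurable borel"
begin

text \<open>Truncating the area at \<open>R\<close> makes the tilted functional bounded on
  \<open>paths \<sigma>\<close>, so that the untilted limit applies to it. The factor
  \<open>k\<close> is \<open>3\<close> in the moment bound and \<open>1\<close> in the tilt.\<close>

lemma truncated_limit:
  assumes k: "k \<ge> 0"
  shows "(\<lambda>m. walk_avg \<sigma> m (\<lambda>y. f y * exp (k * min R (integral {0..\<sigma>} y))))
    \<longlonglongrightarrow> (\<integral>e. f (restr \<sigma> (apply_bcontfun e)) * exp (k * min R (excursion_area \<sigma> e)) \<partial>\<mu>)"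
proof -
  define h where "h y = f y * exp (k * min R (integral {0..\<sigma>} y))" for y
  have restr: "h (restr \<sigma> (apply_bcontfun e)) = f (restr \<sigma> (apply_bcontfun e)) * exp (k * min R (excursion_area \<sigma> e))" for e
    unfolding h_def integral_restr ..
  have "(\<lambda>m. tree_avg m (\<lambda>T. h (scaled_walk \<sigma> m T))) \<longlonglongrightarrow> (\<integral>e. h (restr \<sigma> (apply_bcontfun e)) \<partial>\<mu>)"
  proof (rule tree_avg_limit[OF \<sigma> law, where B = "B * exp (k * R)"])
    fix y assume y: "y \<in> paths \<sigma>"
    have "\<bar>h y\<bar> = \<bar>f y\<bar> * exp (k * min R (integral {0..\<sigma>} y))" by (simp add: h_def abs_mult)
    also have "\<dots> \<le> B * exp (k * R)"
      using bound[OF y] k by (intro mult_mono) (auto intro: mult_left_mono order_trans[OF abs_ge_zero])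
    finally show "\<bar>h y\<bar> \<le> B * exp (k * R)" .
  next
    fix x :: "real \<Rightarrow> real" and \<eta> :: real
    assume x: "x \<in> paths \<sigma>" "continuous_on {0..\<sigma>} x" and \<eta>: "\<eta> > 0"
    define F :: "real \<times> real \<Rightarrow> real" where "F = (\<lambda>z. fst z * exp (k * min R (snd z)))"
    have "isCont F z" for z unfolding F_def by (intro continuous_intros)
    then obtain d where d: "d > 0" "\<And>z. dist z (f x, integral {0..\<sigma>} x) < d \<Longrightarrow> dist (F z) (F (f x, integral {0..\<sigma>} x)) < \<eta>"
      using \<eta> unfolding continuous_at_eps_delta by metis
    obtain \<gamma> where \<gamma>: "\<gamma> > 0" "\<And>y. y \<in> paths \<sigma> \<Longrightarrow> (\<forall>t\<in>{0..\<sigma>}. \<bar>y t - x t\<bar> \<le> \<gamma>) \<Longrightarrow> \<bar>f y - f x\<bar> < d / 2"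
      using cont[OF x half_gt_zero[OF d(1)]] by metis
    define \<gamma>' where "\<gamma>' = min \<gamma> (d / (2 * \<sigma>))"
    show "\<exists>\<gamma>>0. \<forall>y\<in>paths \<sigma>. (\<forall>t\<in>{0..\<sigma>}. \<bar>y t - x t\<bar> \<le> \<gamma>) \<longrightarrow> \<bar>h y - h x\<bar> < \<eta>"
    proof (intro exI[of _ \<gamma>'] conjI ballI impI)
      show "\<gamma>' > 0" using \<gamma>(1) d(1) \<sigma> by (simp add: \<gamma>'_def)
      fix y assume y: "y \<in> paths \<sigma>" and c: "\<forall>t\<in>{0..\<sigma>}. \<bar>y t - x t\<bar> \<le> \<gamma>'"
      have "\<bar>f y - f x\<bar> < d / 2" by (rule \<gamma>(2)[OF y]) (use c in \<open>auto simp: \<gamma>'_def\<close>)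
      moreover have "\<bar>integral {0..\<sigma>} y - integral {0..\<sigma>} x\<bar> \<le> d / 2"
      proof -
        have "\<bar>integral {0..\<sigma>} y - integral {0..\<sigma>} x\<bar> \<le> \<gamma>' * \<sigma>" by (rule paths_integral_diff[OF \<sigma> x(1) y c])
        also have "\<dots> \<le> d / (2 * \<sigma>) * \<sigma>" using \<sigma> by (intro mult_right_mono) (auto simp: \<gamma>'_def)
        finally show ?thesis using \<sigma> by simp
      qed
      moreover have "dist (f y, integral {0..\<sigma>} y) (f x, integral {0..\<sigma>} x) \<le> \<bar>f y - f x\<bar> + \<bar>integral {0..\<sigma>} y - integral {0..\<sigma>} x\<bar>"
        unfolding dist_Pair_Pair dist_real_def by (rule order_trans[OF sqrt_sum_squares_le_sum_abs]) simp
      ultimately have "dist (f y, integral {0..\<sigma>} y) (f x, integral {0..\<sigma>} x) < d" by linarith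
      from d(2)[OF this] show "\<bar>h y - h x\<bar> < \<eta>" by (simp add: F_def h_def dist_real_def)
    qed
  next
    show "(\<lambda>e. h (restr \<sigma> (apply_bcontfun e))) \<in> borel_measurable borel"
      unfolding restr by (intro borel_measurable_times meas exp_tilt_measurable excursion_area_measurable[OF \<sigma>])
  qed
  then show ?thesis unfolding walk_avg_def h_def integral_restr .
qed

end

context excursion
begin

lemma excursion_area_measurable_mu: "excursion_area \<sigma> \<in> borel_measurable \<mu>"
  using excursion_area_measurable[OF \<sigma>] by (simp add: measurable_def space_mu sets_mu)

text \<open>Exponential moments of the excursion area are inherited from the trees: the truncated
  moments are limits of averages over trees, hence bounded by the same \<open>C\<close>, and
  monotone convergence removes the truncation. The factor \<open>3\<close> is the one of
  \<open>exp_tilt_error\<close>.\<close>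

lemma excursion_exp_moment:
  obtains C where "C \<ge> 0" "integrable \<mu> (\<lambda>e. exp (3 * excursion_area \<sigma> e))" "(\<integral>e. exp (3 * excursion_area \<sigma> e) \<partial>\<mu>) \<le> C"
    "eventually (\<lambda>m. walk_avg \<sigma> m (\<lambda>y. exp (3 * integral {0..\<sigma>} y)) \<le> C) sequentially"
proof -
  obtain C where C: "eventually (\<lambda>m. walk_avg \<sigma> m (\<lambda>y. exp (3 * integral {0..\<sigma>} y)) \<le> C) sequentially"
    using walk_exp_moment[OF \<sigma>, of 3] unfolding walk_avg_def by auto
  interpret one: path_observable \<sigma> \<mu> "\<lambda>_. 1" 1 by standard (auto intro: exI[of _ 1])
  let ?f = "\<lambda>n e. exp (3 * min (real n) (excursion_area \<sigma> e))"
  have le: "(\<integral>e. ?f n e \<partial>\<mu>) \<le> C" for n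
  proof (rule tendsto_upperbound)
    show "(\<lambda>m. walk_avg \<sigma> m (\<lambda>y. 1 * exp (3 * min (real n) (integral {0..\<sigma>} y)))) \<longlonglongrightarrow> (\<integral>e. ?f n e \<partial>\<mu>)"
      using one.truncated_limit[of 3 "real n"] by simp
    show "eventually (\<lambda>m. walk_avg \<sigma> m (\<lambda>y. 1 * exp (3 * min (real n) (integral {0..\<sigma>} y))) \<le> C) sequentially"
      using C eventually_ge_at_top[of 1]
    proof eventually_elim
      case (elim m)
      have "walk_avg \<sigma> m (\<lambda>y. 1 * exp (3 * min (real n) (integral {0..\<sigma>} y))) \<le> walk_avg \<sigma> m (\<lambda>y. exp (3 * integral {0..\<sigma>} y))"
        using \<sigma> elim(2) by (intro walk_avg_mono) auto
      then show ?case using elim(1) by linarith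
    qed
  qed simp
  have int: "integrable \<mu> (?f n)" for n
    by (rule integrable_const_bound[where B = "exp (3 * real n)"]) (simp, rule exp_tilt_measurable(1)[OF excursion_area_measurable_mu])
  have mono: "?f i e \<le> ?f j e" if "i \<le> j" for i j e using that by (auto simp: min_def)
  have "incseq (\<lambda>n. \<integral>e. ?f n e \<partial>\<mu>)"
    unfolding incseq_def by (intro allI impI integral_mono int mono)
  then obtain L where L: "(\<lambda>n. \<integral>e. ?f n e \<partial>\<mu>) \<longlonglongrightarrow> L"
    using le by (blast elim: incseq_convergent)
  have lim: "(\<lambda>n. ?f n e) \<longlonglongrightarrow> exp (3 * excursion_area \<sigma> e)" for e
  proof (rule tendsto_eventually)
    have "eventually (\<lambda>n. n \<ge> nat \<lceil>excursion_area \<sigma> e\<rceil>) sequentially" by (rule eventually_ge_at_top)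
    then show "eventually (\<lambda>n. ?f n e = exp (3 * excursion_area \<sigma> e)) sequentially"
      by eventually_elim (simp add: min_def; linarith)
  qed
  have AEm: "AE e in \<mu>. mono (\<lambda>n. ?f n e)" "AE e in \<mu>. (\<lambda>n. ?f n e) \<longlonglongrightarrow> exp (3 * excursion_area \<sigma> e)"
    using mono lim by (auto simp: mono_def)
  have mm: "(\<lambda>e. exp (3 * excursion_area \<sigma> e)) \<in> borel_measurable \<mu>"
    by (rule exp_tilt_measurable(3)[OF excursion_area_measurable_mu])
  show thesis
  proof (rule that[of "max C 0"])
    show "integrable \<mu> (\<lambda>e. exp (3 * excursion_area \<sigma> e))"
      by (rule integrable_monotone_convergence[OF int AEm L mm])
    have "(\<integral>e. exp (3 * excursion_area \<sigma> e) \<partial>\<mu>) = L" by (rule integral_monotone_convergence[OF int AEm L mm])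
    also have "L \<le> C" using L le by (intro LIMSEQ_le_const2) auto
    finally show "(\<integral>e. exp (3 * excursion_area \<sigma> e) \<partial>\<mu>) \<le> max C 0" by simp
    show "eventually (\<lambda>m. walk_avg \<sigma> m (\<lambda>y. exp (3 * integral {0..\<sigma>} y)) \<le> max C 0) sequentially"
      using C by eventually_elim simp
  qed simp
qed

end

context path_observable
begin

lemma meas_mu: "(\<lambda>e. f (restr \<sigma> (apply_bcontfun e))) \<in> borel_measurable \<mu>"
  using meas by (simp add: measurable_def space_mu sets_mu)

lemma bound_AE: "AE e in \<mu>. \<bar>f (restr \<sigma> (apply_bcontfun e))\<bar> \<le> B"
  using AE_restr_in_paths[OF \<sigma> law] by eventually_elim (rule bound)

text \<open>\<open>R\<close> is chosen first, so that truncation costs little on both sides by the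
  moment bound for \<open>exp (3 * area)\<close>; then \<open>m\<close>, for the error
  \<open>c m - 1\<close> and for the truncated limit.\<close>

lemma tilted_limit:
  assumes c: "c \<longlonglongrightarrow> 1"
  shows "(\<lambda>m. walk_avg \<sigma> m (\<lambda>y. f y * exp (c m * integral {0..\<sigma>} y)))
    \<longlonglongrightarrow> (\<integral>e. f (restr \<sigma> (apply_bcontfun e)) * exp (excursion_area \<sigma> e) \<partial>\<mu>)" (is "?W \<longlonglongrightarrow> ?I")
    and "integrable \<mu> (\<lambda>e. f (restr \<sigma> (apply_bcontfun e)) * exp (excursion_area \<sigma> e))"
proof -
  obtain C where C: "C \<ge> 0" "integrable \<mu> (\<lambda>e. exp (3 * excursion_area \<sigma> e))" "(\<integral>e. exp (3 * excursion_area \<sigma> e) \<partial>\<mu>) \<le> C"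
    "eventually (\<lambda>m. walk_avg \<sigma> m (\<lambda>y. exp (3 * integral {0..\<sigma>} y)) \<le> C) sequentially"
    using excursion_exp_moment by blast
  let ?f = "\<lambda>e. f (restr \<sigma> (apply_bcontfun e))" and ?a = "excursion_area \<sigma>"
  have B0: "0 \<le> B"
  proof -
    have "(\<lambda>_. 0) \<in> paths \<sigma>" by (auto simp: paths_def skorohod_D_def)
    then show ?thesis using bound by (meson abs_ge_zero order_trans)
  qed
  have i3: "integrable \<mu> (\<lambda>e. B * exp (3 * ?a e))" using C(2) by simp
  show int: "integrable \<mu> (\<lambda>e. ?f e * exp (?a e))"
  proof (rule Bochner_Integration.integrable_bound[OF i3])
    show "AE e in \<mu>. norm (?f e * exp (?a e)) \<le> norm (B * exp (3 * ?a e))"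
      using bound_AE AE_excursion_area_nonneg[OF \<sigma> law]
    proof eventually_elim
      case (elim e)
      have "\<bar>?f e\<bar> * exp (?a e) \<le> B * exp (3 * ?a e)" using elim B0 by (intro mult_mono) auto
      then show ?case using B0 by (simp add: abs_mult)
    qed
  qed (intro borel_measurable_times meas_mu exp_tilt_measurable excursion_area_measurable_mu)
  have intR: "integrable \<mu> (\<lambda>e. ?f e * exp (1 * min R (?a e)))" for R
  proof (rule integrable_const_bound[where B = "B * exp R"])
    show "AE e in \<mu>. norm (?f e * exp (1 * min R (?a e))) \<le> B * exp R"
      using bound_AE
    proof eventually_elim
      case (elim e)
      have "\<bar>?f e\<bar> * exp (1 * min R (?a e)) \<le> B * exp R" using elim B0 by (intro mult_mono) auto
      then show ?case by (simp add: abs_mult)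
    qed
  qed (intro borel_measurable_times meas_mu exp_tilt_measurable excursion_area_measurable_mu)
  have err: "\<bar>u * exp (k * a) - u * exp (1 * min R a)\<bar> \<le> B * (\<bar>k - 1\<bar> + exp (- R)) * exp (3 * a)"
    if "\<bar>u\<bar> \<le> B" "0 \<le> a" "0 \<le> k" "k \<le> 2" for u k a R
  proof -
    have "\<bar>u * exp (k * a) - u * exp (1 * min R a)\<bar> = \<bar>u\<bar> * \<bar>exp (k * a) - exp (min R a)\<bar>"
      by (simp add: right_diff_distrib[symmetric] abs_mult)
    also have "\<dots> \<le> B * ((\<bar>k - 1\<bar> + exp (- R)) * exp (3 * a))"
      using that by (intro mult_mono exp_tilt_error) auto
    finally show ?thesis by (simp only: mult.assoc)
  qed
  have excursion_err: "\<bar>?I - (\<integral>e. ?f e * exp (1 * min R (?a e)) \<partial>\<mu>)\<bar> \<le> B * exp (- R) * C" for R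
  proof -
    have "?I - (\<integral>e. ?f e * exp (1 * min R (?a e)) \<partial>\<mu>) = (\<integral>e. ?f e * exp (?a e) - ?f e * exp (1 * min R (?a e)) \<partial>\<mu>)"
      by (rule Bochner_Integration.integral_diff[symmetric, OF int intR])
    also have "\<bar>\<dots>\<bar> \<le> (\<integral>e. B * exp (- R) * exp (3 * ?a e) \<partial>\<mu>)"
    proof (rule order_trans[OF integral_abs_bound], rule integral_mono_AE)
      show "AE e in \<mu>. \<bar>?f e * exp (?a e) - ?f e * exp (1 * min R (?a e))\<bar> \<le> B * exp (- R) * exp (3 * ?a e)"
        using bound_AE AE_excursion_area_nonneg[OF \<sigma> law]
      proof eventually_elim
        case (elim e)
        from err[OF elim, of 1 R] show ?case by (simp only: mult_1_left diff_self abs_zero add_0_left)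
      qed
      show "integrable \<mu> (\<lambda>e. \<bar>?f e * exp (?a e) - ?f e * exp (1 * min R (?a e))\<bar>)"
        by (intro integrable_abs Bochner_Integration.integrable_diff int intR)
      show "integrable \<mu> (\<lambda>e. B * exp (- R) * exp (3 * ?a e))" by (intro integrable_mult_right C(2))
    qed
    also have "\<dots> = B * exp (- R) * (\<integral>e. exp (3 * ?a e) \<partial>\<mu>)" by simp
    also have "\<dots> \<le> B * exp (- R) * C" using C(3) B0 by (intro mult_left_mono) auto
    finally show ?thesis .
  qed
  show "?W \<longlonglongrightarrow> ?I"
  proof (rule LIMSEQ_I)
    fix r :: real assume r: "0 < r"
    have "(\<lambda>n. B * exp (- real n) * C) \<longlonglongrightarrow> B * 0 * C"
    proof (intro tendsto_mult tendsto_const)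
      show "(\<lambda>n. exp (- real n)) \<longlonglongrightarrow> 0" by real_asymp
    qed
    then have "eventually (\<lambda>n. B * exp (- real n) * C < r / 4) sequentially" using r by (intro order_tendstoD(2)) auto
    then obtain n where n: "B * exp (- real n) * C < r / 4" by (auto simp: eventually_sequentially)
    define R where "R = real n"
    have R: "B * exp (- R) * C < r / 4" using n by (simp add: R_def)
    let ?WR = "\<lambda>m. walk_avg \<sigma> m (\<lambda>y. f y * exp (1 * min R (integral {0..\<sigma>} y)))"
    let ?IR = "\<integral>e. ?f e * exp (1 * min R (?a e)) \<partial>\<mu>"
    have e1: "eventually (\<lambda>m. \<bar>?WR m - ?IR\<bar> < r / 4) sequentially"
      using tendstoD[OF truncated_limit[of 1 R], of "r / 4"] r by (simp add: dist_real_def)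
    have "(\<lambda>m. B * \<bar>c m - 1\<bar> * C) \<longlonglongrightarrow> B * \<bar>1 - 1\<bar> * C"
      by (intro tendsto_mult tendsto_const tendsto_rabs tendsto_diff c)
    then have e2: "eventually (\<lambda>m. B * \<bar>c m - 1\<bar> * C < r / 4) sequentially" using r by (intro order_tendstoD(2)) auto
    have e3: "eventually (\<lambda>m. 0 < c m) sequentially" "eventually (\<lambda>m. c m < 2) sequentially"
      by (intro order_tendstoD[OF c]; simp)+
    have "eventually (\<lambda>m. norm (?W m - ?I) < r) sequentially"
      using e1 e2 e3 C(4) eventually_ge_at_top[of 1]
    proof eventually_elim
      case (elim m)
      have "\<bar>?W m - ?WR m\<bar> \<le> B * (\<bar>c m - 1\<bar> + exp (- R)) * walk_avg \<sigma> m (\<lambda>y. exp (3 * integral {0..\<sigma>} y))"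
      proof (rule walk_avg_diff[OF \<sigma> elim(6)])
        fix y assume "y \<in> paths \<sigma>"
        from err[OF bound[OF this] paths_integral_nonneg[OF this] less_imp_le[OF elim(3)] less_imp_le[OF elim(4)]]
        show "\<bar>f y * exp (c m * integral {0..\<sigma>} y) - f y * exp (1 * min R (integral {0..\<sigma>} y))\<bar>
          \<le> B * (\<bar>c m - 1\<bar> + exp (- R)) * exp (3 * integral {0..\<sigma>} y)" .
      qed
      also have "\<dots> \<le> B * (\<bar>c m - 1\<bar> + exp (- R)) * C"
        using elim(5) B0 by (intro mult_left_mono mult_nonneg_nonneg) auto
      also have "\<dots> = B * \<bar>c m - 1\<bar> * C + B * exp (- R) * C" by (simp only: distrib_left distrib_right)
      finally have "\<bar>?W m - ?WR m\<bar> < r / 2" using elim(2) R by linarith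
      moreover have "\<bar>?I - ?IR\<bar> < r / 4" using excursion_err[of R] R by linarith
      ultimately show ?case using elim(1) unfolding real_norm_def by linarith
    qed
    then show "\<exists>no. \<forall>m\<ge>no. norm (?W m - ?I) < r" by (simp add: eventually_sequentially)
  qed
qed

end

text \<open>The identity is an admissible time change. Comparing \<open>Inf\<close> with its value
  needs a set bounded below; the supremum of \<open>|lam t - t|\<close>, taken over a bounded set,
  makes every value nonnegative.\<close>

lemma skorohod_dist_le:
  assumes \<sigma>: "\<sigma> > 0" and \<gamma>: "\<And>t. t \<in> {0..\<sigma>} \<Longrightarrow> \<bar>x t - y t\<bar> \<le> \<gamma>"
  shows "skorohod_dist \<sigma> x y \<le> \<gamma>"
proof -
  let ?v = "\<lambda>lam. max (SUP t\<in>{0..\<sigma>}. \<bar>lam t - t\<bar>) (SUP t\<in>{0..\<sigma>}. \<bar>x t - y (lam t)\<bar>)"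
  have nonneg: "0 \<le> ?v lam" if lam: "lam \<in> time_changes \<sigma>" for lam
  proof -
    have "lam t \<in> {0..\<sigma>}" if "t \<in> {0..\<sigma>}" for t using lam that by (auto simp: time_changes_def)
    then have "bdd_above ((\<lambda>t. \<bar>lam t - t\<bar>) ` {0..\<sigma>})" by (intro bdd_aboveI2[of _ _ \<sigma>]) fastforce
    then have "\<bar>lam 0 - 0\<bar> \<le> (SUP t\<in>{0..\<sigma>}. \<bar>lam t - t\<bar>)" using \<sigma> by (intro cSUP_upper) auto
    then show ?thesis by linarith
  qed
  have id: "(\<lambda>t. t) \<in> time_changes \<sigma>" by (auto simp: time_changes_def strict_mono_on_def)
  have "skorohod_dist \<sigma> x y \<le> ?v (\<lambda>t. t)"
    unfolding skorohod_dist_def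
  proof (rule cInf_lower)
    show "?v (\<lambda>t. t) \<in> {?v lam | lam. lam \<in> time_changes \<sigma>}" using id by (intro CollectI exI[of _ "\<lambda>t. t"]) simp
    show "bdd_below {?v lam | lam. lam \<in> time_changes \<sigma>}"
      by (rule bdd_belowI[of _ 0]) (use nonneg in blast)
  qed
  also have "\<dots> \<le> \<gamma>"
  proof (rule max.boundedI)
    have "0 \<le> \<gamma>" using \<gamma>[of 0] \<sigma> by (auto intro: order_trans[OF abs_ge_zero])
    then show "(SUP t\<in>{0..\<sigma>}. \<bar>t - t\<bar>) \<le> \<gamma>" using \<sigma> by simp
    show "(SUP t\<in>{0..\<sigma>}. \<bar>x t - y t\<bar>) \<le> \<gamma>" using \<sigma> \<gamma> by (intro cSUP_least) auto
  qed
  finally show ?thesis .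
qed

lemma restr_in_skorohod_D: "restr \<sigma> (apply_bcontfun e) \<in> skorohod_D \<sigma>"
proof -
  have lim: "(apply_bcontfun e \<longlongrightarrow> apply_bcontfun e t) (at t within S)" for t S
    using continuous_on_apply_bcontfun[of UNIV e] by (meson UNIV_I continuous_on_def tendsto_within_subset subset_UNIV)
  have "(restr \<sigma> (apply_bcontfun e) \<longlongrightarrow> restr \<sigma> (apply_bcontfun e) t) (at_right t)" if t: "t \<in> {0..<\<sigma>}" for t
  proof -
    have ev: "eventually (\<lambda>s. apply_bcontfun e s = restr \<sigma> (apply_bcontfun e) s) (at_right t)"
      by (rule eventually_at_rightI[of t \<sigma>]) (use t in \<open>auto simp: restr_def\<close>)
    have "restr \<sigma> (apply_bcontfun e) t = apply_bcontfun e t" using t by (simp add: restr_def)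
    then show ?thesis by (simp only:) (rule Lim_transform_eventually[OF lim ev])
  qed
  moreover have "\<exists>l. (restr \<sigma> (apply_bcontfun e) \<longlongrightarrow> l) (at_left t)" if t: "t \<in> {0<..\<sigma>}" for t
  proof -
    have ev: "eventually (\<lambda>s. apply_bcontfun e s = restr \<sigma> (apply_bcontfun e) s) (at_left t)"
      by (rule eventually_at_leftI[of 0 t]) (use t in \<open>auto simp: restr_def\<close>)
    show ?thesis by (rule exI) (rule Lim_transform_eventually[OF lim ev])
  qed
  ultimately show ?thesis by (auto simp: skorohod_D_def restr_def)
qed

text \<open>Nearness in the sup norm implies nearness in \<open>skorohod_dist\<close>, so Skorohod
  continuity yields continuity in the sup norm; on the space of bounded continuous paths this also
  gives Borel measurability.\<close>

lemma skorohod_continuous_observable: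
  assumes \<sigma>: "\<sigma> > 0" and law: "brownian_excursion_law \<sigma> \<mu>" and f: "bounded_skorohod_continuous \<sigma> f"
  obtains B where "path_observable \<sigma> \<mu> f B"
proof -
  obtain B where B: "\<forall>x\<in>skorohod_D \<sigma>. \<bar>f x\<bar> \<le> B" using f by (auto simp: bounded_skorohod_continuous_def)
  have cont: "\<exists>\<gamma>>0. \<forall>y\<in>skorohod_D \<sigma>. (\<forall>t\<in>{0..\<sigma>}. \<bar>y t - x t\<bar> \<le> \<gamma>) \<longrightarrow> \<bar>f y - f x\<bar> < \<eta>"
    if "x \<in> skorohod_D \<sigma>" "\<eta> > 0" for x \<eta>
  proof -
    obtain \<delta> where \<delta>: "\<delta> > 0" "\<forall>y\<in>skorohod_D \<sigma>. skorohod_dist \<sigma> x y < \<delta> \<longrightarrow> \<bar>f y - f x\<bar> < \<eta>"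
      using f \<open>x \<in> _\<close> \<open>\<eta> > 0\<close> unfolding bounded_skorohod_continuous_def by meson
    show ?thesis
    proof (intro exI[of _ "\<delta> / 2"] conjI ballI impI)
      fix y assume y: "y \<in> skorohod_D \<sigma>" "\<forall>t\<in>{0..\<sigma>}. \<bar>y t - x t\<bar> \<le> \<delta> / 2"
      have "skorohod_dist \<sigma> x y \<le> \<delta> / 2"
        by (rule skorohod_dist_le[OF \<sigma>]) (use y(2) in \<open>auto simp: abs_minus_commute\<close>)
      then show "\<bar>f y - f x\<bar> < \<eta>" using \<delta> y(1) by simp
    qed (use \<delta>(1) in simp)
  qed
  have "continuous_on UNIV (\<lambda>e. f (restr \<sigma> (apply_bcontfun e)))"
    unfolding continuous_on_iff
  proof (intro ballI allI impI)
    fix e :: "real \<Rightarrow>\<^sub>C real" and \<eta> :: real assume "\<eta> > 0"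
    from cont[OF restr_in_skorohod_D[of \<sigma> e] this] obtain \<gamma> where
      \<gamma>: "\<gamma> > 0" "\<forall>y\<in>skorohod_D \<sigma>. (\<forall>t\<in>{0..\<sigma>}. \<bar>y t - restr \<sigma> (apply_bcontfun e) t\<bar> \<le> \<gamma>) \<longrightarrow> \<bar>f y - f (restr \<sigma> (apply_bcontfun e))\<bar> < \<eta>"
      by blast
    show "\<exists>d>0. \<forall>e'\<in>UNIV. dist e' e < d \<longrightarrow> dist (f (restr \<sigma> (apply_bcontfun e'))) (f (restr \<sigma> (apply_bcontfun e))) < \<eta>"
    proof (intro exI[of _ \<gamma>] conjI ballI impI \<gamma>(1))
      fix e' assume d: "dist e' e < \<gamma>"
      have "\<bar>apply_bcontfun e' t - apply_bcontfun e t\<bar> \<le> \<gamma>" for t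
        using dist_bounded[of e' t e] d by (simp add: dist_real_def)
      then have "\<forall>t\<in>{0..\<sigma>}. \<bar>restr \<sigma> (apply_bcontfun e') t - restr \<sigma> (apply_bcontfun e) t\<bar> \<le> \<gamma>" by (simp add: restr_def)
      then show "dist (f (restr \<sigma> (apply_bcontfun e'))) (f (restr \<sigma> (apply_bcontfun e))) < \<eta>"
        using \<gamma>(2) restr_in_skorohod_D[of \<sigma> e'] by (simp add: dist_real_def)
    qed
  qed
  then have meas: "(\<lambda>e. f (restr \<sigma> (apply_bcontfun e))) \<in> borel_measurable borel"
    by (rule borel_measurable_continuous_onI)
  show thesis
  proof (rule that[of B], unfold_locales)
    have sub: "y \<in> skorohod_D \<sigma>" if "y \<in> paths \<sigma>" for y using that by (simp add: paths_def)
    show "\<bar>f y\<bar> \<le> B" if "y \<in> paths \<sigma>" for y using B sub[OF that] by blast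
    show "\<exists>\<gamma>>0. \<forall>y\<in>paths \<sigma>. (\<forall>t\<in>{0..\<sigma>}. \<bar>y t - x t\<bar> \<le> \<gamma>) \<longrightarrow> \<bar>f y - f x\<bar> < \<eta>"
      if "x \<in> paths \<sigma>" "continuous_on {0..\<sigma>} x" "0 < \<eta>" for x \<eta>
      using cont[OF sub[OF that(1)] that(3)] sub by blast
  qed (use \<sigma> law meas in auto)
qed

theorem theorem7:
  fixes \<sigma> :: real and p :: "nat \<Rightarrow> real" and \<mu> :: "(real \<Rightarrow>\<^sub>C real) measure"
  assumes "\<sigma> > 0"
    and "\<And>m. 0 < p m \<and> p m < 1"
    and "(\<lambda>m. real m * p m powr (2/3)) \<longlonglongrightarrow> \<sigma>"
    and "brownian_excursion_law \<sigma> \<mu>"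
  shows "\<forall>f. bounded_skorohod_continuous \<sigma> f \<longrightarrow>
           (\<lambda>m. tilted_expect m (p m) (\<lambda>T. f (scaled_walk \<sigma> m T)))
             \<longlonglongrightarrow> (\<integral>e. f (restr \<sigma> (apply_bcontfun e)) \<partial>(tilted_excursion_law \<sigma> \<mu>))"
proof (intro allI impI)
  fix f assume f: "bounded_skorohod_continuous \<sigma> f"
  note \<sigma> = assms(1) and p = assms(2) and law = assms(4)
  interpret excursion \<sigma> \<mu> by (rule excursion.intro[OF \<sigma> law])
  obtain B where "path_observable \<sigma> \<mu> f B" by (rule skorohod_continuous_observable[OF \<sigma> law f])
  then interpret F: path_observable \<sigma> \<mu> f B .
  interpret one: path_observable \<sigma> \<mu> "\<lambda>_. 1" 1 by standard (auto intro: exI[of _ 1])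
  let ?c = "\<lambda>m. - ln (1 - p m) * (real m / \<sigma>) powr (3/2)"
  note c = tilt_exponent_limit[OF \<sigma> p assms(3)]
  let ?a = "excursion_area \<sigma>" and ?f = "\<lambda>e. f (restr \<sigma> (apply_bcontfun e))"
  define Z where "Z = (\<integral>e. exp (?a e) \<partial>\<mu>)"
  have iZ: "integrable \<mu> (\<lambda>e. exp (?a e))" using one.tilted_limit(2)[OF c] by simp
  \<comment> \<open>The area is almost surely nonnegative, so \<open>Z \<ge> 1\<close>, and the
    quotient of the two limits is legitimate.\<close>
  have "(\<integral>e. 1 \<partial>\<mu>) \<le> Z" unfolding Z_def
    by (rule integral_mono_AE) (use iZ AE_excursion_area_nonneg[OF \<sigma> law] in auto)
  then have Z: "Z > 0" by (simp add: prob_space[simplified])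
  have "(\<lambda>m. walk_avg \<sigma> m (\<lambda>y. f y * exp (?c m * integral {0..\<sigma>} y)) / walk_avg \<sigma> m (\<lambda>y. 1 * exp (?c m * integral {0..\<sigma>} y)))
    \<longlonglongrightarrow> (\<integral>e. ?f e * exp (?a e) \<partial>\<mu>) / (\<integral>e. 1 * exp (?a e) \<partial>\<mu>)"
    by (rule tendsto_divide[OF F.tilted_limit(1)[OF c] one.tilted_limit(1)[OF c]]) (use Z in \<open>simp add: Z_def\<close>)
  then have "(\<lambda>m. walk_avg \<sigma> m (\<lambda>y. f y * exp (?c m * integral {0..\<sigma>} y)) / walk_avg \<sigma> m (\<lambda>y. exp (?c m * integral {0..\<sigma>} y)))
    \<longlonglongrightarrow> (\<integral>e. ?f e * exp (?a e) \<partial>\<mu>) / Z"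
    unfolding Z_def by (simp only: mult_1_left)
  moreover have "eventually (\<lambda>m. walk_avg \<sigma> m (\<lambda>y. f y * exp (?c m * integral {0..\<sigma>} y)) / walk_avg \<sigma> m (\<lambda>y. exp (?c m * integral {0..\<sigma>} y))
      = tilted_expect m (p m) (\<lambda>T. f (scaled_walk \<sigma> m T))) sequentially"
    using eventually_ge_at_top[of 1] by eventually_elim (rule tilted_expect_eq[OF \<sigma> _ conjunct1[OF p] conjunct2[OF p], symmetric])
  ultimately have "(\<lambda>m. tilted_expect m (p m) (\<lambda>T. f (scaled_walk \<sigma> m T))) \<longlonglongrightarrow> (\<integral>e. ?f e * exp (?a e) \<partial>\<mu>) / Z"
    by (rule Lim_transform_eventually)
  also have "(\<integral>e. ?f e * exp (?a e) \<partial>\<mu>) / Z = (\<integral>e. ?f e \<partial>(tilted_excursion_law \<sigma> \<mu>))"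
  proof -
    have "(\<integral>e. ?f e \<partial>(tilted_excursion_law \<sigma> \<mu>)) = (\<integral>e. (exp (?a e) / Z) *\<^sub>R ?f e \<partial>\<mu>)"
      unfolding tilted_excursion_law_def Z_def[symmetric]
    proof (rule integral_density)
      show "(\<lambda>e. exp (?a e) / Z) \<in> borel_measurable \<mu>"
        by (intro borel_measurable_divide exp_tilt_measurable excursion_area_measurable_mu) simp
      show "AE e in \<mu>. 0 \<le> exp (?a e) / Z" using Z by simp
    qed (rule F.meas_mu)
    also have "\<dots> = (\<integral>e. (?f e * exp (?a e)) / Z \<partial>\<mu>)" by (simp add: mult.commute)
    also have "\<dots> = (\<integral>e. ?f e * exp (?a e) \<partial>\<mu>) / Z" by (rule integral_divide_zero)
    finally show ?thesis ..
  qed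
  finally show "(\<lambda>m. tilted_expect m (p m) (\<lambda>T. f (scaled_walk \<sigma> m T))) \<longlonglongrightarrow> (\<integral>e. ?f e \<partial>(tilted_excursion_law \<sigma> \<mu>))" .
qed

end
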